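(* Let $1\le m\le k\le n-m$, let $\varphi$ be an integrable right $O(k)$-invariant function on $V_{n,k}$, and let $\phi\in\mathcal S(M_{n,m})$ be a Schwartz function. Then $$(E_{-k}F^*_{m,k}\varphi,\ \mathcal F\phi)=\tilde c\,(E_{k-n}A_{k,m}\varphi,\ \phi),\qquad \tilde c=\frac{2^{m(n-k)}\,\pi^{nm/2}\,\Gamma_m((n-k)/2)}{\Gamma_m(k/2)}.$$
   Context: $M_{n,m}$ is the space of real $n\times m$ matrices with Lebesgue measure $dx$; $x'$ is the transpose; $(h,\phi)=\int_{M_{n,m}}h(x)\overline{\phi(x)}\,dx$; $(\mathcal F\phi)(y)=\int_{M_{n,m}}e^{i\,\mathrm{tr}(y'x)}\phi(x)\,dx$. $V_{n,m}=\{v\in M_{n,m}:v'v=I_m\}$ is the Stiefel manifold with $O(n)$-invariant probability measure $d_*v$. "Right $O(k)$-invariant" means $\varphi(u\gamma)=\varphi(u)$ for $\gamma\in O(k)$. $\Gamma_m(\alpha)=\pi^{m(m-1)/4}\prod_{j=0}^{m-1}\Gamma(\alpha-j/2)$. For a function $f$ on $V_{n,m}$ and $\lambda\in\mathbb C$, $(E_\lambda f)(x)=(\det r)^{\lambda/2}f(v)$ for $x\in M_{n,m}$ of rank $m$ with polar decomposition $x=vr^{1/2}$, $r=x'x$, $v\in V_{n,m}$. For $v\in V_{n,m}$ let $g_v\in O(n)$ be any matrix with $g_v\begin{bmatrix}0\\ I_m\end{bmatrix}=v$. Dual Funk transform: $(F^*_{m,k}\varphi)(v)=\int_{V_{n-m,k}}\varphi\Big(g_v\begin{bmatrix}\theta\\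 0\end{bmatrix}\Big)d_*\theta$. Complementary Radon transform: $(A_{k,m}\varphi)(v)=\int_{V_{n-m,k-m}}\varphi\Big(g_v\begin{bmatrix}a&0\\ 0&I_m\end{bmatrix}\Big)d_*a$ ($A_{k,m}$ is the identity if $k=m$). *)

theory Defs
  imports
    "HOL-Probability.Probability"
    "Jordan_Normal_Form.Matrix"
    "Jordan_Normal_Form.Determinant"
    "Jordan_Normal_Form.DL_Rank"
begin

text \<open>
  The dimensions n, m, k and the differences n - m, k - m all occur in one statement (and k - m
  may be 0), so matrices are those of Jordan_Normal_Form, with carrier \<open>carrier_mat n m\<close>.
\<close>

subsection \<open>Measure and integration on the space of real n x m matrices\<close>

definition mat_borel :: "nat \<Rightarrow> nat \<Rightarrow> real mat measure" where
  "mat_borel n m = vimage_algebra (carrier_mat n m)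
     (\<lambda>x. \<lambda>p\<in>{..<n} \<times> {..<m}. x $$ p) (Pi\<^sub>M ({..<n} \<times> {..<m}) (\<lambda>_. borel))"

text \<open>The product of the Lebesgue measures in the entries, completed.\<close>

definition mat_lebesgue :: "nat \<Rightarrow> nat \<Rightarrow> real mat measure" where
  "mat_lebesgue n m = completion
     (distr (Pi\<^sub>M ({..<n} \<times> {..<m}) (\<lambda>_. lborel)) (mat_borel n m) (mat n m))"

definition pairing ::
    "nat \<Rightarrow> nat \<Rightarrow> (real mat \<Rightarrow> complex) \<Rightarrow> (real mat \<Rightarrow> complex) \<Rightarrow> complex" where
  "pairing n m h \<phi> = (LINT x|mat_lebesgue n m. h x * cnj (\<phi> x))"

definition pairing_converges ::
    "nat \<Rightarrow> nat \<Rightarrow> (real mat \<Rightarrow> complex) \<Rightarrow> (real mat \<Rightarrow> complex) \<Rightarrow> bool" where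
  "pairing_converges n m h \<phi> \<longleftrightarrow> integrable (mat_lebesgue n m) (\<lambda>x. h x * cnj (\<phi> x))"

definition mat_tr :: "real mat \<Rightarrow> real" where
  "mat_tr A = (\<Sum>i<dim_row A. A $$ (i, i))"

definition fourier_mat :: "nat \<Rightarrow> nat \<Rightarrow> (real mat \<Rightarrow> complex) \<Rightarrow> real mat \<Rightarrow> complex" where
  "fourier_mat n m \<phi> y =
     (LINT x|mat_lebesgue n m. exp (\<i> * complex_of_real (mat_tr (transpose_mat y * x))) * \<phi> x)"

subsection \<open>Schwartz functions\<close>

definition mat_unit :: "nat \<Rightarrow> nat \<Rightarrow> nat \<times> nat \<Rightarrow> real mat" where
  "mat_unit n m p = mat n m (\<lambda>q. if q = p then 1 else 0)"

definition mat_partial ::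
    "nat \<Rightarrow> nat \<Rightarrow> nat \<times> nat \<Rightarrow> (real mat \<Rightarrow> complex) \<Rightarrow> real mat \<Rightarrow> complex" where
  "mat_partial n m p f x = vector_derivative (\<lambda>t. f (x + t \<cdot>\<^sub>m mat_unit n m p)) (at 0)"

definition mat_partials ::
    "nat \<Rightarrow> nat \<Rightarrow> (nat \<times> nat) list \<Rightarrow> (real mat \<Rightarrow> complex) \<Rightarrow> real mat \<Rightarrow> complex" where
  "mat_partials n m ps f = foldr (mat_partial n m) ps f"

text \<open>
  All iterated partial derivatives (in the entries, in any order, \<open>ps\<close> listing the entries) exist
  everywhere, and each of them times any monomial in the entries (\<open>qs\<close> listing its factors) is
  bounded. Smoothness is implied: all partial derivatives of any given iterated partial derivative
  exist and are bounded, so the latter is Lipschitz and in particular continuous.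
\<close>

definition schwartz_mat :: "nat \<Rightarrow> nat \<Rightarrow> (real mat \<Rightarrow> complex) \<Rightarrow> bool" where
  "schwartz_mat n m f \<longleftrightarrow>
     (\<forall>ps. set ps \<subseteq> {..<n} \<times> {..<m} \<longrightarrow>
        (\<forall>p\<in>{..<n} \<times> {..<m}. \<forall>x\<in>carrier_mat n m.
           (\<lambda>t::real. mat_partials n m ps f (x + t \<cdot>\<^sub>m mat_unit n m p)) differentiable (at 0)) \<and>
        (\<forall>qs. set qs \<subseteq> {..<n} \<times> {..<m} \<longrightarrow>
           bounded ((\<lambda>x. complex_of_real (\<Prod>q\<leftarrow>qs. x $$ q) * mat_partials n m ps f x)
                      ` carrier_mat n m)))"

subsection \<open>Stiefel manifolds\<close>

definition stiefel :: "nat \<Rightarrow> nat \<Rightarrow> real mat set" where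
  "stiefel n m = {v \<in> carrier_mat n m. transpose_mat v * v = 1\<^sub>m m}"

definition orth_group :: "nat \<Rightarrow> real mat set" where
  "orth_group n = {g \<in> carrier_mat n n. transpose_mat g * g = 1\<^sub>m n}"

text \<open>
  The unique Borel probability measure on \<open>stiefel n m\<close> (where m \<le> n) that is invariant under
  left multiplication by O(n). For m = 0 it is the point mass at the n x 0 matrix.
\<close>

definition stiefel_measure :: "nat \<Rightarrow> nat \<Rightarrow> real mat measure" where
  "stiefel_measure n m = (THE \<mu>. prob_space \<mu> \<and>
     sets \<mu> = sets (restrict_space (mat_borel n m) (stiefel n m)) \<and>
     (\<forall>g\<in>orth_group n. distr \<mu> \<mu> (\<lambda>v. g * v) = \<mu>))"

definition right_orth_invariant :: "nat \<Rightarrow> nat \<Rightarrow> (real mat \<Rightarrow> complex) \<Rightarrow> bool" where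
  "right_orth_invariant n k f \<longleftrightarrow> (\<forall>u\<in>stiefel n k. \<forall>\<gamma>\<in>orth_group k. f (u * \<gamma>) = f u)"

subsection \<open>The operators\<close>

definition pos_def_mat :: "nat \<Rightarrow> real mat \<Rightarrow> bool" where
  "pos_def_mat m s \<longleftrightarrow> s \<in> carrier_mat m m \<and> transpose_mat s = s \<and>
     (\<forall>w\<in>carrier_vec m. w \<noteq> 0\<^sub>v m \<longrightarrow> 0 < scalar_prod w (s *\<^sub>v w))"

text \<open>The square root of a positive definite m x m matrix.\<close>

definition mat_sqrt :: "nat \<Rightarrow> real mat \<Rightarrow> real mat" where
  "mat_sqrt m r = (THE s. pos_def_mat m s \<and> s * s = r)"

text \<open>The factor v in the polar decomposition of an n x m matrix x of rank m.\<close>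

definition polar_part :: "nat \<Rightarrow> nat \<Rightarrow> real mat \<Rightarrow> real mat" where
  "polar_part n m x = (THE v. v \<in> stiefel n m \<and> x = v * mat_sqrt m (transpose_mat x * x))"

text \<open>The matrices of rank less than m form a null set; the value there is set to 0.\<close>

definition E_ext ::
    "nat \<Rightarrow> nat \<Rightarrow> complex \<Rightarrow> (real mat \<Rightarrow> complex) \<Rightarrow> real mat \<Rightarrow> complex" where
  "E_ext n m l f x =
     (if vec_space.rank n x = m
      then complex_of_real (Determinant.det (transpose_mat x * x)) powr (l / 2)
             * f (polar_part n m x)
      else 0)"

text \<open>
  The two transforms below do not depend on which \<open>g\<close> is chosen: another choice differs by a right
  factor \<open>diag(h, 1)\<close> with \<open>h\<close> in O(n - m), which the invariant measure absorbs.
\<close>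

definition frame_rot :: "nat \<Rightarrow> nat \<Rightarrow> real mat \<Rightarrow> real mat" where
  "frame_rot n m v = (SOME g. g \<in> orth_group n \<and> g * (0\<^sub>m (n - m) m @\<^sub>r 1\<^sub>m m) = v)"

definition dual_funk ::
    "nat \<Rightarrow> nat \<Rightarrow> nat \<Rightarrow> (real mat \<Rightarrow> complex) \<Rightarrow> real mat \<Rightarrow> complex" where
  "dual_funk n m k f v =
     (LINT \<theta>|stiefel_measure (n - m) k. f (frame_rot n m v * (\<theta> @\<^sub>r 0\<^sub>m m k)))"

text \<open>For k = m the integration is over the single (n - m) x 0 matrix, and the result is \<open>f v\<close>.\<close>

definition compl_radon ::
    "nat \<Rightarrow> nat \<Rightarrow> nat \<Rightarrow> (real mat \<Rightarrow> complex) \<Rightarrow> real mat \<Rightarrow> complex" where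
  "compl_radon n k m f v =
     (LINT a|stiefel_measure (n - m) (k - m).
        f (frame_rot n m v * four_block_mat a (0\<^sub>m (n - m) m) (0\<^sub>m m (k - m)) (1\<^sub>m m)))"

definition Gamma_mult :: "nat \<Rightarrow> real \<Rightarrow> real" where
  "Gamma_mult m \<alpha> = pi powr (real m * (real m - 1) / 4) * (\<Prod>j<m. Gamma (\<alpha> - real j / 2))"

end

theory Submission
  imports Defs
begin

text \<open>
  Averaging \<open>x \<mapsto> g x\<close> over \<open>g \<in> O(n)\<close> turns both pairings into
      integrals over \<open>V_{n,k}\<close>. On almost
  every \<open>x\<close> the integrand depends on \<open>x\<close>, apart from the rotation, through
      the Gram matrix \<open>r = x'x\<close>
  only. By induction on the number of columns, the weight \<open>det(r)^{-k/2}\<close> pushes Lebesgue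
      measure on
  \<open>M_{n,m}\<close> forward under \<open>x \<mapsto> x'x\<close> to a constant multiple of the
      image of Lebesgue measure on
  \<open>M_{n-k,m}\<close>. Hence \<open>(E_{-k} F* f, \<psi>)\<close> is a multiple of the integral
      over \<open>u \<in> V_{n,k}\<close> of \<open>f(u)\<close> times
  the conjugate of the integral of \<open>\<psi>\<close> over the matrices with columns orthogonal to
      those of \<open>u\<close>, and
  \<open>(E_{k-n} A f, \<psi>)\<close> is the analogous expression with the matrices whose columns lie
      in the span
  of \<open>u\<close>. For \<open>\<psi> = F \<phi>\<close> in the first one, the two are linked by the
      formula that the integral of
  \<open>F \<phi>\<close> over a subspace is \<open>(2 \<pi>)^{m(n-k)}\<close> times the integral of
      \<open>\<phi>\<close> over its orthogonal complement;
  the remaining constants combine to the quotient of Siegel gamma functions.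
\<close>

subsection \<open>Matrices with orthonormal columns\<close>

text \<open>The polar part, the frames \<open>g_v\<close> and the Stiefel measure are given by
  definite descriptions or choice, which say nothing about measurability. Measurable substitutes are
  therefore built: the square root as limit of an explicit iteration, the polar part from it, and a
  frame completing it to an orthogonal matrix. They agree with the defined objects off a null set,
  frames up to a factor diag(h, 1) that Haar measure on O(n - m) absorbs, and the completed Lebesgue
  measure tolerates the null set. All disintegrations are proved for nonnegative integrands and then
  carried to complex ones as equalities of image measures, which also yields convergence of both
  pairings. Right invariance of f enters for matrices with columns in the span of u: the rotation
  reaching a given such matrix turns u within its span. With N = n - k, the push-forward constants
  are products over j < m of quotients of sphere areas; the areas in R^(N+k-j) occur in both and
  cancel, leaving those in R^(k-j) and R^(N-j), together with (2 pi)^(Nm).\<close>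

lemma mult_mat_index:
  fixes A :: "real mat"
  assumes "A \<in> carrier_mat a b" "B \<in> carrier_mat b c" "i < a" "j < c"
  shows "(A * B) $$ (i,j) = (\<Sum>k<b. A $$ (i,k) * B $$ (k,j))"
  using assms by (auto simp: scalar_prod_def lessThan_atLeast0 intro!: sum.cong)

lemma mult_mat_vec_index:
  fixes A :: "real mat"
  assumes "A \<in> carrier_mat a b" "w \<in> carrier_vec b" "i < a"
  shows "(A *\<^sub>v w) $ i = (\<Sum>k<b. A $$ (i,k) * w $ k)"
  using assms by (auto simp: scalar_prod_def lessThan_atLeast0 intro!: sum.cong)

lemma append_rows_index:
  fixes A :: "'a::zero mat"
  assumes "A \<in> carrier_mat a c" "B \<in> carrier_mat b c" "i < a + b" "j < c"
  shows "(A @\<^sub>r B) $$ (i,j) = (if i < a then A $$ (i,j) else B $$ (i - a, j))"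
  using assms by (auto simp: append_rows_def)

lemma dim_append_rows [simp]:
  "dim_row (A @\<^sub>r B) = dim_row A + dim_row B" "dim_col (A @\<^sub>r B) = dim_col A"
  by (auto simp: append_rows_def)

text \<open>\<open>append_rows\<close> is itself a block matrix with right blocks of width 0, so
  block multiplication applies after padding by empty columns.\<close>

lemma four_block_mult_append_rows:
  fixes A1 :: "real mat"
  assumes "A1 \<in> carrier_mat r1 n1" "B1 \<in> carrier_mat r1 n2" "C1 \<in> carrier_mat r2 n1"
    "D1 \<in> carrier_mat r2 n2" "A \<in> carrier_mat n1 c" "B \<in> carrier_mat n2 c"
  shows "four_block_mat A1 B1 C1 D1 * (A @\<^sub>r B) = (A1 * A + B1 * B) @\<^sub>r (C1 * A + D1 * B)"
proof -
  have "four_block_mat A1 B1 C1 D1 * four_block_mat A (0\<^sub>m n1 0) B (0\<^sub>m n2 0)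
      = four_block_mat (A1 * A + B1 * B) (A1 * 0\<^sub>m n1 0 + B1 * 0\<^sub>m n2 0)
          (C1 * A + D1 * B) (C1 * 0\<^sub>m n1 0 + D1 * 0\<^sub>m n2 0)"
    by (rule mult_four_block_mat[OF assms(1-4)]) (use assms in auto)
  moreover have "A1 * 0\<^sub>m n1 0 + B1 * 0\<^sub>m n2 0 = 0\<^sub>m r1 0" "C1 * 0\<^sub>m n1 0 + D1
      * 0\<^sub>m n2 0 = 0\<^sub>m r2 0"
    using assms by auto
  ultimately show ?thesis using assms by (simp add: append_rows_def)
qed

lemma append_rows_mult_right:
  fixes A :: "real mat"
  assumes "A \<in> carrier_mat a c" "B \<in> carrier_mat b c" "C \<in> carrier_mat c d"
  shows "(A @\<^sub>r B) * C = (A * C) @\<^sub>r (B * C)"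
proof (rule eq_matI)
  fix i j assume "i < dim_row (A * C @\<^sub>r B * C)" "j < dim_col (A * C @\<^sub>r B * C)"
  then have ij: "i < a + b" "j < d" using assms by (auto simp: append_rows_def)
  have AB: "A @\<^sub>r B \<in> carrier_mat (a+b) c" using assms by auto
  have "i - a < b" if "\<not> i < a" using that ij by auto
  then show "((A @\<^sub>r B) * C) $$ (i, j) = (A * C @\<^sub>r B * C) $$ (i, j)"
    using ij assms
    by (subst mult_mat_index[OF AB], simp_all add: append_rows_index[OF assms(1,2)]
        append_rows_index[of "A * C" a d "B * C" b]
        mult_mat_index[OF assms(1,3)] mult_mat_index[OF assms(2,3)] del: index_mult_mat(1))
qed (use assms in \<open>auto simp: append_rows_def\<close>)

lemma append_rows_nil: "A \<in> carrier_mat a c \<Longrightarrow> A @\<^sub>r 0\<^sub>m 0 c = (A :: real mat)"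
  by (rule eq_matI) (auto simp: append_rows_def)

lemma gram_append_rows:
  fixes A :: "real mat"
  assumes "A \<in> carrier_mat a c" "B \<in> carrier_mat b d" "A' \<in> carrier_mat a d" "B' \<in>
      carrier_mat b c"
  shows "transpose_mat (A @\<^sub>r B') * (A' @\<^sub>r B) = transpose_mat A * A' + transpose_mat B' * B"
proof (rule eq_matI)
  fix i j assume "i < dim_row (transpose_mat A * A' + transpose_mat B' * B)"
    "j < dim_col (transpose_mat A * A' + transpose_mat B' * B)"
  then have ij: "i < c" "j < d" using assms by auto
  have 1: "transpose_mat (A @\<^sub>r B') \<in> carrier_mat c (a+b)" "A' @\<^sub>r B \<in> carrier_mat (a+b) d"
    using assms by auto
  have "(\<Sum>k<a + b. h k) = (\<Sum>k<a. h k) + (\<Sum>k<b. h (a + k))" for h :: "nat \<Rightarrow> real"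
    by (induction b) auto
  then show "(transpose_mat (A @\<^sub>r B') * (A' @\<^sub>r B)) $$ (i,j) = (transpose_mat A * A' +
      transpose_mat B' * B) $$ (i,j)"
    using ij assms mult_mat_index[OF 1 ij]
      mult_mat_index[of "transpose_mat A" c a A' d i j] mult_mat_index[of "transpose_mat B'" c b B d i j]
    by (simp add: append_rows_index[OF assms(1,4)] append_rows_index[OF assms(3,2)] carrier_matD[OF
        assms(1)] carrier_matD[OF assms(4)] del: index_mult_mat(1))
qed (use assms in \<open>auto simp: append_rows_def\<close>)

lemma mat_tr_comm:
  assumes "A \<in> carrier_mat a b" "B \<in> carrier_mat b a"
  shows "mat_tr (A * B) = mat_tr (B * A)"
proof -
  have "mat_tr (A * B) = (\<Sum>i<a. \<Sum>k<b. A $$ (i,k) * B $$ (k,i))"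
    using assms mult_mat_index[OF assms] by (auto simp: mat_tr_def intro!: sum.cong)
  also have "\<dots> = (\<Sum>k<b. \<Sum>i<a. B $$ (k,i) * A $$ (i,k))"
    by (subst sum.swap) (simp add: mult.commute)
  also have "\<dots> = mat_tr (B * A)"
    using assms mult_mat_index[OF assms(2,1)] by (auto simp: mat_tr_def intro!: sum.cong)
  finally show ?thesis .
qed

lemma mat_tr_add: "A \<in> carrier_mat a a \<Longrightarrow> B \<in> carrier_mat a a \<Longrightarrow>
    mat_tr (A + B) = mat_tr A + mat_tr B"
  by (auto simp: mat_tr_def sum.distrib intro!: sum.cong)

lemma orth_group_eq_stiefel: "orth_group n = stiefel n n"
  by (auto simp: orth_group_def stiefel_def)

lemma stiefelD: "v \<in> stiefel n m \<Longrightarrow> v \<in> carrier_mat n m" "v \<in> stiefel n m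
    \<Longrightarrow> transpose_mat v * v = 1\<^sub>m m"
  by (auto simp: stiefel_def)

lemma orth_groupD:
  assumes "g \<in> orth_group n"
  shows "g \<in> carrier_mat n n" "transpose_mat g * g = 1\<^sub>m n" "g * transpose_mat g = 1\<^sub>m n"
    "transpose_mat g \<in> orth_group n"
proof -
  show 1: "g \<in> carrier_mat n n" "transpose_mat g * g = 1\<^sub>m n" using assms by (auto simp:
      orth_group_def)
  show 2: "g * transpose_mat g = 1\<^sub>m n"
    by (rule mat_mult_left_right_inverse[OF _ _ 1(2)]) (use 1 in auto)
  show "transpose_mat g \<in> orth_group n" using 1 2 by (auto simp: orth_group_def)
qed

lemma stiefel_mult:
  assumes "v \<in> stiefel n m" "w \<in> stiefel m l"
  shows "v * w \<in> stiefel n l"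
proof -
  note v = stiefelD[OF assms(1)] and w = stiefelD[OF assms(2)]
  have "transpose_mat (v * w) * (v * w) = transpose_mat w * (transpose_mat v * (v * w))"
    using v(1) w(1) transpose_mult[OF v(1) w(1)] by (simp add: assoc_mult_mat[of _ l m _ n _ l])
  also have "transpose_mat v * (v * w) = w"
    using v w(1) by (subst assoc_mult_mat[symmetric, of _ m n _ m _ l]) auto
  finally show ?thesis using v w by (auto simp: stiefel_def)
qed

lemma orth_mult_stiefel: "g \<in> orth_group n \<Longrightarrow> v \<in> stiefel n m \<Longrightarrow>
    g * v \<in> stiefel n m"
  by (metis orth_group_eq_stiefel stiefel_mult)

lemma orth_group_mult: "g \<in> orth_group n \<Longrightarrow> h \<in> orth_group n \<Longrightarrow> g
    * h \<in> orth_group n"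
  by (metis orth_group_eq_stiefel stiefel_mult)

lemma orth_group_one: "1\<^sub>m n \<in> orth_group n"
  by (auto simp: orth_group_def)

lemma orth_cancel:
  assumes "g \<in> orth_group n" "x \<in> carrier_mat n m"
  shows "transpose_mat g * (g * x) = x" "g * (transpose_mat g * x) = x"
  using assms orth_groupD[OF assms(1)]
  by (simp_all flip: assoc_mult_mat[of _ n n _ n _ m])

lemma gram_orth_mult:
  assumes "g \<in> orth_group n" "x \<in> carrier_mat n m"
  shows "transpose_mat (g * x) * (g * x) = transpose_mat x * x"
  using assms orth_groupD[OF assms(1)] orth_cancel[OF assms]
  by (simp add: transpose_mult[of _ n n _ m] assoc_mult_mat[of _ m n _ n _ m])

lemma gram_stiefel_mult:
  assumes "g \<in> stiefel n l" "x \<in> carrier_mat l m"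
  shows "transpose_mat (g * x) * (g * x) = transpose_mat x * x"
proof -
  note g = stiefelD[OF assms(1)]
  have "transpose_mat (g * x) * (g * x) = transpose_mat x * (transpose_mat g * (g * x))"
    using g(1) assms(2) by (simp add: transpose_mult[of _ n l _ m] assoc_mult_mat[of _ m l _ n _ m])
  also have "transpose_mat g * (g * x) = x"
    using g assms(2) by (subst assoc_mult_mat[symmetric, of _ l n _ l _ m]) auto
  finally show ?thesis .
qed

section \<open>The squared Frobenius norm\<close>

definition fsq :: "real mat \<Rightarrow> real" where
  "fsq x = (\<Sum>i<dim_row x. \<Sum>j<dim_col x. (x $$ (i,j))\<^sup>2)"

lemma fsq_eq: "x \<in> carrier_mat n m \<Longrightarrow> fsq x = (\<Sum>i<n. \<Sum>j<m. (x $$ (i,j))\<^sup>2)"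
  by (auto simp: fsq_def)

lemma fsq_nonneg: "fsq x \<ge> 0"
  by (auto simp: fsq_def intro!: sum_nonneg)

lemma fsq_eq_tr:
  assumes "x \<in> carrier_mat n m"
  shows "fsq x = mat_tr (transpose_mat x * x)"
proof -
  have "mat_tr (transpose_mat x * x) = (\<Sum>j<m. \<Sum>i<n. (x $$ (i,j))\<^sup>2)"
    using assms mult_mat_index[of "transpose_mat x" m n x m]
    by (auto simp: mat_tr_def power2_eq_square intro!: sum.cong)
  also have "\<dots> = fsq x" using assms by (subst sum.swap) (auto simp: fsq_eq)
  finally show ?thesis by simp
qed

lemma fsq_orth: "g \<in> orth_group n \<Longrightarrow> x \<in> carrier_mat n m \<Longrightarrow> fsq
    (g * x) = fsq x"
  by (metis fsq_eq_tr gram_orth_mult mult_carrier_mat orth_groupD(1))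

lemma fsq_append_rows:
  assumes "A \<in> carrier_mat a c" "B \<in> carrier_mat b c"
  shows "fsq (A @\<^sub>r B) = fsq A + fsq B"
proof -
  have "A @\<^sub>r B \<in> carrier_mat (a + b) c" using assms by auto
  then show ?thesis using assms
    by (simp add: fsq_eq_tr[of _ "a+b" c] fsq_eq_tr[of A a c] fsq_eq_tr[of B b c] gram_append_rows[of A
        a c B b c A B] mat_tr_add[of _ c])
qed

text \<open>The matrix \<open>[v; 0]\<close> has a zero row, so its determinant vanishes and its kernel contains
  a vector orthogonal to the columns of \<open>v\<close>.\<close>
lemma stiefel_extend_column:
  assumes v: "v \<in> stiefel n m" and mn: "m < n"
  shows "\<exists>w\<in>stiefel n (Suc m). w * (1\<^sub>m m @\<^sub>r 0\<^sub>m 1 m) = v"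
proof -
  note vc = stiefelD[OF v]
  define M where "M = transpose_mat v @\<^sub>r (0\<^sub>m (n - m) n :: real mat)"
  have M: "M \<in> carrier_mat n n"
    unfolding M_def using carrier_append_rows[of "transpose_mat v" m n "0\<^sub>m (n-m) n" "n-m"] vc mn by auto
  have "det (transpose_mat M) = 0"
  proof -
    have "M $$ (n-1, i) = 0" if "i < n" for i
      using append_rows_index[of "transpose_mat v" m n "0\<^sub>m (n-m) n" "n-m" "n-1" i] mn vc(1) that
      by (auto simp: M_def)
    then have "transpose_mat M *\<^sub>v unit_vec n (n-1) = 0\<^sub>v n"
      using mn M by (intro eq_vecI) auto
    moreover have "unit_vec n (n-1) \<noteq> (0\<^sub>v n :: real vec)" using mn by simp
    moreover have "transpose_mat M \<in> carrier_mat n n" using M by simp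
    ultimately show ?thesis using det_0_iff_vec_prod_zero[of "transpose_mat M" n] unit_vec_carrier by blast
  qed
  then have "det M = 0" using det_transpose[OF M] by simp
  then obtain u where u: "u \<in> carrier_vec n" "u \<noteq> 0\<^sub>v n" "M *\<^sub>v u = 0\<^sub>v n"
    using det_0_iff_vec_prod_zero[OF M] by auto
  have orth: "(\<Sum>k<n. v $$ (k,j) * u $ k) = 0" if "j < m" for j
  proof -
    have "(M *\<^sub>v u) $ j = 0" using u that mn by auto
    then have "(\<Sum>k<n. M $$ (j,k) * u $ k) = 0"
      using mult_mat_vec_index[OF M u(1), of j] that mn by auto
    moreover have "M $$ (j,k) = v $$ (k,j)" if "k < n" for k
      unfolding M_def using append_rows_index[of "transpose_mat v" m n "0\<^sub>m (n-m) n" "n-m" j k]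
          that \<open>j < m\<close> vc by auto
    ultimately show ?thesis by simp
  qed
  define c where "c = (\<Sum>k<n. (u $ k)\<^sup>2)"
  have "c > 0"
  proof -
    obtain i where "i < n" "u $ i \<noteq> 0" using u by (metis eq_vecI carrier_vecD index_zero_vec)
    then show ?thesis unfolding c_def by (intro sum_pos2[of _ i]) auto
  qed
  define w where "w = mat n (Suc m) (\<lambda>(i,j). if j < m then v $$ (i,j) else u $ i / sqrt c)"
  have w: "w \<in> carrier_mat n (Suc m)" by (simp add: w_def)
  have "transpose_mat w * w = 1\<^sub>m (Suc m)"
  proof (rule eq_matI)
    fix i j assume ij': "i < dim_row (1\<^sub>m (Suc m) :: real mat)" "j < dim_col (1\<^sub>m (Suc m)
        :: real mat)"
    then have ij: "i < Suc m" "j < Suc m" by auto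
    have *: "(transpose_mat w * w) $$ (i,j) = (\<Sum>k<n. w $$ (k,i) * w $$ (k,j))"
      using mult_mat_index[of "transpose_mat w" "Suc m" n w "Suc m" i j] w ij by auto
    have vv: "(\<Sum>k<n. v $$ (k,i) * v $$ (k,j)) = (if i = j then 1 else 0)" if "i < m" "j < m"
    proof -
      have "(transpose_mat v * v) $$ (i,j) = (\<Sum>k<n. v $$ (k,i) * v $$ (k,j))"
        using mult_mat_index[of "transpose_mat v" m n v m i j] vc(1) that by auto
      then show ?thesis using vc(2) that by auto
    qed
    have uu: "(\<Sum>k<n. u $ k * u $ k / \<bar>c\<bar>) = 1"
    proof -
      have "(\<Sum>k<n. u $ k * u $ k / \<bar>c\<bar>) = (\<Sum>k<n. (u $ k)\<^sup>2) / c"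
        using \<open>c > 0\<close> by (simp add: power2_eq_square sum_divide_distrib)
      then show ?thesis using \<open>c > 0\<close> by (simp add: c_def)
    qed
    have vu: "(\<Sum>k<n. v $$ (k,l) * u $ k / sqrt c) = 0" "(\<Sum>k<n. u $ k * v $$ (k,l) / sqrt c) =
        0" if "l < m" for l
      using orth[OF that] by (simp_all add: sum_divide_distrib[symmetric] mult.commute)
    show "(transpose_mat w * w) $$ (i,j) = 1\<^sub>m (Suc m) $$ (i,j)"
      unfolding * using ij
      by (cases "i < m"; cases "j < m") (auto simp: w_def vv uu vu less_Suc_eq)
  qed (use w in auto)
  then have "w \<in> stiefel n (Suc m)" using w by (auto simp: stiefel_def)
  moreover have "w * (1\<^sub>m m @\<^sub>r 0\<^sub>m 1 m) = v"
  proof (rule eq_matI)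
    fix i j assume "i < dim_row v" "j < dim_col v"
    then have ij: "i < n" "j < m" using vc by auto
    have c: "1\<^sub>m m @\<^sub>r 0\<^sub>m 1 m \<in> carrier_mat (Suc m) m"
      using carrier_append_rows[of "1\<^sub>m m" m m "0\<^sub>m 1 m" 1] by auto
    have "(w * (1\<^sub>m m @\<^sub>r 0\<^sub>m 1 m)) $$ (i,j) = (\<Sum>k<Suc m. w $$ (i,k) *
        (1\<^sub>m m @\<^sub>r 0\<^sub>m 1 m) $$ (k,j))"
      using mult_mat_index[OF w c ij] .
    also have "\<dots> = (\<Sum>k<Suc m. if k = j then w $$ (i,k) else 0)"
      using ij by (intro sum.cong) (auto simp: append_rows_index[of "1\<^sub>m m" m m "0\<^sub>m (Suc
          0) m" "Suc 0"] less_Suc_eq)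
    also have "\<dots> = v $$ (i,j)" using ij by (auto simp: w_def)
    finally show "(w * (1\<^sub>m m @\<^sub>r 0\<^sub>m 1 m)) $$ (i,j) = v $$ (i,j)" .
  qed (use w vc in \<open>auto simp: append_rows_def\<close>)
  ultimately show ?thesis by auto
qed

lemma top_frame_stiefel: "1\<^sub>m m @\<^sub>r 0\<^sub>m l m \<in> stiefel (m + l) m"
  using gram_append_rows[of "1\<^sub>m m" m m "0\<^sub>m l m" l m "1\<^sub>m m" "0\<^sub>m l m"]
    carrier_append_rows[of "1\<^sub>m m" m m "0\<^sub>m l m" l]
  by (auto simp: stiefel_def)

lemma bot_frame_stiefel: "0\<^sub>m l m @\<^sub>r 1\<^sub>m m \<in> stiefel (l + m) m"
  using gram_append_rows[of "0\<^sub>m l m" l m "1\<^sub>m m" m m "0\<^sub>m l m" "1\<^sub>m m"]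
    carrier_append_rows[of "0\<^sub>m l m" l m "1\<^sub>m m" m]
  by (auto simp: stiefel_def)

text \<open>Columns are added one at a time; the induction runs over the number \<open>l\<close> of
  missing columns while \<open>m\<close> and \<open>v\<close> vary. Every frame is thereby an image
  of the standard frame, which yields transitivity of O(n) on the Stiefel manifold.\<close>

lemma stiefel_extend:
  "v \<in> stiefel (m + l) m \<Longrightarrow> \<exists>g\<in>orth_group (m + l). g * (1\<^sub>m m
      @\<^sub>r 0\<^sub>m l m) = v"
proof (induction l arbitrary: m v)
  case 0
  then have "v * (1\<^sub>m m @\<^sub>r 0\<^sub>m 0 m) = v"
    using stiefelD(1)[OF 0] append_rows_nil[of "1\<^sub>m m" m m] by auto
  then show ?case using 0 by (auto simp: orth_group_eq_stiefel)
next
  case (Suc l)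
  from stiefel_extend_column[OF Suc.prems] obtain w where
    w: "w \<in> stiefel (m + Suc l) (Suc m)" "w * (1\<^sub>m m @\<^sub>r 0\<^sub>m 1 m) = v" by auto
  then obtain g where g: "g \<in> orth_group (m + Suc l)" "g * (1\<^sub>m (Suc m) @\<^sub>r 0\<^sub>m l
      (Suc m)) = w"
    using Suc.IH[of w "Suc m"] by auto
  have 1: "1\<^sub>m m @\<^sub>r (0\<^sub>m 1 m :: real mat) \<in> carrier_mat (Suc m) m"
    using carrier_append_rows[of "1\<^sub>m m" m m "0\<^sub>m 1 m" 1] by auto
  have 2: "1\<^sub>m (Suc m) @\<^sub>r (0\<^sub>m l (Suc m) :: real mat) \<in> carrier_mat (m + Suc l) (Suc m)"
    using stiefelD(1)[OF top_frame_stiefel[of "Suc m" l]] by simp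
  have "(1\<^sub>m (Suc m) @\<^sub>r 0\<^sub>m l (Suc m)) * (1\<^sub>m m @\<^sub>r 0\<^sub>m 1 m) =
      (1\<^sub>m m @\<^sub>r 0\<^sub>m 1 m) @\<^sub>r (0\<^sub>m l m :: real mat)"
    using append_rows_mult_right[OF _ _ 1, of "1\<^sub>m (Suc m)" "Suc m" "0\<^sub>m l (Suc m)" l] 1 by auto
  also have "\<dots> = 1\<^sub>m m @\<^sub>r 0\<^sub>m (Suc l) m"
    by (rule eq_matI) (auto simp: append_rows_def)
  finally have "g * (1\<^sub>m m @\<^sub>r 0\<^sub>m (Suc l) m) = v"
    using g w(2) assoc_mult_mat[OF orth_groupD(1)[OF g(1)] 2 1] by simp
  then show ?case using g(1) by blast
qed

lemma stiefel_transitive: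
  assumes "v \<in> stiefel n m" "w \<in> stiefel n m" "m \<le> n"
  shows "\<exists>g\<in>orth_group n. g * v = w"
proof -
  define E :: "real mat" where "E = 1\<^sub>m m @\<^sub>r 0\<^sub>m (n - m) m"
  obtain g h where g: "g \<in> orth_group n" "g * E = v" and h: "h \<in> orth_group n" "h * E = w"
    using stiefel_extend[of v m "n-m"] stiefel_extend[of w m "n-m"] assms unfolding E_def by auto
  have E: "E \<in> carrier_mat n m" using stiefelD(1)[OF top_frame_stiefel[of m "n-m"]] assms(3) by
      (simp add: E_def)
  have "transpose_mat g * v = E" using orth_cancel(1)[OF g(1) E] g by simp
  then have "(h * transpose_mat g) * v = w"
    using h stiefelD(1)[OF assms(1)] orth_groupD(1)[OF h(1)] orth_groupD(1)[OF g(1)]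
    by (subst assoc_mult_mat[of _ n n _ n _ m]) auto
  then show ?thesis using orth_group_mult[OF h(1) orth_groupD(4)[OF g(1)]] by blast
qed

subsection \<open>Square roots of Gram matrices\<close>

text \<open>Cramer's formula makes every entry a rational function of the entries of
  \<open>A\<close>, from which measurability is read off. At determinant 0 the value is the zero
  matrix.\<close>

definition minv :: "real mat \<Rightarrow> real mat" where
  "minv A = (1 / det A) \<cdot>\<^sub>m adj_mat A"

lemma minv:
  assumes "A \<in> carrier_mat n n" "det A \<noteq> 0"
  shows "minv A \<in> carrier_mat n n" "A * minv A = 1\<^sub>m n" "minv A * A = 1\<^sub>m n"
proof -
  note a = adj_mat[OF assms(1)]
  show "minv A \<in> carrier_mat n n" using a by (auto simp: minv_def)
  show "A * minv A = 1\<^sub>m n" unfolding minv_def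
    using a assms by (subst mult_smult_distrib[of _ n n _ n]) (auto intro!: eq_matI)
  show "minv A * A = 1\<^sub>m n" unfolding minv_def
    using a assms by (subst mult_smult_assoc_mat[of _ n n _ n]) (auto intro!: eq_matI)
qed

text \<open>The trace of D'SD is the sum of the quadratic form of S over the columns of D, so
  definiteness can be tested against a whole matrix at once.\<close>

lemma pos_def_quad:
  assumes "pos_def_mat m S" "D \<in> carrier_mat m m"
  shows "mat_tr (transpose_mat D * (S * D)) \<ge> 0"
    "mat_tr (transpose_mat D * (S * D)) = 0 \<Longrightarrow> D = 0\<^sub>m m m"
proof -
  have S: "S \<in> carrier_mat m m" using assms by (simp add: pos_def_mat_def)
  have eq: "mat_tr (transpose_mat D * (S * D)) = (\<Sum>j<m. col D j \<bullet> (S *\<^sub>v col D j))"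
    using assms(2) S by (auto simp: mat_tr_def simp del: col_mult2 intro!: sum.cong arg_cong2[where f =
        scalar_prod] col_mult2)
  have nn: "col D j \<bullet> (S *\<^sub>v col D j) \<ge> 0" "col D j \<bullet> (S *\<^sub>v col D j) =
      0 \<Longrightarrow> col D j = 0\<^sub>v m" if "j < m" for j
  proof -
    have c: "col D j \<in> carrier_vec m" using assms(2) by auto
    show "col D j \<bullet> (S *\<^sub>v col D j) \<ge> 0"
    proof (cases "col D j = 0\<^sub>v m")
      case False
      then show ?thesis using assms(1) c unfolding pos_def_mat_def by (metis less_imp_le)
    qed (use S in \<open>simp add: scalar_prod_def\<close>)
    show "col D j \<bullet> (S *\<^sub>v col D j) = 0 \<Longrightarrow> col D j = 0\<^sub>v m"
      using assms(1) c unfolding pos_def_mat_def by (metis less_irrefl)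
  qed
  show "mat_tr (transpose_mat D * (S * D)) \<ge> 0" unfolding eq using nn by (intro sum_nonneg) auto
  assume "mat_tr (transpose_mat D * (S * D)) = 0"
  then have "\<forall>j\<in>{..<m}. col D j \<bullet> (S *\<^sub>v col D j) = 0"
    unfolding eq by (subst (asm) sum_nonneg_eq_0_iff) (use nn in auto)
  then have z: "col D j = 0\<^sub>v m" if "j < m" for j using nn that by auto
  show "D = 0\<^sub>m m m"
  proof (rule eq_matI)
    fix i j assume "i < dim_row (0\<^sub>m m m :: real mat)" "j < dim_col (0\<^sub>m m m :: real mat)"
    then show "D $$ (i,j) = 0\<^sub>m m m $$ (i,j)" using z[of j] assms(2)
      by (metis carrier_matD index_col index_zero_mat index_zero_vec(1))
  qed (use assms in auto)
qed

text \<open>For D = S - T one has SD + DT = S^2 - T^2 = 0, even if S and T do not commute.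
  Multiplying by D and taking traces gives tr(DSD) + tr(DTD) = 0 with both terms nonnegative, so D =
  0.\<close>

lemma pos_def_sqrt_unique:
  assumes S: "pos_def_mat m S" and T: "pos_def_mat m T" and eq: "S * S = T * T"
  shows "S = T"
proof -
  have c: "S \<in> carrier_mat m m" "T \<in> carrier_mat m m" and t: "transpose_mat S = S" "transpose_mat T = T"
    using S T by (auto simp: pos_def_mat_def)
  define D where "D = S - T"
  have D: "D \<in> carrier_mat m m" "transpose_mat D = D"
    using c t by (auto simp: D_def transpose_minus)
  have ST: "S * T \<in> carrier_mat m m" "S * S \<in> carrier_mat m m" "T * T \<in> carrier_mat m m"
      using c by auto
  have 0: "S * D + D * T = 0\<^sub>m m m"
  proof -
    have "S * D = S * S - S * T" "D * T = S * T - T * T"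
      unfolding D_def using c by (auto simp: mult_minus_distrib_mat[of _ m m _ m]
          minus_mult_distrib_mat[of _ m m _ _ m])
    then show ?thesis using ST eq c by (intro eq_matI) (auto simp del: index_mult_mat(1))
  qed
  have "D * (S * D) + D * (D * T) = 0\<^sub>m m m"
    using 0 D c by (subst mult_add_distrib_mat[symmetric, of _ m m _ m]) auto
  then have "mat_tr (D * (S * D)) + mat_tr (D * (D * T)) = 0"
    using mat_tr_add[of "D * (S * D)" m "D * (D * T)"] D c by (simp add: mat_tr_def)
  moreover have "mat_tr (D * (D * T)) = mat_tr (D * (T * D))"
    using mat_tr_comm[of D m m "D * T"] D c by (simp add: assoc_mult_mat[of _ m m _ m _ m])
  ultimately have "mat_tr (transpose_mat D * (S * D)) = 0"
    using pos_def_quad(1)[OF S D(1)] pos_def_quad(1)[OF T D(1)] D by simp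
  then have "D = 0\<^sub>m m m" by (rule pos_def_quad(2)[OF S D(1)])
  have "S $$ (i,j) = T $$ (i,j)" if "i < m" "j < m" for i j
  proof -
    have "D $$ (i,j) = 0" using \<open>D = 0\<^sub>m m m\<close> that by simp
    then show ?thesis using that c by (simp add: D_def)
  qed
  then show ?thesis using c by (intro eq_matI) auto
qed

section \<open>Euclidean norms of vectors and bounds for operator norms\<close>

definition vn :: "real vec \<Rightarrow> real" where
  "vn w = L2_set (\<lambda>i. w $ i) {..<dim_vec w}"

lemma vn_nonneg: "vn w \<ge> 0" by (simp add: vn_def)

lemma vn_sq: "(vn w)\<^sup>2 = w \<bullet> w"
  by (auto simp: vn_def L2_set_def scalar_prod_def sum_nonneg power2_eq_square lessThan_atLeast0)

lemma vn_add: "dim_vec v = dim_vec w \<Longrightarrow> vn (v + w) \<le> vn v + vn w"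
proof -
  assume d: "dim_vec v = dim_vec w"
  have "vn (v + w) = L2_set (\<lambda>i. v $ i + w $ i) {..<dim_vec w}"
    using d by (auto simp: vn_def intro!: L2_set_cong)
  then show ?thesis
    using L2_set_triangle_ineq[of "\<lambda>i. v $ i" "\<lambda>i. w $ i" "{..<dim_vec w}"] d by (simp
        add: vn_def)
qed

lemma vn_smult: "vn (c \<cdot>\<^sub>v w) = \<bar>c\<bar> * vn w"
proof -
  have "(vn (c \<cdot>\<^sub>v w))\<^sup>2 = (\<bar>c\<bar> * vn w)\<^sup>2"
    by (simp add: vn_sq power_mult_distrib power2_eq_square[of c])
  then show ?thesis by (simp add: vn_nonneg power2_eq_iff_nonneg)
qed

lemma abs_scalar_prod_le: "dim_vec v = dim_vec w \<Longrightarrow> \<bar>v \<bullet> w\<bar> \<le> vn v * vn w"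
proof -
  assume d: "dim_vec v = dim_vec w"
  have "\<bar>v \<bullet> w\<bar> \<le> (\<Sum>i<dim_vec w. \<bar>v $ i\<bar> * \<bar>w $ i\<bar>)"
    unfolding scalar_prod_def lessThan_atLeast0 by (rule order_trans[OF sum_abs]) (simp add: abs_mult)
  also have "\<dots> \<le> vn v * vn w" unfolding vn_def d by (rule L2_set_mult_ineq)
  finally show ?thesis .
qed

text \<open>Cauchy-Schwarz in each row: the Frobenius norm bounds the operator norm.\<close>

lemma vn_mult_mat_vec_le:
  assumes "A \<in> carrier_mat a b" "w \<in> carrier_vec b"
  shows "(vn (A *\<^sub>v w))\<^sup>2 \<le> fsq A * (vn w)\<^sup>2"
proof -
  have "(vn (A *\<^sub>v w))\<^sup>2 = (\<Sum>i<a. (row A i \<bullet> w)\<^sup>2)"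
    using assms unfolding vn_sq scalar_prod_def[of "A *\<^sub>v w"]
    by (auto simp: power2_eq_square lessThan_atLeast0 intro!: sum.cong)
  also have "\<dots> \<le> (\<Sum>i<a. (row A i \<bullet> row A i) * (vn w)\<^sup>2)"
  proof (rule sum_mono)
    fix i assume "i \<in> {..<a}"
    have "\<bar>row A i \<bullet> w\<bar> \<le> vn (row A i) * vn w" using assms by (intro
        abs_scalar_prod_le) auto
    then have "(row A i \<bullet> w)\<^sup>2 \<le> (vn (row A i) * vn w)\<^sup>2" by (rule
        abs_le_square_iff[THEN iffD1, OF order_trans]) (simp add: vn_nonneg)
    then show "(row A i \<bullet> w)\<^sup>2 \<le> (row A i \<bullet> row A i) * (vn w)\<^sup>2" by
        (simp add: power_mult_distrib vn_sq)
  qed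
  also have "\<dots> = fsq A * (vn w)\<^sup>2"
    using assms(1) by (auto simp: fsq_eq scalar_prod_def power2_eq_square lessThan_atLeast0 simp flip:
        sum_distrib_right intro!: sum.cong)
  finally show ?thesis .
qed

definition op_bound :: "nat \<Rightarrow> real mat \<Rightarrow> real \<Rightarrow> bool" where
  "op_bound m A b \<longleftrightarrow> A \<in> carrier_mat m m \<and> 0 \<le> b \<and>
      (\<forall>w\<in>carrier_vec m. vn (A *\<^sub>v w) \<le> b * vn w)"

lemma op_bound_zero: "op_bound m (0\<^sub>m m m) 0"
proof -
  have "0\<^sub>m m m *\<^sub>v w = (0\<^sub>v m :: real vec)" if "w \<in> carrier_vec m" for w
    using that by (intro eq_vecI) auto
  then show ?thesis by (auto simp: op_bound_def vn_def L2_set_def)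
qed

lemma op_bound_add: "op_bound m A a \<Longrightarrow> op_bound m B b \<Longrightarrow> op_bound m (A +
    B) (a + b)"
  unfolding op_bound_def
proof safe
  fix w :: "real vec" assume A: "A \<in> carrier_mat m m" "B \<in> carrier_mat m m" "w \<in> carrier_vec m"
    "\<forall>w\<in>carrier_vec m. vn (A *\<^sub>v w) \<le> a * vn w" "\<forall>w\<in>carrier_vec m. vn
        (B *\<^sub>v w) \<le> b * vn w"
  have "vn ((A + B) *\<^sub>v w) = vn (A *\<^sub>v w + B *\<^sub>v w)" using A by (simp add:
      add_mult_distrib_mat_vec[of _ m m])
  also have "\<dots> \<le> vn (A *\<^sub>v w) + vn (B *\<^sub>v w)" using A by (intro vn_add) auto
  also have "\<dots> \<le> (a + b) * vn w" using A by (simp add: distrib_right add_mono)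
  finally show "vn ((A + B) *\<^sub>v w) \<le> (a + b) * vn w" .
qed auto

lemma op_bound_mult: "op_bound m A a \<Longrightarrow> op_bound m B b \<Longrightarrow> op_bound m (A *
    B) (a * b)"
  unfolding op_bound_def
proof safe
  fix w :: "real vec" assume A: "A \<in> carrier_mat m m" "B \<in> carrier_mat m m" "w \<in>
      carrier_vec m" "0 \<le> a"
    "\<forall>w\<in>carrier_vec m. vn (A *\<^sub>v w) \<le> a * vn w" "\<forall>w\<in>carrier_vec m. vn
        (B *\<^sub>v w) \<le> b * vn w"
  have "vn ((A * B) *\<^sub>v w) = vn (A *\<^sub>v (B *\<^sub>v w))" using A by (simp add:
      assoc_mult_mat_vec[of _ m m _ m])
  also have "\<dots> \<le> a * vn (B *\<^sub>v w)" using A by auto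
  also have "\<dots> \<le> a * (b * vn w)" using A by (intro mult_left_mono) auto
  finally show "vn ((A * B) *\<^sub>v w) \<le> a * b * vn w" by (simp add: mult.assoc)
qed auto

lemma op_bound_smult: "op_bound m A a \<Longrightarrow> op_bound m (c \<cdot>\<^sub>m A) (\<bar>c\<bar> * a)"
  unfolding op_bound_def
proof safe
  fix w :: "real vec" assume A: "A \<in> carrier_mat m m" "w \<in> carrier_vec m"
      "\<forall>w\<in>carrier_vec m. vn (A *\<^sub>v w) \<le> a * vn w"
  have "(c \<cdot>\<^sub>m A) *\<^sub>v w = c \<cdot>\<^sub>v (A *\<^sub>v w)" using A by (intro eq_vecI) auto
  then show "vn ((c \<cdot>\<^sub>m A) *\<^sub>v w) \<le> \<bar>c\<bar> * a * vn w" using A by (simp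
      add: vn_smult mult.assoc mult_left_mono)
qed auto

lemma op_bound_mono: "op_bound m A a \<Longrightarrow> a \<le> b \<Longrightarrow> op_bound m A b"
  unfolding op_bound_def by (meson mult_right_mono order_trans vn_nonneg)

text \<open>Testing against unit vectors turns operator bounds into bounds for entries, from which
  entrywise convergence of the iteration follows.\<close>

lemma op_bound_entry:
  assumes "op_bound m A a" "i < m" "j < m"
  shows "\<bar>A $$ (i,j)\<bar> \<le> a"
proof -
  have A: "A \<in> carrier_mat m m" using assms by (simp add: op_bound_def)
  have u: "vn (unit_vec m k) = 1" if "k < m" for k
    using that vn_sq[of "unit_vec m k"] vn_nonneg[of "unit_vec m k"] by (simp add: power2_eq_1_iff)
  have "A $$ (i,j) = unit_vec m i \<bullet> (A *\<^sub>v unit_vec m j)"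
    using assms A by auto
  also have "\<bar>\<dots>\<bar> \<le> vn (unit_vec m i) * vn (A *\<^sub>v unit_vec m j)"
    using A by (intro abs_scalar_prod_le) auto
  also have "\<dots> \<le> a" using assms u[of i] u[of j] unfolding op_bound_def by (metis
      mult.right_neutral mult_1 unit_vec_carrier)
  finally show ?thesis .
qed

section \<open>The square root of a Gram matrix as the limit of an iteration\<close>

primrec sqrt_iter :: "nat \<Rightarrow> real mat \<Rightarrow> nat \<Rightarrow> real mat" where
  "sqrt_iter m B 0 = 0\<^sub>m m m"
| "sqrt_iter m B (Suc j) = (1/2) \<cdot>\<^sub>m (B + sqrt_iter m B j * sqrt_iter m B j)"

text \<open>For \<open>r\<close> positive definite, \<open>1 - r / c\<close> has operator norm less
    than 1, so that the contraction
  \<open>Y \<mapsto> ((1 - r / c) + Y\<^sup>2) / 2\<close> has a fixed point with \<open>c (1 -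
      Y)\<^sup>2 = r\<close>.\<close>
definition sqrt_seq :: "nat \<Rightarrow> real mat \<Rightarrow> nat \<Rightarrow> real mat" where
  "sqrt_seq m r j = sqrt (mat_tr r + 1) \<cdot>\<^sub>m
     (1\<^sub>m m - sqrt_iter m (1\<^sub>m m - (1 / (mat_tr r + 1)) \<cdot>\<^sub>m r) j)"

lemma sqrt_iter_carrier: "B \<in> carrier_mat m m \<Longrightarrow> sqrt_iter m B j \<in> carrier_mat m m"
  by (induction j) auto

text \<open>The iteration stays in the ball of radius r and contracts there: since P^2 - Q^2 = P(P -
  Q) + (P - Q)Q, each difference of successive values is bounded by (r + r)/2 times the previous
  one. Symmetry, the fixed point equation and the bound pass to the entrywise limit.\<close>

lemma sqrt_iter_limit:
  assumes B: "op_bound m B b" "b < 1" "transpose_mat B = B"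
  obtains Y r where "Y \<in> carrier_mat m m" "transpose_mat Y = Y" "B + Y * Y = 2 \<cdot>\<^sub>m Y"
    "op_bound m Y r" "r < 1"
    "\<And>i j. i < m \<Longrightarrow> j < m \<Longrightarrow> (\<lambda>N. sqrt_iter m B N $$ (i,j))
        \<longlonglongrightarrow> Y $$ (i,j)"
proof -
  have b0: "0 \<le> b" and Bc: "B \<in> carrier_mat m m" using B by (auto simp: op_bound_def)
  \<comment> \<open>The smaller root of (b + r^2)/2 = r, so that the ball of radius r is mapped into
    itself; it is below 1 because b < 1.\<close>
  define r where "r = 1 - sqrt (1 - b)"
  have r: "0 \<le> r" "r < 1" using b0 B(2) by (auto simp: r_def)
  have rb: "(b + r * r) / 2 = r"
  proof -
    define s where "s = sqrt (1 - b)"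
    have "s * s = 1 - b" using B(2) by (simp add: s_def)
    then have b: "b = 1 - s * s" by simp
    have r: "r = 1 - s" by (simp add: r_def s_def)
    show ?thesis unfolding b r by (simp add: field_simps)
  qed
  let ?Y = "sqrt_iter m B"
  note Yc = sqrt_iter_carrier[OF Bc]
  have Yb: "op_bound m (?Y N) r" for N
  proof (induction N)
    case 0
    then show ?case using op_bound_mono[OF op_bound_zero r(1)] by simp
  next
    case (Suc N)
    have "op_bound m (?Y (Suc N)) (\<bar>1/2\<bar> * (b + r * r))"
      unfolding sqrt_iter.simps by (intro op_bound_smult op_bound_add op_bound_mult Suc B)
    then show ?case using rb by simp
  qed
  \<comment> \<open>For N = 0 the difference is the first iterate, bounded by r <= 1 = r^0.
    Afterwards \<open>B\<close> cancels and only the quadratic terms remain.\<close>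
  have Yd: "op_bound m (?Y (Suc N) + (-1) \<cdot>\<^sub>m ?Y N) (r ^ N)" for N
  proof (induction N)
    case 0
    have "?Y (Suc 0) + (-1) \<cdot>\<^sub>m ?Y 0 = ?Y (Suc 0)" using Bc by (intro eq_matI) auto
    then show ?case using Yb[of "Suc 0"] r op_bound_mono by (metis less_imp_le power_0)
  next
    case (Suc N)
    let ?D = "?Y (Suc N) + (-1) \<cdot>\<^sub>m ?Y N"
    have e: "?Y (Suc (Suc N)) + (-1) \<cdot>\<^sub>m ?Y (Suc N) = (1/2) \<cdot>\<^sub>m (?Y (Suc N) *
        ?D + ?D * ?Y N)"
    proof -
      define P Q where "P = ?Y (Suc N)" and "Q = ?Y N"
      have PQ: "P \<in> carrier_mat m m" "Q \<in> carrier_mat m m" using Yc[of "Suc N"] Yc[of N] by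
          (auto simp: P_def Q_def)
      have 1: "P * (P + (-1) \<cdot>\<^sub>m Q) = P * P + (-1) \<cdot>\<^sub>m (P * Q)"
        "(P + (-1) \<cdot>\<^sub>m Q) * Q = P * Q + (-1) \<cdot>\<^sub>m (Q * Q)"
        using PQ by (simp_all add: mult_add_distrib_mat[of _ m m _ m] add_mult_distrib_mat[of _ m m _ _
            m] mult_smult_distrib[of _ m m _ m] mult_smult_assoc_mat[of _ m m _ m])
      have 2: "P * P \<in> carrier_mat m m" "P * Q \<in> carrier_mat m m" "Q * Q \<in> carrier_mat m m"
          using PQ by auto
      have "(1/2) \<cdot>\<^sub>m (B + P * P) + (-1) \<cdot>\<^sub>m ((1/2) \<cdot>\<^sub>m (B + Q *
          Q)) = (1/2) \<cdot>\<^sub>m (P * (P + (-1) \<cdot>\<^sub>m Q) + (P + (-1) \<cdot>\<^sub>m Q) * Q)"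
        unfolding 1 using 2 PQ Bc by (intro eq_matI) (auto simp: field_simps simp del: index_mult_mat(1))
      then show ?thesis by (simp add: P_def Q_def)
    qed
    have "op_bound m ((1/2) \<cdot>\<^sub>m (?Y (Suc N) * ?D + ?D * ?Y N)) (\<bar>1/2\<bar> * (r * r ^
        N + r ^ N * r))"
      by (intro op_bound_smult op_bound_add op_bound_mult Suc Yb)
    then show ?case unfolding e by simp
  qed
  have conv: "convergent (\<lambda>N. ?Y N $$ (i,j))" if ij: "i < m" "j < m" for i j
  proof -
    have "summable (\<lambda>N. ?Y (Suc N) $$ (i,j) - ?Y N $$ (i,j))"
    proof (rule summable_comparison_test')
      show "summable (\<lambda>N. r ^ N)" using r by (intro summable_geometric) auto
      fix N show "norm (?Y (Suc N) $$ (i,j) - ?Y N $$ (i,j)) \<le> r ^ N"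
        using op_bound_entry[OF Yd[of N] ij] ij Yc[of N] Yc[of "Suc N"] by (simp del: sqrt_iter.simps)
    qed
    then have "convergent (\<lambda>N. \<Sum>k<N. ?Y (Suc k) $$ (i,j) - ?Y k $$ (i,j))"
      by (simp add: summable_iff_convergent)
    then have "convergent (\<lambda>N. ?Y N $$ (i,j) - ?Y 0 $$ (i,j))"
      using sum_lessThan_telescope[of "\<lambda>N. ?Y N $$ (i,j)"] by simp
    then show ?thesis using ij by simp
  qed
  define Y where "Y = mat m m (\<lambda>(i,j). lim (\<lambda>N. ?Y N $$ (i,j)))"
  have Y: "Y \<in> carrier_mat m m" by (simp add: Y_def)
  have lim: "(\<lambda>N. ?Y N $$ (i,j)) \<longlonglongrightarrow> Y $$ (i,j)" if "i < m" "j < m" for i j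
    using conv[OF that] that by (simp add: Y_def convergent_LIMSEQ_iff)
  have sym: "transpose_mat (?Y N) = ?Y N" for N
  proof (induction N)
    case (Suc N)
    have "transpose_mat (?Y (Suc N)) = (1/2) \<cdot>\<^sub>m (transpose_mat B + transpose_mat (?Y N * ?Y N))"
      using Bc Yc[of N] by (intro eq_matI) auto
    also have "transpose_mat (?Y N * ?Y N) = ?Y N * ?Y N" using Suc Yc[of N] by (simp add:
        transpose_mult[of _ m m _ m])
    finally show ?case using B(3) by simp
  qed auto
  have "transpose_mat Y = Y"
  proof (rule eq_matI)
    fix i j assume "i < dim_row Y" "j < dim_col Y"
    then have ij: "i < m" "j < m" using Y by auto
    have "?Y N $$ (j,i) = ?Y N $$ (i,j)" for N
      using ij Yc[of N] sym[of N] by (metis carrier_matD index_transpose_mat(1))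
    then have "Y $$ (j,i) = Y $$ (i,j)" using lim[OF ij] lim[OF ij(2,1)] LIMSEQ_unique by auto
    then show "transpose_mat Y $$ (i,j) = Y $$ (i,j)" using ij Y by auto
  qed (use Y in auto)
  moreover have "B + Y * Y = 2 \<cdot>\<^sub>m Y"
  proof (rule eq_matI)
    fix i j assume "i < dim_row (2 \<cdot>\<^sub>m Y)" "j < dim_col (2 \<cdot>\<^sub>m Y)"
    then have ij: "i < m" "j < m" using Y by auto
    have "(\<lambda>N. (1/2) * (B $$ (i,j) + (\<Sum>k<m. ?Y N $$ (i,k) * ?Y N $$ (k,j))))
        \<longlonglongrightarrow> (1/2) * (B $$ (i,j) + (\<Sum>k<m. Y $$ (i,k) * Y $$ (k,j)))"
      using ij by (intro tendsto_intros lim) auto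
    then have "(\<lambda>N. ?Y (Suc N) $$ (i,j)) \<longlonglongrightarrow> (1/2) * (B $$ (i,j) +
        (\<Sum>k<m. Y $$ (i,k) * Y $$ (k,j)))"
      using ij Bc by (simp add: mult_mat_index[OF Yc Yc] carrier_matD[OF Yc] del: index_mult_mat(1))
    moreover have "(\<lambda>N. ?Y (Suc N) $$ (i,j)) \<longlonglongrightarrow> Y $$ (i,j)"
      using lim[OF ij] by (rule LIMSEQ_Suc)
    ultimately have "(1/2) * (B $$ (i,j) + (\<Sum>k<m. Y $$ (i,k) * Y $$ (k,j))) = Y $$ (i,j)"
      by (rule LIMSEQ_unique)
    then show "(B + Y * Y) $$ (i,j) = (2 \<cdot>\<^sub>m Y) $$ (i,j)"
      using ij Bc Y by (simp add: mult_mat_index[OF Y Y] del: index_mult_mat(1))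
  qed (use Y Bc in auto)
  moreover have "op_bound m Y r"
    unfolding op_bound_def
  proof (intro conjI ballI)
    fix w :: "real vec" assume w: "w \<in> carrier_vec m"
    have eq: "vn (A *\<^sub>v w) = sqrt (\<Sum>i<m. (\<Sum>k<m. A $$ (i,k) * w $ k)\<^sup>2)" if "A
        \<in> carrier_mat m m" for A
      using that w mult_mat_vec_index[OF that w] by (simp add: vn_def L2_set_def del: index_mult_mat_vec)
    have "(\<lambda>N. vn (?Y N *\<^sub>v w)) \<longlonglongrightarrow> vn (Y *\<^sub>v w)"
      unfolding eq[OF Y] eq[OF Yc] by (intro tendsto_intros lim) auto
    then show "vn (Y *\<^sub>v w) \<le> r * vn w"
      by (rule LIMSEQ_le_const2) (use Yb w in \<open>auto simp: op_bound_def\<close>)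
  qed (use Y r in auto)
  ultimately show ?thesis using that Y r lim by blast
qed

lemma scalar_prod_gram:
  fixes x :: "real mat"
  assumes "x \<in> carrier_mat n m" "w \<in> carrier_vec m"
  shows "w \<bullet> ((transpose_mat x * x) *\<^sub>v w) = (vn (x *\<^sub>v w))\<^sup>2"
proof -
  have "w \<bullet> ((transpose_mat x * x) *\<^sub>v w) = w \<bullet> (transpose_mat x *\<^sub>v (x
      *\<^sub>v w))"
    using assms by (simp add: assoc_mult_mat_vec[of _ m n _ m])
  also have "\<dots> = (x *\<^sub>v w) \<bullet> (x *\<^sub>v w)"
    using assms transpose_vec_mult_scalar[of x n m w "x *\<^sub>v w"]
      comm_scalar_prod[of w m "transpose_mat x *\<^sub>v (x *\<^sub>v w)"] by auto
  finally show ?thesis by (simp add: vn_sq)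
qed

text \<open>With q = w'rw = |xw|^2 one has |w - rw/c|^2 = |w|^2 - 2q/c + |rw|^2/c^2. The bound
  |rw|^2 <= cq, from the Frobenius norm of x', reduces this to at most |w|^2 - q/c, and
  invertibility of r bounds |w|^2 by a multiple of q/c.\<close>

lemma gram_contraction:
  assumes x: "x \<in> carrier_mat n m" and det: "det (transpose_mat x * x) \<noteq> 0"
  shows "\<exists>b<1. op_bound m (1\<^sub>m m - (1 / (mat_tr (transpose_mat x * x) + 1))
      \<cdot>\<^sub>m (transpose_mat x * x)) b"
proof -
  define r where "r = transpose_mat x * x"
  have r: "r \<in> carrier_mat m m" using x by (auto simp: r_def)
  define c where "c = mat_tr r + 1"
  have c: "c = fsq x + 1" "c > 0" using fsq_eq_tr[OF x] fsq_nonneg[of x] by (auto simp: c_def r_def)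
  note R = minv[OF r det[folded r_def]]
  \<comment> \<open>From |w|^2 <= \<open>fsq (minv r)\<close> |rw|^2 and |rw|^2 <= cq comes |w|^2 <=
    K q/c. The added 1 makes K >= 1, so that 1 - 1/K has a real square root.\<close>
  define K where "K = fsq (minv r) * c\<^sup>2 + 1"
  have K: "K \<ge> 1" using fsq_nonneg by (auto simp: K_def)
  define b where "b = sqrt (1 - 1 / K)"
  have b: "0 \<le> b" "b < 1" "b\<^sup>2 = 1 - 1/K" using K by (auto simp: b_def)
  have "op_bound m (1\<^sub>m m - (1 / c) \<cdot>\<^sub>m r) b"
    unfolding op_bound_def
  proof (intro conjI ballI)
    fix w :: "real vec" assume w: "w \<in> carrier_vec m"
    have rw: "r *\<^sub>v w \<in> carrier_vec m" using r w by auto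
    define q where "q = (vn (x *\<^sub>v w))\<^sup>2"
    have qr: "w \<bullet> (r *\<^sub>v w) = q" using scalar_prod_gram[OF x w] by (simp add: r_def q_def)
    have q0: "q \<ge> 0" by (simp add: q_def)
    have 1: "(vn (r *\<^sub>v w))\<^sup>2 \<le> c * q"
    proof -
      have "r *\<^sub>v w = transpose_mat x *\<^sub>v (x *\<^sub>v w)" using x w by (simp add: r_def
          assoc_mult_mat_vec[of _ m n _ m])
      then have "(vn (r *\<^sub>v w))\<^sup>2 \<le> fsq (transpose_mat x) * q"
        using vn_mult_mat_vec_le[of "transpose_mat x" m n "x *\<^sub>v w"] x w by (simp add: q_def)
      moreover have "fsq (transpose_mat x) = fsq x" using x by (simp add: fsq_def sum.swap[of _ "{..<m}"])
      ultimately have "(vn (r *\<^sub>v w))\<^sup>2 \<le> fsq x * q" by simp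
      also have "\<dots> \<le> c * q" using q0 c by (intro mult_right_mono) auto
      finally show ?thesis .
    qed
    have 2: "(vn w)\<^sup>2 \<le> K * (q / c)"
    proof -
      have "w = minv r *\<^sub>v (r *\<^sub>v w)" using R r w by (simp flip: assoc_mult_mat_vec[of _ m m _ m])
      then have "(vn w)\<^sup>2 \<le> fsq (minv r) * (vn (r *\<^sub>v w))\<^sup>2"
        using vn_mult_mat_vec_le[OF R(1) rw] by simp
      also have "\<dots> \<le> fsq (minv r) * (c * q)" using 1 fsq_nonneg by (intro mult_left_mono) auto
      also have "\<dots> = (fsq (minv r) * c\<^sup>2) * (q / c)" using c by (simp add: power2_eq_square)
      also have "\<dots> \<le> K * (q / c)" using q0 c by (intro mult_right_mono) (auto simp: K_def)
      finally show ?thesis .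
    qed
    have e: "(1\<^sub>m m - (1 / c) \<cdot>\<^sub>m r) *\<^sub>v w = w - (1/c) \<cdot>\<^sub>v (r *\<^sub>v w)"
      using r w by (subst minus_mult_distrib_mat_vec[of _ m m]) auto
    have "(vn (w - (1/c) \<cdot>\<^sub>v (r *\<^sub>v w)))\<^sup>2 = (vn w)\<^sup>2 - 2 / c * q + (vn
        (r *\<^sub>v w))\<^sup>2 / c\<^sup>2"
    proof -
      have "(w - (1/c) \<cdot>\<^sub>v (r *\<^sub>v w)) \<bullet> (w - (1/c) \<cdot>\<^sub>v (r *\<^sub>v w)) =
        w \<bullet> w - (1/c) * (w \<bullet> (r *\<^sub>v w)) - (1/c) * ((r *\<^sub>v w) \<bullet> w) +
            (1/c) * ((1/c) * ((r *\<^sub>v w) \<bullet> (r *\<^sub>v w)))"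
        using w rw by (simp add: minus_scalar_prod_distrib[of _ m] scalar_prod_minus_distrib[of _ m]
            diff_divide_distrib)
      moreover have "a - (1/c) * b - (1/c) * b + (1/c) * ((1/c) * d) = a - 2 / c * b + d / c\<^sup>2"
          for a b d :: real
        by (simp add: power2_eq_square)
      ultimately show ?thesis unfolding vn_sq comm_scalar_prod[OF rw w] qr by simp
    qed
    also have "\<dots> \<le> (vn w)\<^sup>2 - 2 / c * q + c * q / c\<^sup>2"
      using 1 by (simp add: divide_right_mono)
    also have "\<dots> = (vn w)\<^sup>2 - q / c" using c(2) by (simp add: power2_eq_square)
    also have "\<dots> \<le> (vn w)\<^sup>2 - (vn w)\<^sup>2 / K" using 2 K by (simp add: field_simps)
    also have "\<dots> = (b * vn w)\<^sup>2" unfolding power_mult_distrib b(3) by (simp add: left_diff_distrib)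
    finally have "(vn ((1\<^sub>m m - (1 / c) \<cdot>\<^sub>m r) *\<^sub>v w))\<^sup>2 \<le> (b * vn
        w)\<^sup>2" by (simp add: e)
    then show "vn ((1\<^sub>m m - (1 / c) \<cdot>\<^sub>m r) *\<^sub>v w) \<le> b * vn w"
      by (rule power2_le_imp_le) (use b vn_nonneg in auto)
  qed (use r b in auto)
  then show ?thesis using b by (auto simp: r_def c_def)
qed

text \<open>From B + Y^2 = 2Y with B = 1 - r/c follows c(1 - Y)^2 = r, and the bound of Y below 1
  makes sqrt(c)(1 - Y) positive definite. The third claim exhibits the root as a pointwise limit of
  expressions that are measurable in r.\<close>

lemma gram_sqrt:
  assumes x: "x \<in> carrier_mat n m" and det: "det (transpose_mat x * x) \<noteq> 0"
  shows "pos_def_mat m (mat_sqrt m (transpose_mat x * x))" (is ?P)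
    and "mat_sqrt m (transpose_mat x * x) * mat_sqrt m (transpose_mat x * x) = transpose_mat x * x" (is ?Q)
    and "\<And>i j. i < m \<Longrightarrow> j < m \<Longrightarrow>
      (\<lambda>N. sqrt_seq m (transpose_mat x * x) N $$ (i,j)) \<longlonglongrightarrow> mat_sqrt m
          (transpose_mat x * x) $$ (i,j)"
proof -
  define r where "r = transpose_mat x * x"
  have r: "r \<in> carrier_mat m m" "transpose_mat r = r" using x by (auto simp: r_def
      transpose_mult[of _ m n _ m])
  define c where "c = mat_tr r + 1"
  have c: "c > 0" using fsq_eq_tr[OF x] fsq_nonneg[of x] by (auto simp: c_def r_def)
  define B where "B = 1\<^sub>m m - (1 / c) \<cdot>\<^sub>m r"
  have B: "B \<in> carrier_mat m m" "transpose_mat B = B"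
  proof -
    show "B \<in> carrier_mat m m" using r unfolding B_def by (intro minus_carrier_mat) auto
    have "r $$ (j,i) = r $$ (i,j)" if "i < m" "j < m" for i j
      using that r by (metis carrier_matD index_transpose_mat(1))
    then show "transpose_mat B = B" using r(1) unfolding B_def by (intro eq_matI) auto
  qed
  obtain b where b: "b < 1" "op_bound m B b"
    using gram_contraction[OF assms] by (auto simp: B_def c_def r_def)
  obtain Y q where Y: "Y \<in> carrier_mat m m" "transpose_mat Y = Y" "B + Y * Y = 2 \<cdot>\<^sub>m Y"
    "op_bound m Y q" "q < 1"
    "\<And>i j. i < m \<Longrightarrow> j < m \<Longrightarrow> (\<lambda>N. sqrt_iter m B N $$ (i,j))
        \<longlonglongrightarrow> Y $$ (i,j)"
    using sqrt_iter_limit[OF b(2,1) B(2)] by metis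
  define S where "S = sqrt c \<cdot>\<^sub>m (1\<^sub>m m - Y)"
  have S: "S \<in> carrier_mat m m" using Y(1) by (auto simp: S_def intro!: minus_carrier_mat)
  have St: "transpose_mat S = S"
  proof -
    have "Y $$ (j,i) = Y $$ (i,j)" if "i < m" "j < m" for i j
      using that Y by (metis carrier_matD index_transpose_mat(1))
    then show ?thesis using Y(1) unfolding S_def by (intro eq_matI) auto
  qed
  have SS: "S * S = r"
  proof (rule eq_matI)
    fix i j assume "i < dim_row r" "j < dim_col r"
    then have ij: "i < m" "j < m" using r by auto
    have ss: "sqrt c * (sqrt c * z) = c * z" for z
      using c by (simp flip: mult.assoc)
    have "S * S = sqrt c \<cdot>\<^sub>m (sqrt c \<cdot>\<^sub>m ((1\<^sub>m m - Y) * (1\<^sub>m m - Y)))"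
      unfolding S_def using Y(1) by (simp add: minus_carrier_mat mult_smult_distrib[of _ m m _ m]
          mult_smult_assoc_mat[of _ m m _ m])
    moreover have "(1\<^sub>m m - Y) * (1\<^sub>m m - Y) = 1\<^sub>m m - Y - (Y - Y * Y)"
      using Y(1) by (simp add: minus_carrier_mat mult_minus_distrib_mat[of _ m m _ m]
          minus_mult_distrib_mat[of _ m m _ _ m])
    ultimately have "(S * S) $$ (i,j) = sqrt c * (sqrt c * (1\<^sub>m m $$ (i,j) - Y $$ (i,j) - (Y $$
        (i,j) - (Y * Y) $$ (i,j))))"
      using ij Y(1) by (simp del: index_mult_mat(1) index_one_mat(1) add: index_one_mat(2,3))
    also have "\<dots> = c * (1\<^sub>m m $$ (i,j) - 2 * Y $$ (i,j) + (Y * Y) $$ (i,j))"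
      unfolding ss by (simp add: algebra_simps del: index_mult_mat(1))
    finally have SSij: "(S * S) $$ (i,j) = c * (1\<^sub>m m $$ (i,j) - 2 * Y $$ (i,j) + (Y * Y) $$ (i,j))" .
    have "(B + Y * Y) $$ (i,j) = 2 * Y $$ (i,j)" using Y ij by simp
    then have "B $$ (i,j) + (Y * Y) $$ (i,j) = 2 * Y $$ (i,j)" using ij Y(1) B(1) by (simp del:
        index_mult_mat(1))
    moreover have "B $$ (i,j) = 1\<^sub>m m $$ (i,j) - r $$ (i,j) / c" using ij r by (simp add: B_def)
    ultimately have "1\<^sub>m m $$ (i,j) - 2 * Y $$ (i,j) + (Y * Y) $$ (i,j) = r $$ (i,j) / c" by linarith
    with SSij have "(S * S) $$ (i,j) = c * (r $$ (i,j) / c)" by metis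
    then show "(S * S) $$ (i,j) = r $$ (i,j)" using c by simp
  qed (use S r in auto)
  have pd: "pos_def_mat m S"
    unfolding pos_def_mat_def
  proof (intro conjI ballI impI S St)
    fix w :: "real vec" assume w: "w \<in> carrier_vec m" "w \<noteq> 0\<^sub>v m"
    have Yw: "Y *\<^sub>v w \<in> carrier_vec m" using Y w by auto
    have "vn w > 0"
    proof -
      obtain i where i: "i < m" "w $ i \<noteq> 0" using w by (metis eq_vecI carrier_vecD index_zero_vec)
      then have "(\<Sum>i<m. (w $ i)\<^sup>2) > 0" by (intro sum_pos2[of _ i]) auto
      then show ?thesis using w by (auto simp: vn_def L2_set_def)
    qed
    have "S *\<^sub>v w = sqrt c \<cdot>\<^sub>v (w - Y *\<^sub>v w)"
    proof -
      have "S *\<^sub>v w = sqrt c \<cdot>\<^sub>v ((1\<^sub>m m - Y) *\<^sub>v w)" using Y(1) w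
          unfolding S_def by (intro eq_vecI) auto
      then show ?thesis using Y(1) w by (simp add: minus_mult_distrib_mat_vec[of _ m m])
    qed
    then have "w \<bullet> (S *\<^sub>v w) = sqrt c * ((vn w)\<^sup>2 - w \<bullet> (Y *\<^sub>v w))"
      using w Yw by (simp add: scalar_prod_minus_distrib[of _ m] vn_sq)
    moreover have "w \<bullet> (Y *\<^sub>v w) \<le> vn w * vn (Y *\<^sub>v w)" using
        abs_scalar_prod_le[of w "Y *\<^sub>v w"] w Y(1) by auto
    moreover have "vn w * vn (Y *\<^sub>v w) \<le> vn w * (q * vn w)" using Y(4) w by (intro
        mult_left_mono) (auto simp: op_bound_def vn_nonneg)
    moreover have "vn w * (q * vn w) < (vn w)\<^sup>2" using \<open>vn w > 0\<close> Y(5) by (simp add: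
        power2_eq_square)
    ultimately show "w \<bullet> (S *\<^sub>v w) > 0" using c by simp
  qed
  have eq: "mat_sqrt m r = S"
    unfolding mat_sqrt_def
    by (rule the_equality) (use pd SS pos_def_sqrt_unique in auto)
  show ?P ?Q using pd SS eq by (simp_all add: r_def)
  fix i j assume ij: "i < m" "j < m"
  have "(\<lambda>N. sqrt c * (1\<^sub>m m $$ (i,j) - sqrt_iter m B N $$ (i,j)))
      \<longlonglongrightarrow> sqrt c * (1\<^sub>m m $$ (i,j) - Y $$ (i,j))"
    by (intro tendsto_intros Y(6) ij)
  moreover have "sqrt c * (1\<^sub>m m $$ (i,j) - sqrt_iter m B N $$ (i,j)) = sqrt_seq m r N $$ (i,j)" for N
    using ij sqrt_iter_carrier[OF B(1), of N] by (simp add: sqrt_seq_def B_def c_def)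
  moreover have "sqrt c * (1\<^sub>m m $$ (i,j) - Y $$ (i,j)) = S $$ (i,j)"
    using ij Y(1) by (simp add: S_def)
  ultimately show "(\<lambda>N. sqrt_seq m (transpose_mat x * x) N $$ (i,j)) \<longlonglongrightarrow>
      mat_sqrt m (transpose_mat x * x) $$ (i,j)"
    using eq by (simp add: r_def)
qed

subsection \<open>Polar decomposition and frames\<close>

lemma pos_def_det: assumes "pos_def_mat m s" shows "det s \<noteq> 0"
proof
  assume "det s = 0"
  then obtain v where "v \<in> carrier_vec m" "v \<noteq> 0\<^sub>v m" "s *\<^sub>v v = 0\<^sub>v m"
    using det_0_iff_vec_prod_zero[of s m] assms by (auto simp: pos_def_mat_def)
  then show False using assms by (force simp: pos_def_mat_def)
qed

lemma gram_carrier: "x \<in> carrier_mat n m \<Longrightarrow> transpose_mat x * (x :: real mat) \<in>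
    carrier_mat m m"
  by auto

text \<open>The determinant is 0 or the square of the determinant of the root. This allows the
  complex power in \<open>E_ext\<close> to be replaced by a real one.\<close>

lemma det_gram_nonneg:
  assumes "x \<in> carrier_mat n m"
  shows "det (transpose_mat x * (x :: real mat)) \<ge> 0"
proof (cases "det (transpose_mat x * x) = 0")
  case False
  define s where "s = mat_sqrt m (transpose_mat x * x)"
  have "pos_def_mat m s" "s * s = transpose_mat x * x" using gram_sqrt[OF assms False] by (auto simp: s_def)
  then have "det (transpose_mat x * x) = det s * det s"
    using det_mult[of s m s] by (auto simp: pos_def_mat_def)
  then show ?thesis by simp
qed simp

text \<open>The Gram matrix of vs is s^2, so uniqueness of the root recovers s, and invertibility of
  s recovers v. To compute a polar part it then suffices to exhibit one decomposition.\<close>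

lemma polar_unique:
  assumes v: "v \<in> stiefel n m" and s: "pos_def_mat m s"
  shows "polar_part n m (v * s) = v" "mat_sqrt m (transpose_mat (v * s) * (v * s)) = s"
    "det (transpose_mat (v * s) * (v * s)) \<noteq> 0"
proof -
  have c: "s \<in> carrier_mat m m" "transpose_mat s = s" using s by (auto simp: pos_def_mat_def)
  note vc = stiefelD[OF v]
  have g: "transpose_mat (v * s) * (v * s) = s * s"
    using gram_stiefel_mult[OF v c(1)] c(2) by simp
  then show r: "mat_sqrt m (transpose_mat (v * s) * (v * s)) = s"
    unfolding mat_sqrt_def using s pos_def_sqrt_unique by (intro the_equality) auto
  show "det (transpose_mat (v * s) * (v * s)) \<noteq> 0"
    unfolding g using pos_def_det[OF s] det_mult[OF c(1) c(1)] by simp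
  show "polar_part n m (v * s) = v"
    unfolding polar_part_def r
  proof (rule the_equality)
    fix w assume w: "w \<in> stiefel n m \<and> v * s = w * s"
    have "u * s * minv s = u" if "u \<in> carrier_mat n m" for u
      using that minv[OF c(1) pos_def_det[OF s]] c(1)
      by (simp add: assoc_mult_mat[of _ n m _ m _ m])
    then have "v * s * minv s = v" "w * s * minv s = w" using w vc(1) stiefelD(1)[of w n m] by blast+
    then show "w = v" using w by metis
  qed (use v in simp)
qed

text \<open>The matrix v = x s^(-1) satisfies v'v = s^(-1) s^2 s^(-1) = 1 for the symmetric root s.
  The third claim replaces the description of the polar part by a formula.\<close>

lemma polar:
  assumes x: "x \<in> carrier_mat n m" and det: "det (transpose_mat x * x) \<noteq> 0"
  shows "polar_part n m x \<in> stiefel n m"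
    "x = polar_part n m x * mat_sqrt m (transpose_mat x * x)"
    "polar_part n m x = x * minv (mat_sqrt m (transpose_mat x * x))"
proof -
  define s where "s = mat_sqrt m (transpose_mat x * x)"
  have s: "pos_def_mat m s" "s * s = transpose_mat x * x" using gram_sqrt[OF assms] by (auto simp: s_def)
  have c: "s \<in> carrier_mat m m" "transpose_mat s = s" using s by (auto simp: pos_def_mat_def)
  note i = minv[OF c(1) pos_def_det[OF s(1)]]
  define v where "v = x * minv s"
  have v: "v \<in> carrier_mat n m" using x i by (auto simp: v_def)
  have xs: "x = v * s" unfolding v_def using x i c by (simp add: assoc_mult_mat[of _ n m _ m _ m])
  have "v \<in> stiefel n m"
  proof -
    have "transpose_mat v * v = transpose_mat (minv s) * (transpose_mat x * x) * minv s"
      unfolding v_def using x i by (simp add: transpose_mult[of _ n m _ m] assoc_mult_mat[of _ m m _ m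
          _ m] assoc_mult_mat[of _ m m _ n _ m] assoc_mult_mat[of _ m n _ m _ m])
    also have "\<dots> = transpose_mat (minv s) * s * (s * minv s)"
      unfolding s(2)[symmetric] using i c by (simp add: assoc_mult_mat[of _ m m _ m _ m])
    also have "transpose_mat (minv s) * s = 1\<^sub>m m"
      using i c transpose_mult[OF c(1) i(1)] by simp
    finally show ?thesis using i v by (auto simp: stiefel_def)
  qed
  from polar_unique(1)[OF this s(1)] have "polar_part n m x = v" using xs by simp
  then show "polar_part n m x \<in> stiefel n m" "x = polar_part n m x * mat_sqrt m (transpose_mat x * x)"
    "polar_part n m x = x * minv (mat_sqrt m (transpose_mat x * x))"
    using \<open>v \<in> stiefel n m\<close> xs v_def unfolding s_def by auto
qed

lemma mat_sqrt_carrier: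
  "x \<in> carrier_mat n m \<Longrightarrow> det (transpose_mat x * x) \<noteq> 0 \<Longrightarrow>
      mat_sqrt m (transpose_mat x * x) \<in> carrier_mat m m"
  using gram_sqrt(1)[of x n m] by (auto simp: pos_def_mat_def)

text \<open>If x = vs, then gx = (gv)s is a decomposition of the required form.\<close>

lemma polar_orth_left:
  assumes x: "x \<in> carrier_mat n m" and det: "det (transpose_mat x * x) \<noteq> 0" and g: "g \<in>
      orth_group n"
  shows "polar_part n m (g * x) = g * polar_part n m x"
proof -
  define s where "s = mat_sqrt m (transpose_mat x * x)"
  have s: "pos_def_mat m s" using gram_sqrt[OF x det] by (auto simp: s_def)
  note p = polar[OF x det, folded s_def]
  have "g * x = (g * polar_part n m x) * s"
    using p(2) stiefelD(1)[OF p(1)] orth_groupD(1)[OF g] s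
    by (subst assoc_mult_mat[of _ n n _ m _ m]) (auto simp: pos_def_mat_def)
  then show ?thesis using polar_unique(1)[OF orth_mult_stiefel[OF g p(1)] s] by simp
qed

lemma pos_def_conj:
  assumes s: "pos_def_mat m s" and g: "g \<in> orth_group m"
  shows "pos_def_mat m (transpose_mat g * s * g)"
  unfolding pos_def_mat_def
proof (intro conjI ballI impI)
  have c: "s \<in> carrier_mat m m" "transpose_mat s = s" using s by (auto simp: pos_def_mat_def)
  note gd = orth_groupD[OF g]
  show "transpose_mat g * s * g \<in> carrier_mat m m" using c gd by auto
  show "transpose_mat (transpose_mat g * s * g) = transpose_mat g * s * g"
    using c gd by (simp add: transpose_mult[of _ m m _ m] assoc_mult_mat[of _ m m _ m _ m])
  fix w :: "real vec" assume w: "w \<in> carrier_vec m" "w \<noteq> 0\<^sub>v m"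
  have "g *\<^sub>v w \<noteq> 0\<^sub>v m"
  proof
    assume 0: "g *\<^sub>v w = 0\<^sub>v m"
    have "transpose_mat g *\<^sub>v (g *\<^sub>v w) = w" using gd w by (simp flip:
        assoc_mult_mat_vec[of _ m m _ m])
    then have "w = transpose_mat g *\<^sub>v 0\<^sub>v m" unfolding 0 by simp
    also have "\<dots> = 0\<^sub>v m" using gd by (intro eq_vecI) auto
    finally show False using w by simp
  qed
  then have "0 < (g *\<^sub>v w) \<bullet> (s *\<^sub>v (g *\<^sub>v w))" using s gd w by (auto simp:
      pos_def_mat_def)
  also have "\<dots> = (transpose_mat g *\<^sub>v (s *\<^sub>v (g *\<^sub>v w))) \<bullet> w"
    using transpose_vec_mult_scalar[of g m m w "s *\<^sub>v (g *\<^sub>v w)"] gd c w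
    by (simp add: comm_scalar_prod[of "g *\<^sub>v w" m])
  also have "\<dots> = w \<bullet> ((transpose_mat g * s * g) *\<^sub>v w)"
    using gd c w by (simp add: comm_scalar_prod[of w m] assoc_mult_mat_vec[of _ m m _ m]
        assoc_mult_mat[of _ m m _ m _ m])
  finally show "0 < w \<bullet> ((transpose_mat g * s * g) *\<^sub>v w)" .
qed

text \<open>If x = vs, then xg = (vg)(g'sg), and g'sg is again positive definite.\<close>

lemma polar_orth_right:
  assumes x: "x \<in> carrier_mat n m" and det: "det (transpose_mat x * x) \<noteq> 0" and g: "g \<in>
      orth_group m"
  shows "polar_part n m (x * g) = polar_part n m x * g" "det (transpose_mat (x * g) * (x * g)) \<noteq> 0"
proof -
  define s where "s = mat_sqrt m (transpose_mat x * x)"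
  have s: "pos_def_mat m s" using gram_sqrt[OF x det] by (auto simp: s_def)
  then have c: "s \<in> carrier_mat m m" by (auto simp: pos_def_mat_def)
  note p = polar[OF x det, folded s_def] and gd = orth_groupD[OF g]
  note pc = stiefelD(1)[OF p(1)]
  have e: "x * g = (polar_part n m x * g) * (transpose_mat g * s * g)"
  proof -
    have "(polar_part n m x * g) * (transpose_mat g * s * g) = polar_part n m x * (g * (transpose_mat g
        * (s * g)))"
      using pc gd c by (simp add: assoc_mult_mat[of _ n m _ m _ m] assoc_mult_mat[of _ m m _ m _ m])
    also have "g * (transpose_mat g * (s * g)) = s * g"
      using orth_cancel(2)[OF g, of "s * g" m] c gd by auto
    also have "polar_part n m x * (s * g) = polar_part n m x * s * g"
      using pc gd c by (simp add: assoc_mult_mat[of _ n m _ m _ m])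
    finally show ?thesis using p(2) by simp
  qed
  have "polar_part n m x * g \<in> stiefel n m" using stiefel_mult[OF p(1)] g by (simp add:
      orth_group_eq_stiefel)
  from polar_unique[OF this pos_def_conj[OF s g]]
  show "polar_part n m (x * g) = polar_part n m x * g" "det (transpose_mat (x * g) * (x * g)) \<noteq> 0"
    unfolding e by auto
qed

section \<open>Rank and the Gram determinant\<close>

text \<open>Since |xw|^2 = w'x'xw, the matrices x and x'x have the same kernel.\<close>

lemma gram_det_kernel:
  assumes x: "x \<in> carrier_mat n m"
  shows "det (transpose_mat x * (x :: real mat)) \<noteq> 0 \<longleftrightarrow>
      (\<forall>w\<in>carrier_vec m. x *\<^sub>v w = 0\<^sub>v n \<longrightarrow> w = 0\<^sub>v m)"
proof -
  have "(transpose_mat x * x) *\<^sub>v w = 0\<^sub>v m \<longleftrightarrow> x *\<^sub>v w = 0\<^sub>v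
      n" if w: "w \<in> carrier_vec m" for w
  proof
    assume "(transpose_mat x * x) *\<^sub>v w = 0\<^sub>v m"
    then have "(vn (x *\<^sub>v w))\<^sup>2 = 0" using scalar_prod_gram[OF x w] w by simp
    then have "vn (x *\<^sub>v w) = 0" by simp
    then show "x *\<^sub>v w = 0\<^sub>v n" using x w by (intro eq_vecI) (auto simp: vn_def
        L2_set_eq_0_iff simp del: index_mult_mat_vec)
  next
    assume "x *\<^sub>v w = 0\<^sub>v n"
    then show "(transpose_mat x * x) *\<^sub>v w = 0\<^sub>v m" using x w by (subst
        assoc_mult_mat_vec[of _ m n _ m]) auto
  qed
  then show ?thesis
    using det_0_iff_vec_prod_zero[OF gram_carrier[OF x]] by blast
qed

text \<open>Connects the determinant condition, whose measurability is plain, with the rank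
  condition in \<open>E_ext\<close>.\<close>

lemma rank_eq_of_det_gram:
  assumes x: "x \<in> carrier_mat n m" and det: "det (transpose_mat x * (x :: real mat)) \<noteq> 0"
  shows "vec_space.rank n x = m"
proof -
  note k = gram_det_kernel[OF x, THEN iffD1, OF det]
  \<comment> \<open>Linear dependence is formulated for the set of columns, so a repetition has to
    be excluded separately: equal columns i and j would put e_i - e_j into the kernel.\<close>
  have "distinct (cols x)"
  proof (rule ccontr)
    assume "\<not> distinct (cols x)"
    then obtain i j where ij: "i < m" "j < m" "i \<noteq> j" "col x i = col x j"
      using x by (auto simp: distinct_conv_nth)
    have "x *\<^sub>v (unit_vec m i - unit_vec m j) = x *\<^sub>v unit_vec m i - x *\<^sub>v unit_vec m j"
      using x by (intro mult_minus_distrib_mat_vec) auto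
    moreover have "x *\<^sub>v unit_vec m l = col x l" if "l < m" for l
      using x that by (intro eq_vecI) auto
    ultimately have "x *\<^sub>v (unit_vec m i - unit_vec m j) = 0\<^sub>v n"
      using ij x by (intro eq_vecI) auto
    then have "unit_vec m i - unit_vec m j = (0\<^sub>v m :: real vec)" using k by auto
    then have "(unit_vec m i - unit_vec m j :: real vec) $ i = 0" using ij by simp
    then show False using ij by simp
  qed
  moreover have "\<not> module.lin_dep class_ring (module_vec TYPE(real) n) (set (cols x))"
  proof
    assume "module.lin_dep class_ring (module_vec TYPE(real) n) (set (cols x))"
    then show False using vec_space.lin_depE[OF x _ \<open>distinct (cols x)\<close>] k by metis
  qed
  ultimately show ?thesis using vec_space.lin_indpt_full_rank[OF x] by blast
qed

section \<open>Completing a frame to an orthogonal matrix\<close>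

definition append_cols :: "real mat \<Rightarrow> real mat \<Rightarrow> real mat" where
  "append_cols A B = mat (dim_row A) (dim_col A + dim_col B)
     (\<lambda>(i,j). if j < dim_col A then A $$ (i,j) else B $$ (i, j - dim_col A))"

lemma append_cols_carrier: "A \<in> carrier_mat n a \<Longrightarrow> B \<in> carrier_mat n b
    \<Longrightarrow> append_cols A B \<in> carrier_mat n (a + b)"
  by (auto simp: append_cols_def)

lemma append_cols_mult_rows:
  assumes "A \<in> carrier_mat n a" "B \<in> carrier_mat n b" "X \<in> carrier_mat a c" "Y \<in>
      carrier_mat b c"
  shows "append_cols A B * (X @\<^sub>r Y) = A * X + B * Y"
proof (rule eq_matI)
  fix i j assume "i < dim_row (A * X + B * Y)" "j < dim_col (A * X + B * Y)"
  then have ij: "i < n" "j < c" using assms by auto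
  have c: "X @\<^sub>r Y \<in> carrier_mat (a + b) c" using assms by auto
  have "(\<Sum>k<a + b. h k) = (\<Sum>k<a. h k) + (\<Sum>k<b. h (a + k))" for h :: "nat \<Rightarrow> real"
    by (induction b) auto
  then show "(append_cols A B * (X @\<^sub>r Y)) $$ (i,j) = (A * X + B * Y) $$ (i,j)"
    using ij assms mult_mat_index[OF append_cols_carrier[OF assms(1,2)] c ij]
      mult_mat_index[OF assms(1,3) ij] mult_mat_index[OF assms(2,4) ij]
    by (simp add: append_rows_index[OF assms(3,4)] append_cols_def del: index_mult_mat(1))
qed (use assms in \<open>auto simp: append_cols_def\<close>)

lemma gram_append_cols:
  assumes "A \<in> carrier_mat n a" "B \<in> carrier_mat n b"
  shows "transpose_mat (append_cols A B) * append_cols A B =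
    four_block_mat (transpose_mat A * A) (transpose_mat A * B) (transpose_mat B * A) (transpose_mat B * B)"
proof (rule eq_matI)
  let ?F = "four_block_mat (transpose_mat A * A) (transpose_mat A * B) (transpose_mat B * A)
      (transpose_mat B * B)"
  fix i j assume "i < dim_row ?F" "j < dim_col ?F"
  then have ij: "i < a + b" "j < a + b" using assms by auto
  note c = append_cols_carrier[OF assms]
  have "(transpose_mat (append_cols A B) * append_cols A B) $$ (i,j) =
    (\<Sum>k<n. append_cols A B $$ (k,i) * append_cols A B $$ (k,j))"
    using mult_mat_index[of "transpose_mat (append_cols A B)" "a+b" n "append_cols A B" "a+b" i j] c ij by auto
  moreover have "(transpose_mat X * Y) $$ (p,q) = (\<Sum>k<n. X $$ (k,p) * Y $$ (k,q))"
    if "X \<in> carrier_mat n x" "Y \<in> carrier_mat n y" "p < x" "q < y" for X Y :: "real mat" and x y p q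
    using mult_mat_index[of "transpose_mat X" x n Y y p q] that by auto
  moreover have "i - a < b" if "\<not> i < a" using that ij by simp
  moreover have "j - a < b" if "\<not> j < a" using that ij by simp
  ultimately show "(transpose_mat (append_cols A B) * append_cols A B) $$ (i,j) = ?F $$ (i,j)"
    using ij assms by (auto simp: append_cols_def simp del: index_mult_mat(1))
qed (use assms append_cols_carrier[OF assms] in auto)

lemma append_cols_stiefel:
  assumes "A \<in> stiefel n a" "B \<in> stiefel n b" "transpose_mat A * B = 0\<^sub>m a b"
  shows "append_cols A B \<in> stiefel n (a + b)"
proof -
  note A = stiefelD[OF assms(1)] and B = stiefelD[OF assms(2)]
  have "transpose_mat B * A = transpose_mat (transpose_mat A * B)"
    using A B by (simp add: transpose_mult[of _ a n _ b])
  also have "\<dots> = 0\<^sub>m b a" using assms(3) by simp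
  finally have "transpose_mat (append_cols A B) * append_cols A B = 1\<^sub>m (a + b)"
    using gram_append_cols[OF A(1) B(1)] A B assms(3) by simp
  then show ?thesis using append_cols_carrier[OF A(1) B(1)] by (auto simp: stiefel_def)
qed

definition bot_rows :: "nat \<Rightarrow> nat \<Rightarrow> real mat \<Rightarrow> real mat" where
  "bot_rows l m x = mat m m (\<lambda>(i,j). x $$ (l + i, j))"

text \<open>The columns of the first block are an orthonormal basis of the complement of the span of
  \<open>v\<close>, obtained from the projections of the first \<open>l\<close> unit vectors; these
      projections are linearly
  independent iff the last \<open>m\<close> rows of \<open>v\<close> are.\<close>
definition compl_cols :: "nat \<Rightarrow> nat \<Rightarrow> real mat \<Rightarrow> real mat" where
  "compl_cols l m v = (1\<^sub>m l @\<^sub>r 0\<^sub>m m l) - v * (transpose_mat v * (1\<^sub>m l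
      @\<^sub>r 0\<^sub>m m l))"

definition frame_of :: "nat \<Rightarrow> nat \<Rightarrow> real mat \<Rightarrow> real mat" where
  "frame_of l m v = append_cols (polar_part (l + m) l (compl_cols l m v)) v"

text \<open>Let C be the frame of the first l unit vectors and K = C - vv'C. If Kw = 0, then Cw = vz
  with z = v'Cw. The last m rows of C vanish, so the bottom block of v annihilates z; hence z = 0,
  so Cw = 0 and w = 0.\<close>

lemma compl_cols:
  assumes v: "v \<in> stiefel (l + m) m" and b: "det (bot_rows l m v) \<noteq> 0"
  shows "compl_cols l m v \<in> carrier_mat (l + m) l"
    "transpose_mat v * compl_cols l m v = 0\<^sub>m m l"
    "det (transpose_mat (compl_cols l m v) * compl_cols l m v) \<noteq> 0"
proof -
  define C :: "real mat" where "C = 1\<^sub>m l @\<^sub>r 0\<^sub>m m l"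
  have C: "C \<in> carrier_mat (l + m) l" using stiefelD(1)[OF top_frame_stiefel[of l m]] by (simp add: C_def)
  note vc = stiefelD[OF v]
  have VC: "transpose_mat v * C \<in> carrier_mat m l" using vc C by auto
  show K: "compl_cols l m v \<in> carrier_mat (l + m) l"
    unfolding compl_cols_def C_def[symmetric] using vc C VC by (intro minus_carrier_mat) auto
  have "transpose_mat v * (v * (transpose_mat v * C)) = transpose_mat v * C"
    using vc VC by (subst assoc_mult_mat[symmetric, of _ m "l+m" _ m _ l]) auto
  then show "transpose_mat v * compl_cols l m v = 0\<^sub>m m l"
    unfolding compl_cols_def C_def[symmetric] using vc C VC
    by (subst mult_minus_distrib_mat[of _ m "l+m" _ l]) auto
  show "det (transpose_mat (compl_cols l m v) * compl_cols l m v) \<noteq> 0"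
    unfolding gram_det_kernel[OF K]
  proof (intro ballI impI)
    fix w :: "real vec" assume w: "w \<in> carrier_vec l" "compl_cols l m v *\<^sub>v w = 0\<^sub>v (l + m)"
    define z where "z = (transpose_mat v * C) *\<^sub>v w"
    have z: "z \<in> carrier_vec m" using VC w by (auto simp: z_def)
    have "compl_cols l m v *\<^sub>v w = C *\<^sub>v w - (v * (transpose_mat v * C)) *\<^sub>v w"
      unfolding compl_cols_def C_def[symmetric] using w C vc VC by (intro minus_mult_distrib_mat_vec) auto
    also have "(v * (transpose_mat v * C)) *\<^sub>v w = v *\<^sub>v z"
      unfolding z_def using vc VC w by (intro assoc_mult_mat_vec) auto
    finally have e: "C *\<^sub>v w - v *\<^sub>v z = 0\<^sub>v (l + m)" using w by simp
    have Cw: "(C *\<^sub>v w) $ i = (v *\<^sub>v z) $ i" if "i < l + m" for i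
    proof -
      have "(C *\<^sub>v w - v *\<^sub>v z) $ i = 0" using e that by simp
      then show ?thesis using that vc C by (simp del: index_mult_mat_vec)
    qed
    have Cw': "(C *\<^sub>v w) $ i = (if i < l then w $ i else 0)" if "i < l + m" for i
    proof -
      have "(C *\<^sub>v w) $ i = (\<Sum>k<l. C $$ (i,k) * w $ k)" using mult_mat_vec_index[OF C w(1) that] .
      also have "\<dots> = (\<Sum>k<l. if k = i then w $ i else 0)"
        using that by (intro sum.cong) (auto simp: C_def append_rows_index[of "1\<^sub>m l" l l
            "0\<^sub>m m l" m])
      also have "\<dots> = (if i < l then w $ i else 0)" by simp
      finally show ?thesis .
    qed
    have B: "bot_rows l m v \<in> carrier_mat m m" by (simp add: bot_rows_def)
    have "bot_rows l m v *\<^sub>v z = 0\<^sub>v m"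
    proof (rule eq_vecI)
      fix i assume "i < dim_vec (0\<^sub>v m :: real vec)"
      then have i: "i < m" by simp
      have "(bot_rows l m v *\<^sub>v z) $ i = (v *\<^sub>v z) $ (l + i)"
        using mult_mat_vec_index[OF B z i] mult_mat_vec_index[OF vc(1) z, of "l + i"] i
        by (simp add: bot_rows_def del: index_mult_mat_vec)
      then show "(bot_rows l m v *\<^sub>v z) $ i = 0\<^sub>v m $ i" using Cw[of "l+i"] Cw'[of "l+i"] i by simp
    qed (simp add: bot_rows_def)
    then have "z = 0\<^sub>v m" using det_0_iff_vec_prod_zero[OF B] b z by blast
    then have "(v *\<^sub>v z) $ i = 0" if "i < l + m" for i using mult_mat_vec_index[OF vc(1) z that]
        that by simp
    then have "w $ i = 0" if "i < l" for i using Cw[of i] Cw'[of i] that by simp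
    then show "w = 0\<^sub>v l" using w by (intro eq_vecI) auto
  qed
qed

text \<open>The polar part of K is K s^(-1), hence still orthogonal to \<open>v\<close>. Joining
  \<open>v\<close> on the right gives an orthogonal matrix by explicit formulas rather than by
  choice.\<close>

lemma frame_of:
  assumes v: "v \<in> stiefel (l + m) m" and b: "det (bot_rows l m v) \<noteq> 0"
  shows "frame_of l m v \<in> orth_group (l + m)" "frame_of l m v * (0\<^sub>m l m @\<^sub>r 1\<^sub>m m) = v"
proof -
  define K where "K = compl_cols l m v"
  note k = compl_cols[OF assms, folded K_def]
  note p = polar[OF k(1,3)]
  note vc = stiefelD[OF v]
  define s where "s = mat_sqrt l (transpose_mat K * K)"
  have s: "s \<in> carrier_mat l l" "minv s \<in> carrier_mat l l"
    using mat_sqrt_carrier[OF k(1,3)] pos_def_det[OF gram_sqrt(1)[OF k(1,3)]] minv(1) by (auto simp: s_def)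
  have "transpose_mat v * (K * minv s) = (transpose_mat v * K) * minv s"
    using vc k(1) s by (intro assoc_mult_mat[symmetric]) auto
  then have 0: "transpose_mat v * polar_part (l + m) l K = 0\<^sub>m m l" using p(3) k(2) s by (simp add: s_def)
  have "transpose_mat (polar_part (l + m) l K) * v = transpose_mat (transpose_mat v * polar_part (l + m) l K)"
    using vc stiefelD(1)[OF p(1)] by (simp add: transpose_mult[of _ m "l+m" _ l])
  then have "transpose_mat (polar_part (l + m) l K) * v = 0\<^sub>m l m" using 0 by simp
  then show "frame_of l m v \<in> orth_group (l + m)"
    using append_cols_stiefel[OF p(1) v] by (simp add: frame_of_def K_def orth_group_eq_stiefel)
  show "frame_of l m v * (0\<^sub>m l m @\<^sub>r 1\<^sub>m m) = v"
    unfolding frame_of_def K_def[symmetric] using vc stiefelD(1)[OF p(1)]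
    by (subst append_cols_mult_rows[of _ "l+m" l _ m _ m]) auto
qed

text \<open>Two orthogonal matrices with the same last \<open>m\<close> columns differ by a right factor
  \<open>diag(h, 1)\<close>.\<close>
definition block_orth :: "nat \<Rightarrow> real mat \<Rightarrow> nat \<Rightarrow> real mat" where
  "block_orth l h m = four_block_mat h (0\<^sub>m l m) (0\<^sub>m m l) (1\<^sub>m m)"

lemma block_orth_carrier: "h \<in> carrier_mat l l \<Longrightarrow> block_orth l h m \<in> carrier_mat
    (l + m) (l + m)"
  by (simp add: block_orth_def)

lemma block_orth_orth:
  assumes "h \<in> orth_group l"
  shows "block_orth l h m \<in> orth_group (l + m)"
proof -
  note h = orth_groupD[OF assms]
  have "transpose_mat (block_orth l h m) = four_block_mat (transpose_mat h) (0\<^sub>m l m) (0\<^sub>m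
      m l) (1\<^sub>m m)"
    using h by (simp add: block_orth_def transpose_four_block_mat[of _ l l _ m _ m])
  then have "transpose_mat (block_orth l h m) * block_orth l h m = 1\<^sub>m (l + m)"
    using h mult_four_block_mat[of "transpose_mat h" l l "0\<^sub>m l m" m "0\<^sub>m m l" m "1\<^sub>m
        m" h l "0\<^sub>m l m" m "0\<^sub>m m l" "1\<^sub>m m"]
    by (simp add: block_orth_def)
  then show ?thesis using block_orth_carrier[OF h(1)] by (simp add: orth_group_def)
qed

lemma block_orth_mult:
  assumes "h \<in> carrier_mat l l" "h' \<in> carrier_mat l l"
  shows "block_orth l h m * block_orth l h' m = block_orth l (h * h') m"
  using assms mult_four_block_mat[of h l l "0\<^sub>m l m" m "0\<^sub>m m l" m "1\<^sub>m m" h' l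
      "0\<^sub>m l m" m "0\<^sub>m m l" "1\<^sub>m m"]
  by (simp add: block_orth_def)

lemma block_orth_rows:
  assumes "h \<in> carrier_mat l l" "X \<in> carrier_mat l c" "Y \<in> carrier_mat m c"
  shows "block_orth l h m * (X @\<^sub>r Y) = (h * X) @\<^sub>r Y"
  using assms four_block_mult_append_rows[of h l l "0\<^sub>m l m" m "0\<^sub>m m l" m "1\<^sub>m m" X c Y]
  by (simp add: block_orth_def)

text \<open>The matrix q, the transpose of g' times g, fixes the last m unit vectors, so these are
  its last columns; orthogonality of the other columns to them produces the zero block
  below.\<close>

lemma orth_same_last_cols:
  assumes g: "g \<in> orth_group (l + m)" and g': "g' \<in> orth_group (l + m)"
    and eq: "g * (0\<^sub>m l m @\<^sub>r 1\<^sub>m m) = g' * (0\<^sub>m l m @\<^sub>r 1\<^sub>m m)"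
  shows "\<exists>h\<in>orth_group l. g = g' * block_orth l h m"
proof -
  define q where "q = transpose_mat g' * g"
  have q: "q \<in> orth_group (l + m)" using g g' by (simp add: q_def orth_group_mult orth_groupD(4))
  note qc = orth_groupD[OF q]
  have E: "0\<^sub>m l m @\<^sub>r (1\<^sub>m m :: real mat) \<in> carrier_mat (l + m) m" using
      stiefelD(1)[OF bot_frame_stiefel] .
  have qE: "q * (0\<^sub>m l m @\<^sub>r 1\<^sub>m m) = 0\<^sub>m l m @\<^sub>r 1\<^sub>m m"
    unfolding q_def using eq orth_cancel(1)[OF g' E] orth_groupD(1)[OF g] orth_groupD(1)[OF g'] E
    by (subst assoc_mult_mat[of _ "l+m" "l+m" _ "l+m" _ m]) auto
  have last: "q $$ (i, l + j) = (if i = l + j then 1 else 0)" if "i < l + m" "j < m" for i j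
  proof -
    have "(q * (0\<^sub>m l m @\<^sub>r 1\<^sub>m m)) $$ (i,j) = (\<Sum>k<l+m. q $$ (i,k) * (0\<^sub>m
        l m @\<^sub>r 1\<^sub>m m) $$ (k,j))"
      by (rule mult_mat_index[OF qc(1) E that])
    also have "\<dots> = (\<Sum>k<l+m. if k = l + j then q $$ (i,k) else 0)"
      using that by (intro sum.cong) (auto simp: append_rows_index[of "0\<^sub>m l m" l m "1\<^sub>m m" m])
    also have "\<dots> = q $$ (i, l + j)" using that by simp
    finally have "q $$ (i, l + j) = (0\<^sub>m l m @\<^sub>r 1\<^sub>m m) $$ (i,j)" using qE by simp
    then show ?thesis using that by (auto simp: append_rows_index[of "0\<^sub>m l m" l m "1\<^sub>m m" m])
  qed
  have low: "q $$ (l + i, j) = 0" if "i < m" "j < l" for i j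
  proof -
    have "(transpose_mat q * q) $$ (l + i, j) = (\<Sum>k<l+m. q $$ (k, l+i) * q $$ (k,j))"
      using mult_mat_index[of "transpose_mat q" "l+m" "l+m" q "l+m" "l+i" j] qc(1) that by auto
    also have "\<dots> = (\<Sum>k<l+m. if k = l + i then q $$ (k,j) else 0)"
      using that by (intro sum.cong) (auto simp: last)
    also have "\<dots> = q $$ (l + i, j)" using that by simp
    finally show ?thesis using qc(2) that by simp
  qed
  define h where "h = mat l l (\<lambda>(i,j). q $$ (i,j))"
  have h: "h \<in> carrier_mat l l" by (simp add: h_def)
  have qb: "q = block_orth l h m"
  proof (rule eq_matI)
    fix i j assume "i < dim_row (block_orth l h m)" "j < dim_col (block_orth l h m)"
    then have ij: "i < l + m" "j < l + m" using block_orth_carrier[OF h, of m] by auto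
    show "q $$ (i,j) = block_orth l h m $$ (i,j)"
      using ij last[of i "j - l"] low[of "i - l" j] h
      by (cases "i < l"; cases "j < l") (auto simp: block_orth_def h_def)
  qed (use qc block_orth_carrier[OF h, of m] in auto)
  have "h \<in> orth_group l"
  proof -
    have "(transpose_mat h * h) $$ (i,j) = 1\<^sub>m l $$ (i,j)" if ij: "i < l" "j < l" for i j
    proof -
      have "(transpose_mat q * q) $$ (i,j) = (\<Sum>k<l+m. q $$ (k,i) * q $$ (k,j))"
        using mult_mat_index[of "transpose_mat q" "l+m" "l+m" q "l+m" i j] qc(1) that by auto
      also have "\<dots> = (\<Sum>k<l. q $$ (k,i) * q $$ (k,j)) + (\<Sum>k<m. q $$ (l+k,i) * q $$ (l+k,j))"
        by (induction m) auto
      also have "\<dots> = (transpose_mat h * h) $$ (i,j)"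
        using ij low mult_mat_index[of "transpose_mat h" l l h l i j] h by (auto simp: h_def)
      finally show ?thesis using qc(2) ij by simp
    qed
    then have "transpose_mat h * h = 1\<^sub>m l" using h by (intro eq_matI) auto
    then show ?thesis using h by (simp add: orth_group_def)
  qed
  moreover have "g = g' * q" unfolding q_def using orth_cancel(2)[OF g' orth_groupD(1)[OF g]] by simp
  ultimately show ?thesis using qb by auto
qed

subsection \<open>Lebesgue measure on matrices\<close>

abbreviation entries :: "nat \<Rightarrow> nat \<Rightarrow> (nat \<times> nat) set" where
  "entries n m \<equiv> {..<n} \<times> {..<m}"

text \<open>Lebesgue measure on the Borel sets, before completion. Products and images of measures
  are formed here; the completed measure is reached through \<open>AE_eq_completion\<close> and
  \<open>fourier_mat_eq\<close>.\<close>

definition lmat :: "nat \<Rightarrow> nat \<Rightarrow> real mat measure" where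
  "lmat n m = distr (Pi\<^sub>M (entries n m) (\<lambda>_. lborel)) (mat_borel n m) (mat n m)"

lemma mat_lebesgue_eq: "mat_lebesgue n m = completion (lmat n m)"
  by (simp add: mat_lebesgue_def lmat_def)

lemma space_mat_borel [simp]: "space (mat_borel n m) = carrier_mat n m"
  by (simp add: mat_borel_def)

lemma sets_lmat [simp, measurable_cong]: "sets (lmat n m) = sets (mat_borel n m)"
  by (simp add: lmat_def)

lemma space_lmat [simp]: "space (lmat n m) = carrier_mat n m"
  by (simp add: lmat_def)

lemma entries_measurable:
  "(\<lambda>x. \<lambda>p\<in>entries n m. x $$ p) \<in> mat_borel n m \<rightarrow>\<^sub>M
      Pi\<^sub>M (entries n m) (\<lambda>_. borel)"
  unfolding mat_borel_def by (rule measurable_vimage_algebra1) (auto simp: space_PiM)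

lemma entry_measurable:
  assumes "i < n" "j < m"
  shows "(\<lambda>x. x $$ (i,j)) \<in> borel_measurable (mat_borel n m)"
proof -
  have "(\<lambda>x. (\<lambda>p\<in>entries n m. x $$ p) (i,j)) \<in> borel_measurable (mat_borel n m)"
    by (rule measurable_compose[OF entries_measurable measurable_component_singleton]) (use assms in auto)
  then show ?thesis using assms by simp
qed

lemma mat_borelI:
  assumes "\<And>w. w \<in> space N \<Longrightarrow> F w \<in> carrier_mat n m"
    and "\<And>i j. i < n \<Longrightarrow> j < m \<Longrightarrow> (\<lambda>w. F w $$ (i,j)) \<in>
        borel_measurable N"
  shows "F \<in> N \<rightarrow>\<^sub>M mat_borel n m"
  unfolding mat_borel_def
proof (rule measurable_vimage_algebra2)
  show "(\<lambda>w. \<lambda>p\<in>entries n m. F w $$ p) \<in> N \<rightarrow>\<^sub>M Pi\<^sub>M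
      (entries n m) (\<lambda>_. borel)"
    by (rule measurable_restrict) (use assms(2) in auto)
qed (use assms(1) in auto)

lemma mat_borel_entry:
  assumes "F \<in> N \<rightarrow>\<^sub>M mat_borel n m" "i < n" "j < m"
  shows "(\<lambda>w. F w $$ (i,j)) \<in> borel_measurable N"
  by (rule measurable_compose[OF assms(1) entry_measurable[OF assms(2,3)]])

lemma mat_borel_carrier:
  "F \<in> N \<rightarrow>\<^sub>M mat_borel n m \<Longrightarrow> w \<in> space N \<Longrightarrow> F
      w \<in> carrier_mat n m"
  using measurable_space[of F N "mat_borel n m" w] by simp

lemma mat_measurable: "mat n m \<in> Pi\<^sub>M (entries n m) (\<lambda>_. lborel)
    \<rightarrow>\<^sub>M mat_borel n m"
proof (rule mat_borelI)
  fix i j assume "i < n" "j < m"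
  then show "(\<lambda>w. mat n m w $$ (i,j)) \<in> borel_measurable (Pi\<^sub>M (entries n m)
      (\<lambda>_. lborel))"
    using measurable_component_singleton[of "(i,j)" "entries n m" "\<lambda>_. lborel"] by simp
qed auto

lemma nn_integral_lmat:
  "F \<in> borel_measurable (mat_borel n m) \<Longrightarrow>
   (\<integral>\<^sup>+x. F x \<partial>lmat n m) = (\<integral>\<^sup>+w. F (mat n m w)
       \<partial>Pi\<^sub>M (entries n m) (\<lambda>_. lborel))"
  unfolding lmat_def by (intro nn_integral_distr mat_measurable) auto

definition rect :: "nat \<Rightarrow> nat \<Rightarrow> (nat \<times> nat \<Rightarrow> real set)
    \<Rightarrow> real mat set" where
  "rect n m A = {x \<in> carrier_mat n m. \<forall>i<n. \<forall>j<m. x $$ (i,j) \<in> A (i,j)}"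

lemma rect_vimage:
  "mat n m w \<in> rect n m A \<longleftrightarrow> (\<forall>p\<in>entries n m. w p \<in> A p)"
  by (auto simp: rect_def)

lemma rect_iff: "x \<in> rect n m A \<longleftrightarrow> x \<in> carrier_mat n m \<and>
    (\<forall>p\<in>entries n m. x $$ p \<in> A p)"
  by (auto simp: rect_def)

lemma rect_sets:
  assumes "\<And>p. p \<in> entries n m \<Longrightarrow> A p \<in> sets borel"
  shows "rect n m A \<in> sets (mat_borel n m)"
proof -
  have "rect n m A = (\<lambda>x. \<lambda>p\<in>entries n m. x $$ p) -` (Pi\<^sub>E (entries n m) A)
      \<inter> space (mat_borel n m)"
    by (rule Set.set_eqI) (auto simp only: rect_iff space_mat_borel PiE_iff vimage_eq Int_iff
        restrict_apply extensional_restrict if_True restrict_extensional cong: ball_cong)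
  also have "\<dots> \<in> sets (mat_borel n m)"
    by (rule measurable_sets[OF entries_measurable]) (use assms in \<open>auto intro!:
        sets_PiM_I_finite\<close>)
  finally show ?thesis .
qed

interpretation lb: product_sigma_finite "\<lambda>_ :: nat \<times> nat. lborel :: real measure" ..

lemma emeasure_lmat_rect:
  assumes "\<And>p. p \<in> entries n m \<Longrightarrow> A p \<in> sets borel"
  shows "emeasure (lmat n m) (rect n m A) = (\<Prod>p\<in>entries n m. emeasure lborel (A p))"
proof -
  have "mat n m -` rect n m A \<inter> space (Pi\<^sub>M (entries n m) (\<lambda>_. lborel)) =
      Pi\<^sub>E (entries n m) A"
    by (rule Set.set_eqI) (simp add: rect_vimage space_PiM PiE_iff conj_commute)
  then show ?thesis
    unfolding lmat_def using assms
    by (simp add: emeasure_distr[OF mat_measurable rect_sets] lb.emeasure_PiM)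
qed

text \<open>Passing to the entries reduces the claim to uniqueness of the product measure. The
  images of Lebesgue measure under affine maps, joining of blocks and transposition are all verified
  on boxes through it.\<close>

lemma lmat_eqI:
  assumes s: "sets M = sets (mat_borel n m)"
    and eq: "\<And>A. (\<And>p. p \<in> entries n m \<Longrightarrow> A p \<in> sets borel) \<Longrightarrow>
      emeasure M (rect n m A) = (\<Prod>p\<in>entries n m. emeasure lborel (A p))"
  shows "M = lmat n m"
proof -
  let ?e = "\<lambda>x. \<lambda>p\<in>entries n m. x $$ p" and ?P = "Pi\<^sub>M (entries n m)
      (\<lambda>_. lborel :: real measure)"
  have sp: "space M = carrier_mat n m" using sets_eq_imp_space_eq[OF s] by simp
  have sP: "sets (Pi\<^sub>M (entries n m) (\<lambda>_. borel :: real measure)) = sets ?P" by (intro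
      sets_PiM_cong) auto
  have e: "?e \<in> M \<rightarrow>\<^sub>M ?P"
    by (subst measurable_cong_sets[OF s sP[symmetric]]) (rule entries_measurable)
  have "distr M ?P ?e = ?P"
  proof (rule lb.PiM_eqI)
    fix A :: "nat \<times> nat \<Rightarrow> real set" assume A: "\<And>p. p \<in> entries n m
        \<Longrightarrow> A p \<in> sets lborel"
    have "?e -` Pi\<^sub>E (entries n m) A \<inter> space M = rect n m A"
      by (rule Set.set_eqI) (auto simp only: rect_iff sp PiE_iff vimage_eq Int_iff restrict_apply
          extensional_restrict if_True restrict_extensional cong: ball_cong)
    then show "emeasure (distr M ?P ?e) (Pi\<^sub>E (entries n m) A) = (\<Prod>p\<in>entries n m.
        emeasure lborel (A p))"
      using A eq[of A] by (subst emeasure_distr[OF e]) (auto intro!: sets_PiM_I_finite)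
  qed auto
  then have "lmat n m = distr (distr M ?P ?e) (mat_borel n m) (mat n m)" by (simp add: lmat_def)
  also have "\<dots> = distr M (mat_borel n m) (mat n m \<circ> ?e)"
    by (rule distr_distr[OF mat_measurable e])
  also have "\<dots> = distr M (mat_borel n m) (\<lambda>x. x)"
    by (rule distr_cong) (auto simp: sp intro!: eq_matI)
  also have "\<dots> = M" by (rule distr_id2) (use s in simp)
  finally show ?thesis by simp
qed

lemma sigma_finite_lmat: "sigma_finite_measure (lmat n m)"
proof
  define B where "B N = rect n m (\<lambda>_. {- real N .. real N})" for N :: nat
  have fin: "emeasure (lmat n m) (B N) \<noteq> \<infinity>" for N
    unfolding B_def by (subst emeasure_lmat_rect) (auto simp: ennreal_power)
  have cov: "(\<Union>N. B N) = carrier_mat n m"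
  proof (intro equalityI subsetI)
    fix x :: "real mat" assume x: "x \<in> carrier_mat n m"
    obtain N :: nat where N: "(\<Sum>p\<in>entries n m. \<bar>x $$ p\<bar>) \<le> real N" using
        real_arch_simple by blast
    have "\<bar>x $$ (i,j)\<bar> \<le> real N" if "i < n" "j < m" for i j
      using N member_le_sum[of "(i,j)" "entries n m" "\<lambda>p. \<bar>x $$ p\<bar>"] that by auto
    then have "x \<in> B N" using x by (fastforce simp: B_def rect_def abs_le_iff)
    then show "x \<in> (\<Union>N. B N)" by auto
  qed (auto simp: B_def rect_def)
  show "\<exists>A. countable A \<and> A \<subseteq> sets (lmat n m) \<and> \<Union>A = space (lmat n
      m) \<and> (\<forall>a\<in>A. emeasure (lmat n m) a \<noteq> \<infinity>)"
    using fin cov by (intro exI[of _ "range B"]) (auto simp: B_def intro!: rect_sets)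
qed

subsection \<open>Measurability of matrix operations\<close>

lemma mat_mult_measurable:
  assumes "F \<in> N \<rightarrow>\<^sub>M mat_borel n m" "G \<in> N \<rightarrow>\<^sub>M mat_borel m l"
  shows "(\<lambda>w. F w * G w) \<in> N \<rightarrow>\<^sub>M mat_borel n l"
proof (rule mat_borelI)
  note c = mat_borel_carrier[OF assms(1)] mat_borel_carrier[OF assms(2)]
  show "F w * G w \<in> carrier_mat n l" if "w \<in> space N" for w using c[OF that] by auto
  fix i j assume ij: "i < n" "j < l"
  have "(\<lambda>w. \<Sum>k<m. F w $$ (i,k) * G w $$ (k,j)) \<in> borel_measurable N"
    using ij by (intro borel_measurable_sum borel_measurable_times mat_borel_entry[OF assms(1)]
        mat_borel_entry[OF assms(2)]) auto
  then show "(\<lambda>w. (F w * G w) $$ (i,j)) \<in> borel_measurable N"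
    by (rule measurable_cong[THEN iffD1, rotated]) (simp add: mult_mat_index[OF c(1) c(2)] ij del:
        index_mult_mat(1))
qed

lemma mat_transpose_measurable:
  assumes "F \<in> N \<rightarrow>\<^sub>M mat_borel n m"
  shows "(\<lambda>w. transpose_mat (F w)) \<in> N \<rightarrow>\<^sub>M mat_borel m n"
proof (rule mat_borelI)
  note c = mat_borel_carrier[OF assms(1)]
  show "transpose_mat (F w) \<in> carrier_mat m n" if "w \<in> space N" for w using c[OF that] by auto
  fix i j assume ij: "i < m" "j < n"
  show "(\<lambda>w. transpose_mat (F w) $$ (i,j)) \<in> borel_measurable N"
    by (rule measurable_cong[THEN iffD1, OF _ mat_borel_entry[OF assms(1) ij(2,1)]]) (use ij in
        \<open>simp add: carrier_matD[OF c]\<close>)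
qed

lemma mat_add_measurable:
  assumes "F \<in> N \<rightarrow>\<^sub>M mat_borel n m" "G \<in> N \<rightarrow>\<^sub>M mat_borel n m"
  shows "(\<lambda>w. F w + G w) \<in> N \<rightarrow>\<^sub>M mat_borel n m"
proof (rule mat_borelI)
  note c = mat_borel_carrier[OF assms(1)] mat_borel_carrier[OF assms(2)]
  show "F w + G w \<in> carrier_mat n m" if "w \<in> space N" for w using c[OF that] by auto
  fix i j assume ij: "i < n" "j < m"
  have "(\<lambda>w. F w $$ (i,j) + G w $$ (i,j)) \<in> borel_measurable N"
    using ij by (intro borel_measurable_add mat_borel_entry[OF assms(1)] mat_borel_entry[OF assms(2)]) auto
  then show "(\<lambda>w. (F w + G w) $$ (i,j)) \<in> borel_measurable N"
    by (rule measurable_cong[THEN iffD1, rotated]) (use ij in \<open>simp add: carrier_matD[OF c(1)]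
        carrier_matD[OF c(2)]\<close>)
qed

lemma mat_minus_measurable:
  assumes "F \<in> N \<rightarrow>\<^sub>M mat_borel n m" "G \<in> N \<rightarrow>\<^sub>M mat_borel n m"
  shows "(\<lambda>w. F w - G w) \<in> N \<rightarrow>\<^sub>M mat_borel n m"
proof (rule mat_borelI)
  note c = mat_borel_carrier[OF assms(1)] mat_borel_carrier[OF assms(2)]
  show "F w - G w \<in> carrier_mat n m" if "w \<in> space N" for w using c[OF that] by (auto intro!:
      minus_carrier_mat)
  fix i j assume ij: "i < n" "j < m"
  have "(\<lambda>w. F w $$ (i,j) - G w $$ (i,j)) \<in> borel_measurable N"
    using ij by (intro borel_measurable_diff mat_borel_entry[OF assms(1)] mat_borel_entry[OF assms(2)]) auto
  then show "(\<lambda>w. (F w - G w) $$ (i,j)) \<in> borel_measurable N"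
    by (rule measurable_cong[THEN iffD1, rotated]) (use ij in \<open>simp add: carrier_matD[OF c(1)]
        carrier_matD[OF c(2)]\<close>)
qed

lemma mat_smult_measurable:
  assumes "f \<in> borel_measurable N" "F \<in> N \<rightarrow>\<^sub>M mat_borel n m"
  shows "(\<lambda>w. f w \<cdot>\<^sub>m F w) \<in> N \<rightarrow>\<^sub>M mat_borel n m"
proof (rule mat_borelI)
  note c = mat_borel_carrier[OF assms(2)] mat_borel_carrier[OF assms(2)]
  show "f w \<cdot>\<^sub>m F w \<in> carrier_mat n m" if "w \<in> space N" for w using c[OF that] by auto
  fix i j assume ij: "i < n" "j < m"
  have "(\<lambda>w. f w * F w $$ (i,j)) \<in> borel_measurable N"
    using ij by (intro borel_measurable_times assms(1) mat_borel_entry[OF assms(2)]) auto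
  then show "(\<lambda>w. (f w \<cdot>\<^sub>m F w) $$ (i,j)) \<in> borel_measurable N"
    by (rule measurable_cong[THEN iffD1, rotated]) (use ij in \<open>simp add: carrier_matD[OF c(1)]
        carrier_matD[OF c(2)]\<close>)
qed

lemma mat_const_measurable: "X \<in> carrier_mat n m \<Longrightarrow> (\<lambda>w. X) \<in> N
    \<rightarrow>\<^sub>M mat_borel n m"
  by (rule measurable_const) simp

lemma append_rows_measurable:
  assumes "F \<in> N \<rightarrow>\<^sub>M mat_borel a m" "G \<in> N \<rightarrow>\<^sub>M mat_borel b m"
  shows "(\<lambda>w. F w @\<^sub>r G w) \<in> N \<rightarrow>\<^sub>M mat_borel (a + b) m"
proof (rule mat_borelI)
  note c = mat_borel_carrier[OF assms(1)] mat_borel_carrier[OF assms(2)]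
  show "F w @\<^sub>r G w \<in> carrier_mat (a + b) m" if "w \<in> space N" for w using c[OF that] by auto
  fix i j assume ij: "i < a + b" "j < m"
  have "(\<lambda>w. if i < a then F w $$ (i,j) else G w $$ (i - a, j)) \<in> borel_measurable N"
    using ij mat_borel_entry[OF assms(1), of i j] mat_borel_entry[OF assms(2), of "i - a" j] by (cases
        "i < a") auto
  then show "(\<lambda>w. (F w @\<^sub>r G w) $$ (i,j)) \<in> borel_measurable N"
    by (rule measurable_cong[THEN iffD1, rotated]) (simp add: append_rows_index[OF c(1) c(2)] ij)
qed

lemma append_cols_measurable:
  assumes "F \<in> N \<rightarrow>\<^sub>M mat_borel n a" "G \<in> N \<rightarrow>\<^sub>M mat_borel n b"
  shows "(\<lambda>w. append_cols (F w) (G w)) \<in> N \<rightarrow>\<^sub>M mat_borel n (a + b)"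
proof (rule mat_borelI)
  note c = mat_borel_carrier[OF assms(1)] mat_borel_carrier[OF assms(2)]
  show "append_cols (F w) (G w) \<in> carrier_mat n (a + b)" if "w \<in> space N" for w
    using c[OF that] by (auto intro!: append_cols_carrier)
  fix i j assume ij: "i < n" "j < a + b"
  have "(\<lambda>w. if j < a then F w $$ (i,j) else G w $$ (i, j - a)) \<in> borel_measurable N"
    using ij mat_borel_entry[OF assms(1), of i j] mat_borel_entry[OF assms(2), of i "j - a"] by (cases
        "j < a") auto
  then show "(\<lambda>w. append_cols (F w) (G w) $$ (i,j)) \<in> borel_measurable N"
    by (rule measurable_cong[THEN iffD1, rotated]) (use c ij in \<open>fastforce simp: append_cols_def\<close>)
qed

lemma mat_det_measurable:
  assumes "F \<in> N \<rightarrow>\<^sub>M mat_borel n n"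
  shows "(\<lambda>w. det (F w)) \<in> borel_measurable N"
proof -
  note c = mat_borel_carrier[OF assms(1)]
  have "(\<lambda>w. \<Sum>p | p permutes {0..<n}. signof p * (\<Prod>i = 0..<n. F w $$ (i, p i)))
      \<in> borel_measurable N"
  proof (intro borel_measurable_sum borel_measurable_times borel_measurable_const borel_measurable_prod)
    fix p i assume "p \<in> {p. p permutes {0..<n}}" "i \<in> {0..<n}"
    then have "p i < n" "i < n" using permutes_in_image[of p "{0..<n}" i] by auto
    then show "(\<lambda>w. F w $$ (i, p i)) \<in> borel_measurable N" by (intro mat_borel_entry[OF assms])
  qed
  then show ?thesis
    by (rule measurable_cong[THEN iffD1, rotated]) (simp add: det_def'[OF c])
qed

lemma mat_tr_measurable:
  assumes "F \<in> N \<rightarrow>\<^sub>M mat_borel n n"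
  shows "(\<lambda>w. mat_tr (F w)) \<in> borel_measurable N"
proof -
  have "(\<lambda>w. \<Sum>i<n. F w $$ (i,i)) \<in> borel_measurable N"
    by (intro borel_measurable_sum mat_borel_entry[OF assms]) auto
  then show ?thesis
    by (rule measurable_cong[THEN iffD1, rotated]) (simp add: mat_tr_def carrier_matD[OF
        mat_borel_carrier[OF assms]])
qed

lemma fsq_measurable:
  assumes "F \<in> N \<rightarrow>\<^sub>M mat_borel n m"
  shows "(\<lambda>w. fsq (F w)) \<in> borel_measurable N"
proof -
  have "(\<lambda>w. \<Sum>i<n. \<Sum>j<m. (F w $$ (i,j))\<^sup>2) \<in> borel_measurable N"
    by (intro borel_measurable_sum borel_measurable_power mat_borel_entry[OF assms]) auto
  then show ?thesis
    by (rule measurable_cong[THEN iffD1, rotated]) (simp add: fsq_eq[OF mat_borel_carrier[OF assms]])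
qed

lemma minv_measurable:
  assumes "F \<in> N \<rightarrow>\<^sub>M mat_borel n n"
  shows "(\<lambda>w. minv (F w)) \<in> N \<rightarrow>\<^sub>M mat_borel n n"
  unfolding minv_def
proof (rule mat_smult_measurable)
  note c = mat_borel_carrier[OF assms(1)]
  show "(\<lambda>w. 1 / det (F w)) \<in> borel_measurable N"
    using mat_det_measurable[OF assms] by measurable
  show "(\<lambda>w. adj_mat (F w)) \<in> N \<rightarrow>\<^sub>M mat_borel n n"
  proof (rule mat_borelI)
    show "adj_mat (F w) \<in> carrier_mat n n" if "w \<in> space N" for w using adj_mat(1) c[OF that] by blast
    fix i j assume ij: "i < n" "j < n"
    have "(\<lambda>w. mat_delete (F w) j i) \<in> N \<rightarrow>\<^sub>M mat_borel (n - 1) (n - 1)"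
    proof (rule mat_borelI)
      show "mat_delete (F w) j i \<in> carrier_mat (n-1) (n-1)" if "w \<in> space N" for w
        using c[OF that] mat_delete_carrier by blast
      fix i' j' assume ij': "i' < n - 1" "j' < n - 1"
      let ?i = "if i' < j then i' else Suc i'" and ?j = "if j' < i then j' else Suc j'"
      have "(\<lambda>w. F w $$ (?i, ?j)) \<in> borel_measurable N"
        using ij ij' by (intro mat_borel_entry[OF assms]) auto
      then show "(\<lambda>w. mat_delete (F w) j i $$ (i',j')) \<in> borel_measurable N"
        by (rule measurable_cong[THEN iffD1, rotated]) (use c ij ij' in \<open>fastforce simp:
            mat_delete_def\<close>)
    qed
    then have "(\<lambda>w. cofactor (F w) j i) \<in> borel_measurable N"
      unfolding cofactor_def by (intro borel_measurable_times mat_det_measurable) auto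
    then show "(\<lambda>w. adj_mat (F w) $$ (i,j)) \<in> borel_measurable N"
      by (rule measurable_cong[THEN iffD1, rotated]) (use c ij in \<open>fastforce simp: adj_mat_def\<close>)
  qed
qed

section \<open>Measurable square roots and polar parts\<close>

text \<open>A total substitute for \<open>mat_sqrt\<close>: a limit of measurable entries is
  measurable, a property that a definite description does not display.\<close>

definition msqrt :: "nat \<Rightarrow> real mat \<Rightarrow> real mat" where
  "msqrt m r = mat m m (\<lambda>p. lim (\<lambda>N. sqrt_seq m r N $$ p))"

lemma msqrt_eq:
  assumes "x \<in> carrier_mat n m" "det (transpose_mat x * x) \<noteq> 0"
  shows "msqrt m (transpose_mat x * x) = mat_sqrt m (transpose_mat x * x)"
  using gram_sqrt(3)[OF assms] mat_sqrt_carrier[OF assms] by (auto simp: msqrt_def limI intro!: eq_matI)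

lemma sqrt_seq_measurable:
  assumes "F \<in> N \<rightarrow>\<^sub>M mat_borel m m"
  shows "(\<lambda>w. sqrt_seq m (F w) k) \<in> N \<rightarrow>\<^sub>M mat_borel m m"
proof -
  have it: "(\<lambda>w. sqrt_iter m (G w) k) \<in> N \<rightarrow>\<^sub>M mat_borel m m" if G: "G
      \<in> N \<rightarrow>\<^sub>M mat_borel m m" for G
    by (induction k) (auto intro!: mat_const_measurable mat_smult_measurable mat_add_measurable
        mat_mult_measurable G)
  show ?thesis unfolding sqrt_seq_def
    by (intro mat_smult_measurable mat_minus_measurable it mat_const_measurable borel_measurable_divide
        borel_measurable_add
        borel_measurable_const mat_tr_measurable[OF assms] assms measurable_compose[OF _
            borel_measurable_sqrt]) auto
qed

lemma msqrt_measurable: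
  assumes "F \<in> N \<rightarrow>\<^sub>M mat_borel m m"
  shows "(\<lambda>w. msqrt m (F w)) \<in> N \<rightarrow>\<^sub>M mat_borel m m"
proof (rule mat_borelI)
  fix i j assume ij: "i < m" "j < m"
  have "(\<lambda>w. lim (\<lambda>k. sqrt_seq m (F w) k $$ (i,j))) \<in> borel_measurable N"
    by (intro borel_measurable_lim_metric mat_borel_entry[OF sqrt_seq_measurable[OF assms] ij])
  then show "(\<lambda>w. msqrt m (F w) $$ (i,j)) \<in> borel_measurable N" using ij by (simp add: msqrt_def)
qed (simp add: msqrt_def)

lemma gram_measurable:
  "F \<in> N \<rightarrow>\<^sub>M mat_borel n m \<Longrightarrow> (\<lambda>w. transpose_mat (F w) * F
      w) \<in> N \<rightarrow>\<^sub>M mat_borel m m"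
  by (intro mat_mult_measurable mat_transpose_measurable)

text \<open>The fallback on rank deficient matrices is a frame, so for m <= n all values lie in the
  Stiefel manifold.\<close>

definition polar0 :: "nat \<Rightarrow> nat \<Rightarrow> real mat \<Rightarrow> real mat" where
  "polar0 n m x = (if det (transpose_mat x * x) = 0 then 1\<^sub>m m @\<^sub>r 0\<^sub>m (n - m) m
     else x * minv (msqrt m (transpose_mat x * x)))"

lemma polar0_eq:
  "x \<in> carrier_mat n m \<Longrightarrow> det (transpose_mat x * x) \<noteq> 0 \<Longrightarrow>
      polar0 n m x = polar_part n m x"
  using polar(3)[of x n m] msqrt_eq[of x n m] by (simp add: polar0_def)

lemma polar0_stiefel:
  assumes "x \<in> carrier_mat n m" "m \<le> n"
  shows "polar0 n m x \<in> stiefel n m"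
proof (cases "det (transpose_mat x * x) = 0")
  case True
  then show ?thesis using top_frame_stiefel[of m "n - m"] assms by (simp add: polar0_def)
qed (use polar(1) polar0_eq assms in auto)

definition stiefel_borel :: "nat \<Rightarrow> nat \<Rightarrow> real mat measure" where
  "stiefel_borel n m = restrict_space (mat_borel n m) (stiefel n m)"

lemma space_stiefel_borel [simp]: "space (stiefel_borel n m) = stiefel n m"
  by (auto simp: stiefel_borel_def space_restrict_space stiefel_def)

lemma stiefel_borelI:
  "F \<in> N \<rightarrow>\<^sub>M mat_borel n m \<Longrightarrow> (\<And>w. w \<in> space N
      \<Longrightarrow> F w \<in> stiefel n m) \<Longrightarrow> F \<in> N \<rightarrow>\<^sub>M
      stiefel_borel n m"
  unfolding stiefel_borel_def by (rule measurable_restrict_space2) auto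

lemma stiefel_borelD: "F \<in> N \<rightarrow>\<^sub>M stiefel_borel n m \<Longrightarrow> F \<in> N
    \<rightarrow>\<^sub>M mat_borel n m"
  unfolding stiefel_borel_def measurable_restrict_space2_iff by simp

lemma polar0_measurable:
  assumes F: "F \<in> N \<rightarrow>\<^sub>M mat_borel n m" and "m \<le> n"
  shows "(\<lambda>w. polar0 n m (F w)) \<in> N \<rightarrow>\<^sub>M stiefel_borel n m"
proof (rule stiefel_borelI)
  have c: "1\<^sub>m m @\<^sub>r (0\<^sub>m (n - m) m :: real mat) \<in> carrier_mat n m"
    using stiefelD(1)[OF top_frame_stiefel[of m "n - m"]] assms(2) by simp
  have d: "(\<lambda>w. det (transpose_mat (F w) * F w)) \<in> borel_measurable N"
    by (rule mat_det_measurable[OF gram_measurable[OF F]])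
  show "(\<lambda>w. polar0 n m (F w)) \<in> N \<rightarrow>\<^sub>M mat_borel n m"
    unfolding polar0_def
  proof (rule measurable_If)
    show "{w \<in> space N. det (transpose_mat (F w) * F w) = 0} \<in> sets N"
      using d by measurable
  qed (rule mat_const_measurable[OF c] mat_mult_measurable[OF F minv_measurable[OF msqrt_measurable[OF
      gram_measurable[OF F]]]])+
qed (use polar0_stiefel mat_borel_carrier[OF F] assms(2) in auto)

subsection \<open>Invariance of Lebesgue measure\<close>

lemma mat_left_mult_measurable:
  "g \<in> carrier_mat n m \<Longrightarrow> F \<in> N \<rightarrow>\<^sub>M mat_borel m l
      \<Longrightarrow> (\<lambda>w. g * F w) \<in> N \<rightarrow>\<^sub>M mat_borel n l"
  by (rule mat_mult_measurable[OF mat_const_measurable])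

text \<open>The one-dimensional substitution in each entry of a box. Negative \<open>c\<close>
  covers the reflection x -> -x used for rotation invariance.\<close>

lemma lmat_affine:
  assumes t: "t \<in> carrier_mat n m" and c: "c \<noteq> 0"
  shows "lmat n m = density (distr (lmat n m) (mat_borel n m) (\<lambda>x. t + c \<cdot>\<^sub>m x))
      (\<lambda>_. ennreal (\<bar>c\<bar> ^ (n * m)))"
proof (rule lmat_eqI[symmetric])
  fix A :: "nat \<times> nat \<Rightarrow> real set" assume A: "\<And>p. p \<in> entries n m
      \<Longrightarrow> A p \<in> sets borel"
  have meas: "(\<lambda>x. t + c \<cdot>\<^sub>m x) \<in> lmat n m \<rightarrow>\<^sub>M mat_borel n m"
    by (intro mat_add_measurable mat_smult_measurable mat_const_measurable t borel_measurable_const) simp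
  have R: "rect n m A \<in> sets (mat_borel n m)" by (rule rect_sets[OF A])
  have A': "(\<lambda>x. t $$ p + c * x) -` A p \<in> sets borel" if "p \<in> entries n m" for p
    using measurable_sets[of "\<lambda>x. t $$ p + c * x" borel borel "A p"] A[OF that] by simp
  have pre: "(\<lambda>x. t + c \<cdot>\<^sub>m x) -` rect n m A \<inter> space (lmat n m) = rect n m
      (\<lambda>p. (\<lambda>x. t $$ p + c * x) -` A p)"
    using t by (auto simp: rect_def)
  have one: "emeasure lborel (A p) = ennreal \<bar>c\<bar> * emeasure lborel ((\<lambda>x. t $$ p + c *
      x) -` A p)" if "p \<in> entries n m" for p
  proof -
    have "emeasure lborel (A p) = emeasure (density (distr lborel borel (\<lambda>x. t $$ p + c * x))
        (\<lambda>_. ennreal \<bar>c\<bar>)) (A p)"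
      using lborel_real_affine[OF c, of "t $$ p"] by simp
    also have "\<dots> = ennreal \<bar>c\<bar> * emeasure lborel ((\<lambda>x. t $$ p + c * x) -` A p)"
      using A[OF that] by (simp add: emeasure_density nn_integral_cmult emeasure_distr)
    finally show ?thesis .
  qed
  have "emeasure (density (distr (lmat n m) (mat_borel n m) (\<lambda>x. t + c \<cdot>\<^sub>m x))
      (\<lambda>_. ennreal (\<bar>c\<bar> ^ (n * m)))) (rect n m A)
      = ennreal (\<bar>c\<bar> ^ (n * m)) * emeasure (lmat n m) (rect n m (\<lambda>p. (\<lambda>x. t
          $$ p + c * x) -` A p))"
    using R by (simp add: emeasure_density nn_integral_cmult emeasure_distr[OF meas] pre[simplified])
  also have "\<dots> = ennreal (\<bar>c\<bar> ^ (n * m)) * (\<Prod>p\<in>entries n m. emeasure lborel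
      ((\<lambda>x. t $$ p + c * x) -` A p))"
    by (subst emeasure_lmat_rect[OF A']) auto
  also have "\<dots> = (\<Prod>p\<in>entries n m. ennreal \<bar>c\<bar>) * (\<Prod>p\<in>entries n m.
      emeasure lborel ((\<lambda>x. t $$ p + c * x) -` A p))"
    by (simp add: card_cartesian_product ennreal_power)
  also have "\<dots> = (\<Prod>p\<in>entries n m. emeasure lborel (A p))"
    unfolding prod.distrib[symmetric] by (intro prod.cong refl one[symmetric])
  finally show "emeasure (density (distr (lmat n m) (mat_borel n m) (\<lambda>x. t + c \<cdot>\<^sub>m
      x)) (\<lambda>_. ennreal (\<bar>c\<bar> ^ (n * m)))) (rect n m A) = (\<Prod>p\<in>entries n m.
      emeasure lborel (A p))" .
qed simp

lemma nn_integral_lmat_affine: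
  assumes F: "F \<in> borel_measurable (mat_borel n m)" and t: "t \<in> carrier_mat n m" and c: "c = 1
      \<or> c = -1"
  shows "(\<integral>\<^sup>+x. F (t + c \<cdot>\<^sub>m x) \<partial>lmat n m) =
      (\<integral>\<^sup>+x. F x \<partial>lmat n m)"
proof -
  have c0: "c \<noteq> 0" "\<bar>c\<bar> = 1" using c by auto
  have meas: "(\<lambda>x. t + c \<cdot>\<^sub>m x) \<in> lmat n m \<rightarrow>\<^sub>M mat_borel n m"
    by (intro mat_add_measurable mat_smult_measurable mat_const_measurable t borel_measurable_const) simp
  have "(\<integral>\<^sup>+x. F x \<partial>lmat n m) = (\<integral>\<^sup>+x. F x \<partial>density
      (distr (lmat n m) (mat_borel n m) (\<lambda>x. t + c \<cdot>\<^sub>m x)) (\<lambda>_. ennreal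
      (\<bar>c\<bar> ^ (n * m))))"
    using lmat_affine[OF t c0(1)] by simp
  also have "\<dots> = (\<integral>\<^sup>+x. F (t + c \<cdot>\<^sub>m x) \<partial>lmat n m)"
    using F by (subst nn_integral_density) (auto simp: c0(2) nn_integral_distr[OF meas])
  finally show ?thesis by simp
qed

section \<open>Splitting Lebesgue measure by rows and by columns\<close>

lemma lmat_append_rows:
  "lmat (a + b) m = distr (lmat a m \<Otimes>\<^sub>M lmat b m) (mat_borel (a + b) m) (\<lambda>(x,y).
      x @\<^sub>r y)"
proof (rule lmat_eqI[symmetric])
  interpret B: sigma_finite_measure "lmat b m" by (rule sigma_finite_lmat)
  have m1: "(\<lambda>z. fst z @\<^sub>r snd z) \<in> lmat a m \<Otimes>\<^sub>M lmat b m
      \<rightarrow>\<^sub>M mat_borel (a + b) m"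
    using measurable_fst[of "lmat a m" "lmat b m"] measurable_snd[of "lmat a m" "lmat b m"]
    by (intro append_rows_measurable) (simp_all cong: measurable_cong_sets)
  then have meas: "(\<lambda>(x,y). x @\<^sub>r y) \<in> lmat a m \<Otimes>\<^sub>M lmat b m
      \<rightarrow>\<^sub>M mat_borel (a + b) m"
    by (simp add: case_prod_beta')
  fix A :: "nat \<times> nat \<Rightarrow> real set" assume A: "\<And>p. p \<in> entries (a + b) m
      \<Longrightarrow> A p \<in> sets borel"
  define B where "B = (\<lambda>p. A (a + fst p, snd p))"
  have A1: "A p \<in> sets borel" if "p \<in> entries a m" for p using A that by auto
  have B1: "B p \<in> sets borel" if "p \<in> entries b m" for p using A[of "(a + fst p, snd p)"] that
      by (auto simp: B_def)
  have pre: "(\<lambda>(x,y). x @\<^sub>r y) -` rect (a + b) m A \<inter> space (lmat a m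
      \<Otimes>\<^sub>M lmat b m) = rect a m A \<times> rect b m B"
  proof (intro equalityI subsetI)
    fix z assume z: "z \<in> (\<lambda>(x,y). x @\<^sub>r y) -` rect (a + b) m A \<inter> space (lmat a
        m \<Otimes>\<^sub>M lmat b m)"
    obtain x y where [simp]: "z = (x,y)" by (cases z)
    have c: "x \<in> carrier_mat a m" "y \<in> carrier_mat b m" using z by (auto simp: space_pair_measure)
    have r: "(x @\<^sub>r y) $$ (i,j) \<in> A (i,j)" if "i < a + b" "j < m" for i j using z that by
        (auto simp: rect_def)
    have "x $$ (i,j) \<in> A (i,j)" if "i < a" "j < m" for i j
      using r[of i j] that by (simp add: append_rows_index[OF c])
    moreover have "y $$ (i,j) \<in> B (i,j)" if "i < b" "j < m" for i j
      using r[of "a + i" j] that by (simp add: append_rows_index[OF c] B_def)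
    ultimately show "z \<in> rect a m A \<times> rect b m B" using c by (auto simp: rect_def)
  next
    fix z assume z: "z \<in> rect a m A \<times> rect b m B"
    obtain x y where [simp]: "z = (x,y)" by (cases z)
    have c: "x \<in> carrier_mat a m" "y \<in> carrier_mat b m" using z by (auto simp: rect_def)
    have "(x @\<^sub>r y) $$ (i,j) \<in> A (i,j)" if ij: "i < a + b" "j < m" for i j
    proof (cases "i < a")
      case False
      then have "i - a < b" using ij by simp
      then have "y $$ (i - a, j) \<in> B (i - a, j)" using z ij by (auto simp: rect_def)
      then show ?thesis using False ij by (simp add: append_rows_index[OF c] B_def)
    qed (use z ij in \<open>auto simp: append_rows_index[OF c] rect_def\<close>)
    then show "z \<in> (\<lambda>(x,y). x @\<^sub>r y) -` rect (a + b) m A \<inter> space (lmat a m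
        \<Otimes>\<^sub>M lmat b m)"
      using c by (auto simp: rect_def space_pair_measure)
  qed
  have "entries (a + b) m = entries a m \<union> (\<lambda>p. (a + fst p, snd p)) ` entries b m" (is "_
      = _ \<union> ?S")
  proof (intro equalityI subsetI)
    fix p assume p: "p \<in> entries (a + b) m"
    show "p \<in> entries a m \<union> ?S"
    proof (cases "fst p < a")
      case False
      then have "p = (\<lambda>p. (a + fst p, snd p)) (fst p - a, snd p)" "(fst p - a, snd p) \<in> entries b m"
        using p by (auto simp: prod_eq_iff)
      then show ?thesis by blast
    qed (use p in auto)
  qed auto
  then have "(\<Prod>p\<in>entries (a + b) m. emeasure lborel (A p)) = (\<Prod>p\<in>entries a m.
      emeasure lborel (A p)) * (\<Prod>p\<in>?S. emeasure lborel (A p))"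
    by (simp only:) (rule prod.union_disjoint, auto)
  also have "(\<Prod>p\<in>?S. emeasure lborel (A p)) = (\<Prod>p\<in>entries b m. emeasure lborel (B p))"
    by (subst prod.reindex) (auto simp: inj_on_def B_def prod_eq_iff)
  finally show "emeasure (distr (lmat a m \<Otimes>\<^sub>M lmat b m) (mat_borel (a + b) m)
      (\<lambda>(x,y). x @\<^sub>r y)) (rect (a + b) m A)
      = (\<Prod>p\<in>entries (a + b) m. emeasure lborel (A p))"
    using rect_sets[OF A] rect_sets[OF A1] rect_sets[OF B1]
    by (simp add: emeasure_distr[OF meas] pre B.emeasure_pair_measure_Times emeasure_lmat_rect[OF A1]
        emeasure_lmat_rect[OF B1])
qed simp

lemma lmat_append_cols:
  "lmat n (a + b) = distr (lmat n a \<Otimes>\<^sub>M lmat n b) (mat_borel n (a + b)) (\<lambda>(x,y).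
      append_cols x y)"
proof (rule lmat_eqI[symmetric])
  interpret B: sigma_finite_measure "lmat n b" by (rule sigma_finite_lmat)
  have m1: "(\<lambda>z. append_cols (fst z) (snd z)) \<in> lmat n a \<Otimes>\<^sub>M lmat n b
      \<rightarrow>\<^sub>M mat_borel n (a + b)"
    using measurable_fst[of "lmat n a" "lmat n b"] measurable_snd[of "lmat n a" "lmat n b"]
    by (intro append_cols_measurable) (simp_all cong: measurable_cong_sets)
  then have meas: "(\<lambda>(x,y). append_cols x y) \<in> lmat n a \<Otimes>\<^sub>M lmat n b
      \<rightarrow>\<^sub>M mat_borel n (a + b)"
    by (simp add: case_prod_beta')
  have idx: "append_cols x y $$ (i,j) = (if j < a then x $$ (i,j) else y $$ (i, j - a))"
    if "x \<in> carrier_mat n a" "y \<in> carrier_mat n b" "i < n" "j < a + b" for x y i j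
    using that by (auto simp: append_cols_def)
  fix A :: "nat \<times> nat \<Rightarrow> real set" assume A: "\<And>p. p \<in> entries n (a + b)
      \<Longrightarrow> A p \<in> sets borel"
  define B where "B = (\<lambda>p. A (fst p, a + snd p))"
  have A1: "A p \<in> sets borel" if "p \<in> entries n a" for p using A that by auto
  have B1: "B p \<in> sets borel" if "p \<in> entries n b" for p using A[of "(fst p, a + snd p)"] that
      by (auto simp: B_def)
  have pre: "(\<lambda>(x,y). append_cols x y) -` rect n (a + b) A \<inter> space (lmat n a
      \<Otimes>\<^sub>M lmat n b) = rect n a A \<times> rect n b B"
  proof (intro equalityI subsetI)
    fix z assume z: "z \<in> (\<lambda>(x,y). append_cols x y) -` rect n (a + b) A \<inter> space (lmat
        n a \<Otimes>\<^sub>M lmat n b)"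
    obtain x y where [simp]: "z = (x,y)" by (cases z)
    have c: "x \<in> carrier_mat n a" "y \<in> carrier_mat n b" using z by (auto simp: space_pair_measure)
    have r: "append_cols x y $$ (i,j) \<in> A (i,j)" if "i < n" "j < a + b" for i j using z that by
        (auto simp: rect_def)
    have "x $$ (i,j) \<in> A (i,j)" if "i < n" "j < a" for i j
      using r[of i j] that by (simp add: idx[OF c])
    moreover have "y $$ (i,j) \<in> B (i,j)" if "i < n" "j < b" for i j
      using r[of i "a + j"] that by (simp add: idx[OF c] B_def)
    ultimately show "z \<in> rect n a A \<times> rect n b B" using c by (auto simp: rect_def)
  next
    fix z assume z: "z \<in> rect n a A \<times> rect n b B"
    obtain x y where [simp]: "z = (x,y)" by (cases z)
    have c: "x \<in> carrier_mat n a" "y \<in> carrier_mat n b" using z by (auto simp: rect_def)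
    have "append_cols x y $$ (i,j) \<in> A (i,j)" if ij: "i < n" "j < a + b" for i j
    proof (cases "j < a")
      case False
      then have "j - a < b" using ij by simp
      then have "y $$ (i, j - a) \<in> B (i, j - a)" using z ij by (auto simp: rect_def)
      then show ?thesis using False ij by (simp add: idx[OF c] B_def)
    qed (use z ij in \<open>auto simp: idx[OF c] rect_def\<close>)
    then show "z \<in> (\<lambda>(x,y). append_cols x y) -` rect n (a + b) A \<inter> space (lmat n a
        \<Otimes>\<^sub>M lmat n b)"
      using append_cols_carrier[OF c] c by (auto simp: rect_def space_pair_measure)
  qed
  have "entries n (a + b) = entries n a \<union> (\<lambda>p. (fst p, a + snd p)) ` entries n b" (is "_
      = _ \<union> ?S")
  proof (intro equalityI subsetI)
    fix p assume p: "p \<in> entries n (a + b)"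
    show "p \<in> entries n a \<union> ?S"
    proof (cases "snd p < a")
      case False
      then have "p = (\<lambda>p. (fst p, a + snd p)) (fst p, snd p - a)" "(fst p, snd p - a) \<in> entries n b"
        using p by (auto simp: prod_eq_iff)
      then show ?thesis by blast
    qed (use p in auto)
  qed auto
  then have "(\<Prod>p\<in>entries n (a + b). emeasure lborel (A p)) = (\<Prod>p\<in>entries n a.
      emeasure lborel (A p)) * (\<Prod>p\<in>?S. emeasure lborel (A p))"
    by (simp only:) (rule prod.union_disjoint, auto)
  also have "(\<Prod>p\<in>?S. emeasure lborel (A p)) = (\<Prod>p\<in>entries n b. emeasure lborel (B p))"
    by (subst prod.reindex) (auto simp: inj_on_def B_def prod_eq_iff)
  finally show "emeasure (distr (lmat n a \<Otimes>\<^sub>M lmat n b) (mat_borel n (a + b))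
      (\<lambda>(x,y). append_cols x y)) (rect n (a + b) A)
      = (\<Prod>p\<in>entries n (a + b). emeasure lborel (A p))"
    using rect_sets[OF A] rect_sets[OF A1] rect_sets[OF B1]
    by (simp add: emeasure_distr[OF meas] pre B.emeasure_pair_measure_Times emeasure_lmat_rect[OF A1]
        emeasure_lmat_rect[OF B1])
qed simp

lemma measurable_lmat_cong [simp]:
  "N \<rightarrow>\<^sub>M lmat n m = N \<rightarrow>\<^sub>M mat_borel n m" "lmat n m
      \<rightarrow>\<^sub>M N = mat_borel n m \<rightarrow>\<^sub>M N"
  "lmat n m \<Otimes>\<^sub>M lmat n' m' \<rightarrow>\<^sub>M N = mat_borel n m \<Otimes>\<^sub>M
      mat_borel n' m' \<rightarrow>\<^sub>M N"
  by (intro measurable_cong_sets sets_pair_measure_cong; simp)+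

lemma nn_integral_append_rows:
  assumes "F \<in> borel_measurable (mat_borel (a + b) m)"
  shows "(\<integral>\<^sup>+x. F x \<partial>lmat (a + b) m) = (\<integral>\<^sup>+x.
      \<integral>\<^sup>+y. F (x @\<^sub>r y) \<partial>lmat b m \<partial>lmat a m)"
proof -
  interpret B: sigma_finite_measure "lmat b m" by (rule sigma_finite_lmat)
  have meas: "(\<lambda>(x,y). x @\<^sub>r y) \<in> mat_borel a m \<Otimes>\<^sub>M mat_borel b m
      \<rightarrow>\<^sub>M mat_borel (a + b) m"
    unfolding case_prod_beta' by (intro append_rows_measurable measurable_fst measurable_snd)
  have "(\<integral>\<^sup>+x. F x \<partial>lmat (a + b) m) = (\<integral>\<^sup>+z. F (fst z
      @\<^sub>r snd z) \<partial>(lmat a m \<Otimes>\<^sub>M lmat b m))"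
    unfolding lmat_append_rows using meas assms by (subst nn_integral_distr) (auto simp: case_prod_beta')
  also have "\<dots> = (\<integral>\<^sup>+x. \<integral>\<^sup>+y. F (x @\<^sub>r y) \<partial>lmat b
      m \<partial>lmat a m)"
    using measurable_compose[OF meas assms]
    by (subst B.nn_integral_fst[symmetric]) (auto simp: case_prod_beta')
  finally show ?thesis .
qed

lemma nn_integral_append_cols:
  assumes "F \<in> borel_measurable (mat_borel n (a + b))"
  shows "(\<integral>\<^sup>+x. F x \<partial>lmat n (a + b)) = (\<integral>\<^sup>+x.
      \<integral>\<^sup>+y. F (append_cols x y) \<partial>lmat n b \<partial>lmat n a)"
proof -
  interpret B: sigma_finite_measure "lmat n b" by (rule sigma_finite_lmat)
  have meas: "(\<lambda>(x,y). append_cols x y) \<in> mat_borel n a \<Otimes>\<^sub>M mat_borel n b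
      \<rightarrow>\<^sub>M mat_borel n (a + b)"
    unfolding case_prod_beta' by (intro append_cols_measurable measurable_fst measurable_snd)
  have "(\<integral>\<^sup>+x. F x \<partial>lmat n (a + b)) = (\<integral>\<^sup>+z. F (append_cols
      (fst z) (snd z)) \<partial>(lmat n a \<Otimes>\<^sub>M lmat n b))"
    unfolding lmat_append_cols using meas assms by (subst nn_integral_distr) (auto simp: case_prod_beta')
  also have "\<dots> = (\<integral>\<^sup>+x. \<integral>\<^sup>+y. F (append_cols x y) \<partial>lmat
      n b \<partial>lmat n a)"
    using measurable_compose[OF meas assms]
    by (subst B.nn_integral_fst[symmetric]) (auto simp: case_prod_beta')
  finally show ?thesis .
qed

section \<open>Volumes of balls and rotation invariance\<close>

lemma fsq_mat: "fsq (mat n m w) = (\<Sum>p\<in>entries n m. (w p)\<^sup>2)"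
  by (simp add: fsq_def sum.cartesian_product case_prod_beta')

text \<open>The Frobenius ball of n x m matrices is the Euclidean ball of R^(nm).\<close>

lemma emeasure_ball_lmat:
  assumes "r > 0"
  shows "emeasure (lmat n m) {x \<in> carrier_mat n m. fsq x \<le> r\<^sup>2} = ennreal (unit_ball_vol
      (real (n * m)) * r ^ (n * m))"
proof -
  have "{x \<in> space (mat_borel n m). fsq x \<le> r\<^sup>2} \<in> sets (mat_borel n m)"
    using fsq_measurable[OF measurable_ident_sets[OF refl]] by measurable
  then have s: "{x \<in> carrier_mat n m. fsq x \<le> r\<^sup>2} \<in> sets (mat_borel n m)" by simp
  have eq: "mat n m -` {x \<in> carrier_mat n m. fsq x \<le> r\<^sup>2} \<inter> space (Pi\<^sub>M
      (entries n m) (\<lambda>_. lborel)) =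
      {f. sqrt (\<Sum>i\<in>entries n m. (f i)\<^sup>2) \<le> r} \<inter> space (Pi\<^sub>M (entries n
          m) (\<lambda>_. lborel))"
    using assms by (auto simp: fsq_mat real_sqrt_le_iff' sum_nonneg)
  have "emeasure (lmat n m) {x \<in> carrier_mat n m. fsq x \<le> r\<^sup>2} =
      emeasure (Pi\<^sub>M (entries n m) (\<lambda>_. lborel)) (mat n m -` {x \<in> carrier_mat n m.
          fsq x \<le> r\<^sup>2} \<inter> space (Pi\<^sub>M (entries n m) (\<lambda>_. lborel)))"
    unfolding lmat_def by (rule emeasure_distr[OF mat_measurable s])
  then show ?thesis
    using emeasure_cball_aux[of "entries n m" r] assms unfolding eq by (simp add: card_cartesian_product)
qed

text \<open>Both Lebesgue measure and its image under \<open>g\<close> are invariant under translations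
    and under
  the reflection in 0; two such measures are proportional by Fubini's theorem, and they agree on
  balls.\<close>
lemma nn_integral_lmat_orth:
  assumes g: "g \<in> orth_group n" and G: "G \<in> borel_measurable (mat_borel n m)"
  shows "(\<integral>\<^sup>+x. G (g * x) \<partial>lmat n m) = (\<integral>\<^sup>+x. G x \<partial>lmat n m)"
proof -
  interpret L: sigma_finite_measure "lmat n m" by (rule sigma_finite_lmat)
  interpret P: pair_sigma_finite "lmat n m" "lmat n m" by standard
  note gc = orth_groupD[OF g]
  let ?\<mu> = "lmat n m"
  define B where "B = {x \<in> carrier_mat n m. fsq x \<le> 1}"
  \<comment> \<open>The indicator of the unit ball serves as test function: \<open>g\<close>
    preserves it and its integral is positive and finite. The double integral of F(x) G(x + gy),
    taken in both orders and translated, shows that the integrals of G(gy) and of G have the same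
    product with that of F.\<close>
  define F :: "real mat \<Rightarrow> ennreal" where "F = indicator B"
  have "{x \<in> space (mat_borel n m). fsq x \<le> 1} \<in> sets (mat_borel n m)"
    using fsq_measurable[OF measurable_ident_sets[OF refl]] by measurable
  then have Bs: "B \<in> sets (mat_borel n m)" by (simp add: B_def)
  have F: "F \<in> borel_measurable (mat_borel n m)" unfolding F_def using Bs by simp
  have Fg: "F (g * x) = F x" if "x \<in> carrier_mat n m" for x
    using that gc(1) fsq_orth[OF g that] by (auto simp: F_def B_def split: split_indicator)
  have IF: "(\<integral>\<^sup>+x. F x \<partial>?\<mu>) = ennreal (unit_ball_vol (real (n * m)))"
    unfolding F_def using Bs emeasure_ball_lmat[of 1 n m] by (simp add: B_def)
  have mg: "(\<lambda>x. g * x) \<in> mat_borel n m \<rightarrow>\<^sub>M mat_borel n m"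
    by (rule mat_left_mult_measurable[OF gc(1) measurable_ident_sets[OF refl]])
  note Gg = measurable_compose[OF mg G] and Fgm = measurable_compose[OF mg F]
  have tr: "g * (transpose_mat g * x + c \<cdot>\<^sub>m y) = x + c \<cdot>\<^sub>m (g * y)" if "x
      \<in> carrier_mat n m" "y \<in> carrier_mat n m" for x y c
    using that gc orth_cancel(2)[OF g that(1)]
    by (simp add: mult_add_distrib_mat[of _ n n _ m] mult_smult_distrib[of _ n n _ m])
  have m1: "(\<lambda>z. fst z + g * snd z) \<in> mat_borel n m \<Otimes>\<^sub>M mat_borel n m
      \<rightarrow>\<^sub>M mat_borel n m"
    by (rule mat_add_measurable[OF measurable_fst mat_left_mult_measurable[OF gc(1) measurable_snd]])
  have m2: "(\<lambda>z. fst z - g * snd z) \<in> mat_borel n m \<Otimes>\<^sub>M mat_borel n m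
      \<rightarrow>\<^sub>M mat_borel n m"
    by (rule mat_minus_measurable[OF measurable_fst mat_left_mult_measurable[OF gc(1) measurable_snd]])
  have "(\<integral>\<^sup>+x. F x \<partial>?\<mu>) * (\<integral>\<^sup>+y. G (g * y)
      \<partial>?\<mu>) = (\<integral>\<^sup>+x. F x * (\<integral>\<^sup>+y. G (g * y)
      \<partial>?\<mu>) \<partial>?\<mu>)"
    using F by (simp add: nn_integral_multc)
  also have "\<dots> = (\<integral>\<^sup>+x. \<integral>\<^sup>+y. F x * G (x + g * y)
      \<partial>?\<mu> \<partial>?\<mu>)"
  proof (rule nn_integral_cong)
    fix x assume x: "x \<in> space ?\<mu>"
    have "(\<integral>\<^sup>+y. G (g * y) \<partial>?\<mu>) = (\<integral>\<^sup>+y. G (g *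
        (transpose_mat g * x + 1 \<cdot>\<^sub>m y)) \<partial>?\<mu>)"
      by (rule nn_integral_lmat_affine[OF Gg, symmetric]) (use x gc in auto)
    also have "\<dots> = (\<integral>\<^sup>+y. G (x + g * y) \<partial>?\<mu>)"
    proof (rule nn_integral_cong)
      fix y assume y: "y \<in> space ?\<mu>"
      have "1 \<cdot>\<^sub>m z = z" for z :: "real mat" by (rule eq_matI) auto
      then show "G (g * (transpose_mat g * x + 1 \<cdot>\<^sub>m y)) = G (x + g * y)" using tr[of x y
          1] x y by simp
    qed
    finally show "F x * (\<integral>\<^sup>+y. G (g * y) \<partial>?\<mu>) = (\<integral>\<^sup>+y. F x
        * G (x + g * y) \<partial>?\<mu>)"
      using measurable_compose[OF measurable_Pair1'[of x "mat_borel n m" "mat_borel n m"]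
          measurable_compose[OF m1 G]] x
      by (simp add: nn_integral_cmult)
  qed
  also have "\<dots> = (\<integral>\<^sup>+y. \<integral>\<^sup>+x. F x * G (x + g * y)
      \<partial>?\<mu> \<partial>?\<mu>)"
    by (rule P.Fubini'[symmetric])
      (simp add: case_prod_beta' borel_measurable_times_ennreal measurable_compose[OF measurable_fst F]
          measurable_compose[OF m1 G])
  also have "\<dots> = (\<integral>\<^sup>+y. \<integral>\<^sup>+x. F (x - g * y) * G x
      \<partial>?\<mu> \<partial>?\<mu>)"
  proof (rule nn_integral_cong)
    fix y assume y: "y \<in> space ?\<mu>"
    then have gy: "g * y \<in> carrier_mat n m" using gc by auto
    have mm: "(\<lambda>x. F (x - g * y) * G x) \<in> borel_measurable (mat_borel n m)"
      using y by (intro borel_measurable_times_ennreal G measurable_compose[OF _ F]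
          mat_minus_measurable measurable_ident_sets refl mat_const_measurable gy)
    have "(\<integral>\<^sup>+x. F (x - g * y) * G x \<partial>?\<mu>) = (\<integral>\<^sup>+x. F ((g *
        y + 1 \<cdot>\<^sub>m x) - g * y) * G (g * y + 1 \<cdot>\<^sub>m x) \<partial>?\<mu>)"
      by (rule nn_integral_lmat_affine[OF mm gy, symmetric]) auto
    also have "\<dots> = (\<integral>\<^sup>+x. F x * G (x + g * y) \<partial>?\<mu>)"
    proof (rule nn_integral_cong)
      fix x assume x: "x \<in> space ?\<mu>"
      have "z + 1 \<cdot>\<^sub>m x = x + z" "x + z - z = x" if "z \<in> carrier_mat n m" for z
        using x that by (auto intro!: eq_matI)
      from this[OF gy] show "F ((g * y + 1 \<cdot>\<^sub>m x) - g * y) * G (g * y + 1 \<cdot>\<^sub>m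
          x) = F x * G (x + g * y)" by simp
    qed
    finally show "(\<integral>\<^sup>+x. F x * G (x + g * y) \<partial>?\<mu>) = (\<integral>\<^sup>+x.
        F (x - g * y) * G x \<partial>?\<mu>)" by simp
  qed
  also have "\<dots> = (\<integral>\<^sup>+x. \<integral>\<^sup>+y. F (x - g * y) * G x
      \<partial>?\<mu> \<partial>?\<mu>)"
    by (rule P.Fubini')
      (simp add: case_prod_beta' borel_measurable_times_ennreal measurable_compose[OF measurable_fst G]
          measurable_compose[OF m2 F])
  also have "\<dots> = (\<integral>\<^sup>+x. (\<integral>\<^sup>+y. F y \<partial>?\<mu>) * G x
      \<partial>?\<mu>)"
  proof (rule nn_integral_cong)
    fix x assume x: "x \<in> space ?\<mu>"
    have mm: "(\<lambda>y. F (x - g * y)) \<in> borel_measurable (mat_borel n m)"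
      using x by (intro measurable_compose[OF _ F] mat_minus_measurable mg mat_const_measurable) auto
    have tx: "transpose_mat g * x \<in> carrier_mat n m" using x gc by auto
    have "(\<integral>\<^sup>+y. F (x - g * y) \<partial>?\<mu>) = (\<integral>\<^sup>+y. F (x - g *
        (transpose_mat g * x + (-1) \<cdot>\<^sub>m y)) \<partial>?\<mu>)"
      by (rule nn_integral_lmat_affine[OF mm tx, symmetric]) auto
    also have "\<dots> = (\<integral>\<^sup>+y. F y \<partial>?\<mu>)"
    proof (rule nn_integral_cong)
      fix y assume y: "y \<in> space ?\<mu>"
      have "x - (x + (-1) \<cdot>\<^sub>m z) = z" if "z \<in> carrier_mat n m" for z
        using x that by (auto intro!: eq_matI)
      moreover have "g * y \<in> carrier_mat n m" using y gc by auto
      ultimately have "x - (x + (-1) \<cdot>\<^sub>m (g * y)) = g * y" by blast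
      then show "F (x - g * (transpose_mat g * x + (-1) \<cdot>\<^sub>m y)) = F y" using tr[of x y
          "-1"] Fg[of y] x y by simp
    qed
    finally show "(\<integral>\<^sup>+y. F (x - g * y) * G x \<partial>?\<mu>) = (\<integral>\<^sup>+y.
        F y \<partial>?\<mu>) * G x"
      using mm by (simp add: nn_integral_multc)
  qed
  also have "\<dots> = (\<integral>\<^sup>+x. F x \<partial>?\<mu>) * (\<integral>\<^sup>+x. G x
      \<partial>?\<mu>)"
    using G by (simp add: nn_integral_cmult)
  finally have "ennreal (unit_ball_vol (real (n * m))) * (\<integral>\<^sup>+y. G (g * y) \<partial>?\<mu>)
      = ennreal (unit_ball_vol (real (n * m))) * (\<integral>\<^sup>+x. G x \<partial>?\<mu>)" unfolding IF .
  moreover have "ennreal (unit_ball_vol (real (n * m))) \<noteq> 0"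
    by (metis unit_ball_vol_pos of_nat_0_le_iff ennreal_eq_0_iff not_le)
  ultimately show ?thesis
    by (subst (asm) ennreal_mult_cancel_left) (auto simp del: of_nat_mult)
qed

lemma lmat_orth:
  assumes g: "g \<in> orth_group n"
  shows "distr (lmat n m) (lmat n m) (\<lambda>x. g * x) = lmat n m"
proof (rule measure_eqI)
  have mg: "(\<lambda>x. g * x) \<in> mat_borel n m \<rightarrow>\<^sub>M mat_borel n m"
    by (rule mat_left_mult_measurable[OF orth_groupD(1)[OF g] measurable_ident_sets[OF refl]])
  fix A assume "A \<in> sets (distr (lmat n m) (lmat n m) (\<lambda>x. g * x))"
  then have A: "A \<in> sets (mat_borel n m)" by simp
  have "emeasure (distr (lmat n m) (lmat n m) (\<lambda>x. g * x)) A = (\<integral>\<^sup>+x. indicator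
      A x \<partial>distr (lmat n m) (lmat n m) (\<lambda>x. g * x))"
    using A by simp
  also have "\<dots> = (\<integral>\<^sup>+x. indicator A (g * x) \<partial>lmat n m)"
    using A mg by (intro nn_integral_distr) auto
  also have "\<dots> = emeasure (lmat n m) A"
    using A nn_integral_lmat_orth[OF g, of "indicator A"] by simp
  finally show "emeasure (distr (lmat n m) (lmat n m) (\<lambda>x. g * x)) A = emeasure (lmat n m) A" .
qed simp

subsection \<open>Gram matrices of Lebesgue distributed matrices\<close>

text \<open>The Gram matrix of the block matrix with rows (rho, u) and (0, w), where s =
  w'w.\<close>

definition gblock :: "real \<Rightarrow> real mat \<Rightarrow> real mat \<Rightarrow> real mat" where
  "gblock \<rho> u s = four_block_mat (mat 1 1 (\<lambda>_. \<rho>\<^sup>2)) (\<rho> \<cdot>\<^sub>m u)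
      (\<rho> \<cdot>\<^sub>m transpose_mat u) (transpose_mat u * u + s)"

lemma gblock_carrier: "u \<in> carrier_mat 1 m \<Longrightarrow> s \<in> carrier_mat m m
    \<Longrightarrow> gblock \<rho> u s \<in> carrier_mat (1 + m) (1 + m)"
  unfolding gblock_def by (rule four_block_carrier_mat) auto

text \<open>The factorisation into lower triangular, diagonal and upper triangular blocks involves
  no division, so it covers rho = 0.\<close>

lemma det_gblock:
  assumes u: "u \<in> carrier_mat 1 m" and s: "s \<in> carrier_mat m m"
  shows "det (gblock \<rho> u s) = \<rho>\<^sup>2 * det s"
proof -
  define R where "R = mat 1 1 (\<lambda>_. \<rho>)"
  define L where "L = four_block_mat R (0\<^sub>m 1 m) (transpose_mat u) (1\<^sub>m m)"
  define D where "D = four_block_mat (1\<^sub>m 1) (0\<^sub>m 1 m) (0\<^sub>m m 1) s"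
  define U where "U = four_block_mat R u (0\<^sub>m m 1) (1\<^sub>m m)"
  have R: "R \<in> carrier_mat 1 1" by (simp add: R_def)
  have dR: "det R = \<rho>" using det_single[OF R] by (simp add: R_def)
  have c: "L \<in> carrier_mat (1+m) (1+m)" "D \<in> carrier_mat (1+m) (1+m)" "U \<in> carrier_mat (1+m) (1+m)"
    unfolding L_def D_def U_def using R s by (auto intro!: four_block_carrier_mat)
  have LD: "L * D = four_block_mat R (0\<^sub>m 1 m) (transpose_mat u) s"
    unfolding L_def D_def using R u s
    by (subst mult_four_block_mat[of _ 1 1 _ m _ m _ _ 1 _ m]) auto
  have 1: "R * u = \<rho> \<cdot>\<^sub>m u" using u by (intro eq_matI) (auto simp: R_def scalar_prod_def)
  have 2: "transpose_mat u * R = \<rho> \<cdot>\<^sub>m transpose_mat u" using u by (intro eq_matI)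
      (auto simp: R_def scalar_prod_def)
  have 3: "R * R = mat 1 1 (\<lambda>_. \<rho>\<^sup>2)" by (intro eq_matI) (auto simp: R_def
      scalar_prod_def power2_eq_square)
  have "L * D * U = gblock \<rho> u s"
    unfolding LD U_def gblock_def using R u s
    by (subst mult_four_block_mat[of _ 1 1 _ m _ m _ _ 1 _ m]) (auto simp: 1 2 3)
  then have "det (gblock \<rho> u s) = det L * det D * det U"
    using det_mult[of "L * D" "1+m" U] det_mult[OF c(1,2)] c by (metis mult_carrier_mat)
  moreover have "det L = \<rho>" "det D = det s" "det U = \<rho>"
    unfolding L_def D_def U_def using R u s dR
    by (subst det_four_block_mat_upper_right_zero[of _ 1 _ m] det_four_block_mat_lower_left_zero[of _ 1
        _ m]; auto)+
  ultimately show ?thesis by (simp add: power2_eq_square)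
qed

lemma gblock_measurable:
  assumes f: "f \<in> borel_measurable N" and U: "U \<in> N \<rightarrow>\<^sub>M mat_borel 1 m" and S:
      "S \<in> N \<rightarrow>\<^sub>M mat_borel m m"
  shows "(\<lambda>w. gblock (f w) (U w) (S w)) \<in> N \<rightarrow>\<^sub>M mat_borel (1 + m) (1 + m)"
proof (rule mat_borelI)
  note c = mat_borel_carrier[OF U] mat_borel_carrier[OF S]
  show "gblock (f w) (U w) (S w) \<in> carrier_mat (1 + m) (1 + m)" if "w \<in> space N" for w
    by (rule gblock_carrier[OF c[OF that]])
  fix i j assume ij: "i < 1 + m" "j < 1 + m"
  have T: "(\<lambda>w. transpose_mat (U w) * U w + S w) \<in> N \<rightarrow>\<^sub>M mat_borel m m"
    by (intro mat_add_measurable gram_measurable[OF U] S)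
  have "(\<lambda>w. if i < 1 then if j < 1 then (f w)\<^sup>2 else f w * U w $$ (0, j - 1)
      else if j < 1 then f w * U w $$ (0, i - 1) else (transpose_mat (U w) * U w + S w) $$ (i - 1, j -
          1)) \<in> borel_measurable N"
    using ij by (cases "i < 1"; cases "j < 1"; simp only: if_True if_False;
      intro borel_measurable_times borel_measurable_power f mat_borel_entry[OF U] mat_borel_entry[OF T]) auto
  then show "(\<lambda>w. gblock (f w) (U w) (S w) $$ (i,j)) \<in> borel_measurable N"
  proof (rule measurable_cong[THEN iffD1, rotated])
    fix w assume w: "w \<in> space N"
    have "i - 1 < m" if "\<not> i < 1" using that ij by simp
    moreover have "j - 1 < m" if "\<not> j < 1" using that ij by simp
    ultimately show "(if i < 1 then if j < 1 then (f w)\<^sup>2 else f w * U w $$ (0, j - 1)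
      else if j < 1 then f w * U w $$ (0, i - 1) else (transpose_mat (U w) * U w + S w) $$ (i - 1, j -
          1)) = gblock (f w) (U w) (S w) $$ (i,j)"
      using ij c[OF w] by (auto simp: gblock_def)
  qed
qed

lemma mult_append_cols:
  assumes "g \<in> carrier_mat l n" "A \<in> carrier_mat n a" "B \<in> carrier_mat n b"
  shows "g * append_cols A B = append_cols (g * A) (g * B)"
proof (rule eq_matI)
  fix i j assume "i < dim_row (append_cols (g * A) (g * B))" "j < dim_col (append_cols (g * A) (g * B))"
  then have ij: "i < l" "j < a + b" using assms by (auto simp: append_cols_def)
  have "(g * append_cols A B) $$ (i,j) = (\<Sum>k<n. g $$ (i,k) * append_cols A B $$ (k,j))"
    by (rule mult_mat_index[OF assms(1) append_cols_carrier[OF assms(2,3)] ij])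
  also have "\<dots> = append_cols (g * A) (g * B) $$ (i,j)"
  proof (cases "j < a")
    case True
    then show ?thesis using ij assms mult_mat_index[OF assms(1,2) ij(1) True] by (simp add:
        append_cols_def del: index_mult_mat(1))
  next
    case False
    then have "j - a < b" using ij by simp
    then show ?thesis using False ij assms mult_mat_index[OF assms(1,3) ij(1), of "j - a"] by (simp
        add: append_cols_def del: index_mult_mat(1))
  qed
  finally show "(g * append_cols A B) $$ (i,j) = append_cols (g * A) (g * B) $$ (i,j)" .
qed (use assms in \<open>auto simp: append_cols_def\<close>)

lemma fsq_smult: "fsq (c \<cdot>\<^sub>m y) = c\<^sup>2 * fsq y"
  by (simp add: fsq_def sum_distrib_left power_mult_distrib)

text \<open>A nonzero column divided by its length is a one-column frame and extends to an
  orthogonal matrix; the zero column has no direction, and there the identity serves.\<close>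

lemma column_rotation:
  assumes y: "y \<in> carrier_mat (1 + N) 1"
  obtains g where "g \<in> orth_group (1 + N)" "g * (sqrt (fsq y) \<cdot>\<^sub>m (1\<^sub>m 1
      @\<^sub>r 0\<^sub>m N 1)) = y"
proof (cases "fsq y = 0")
  case True
  have "y = 0\<^sub>m (1 + N) 1"
  proof (rule eq_matI)
    fix i j assume ij: "i < dim_row (0\<^sub>m (1 + N) 1 :: real mat)" "j < dim_col (0\<^sub>m (1 + N)
        1 :: real mat)"
    have "\<forall>i\<in>{..<1+N}. (\<Sum>j<1. (y $$ (i,j))\<^sup>2) = 0"
      using True unfolding fsq_eq[OF y] by (subst (asm) sum_nonneg_eq_0_iff) (auto intro: sum_nonneg)
    then show "y $$ (i,j) = 0\<^sub>m (1 + N) 1 $$ (i,j)" using ij by auto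
  qed (use y in auto)
  moreover have "1\<^sub>m (1 + N) * (sqrt (fsq y) \<cdot>\<^sub>m (1\<^sub>m 1 @\<^sub>r 0\<^sub>m N
      1)) = 0\<^sub>m (1 + N) 1"
    using True stiefelD(1)[OF top_frame_stiefel[of 1 N]] by (intro eq_matI) auto
  ultimately show ?thesis using that orth_group_one by metis
next
  case False
  define \<rho> where "\<rho> = sqrt (fsq y)"
  have \<rho>: "\<rho> > 0" using False fsq_nonneg[of y] by (simp add: \<rho>_def)
  define v where "v = (1 / \<rho>) \<cdot>\<^sub>m y"
  have v: "v \<in> carrier_mat (1 + N) 1" using y by (simp add: v_def)
  have "fsq v = (1/\<rho>)\<^sup>2 * fsq y"
    unfolding v_def by (rule fsq_smult)
  also have "\<dots> = 1" using \<rho> False fsq_nonneg[of y] by (simp add: \<rho>_def power_divide)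
  finally have fv: "fsq v = 1" .
  have "transpose_mat v * v = 1\<^sub>m 1"
    using fv[unfolded fsq_eq_tr[OF v]] v by (intro eq_matI) (auto simp: mat_tr_def)
  then have "v \<in> stiefel (1 + N) 1" using v by (simp add: stiefel_def)
  then obtain g where g: "g \<in> orth_group (1 + N)" "g * (1\<^sub>m 1 @\<^sub>r 0\<^sub>m N 1) = v"
    using stiefel_extend[of v 1 N] by auto
  have "g * (\<rho> \<cdot>\<^sub>m (1\<^sub>m 1 @\<^sub>r 0\<^sub>m N 1)) = \<rho> \<cdot>\<^sub>m v"
    using mult_smult_distrib[OF orth_groupD(1)[OF g(1)] stiefelD(1)[OF top_frame_stiefel[of 1 N]], of
        \<rho>] g(2) by simp
  also have "\<dots> = y" using \<rho> by (intro eq_matI) (auto simp: v_def)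
  finally show ?thesis using that g(1) by (simp add: \<rho>_def)
qed

text \<open>The first column \<open>y\<close> of \<open>x\<close> is rotated to \<open>|y| e_1\<close>;
    then \<open>u\<close> is the first row and \<open>w\<close> the remaining
  rows of the other columns.\<close>
lemma nn_integral_gram_step:
  assumes F: "F \<in> borel_measurable (mat_borel (1 + m) (1 + m))"
  shows "(\<integral>\<^sup>+x. F (transpose_mat x * x) \<partial>lmat (1 + N) (1 + m)) =
    (\<integral>\<^sup>+y. \<integral>\<^sup>+u. \<integral>\<^sup>+w. F (gblock (sqrt (fsq y)) u
        (transpose_mat w * w)) \<partial>lmat N m \<partial>lmat 1 m \<partial>lmat (1 + N) 1)"
proof -
  note id = measurable_ident_sets[OF refl]
  have Fg: "(\<lambda>x. F (transpose_mat x * x)) \<in> borel_measurable (mat_borel (1 + N) (1 + m))"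
    by (rule measurable_compose[OF gram_measurable[OF id] F])
  have "(\<integral>\<^sup>+x. F (transpose_mat x * x) \<partial>lmat (1 + N) (1 + m)) =
    (\<integral>\<^sup>+y. \<integral>\<^sup>+x. F (transpose_mat (append_cols y x) * append_cols y x)
        \<partial>lmat (1 + N) m \<partial>lmat (1 + N) 1)"
    by (rule nn_integral_append_cols[OF Fg])
  also have "\<dots> = (\<integral>\<^sup>+y. \<integral>\<^sup>+u. \<integral>\<^sup>+w. F (gblock
      (sqrt (fsq y)) u (transpose_mat w * w)) \<partial>lmat N m \<partial>lmat 1 m \<partial>lmat (1 + N) 1)"
  proof (rule nn_integral_cong)
    fix y assume "y \<in> space (lmat (1 + N) 1)"
    then have y: "y \<in> carrier_mat (1 + N) 1" by simp
    obtain g where g: "g \<in> orth_group (1 + N)" "g * (sqrt (fsq y) \<cdot>\<^sub>m (1\<^sub>m 1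
        @\<^sub>r 0\<^sub>m N 1)) = y"
      by (rule column_rotation[OF y])
    define \<rho> where "\<rho> = sqrt (fsq y)"
    define e where "e = \<rho> \<cdot>\<^sub>m (1\<^sub>m 1 @\<^sub>r (0\<^sub>m N 1 :: real mat))"
    have e: "e \<in> carrier_mat (1 + N) 1" using stiefelD(1)[OF top_frame_stiefel[of 1 N]] by (simp add: e_def)
    have ge: "g * e = y" using g(2) by (simp add: e_def \<rho>_def)
    note gc = orth_groupD[OF g(1)]
    have my: "(\<lambda>x. F (transpose_mat (append_cols y x) * append_cols y x)) \<in>
        borel_measurable (mat_borel (1 + N) m)"
      by (rule measurable_compose[OF append_cols_measurable[OF mat_const_measurable[OF y] id] Fg])
    have me: "(\<lambda>x. F (transpose_mat (append_cols e x) * append_cols e x)) \<in>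
        borel_measurable (mat_borel (1 + N) m)"
      by (rule measurable_compose[OF append_cols_measurable[OF mat_const_measurable[OF e] id] Fg])
    have "(\<integral>\<^sup>+x. F (transpose_mat (append_cols y x) * append_cols y x) \<partial>lmat (1 + N) m)
      = (\<integral>\<^sup>+x. F (transpose_mat (append_cols y (g * x)) * append_cols y (g * x))
          \<partial>lmat (1 + N) m)"
      by (rule nn_integral_lmat_orth[OF g(1) my, symmetric])
    also have "\<dots> = (\<integral>\<^sup>+x. F (transpose_mat (append_cols e x) * append_cols e x)
        \<partial>lmat (1 + N) m)"
    proof (rule nn_integral_cong)
      fix x assume "x \<in> space (lmat (1 + N) m)"
      then have x: "x \<in> carrier_mat (1 + N) m" by simp
      have "append_cols y (g * x) = g * append_cols e x" using mult_append_cols[OF gc(1) e x] ge by simp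
      then show "F (transpose_mat (append_cols y (g * x)) * append_cols y (g * x)) = F (transpose_mat
          (append_cols e x) * append_cols e x)"
        using gram_orth_mult[OF g(1) append_cols_carrier[OF e x]] by simp
    qed
    also have "\<dots> = (\<integral>\<^sup>+u. \<integral>\<^sup>+w. F (transpose_mat (append_cols e
        (u @\<^sub>r w)) * append_cols e (u @\<^sub>r w)) \<partial>lmat N m \<partial>lmat 1 m)"
      by (rule nn_integral_append_rows[OF me])
    also have "\<dots> = (\<integral>\<^sup>+u. \<integral>\<^sup>+w. F (gblock \<rho> u (transpose_mat
        w * w)) \<partial>lmat N m \<partial>lmat 1 m)"
    proof (intro nn_integral_cong)
      fix u w assume "u \<in> space (lmat 1 m)" "w \<in> space (lmat N m)"
      then have u: "u \<in> carrier_mat 1 m" and w: "w \<in> carrier_mat N m" by auto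
      define R where "R = mat 1 1 (\<lambda>_. \<rho>)"
      have R: "R \<in> carrier_mat 1 1" "transpose_mat R = R" unfolding R_def by (auto intro!: eq_matI)
      have eR: "e = R @\<^sub>r 0\<^sub>m N 1"
        unfolding e_def by (rule eq_matI) (auto simp: append_rows_def R_def)
      have uw: "u @\<^sub>r w \<in> carrier_mat (1 + N) m" using u w by auto
      have 1: "R * u = \<rho> \<cdot>\<^sub>m u" using u by (intro eq_matI) (auto simp: R_def scalar_prod_def)
      have 2: "transpose_mat u * R = \<rho> \<cdot>\<^sub>m transpose_mat u" using u by (intro eq_matI)
          (auto simp: R_def scalar_prod_def)
      have 3: "R * R = mat 1 1 (\<lambda>_. \<rho>\<^sup>2)" by (intro eq_matI) (auto simp: R_def
          scalar_prod_def power2_eq_square)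
      have z: "0\<^sub>m N 1 \<in> carrier_mat N 1" by simp
      have "transpose_mat (append_cols e (u @\<^sub>r w)) * append_cols e (u @\<^sub>r w) = gblock
          \<rho> u (transpose_mat w * w)"
      proof -
        have "transpose_mat e * e = mat 1 1 (\<lambda>_. \<rho>\<^sup>2)"
          unfolding eR gram_append_rows[OF R(1) z R(1) z] R(2) 3 by (intro eq_matI) auto
        moreover have "transpose_mat e * (u @\<^sub>r w) = \<rho> \<cdot>\<^sub>m u"
          unfolding eR gram_append_rows[OF R(1) w u z] R(2) 1 using u w by (intro eq_matI) auto
        moreover have "transpose_mat (u @\<^sub>r w) * e = \<rho> \<cdot>\<^sub>m transpose_mat u"
          unfolding eR gram_append_rows[OF u z R(1) w] 2 using u w by (intro eq_matI) auto
        ultimately show ?thesis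
          unfolding gram_append_cols[OF e uw] gblock_def gram_append_rows[OF u w u w] by simp
      qed
      then show "F (transpose_mat (append_cols e (u @\<^sub>r w)) * append_cols e (u @\<^sub>r w)) = F
          (gblock \<rho> u (transpose_mat w * w))" by simp
    qed
    finally show "(\<integral>\<^sup>+x. F (transpose_mat (append_cols y x) * append_cols y x)
        \<partial>lmat (1 + N) m)
      = (\<integral>\<^sup>+u. \<integral>\<^sup>+w. F (gblock (sqrt (fsq y)) u (transpose_mat w * w))
          \<partial>lmat N m \<partial>lmat 1 m)"
      by (simp add: \<rho>_def)
  qed
  finally show ?thesis .
qed

section \<open>Rank deficient matrices form a null set\<close>

lemma fsq_zero_null:
  assumes "n \<ge> 1"
  shows "{y \<in> carrier_mat n 1. fsq y \<le> 0} \<in> null_sets (lmat n 1)"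
proof -
  have "{y \<in> carrier_mat n 1. fsq y \<le> 0} = rect n 1 (\<lambda>_. {0})"
  proof -
    have "fsq y \<le> 0 \<longleftrightarrow> (\<forall>i<n. \<forall>j<1. y $$ (i,j) \<in> {0})" if y:
        "y \<in> carrier_mat n 1" for y
    proof -
      have "fsq y \<le> 0 \<longleftrightarrow> (\<Sum>i<n. (y $$ (i,0))\<^sup>2) = 0"
        using fsq_nonneg[of y] fsq_eq[OF y] by auto
      also have "\<dots> \<longleftrightarrow> (\<forall>i<n. \<forall>j<1. y $$ (i,j) \<in> {0})" by
          (subst sum_nonneg_eq_0_iff) auto
      finally show ?thesis .
    qed
    then show ?thesis by (auto simp: rect_def)
  qed
  moreover have "emeasure (lmat n 1) (rect n 1 (\<lambda>_. {0})) = 0"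
    using assms by (subst emeasure_lmat_rect) (auto simp: card_cartesian_product)
  moreover have "rect n 1 (\<lambda>_. {0}) \<in> sets (mat_borel n 1)" by (rule rect_sets) auto
  ultimately show ?thesis by (auto simp: null_sets_def)
qed

text \<open>By \<open>det_gblock\<close> the determinant vanishes only if the first column does, or
  if the Gram determinant of a matrix with one row and one column less does. The second event is
  null by induction. The recursion is applied to the indicator of determinant 0.\<close>

lemma AE_det_gram: "m \<le> N \<Longrightarrow> AE x in lmat N m. det (transpose_mat x * x) \<noteq> 0"
proof (induction m arbitrary: N)
  case 0
  show ?case
  proof (rule AE_I2)
    fix x assume "x \<in> space (lmat N 0)"
    then have "transpose_mat x * x \<in> carrier_mat 0 0" by auto
    then show "det (transpose_mat x * x) \<noteq> 0" by simp
  qed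
next
  case (Suc m)
  then obtain M where N: "N = 1 + M" "m \<le> M" by (metis Suc_le_D Suc_le_mono plus_1_eq_Suc)
  note id = measurable_ident_sets[OF refl]
  have s: "{x \<in> carrier_mat n l. det (transpose_mat x * x) = 0} \<in> sets (mat_borel n l)" for n l
  proof -
    have "{x \<in> space (mat_borel n l). det (transpose_mat x * x) = 0} \<in> sets (mat_borel n l)"
      using mat_det_measurable[OF gram_measurable[OF id], of n l] by measurable
    then show ?thesis by simp
  qed
  define F :: "real mat \<Rightarrow> ennreal" where "F = (\<lambda>r. indicator {0} (det r))"
  have F: "F \<in> borel_measurable (mat_borel (1 + m) (1 + m))"
    unfolding F_def by (rule measurable_compose[OF mat_det_measurable[OF id]]) simp
  have inner: "(\<integral>\<^sup>+u. \<integral>\<^sup>+w. F (gblock (sqrt (fsq y)) u (transpose_mat w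
      * w)) \<partial>lmat M m \<partial>lmat 1 m) = 0"
    if "fsq y > 0" for y
  proof -
    have "(\<integral>\<^sup>+w. F (gblock (sqrt (fsq y)) u (transpose_mat w * w)) \<partial>lmat M m)
        = 0" if u: "u \<in> carrier_mat 1 m" for u
    proof -
      have "(\<integral>\<^sup>+w. F (gblock (sqrt (fsq y)) u (transpose_mat w * w)) \<partial>lmat M
          m) = (\<integral>\<^sup>+w. 0 \<partial>lmat M m)"
      proof (rule nn_integral_cong_AE)
        show "AE w in lmat M m. F (gblock (sqrt (fsq y)) u (transpose_mat w * w)) = 0"
          using Suc.IH[OF N(2)] AE_space
        proof eventually_elim
          case (elim w)
          then show ?case using \<open>fsq y > 0\<close> det_gblock[OF u gram_carrier[of w M m], of
              "sqrt (fsq y)"]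
            by (simp add: F_def)
        qed
      qed
      then show ?thesis by simp
    qed
    then have "(\<integral>\<^sup>+u. \<integral>\<^sup>+w. F (gblock (sqrt (fsq y)) u (transpose_mat w
        * w)) \<partial>lmat M m \<partial>lmat 1 m) = (\<integral>\<^sup>+u. 0 \<partial>lmat 1 m)"
      by (intro nn_integral_cong) auto
    then show ?thesis by simp
  qed
  have "AE y in lmat (1 + M) 1. fsq y > 0"
  proof -
    have "1 \<le> 1 + M" by simp
    from AE_not_in[OF fsq_zero_null[OF this]] AE_space show ?thesis by eventually_elim auto
  qed
  then have "(\<integral>\<^sup>+y. \<integral>\<^sup>+u. \<integral>\<^sup>+w. F (gblock (sqrt (fsq
      y)) u (transpose_mat w * w)) \<partial>lmat M m \<partial>lmat 1 m \<partial>lmat (1 + M) 1) =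
      (\<integral>\<^sup>+y. 0 \<partial>lmat (1 + M) 1)"
    by (intro nn_integral_cong_AE) (use inner in auto)
  then have "(\<integral>\<^sup>+x. F (transpose_mat x * x) \<partial>lmat (1 + M) (1 + m)) = 0"
    unfolding nn_integral_gram_step[OF F] by simp
  moreover have "F (transpose_mat x * x) = indicator {x \<in> carrier_mat (1 + M) (1 + m). det
      (transpose_mat x * x) = 0} x"
    if "x \<in> carrier_mat (1 + M) (1 + m)" for x
    using that by (auto simp: F_def split: split_indicator)
  then have "(\<integral>\<^sup>+x. F (transpose_mat x * x) \<partial>lmat (1 + M) (1 + m)) =
      (\<integral>\<^sup>+x. indicator {x \<in> carrier_mat (1 + M) (1 + m). det (transpose_mat x * x)
          = 0} x \<partial>lmat (1 + M) (1 + m))"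
    by (intro nn_integral_cong) simp
  then have "(\<integral>\<^sup>+x. F (transpose_mat x * x) \<partial>lmat (1 + M) (1 + m)) = emeasure
      (lmat (1 + M) (1 + m)) {x \<in> carrier_mat (1 + M) (1 + m). det (transpose_mat x * x) = 0}"
    using s[of "1 + M" "1 + m"] by (subst (asm) nn_integral_indicator) auto
  ultimately have "{x \<in> carrier_mat (1 + M) (1 + m). det (transpose_mat x * x) = 0} \<in> null_sets
      (lmat (1 + M) (1 + m))"
    using s by (auto simp: null_sets_def)
  from AE_not_in[OF this] AE_space have "AE x in lmat (1 + M) (1 + m). det (transpose_mat x * x) \<noteq> 0"
    by eventually_elim auto
  then show ?case unfolding N plus_1_eq_Suc .
qed

section \<open>Polar coordinates in a single column\<close>

text \<open>On half lines both sides are volumes of balls: integrating n vol(B) r^(n-1) from 0 to a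
  gives vol(B) a^n.\<close>

lemma distr_radius:
  assumes n: "n \<ge> 1"
  shows "distr (lmat n 1) borel (\<lambda>y. sqrt (fsq y)) =
    density lborel (\<lambda>r. ennreal (real n * unit_ball_vol (real n) * r ^ (n - 1)) * indicator
        {0..} r)" (is "?D = ?E")
proof (rule measure_eqI_generator_eq[of "range (\<lambda>a. {..a})" UNIV _ _ "\<lambda>i. {..real i}"])
  have fm: "(\<lambda>y. sqrt (fsq y)) \<in> borel_measurable (lmat n 1)"
    using fsq_measurable[OF measurable_ident_sets[OF refl], of n 1] by simp
  have pre: "(\<lambda>y. sqrt (fsq y)) -` {..a} \<inter> space (lmat n 1) = {y \<in> carrier_mat n 1.
      sqrt (fsq y) \<le> a}" for a
    by auto
  show "emeasure ?D X = emeasure ?E X" if XR: "X \<in> range (\<lambda>a. {..a})" for X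
  proof -
    obtain a where X: "X = {..a}" using XR by blast
    have d: "emeasure ?D X = emeasure (lmat n 1) {y \<in> carrier_mat n 1. sqrt (fsq y) \<le> a}"
      unfolding X by (subst emeasure_distr[OF fm]) (simp_all only: pre, simp)
    have e: "emeasure ?E X = (\<integral>\<^sup>+r. ennreal (real n * unit_ball_vol (real n) * r ^ (n -
        1)) * indicator {0..a} r \<partial>lborel)"
      unfolding X by (subst emeasure_density) (auto intro!: nn_integral_cong split: split_indicator)
    show ?thesis
    proof (cases "a > 0")
      case True
      have "{y \<in> carrier_mat n 1. sqrt (fsq y) \<le> a} = {y \<in> carrier_mat n 1. fsq y \<le> a\<^sup>2}"
        using True fsq_nonneg by (auto simp: real_sqrt_le_iff')
      then have "emeasure ?D X = ennreal (unit_ball_vol (real n) * a ^ n)"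
        using emeasure_ball_lmat[OF True, of n 1] d by simp
      moreover have "emeasure ?E X = ennreal (unit_ball_vol (real n) * a ^ n - unit_ball_vol (real n) * 0 ^ n)"
        unfolding e
      proof (rule nn_integral_FTC_Icc)
        fix r :: real assume "r \<in> {0..a}"
        then have "0 \<le> r" by simp
        show "((\<lambda>r. unit_ball_vol (real n) * r ^ n) has_real_derivative real n * unit_ball_vol
            (real n) * r ^ (n - 1)) (at r)"
          by (auto intro!: derivative_eq_intros)
        show "0 \<le> real n * unit_ball_vol (real n) * r ^ (n - 1)" using \<open>0 \<le> r\<close> by simp
      qed (use True in auto)
      ultimately show ?thesis using n by (simp add: power_0_left)
    next
      case False
      \<comment> \<open>For a <= 0 the preimage of the half line contains at most the zero column,
        which is null since n >= 1.\<close>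
      have "emeasure (lmat n 1) {y \<in> carrier_mat n 1. sqrt (fsq y) \<le> a} \<le> emeasure (lmat n
          1) {y \<in> carrier_mat n 1. fsq y \<le> 0}"
      proof (rule emeasure_mono)
        show "{y \<in> carrier_mat n 1. sqrt (fsq y) \<le> a} \<subseteq> {y \<in> carrier_mat n 1. fsq
            y \<le> 0}"
        proof safe
          fix y assume "sqrt (fsq y) \<le> a"
          then have "sqrt (fsq y) \<le> 0" using False by linarith
          then show "fsq y \<le> 0" by simp
        qed
        show "{y \<in> carrier_mat n 1. fsq y \<le> 0} \<in> sets (lmat n 1)" using fsq_zero_null[OF n] by auto
      qed
      then have "emeasure ?D X = 0" using fsq_zero_null[OF n] d by (auto simp: null_sets_def)
      moreover have "emeasure ?E X = (\<integral>\<^sup>+(r::real). 0 \<partial>lborel)"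
        unfolding e
      proof (rule nn_integral_cong_AE)
        show "AE r in lborel. ennreal (real n * unit_ball_vol (real n) * r ^ (n - 1)) * indicator {0..a} r = 0"
          using AE_lborel_singleton[of 0] by eventually_elim (use False in \<open>auto split:
              split_indicator\<close>)
      qed
      ultimately show ?thesis by simp
    qed
  qed
  show "emeasure ?D {..real i} \<noteq> \<infinity>" for i
  proof -
    \<comment> \<open>The volume formula requires a positive radius, so the half line ending at i is
      enlarged to i + 1.\<close>
    have "emeasure ?D {..real i} \<le> emeasure ?D {..real (Suc i)}" by (rule emeasure_mono) auto
    also have "\<dots> = emeasure (lmat n 1) {y \<in> carrier_mat n 1. sqrt (fsq y) \<le> real (Suc i)}"
      by (subst emeasure_distr[OF fm]) (simp_all only: pre, simp)
    also have "{y \<in> carrier_mat n 1. sqrt (fsq y) \<le> real (Suc i)} = {y \<in> carrier_mat n 1.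
        fsq y \<le> (real (Suc i))\<^sup>2}"
      by (auto simp: real_sqrt_le_iff' fsq_nonneg simp del: of_nat_Suc)
    also have "emeasure (lmat n 1) {y \<in> carrier_mat n 1. fsq y \<le> (real (Suc i))\<^sup>2} <
        \<infinity>" by (subst emeasure_ball_lmat) auto
    finally show ?thesis by simp
  qed
  show "Int_stable (range (\<lambda>a::real. {..a}))" by (auto simp: Int_stable_def)
  show "(\<Union>i. {..real i}) = UNIV" using real_arch_simple by auto
  show "sets ?D = sigma_sets UNIV (range (\<lambda>a::real. {..a}))" "sets ?E = sigma_sets UNIV (range
      (\<lambda>a::real. {..a}))"
    by (simp_all add: borel_eq_atMost)
qed auto

text \<open>The quotient of the areas of the unit spheres of R^(n+k) and R^n.\<close>

definition radial_const :: "nat \<Rightarrow> nat \<Rightarrow> real" where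
  "radial_const n k = pi powr (real k / 2) * Gamma (real n / 2) / Gamma ((real n + real k) / 2)"

text \<open>Both sides are the area of the unit sphere of R^n; the right one arises from Gamma(n/2 +
  1) = (n/2) Gamma(n/2), where n >= 1 avoids the pole at 0.\<close>

lemma ball_vol_Gamma: "n \<ge> 1 \<Longrightarrow> real n * unit_ball_vol (real n) = 2 * pi powr (real
    n / 2) / Gamma (real n / 2)"
proof -
  assume n: "n \<ge> 1"
  define t where "t = real n / 2"
  have t: "t > 0" "real n = 2 * t" using n by (auto simp: t_def)
  then have "t \<notin> \<int>\<^sub>\<le>\<^sub>0" using nonpos_Ints_nonpos[of t] by auto
  from Gamma_plus1[OF this] t show ?thesis by (simp add: unit_ball_vol_def add.commute)
qed

lemma ball_vol_ratio:
  assumes "n \<ge> 1"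
  shows "real (n + k) * unit_ball_vol (real (n + k)) = radial_const n k * (real n * unit_ball_vol (real n))"
proof -
  have "0 < Gamma (real n / 2)" by (rule Gamma_real_pos) (use assms in simp)
  then have G: "Gamma (real n / 2) \<noteq> 0" by (metis less_irrefl)
  have "real (n + k) * unit_ball_vol (real (n + k)) = 2 * (pi powr (real n / 2) * pi powr (real k / 2))
      / Gamma ((real n + real k) / 2)"
    using ball_vol_Gamma[of "n + k"] assms by (simp add: add_divide_distrib powr_add)
  also have "\<dots> = radial_const n k * (real n * unit_ball_vol (real n))"
    unfolding ball_vol_Gamma[OF assms] radial_const_def using G by simp
  finally show ?thesis .
qed

lemma radial_const_pos: "n \<ge> 1 \<Longrightarrow> radial_const n k > 0"
  by (auto simp: radial_const_def)

lemma nn_integral_radius: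
  assumes "n \<ge> 1" and \<Phi>: "\<Phi> \<in> borel_measurable borel"
  shows "(\<integral>\<^sup>+y. \<Phi> (sqrt (fsq y)) \<partial>lmat n 1) =
    (\<integral>\<^sup>+r. ennreal (real n * unit_ball_vol (real n) * r ^ (n - 1)) * indicator {0..} r
        * \<Phi> r \<partial>lborel)"
proof -
  have fm: "(\<lambda>y. sqrt (fsq y)) \<in> borel_measurable (lmat n 1)"
    using fsq_measurable[OF measurable_ident_sets[OF refl], of n 1] by simp
  have "(\<integral>\<^sup>+y. \<Phi> (sqrt (fsq y)) \<partial>lmat n 1) = (\<integral>\<^sup>+r.
      \<Phi> r \<partial>distr (lmat n 1) borel (\<lambda>y. sqrt (fsq y)))"
    by (rule nn_integral_distr[OF fm, symmetric]) (use \<Phi> in simp)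
  then show ?thesis unfolding distr_radius[OF assms(1)] using \<Phi> by (simp add: nn_integral_density)
qed

text \<open>The case of one column: in polar coordinates the weight removes k powers of the radius
  from r^(n+k-1) and leaves the density of R^n up to the quotient of sphere areas.\<close>

lemma radial_weight:
  assumes n: "n \<ge> 1" and \<Phi>: "\<Phi> \<in> borel_measurable borel"
  shows "(\<integral>\<^sup>+y. ennreal (sqrt (fsq y) powr (- real k)) * \<Phi> (sqrt (fsq y))
      \<partial>lmat (n + k) 1) =
    ennreal (radial_const n k) * (\<integral>\<^sup>+y. \<Phi> (sqrt (fsq y)) \<partial>lmat n 1)"
proof -
  have m: "(\<lambda>r. ennreal (r powr (- real k)) * \<Phi> r) \<in> borel_measurable borel" using
      \<Phi> by measurable
  have "(\<integral>\<^sup>+y. ennreal (sqrt (fsq y) powr (- real k)) * \<Phi> (sqrt (fsq y))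
      \<partial>lmat (n + k) 1) =
    (\<integral>\<^sup>+r. ennreal (real (n + k) * unit_ball_vol (real (n + k)) * r ^ (n + k - 1)) *
        indicator {0..} r * (ennreal (r powr (- real k)) * \<Phi> r) \<partial>lborel)"
    by (rule nn_integral_radius[OF _ m]) (use n in auto)
  also have "\<dots> = (\<integral>\<^sup>+r. ennreal (radial_const n k) * (ennreal (real n *
      unit_ball_vol (real n) * r ^ (n - 1)) * indicator {0..} r * \<Phi> r) \<partial>lborel)"
  proof (rule nn_integral_cong_AE)
    \<comment> \<open>At r = 0 \<open>powr\<close> gives 0, while \<open>r ^ (n - 1)\<close> is 1
      for n = 1; this point is excluded as a null set.\<close>
    show "AE r in lborel. ennreal (real (n + k) * unit_ball_vol (real (n + k)) * r ^ (n + k - 1)) *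
        indicator {0..} r * (ennreal (r powr (- real k)) * \<Phi> r)
      = ennreal (radial_const n k) * (ennreal (real n * unit_ball_vol (real n) * r ^ (n - 1)) *
          indicator {0..} r * \<Phi> r)"
      using AE_lborel_singleton[of 0]
    proof eventually_elim
      case (elim r)
      show ?case
      proof (cases "r > 0")
        case True
        have "n + k - 1 = (n - 1) + k" using n by simp
        then have "r ^ (n + k - 1) * r powr (- real k) = r ^ (n - 1)"
          using True by (simp add: power_add powr_minus powr_realpow)
        then have *: "real (n + k) * unit_ball_vol (real (n + k)) * r ^ (n + k - 1) * r powr (- real k)
          = radial_const n k * (real n * unit_ball_vol (real n) * r ^ (n - 1))"
          unfolding ball_vol_ratio[OF n] by (simp add: mult.assoc)
        have "ennreal (real (n + k) * unit_ball_vol (real (n + k)) * r ^ (n + k - 1)) * ennreal (r powr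
            (- real k))
          = ennreal (radial_const n k) * ennreal (real n * unit_ball_vol (real n) * r ^ (n - 1))"
        proof -
          have nn: "0 \<le> real a * unit_ball_vol (real a) * r ^ b" "0 \<le> r powr c" "0 \<le>
              radial_const n k" for a b c
            using True radial_const_pos[OF n, of k] by (auto intro!: mult_nonneg_nonneg)
          show ?thesis unfolding ennreal_mult[OF nn(1,2), symmetric] ennreal_mult[OF nn(3,1), symmetric] * ..
        qed
        then show ?thesis using True by (simp add: mult.assoc[symmetric])
      qed (use elim in auto)
    qed
  qed
  also have "\<dots> = ennreal (radial_const n k) * (\<integral>\<^sup>+y. \<Phi> (sqrt (fsq y))
      \<partial>lmat n 1)"
    unfolding nn_integral_radius[OF n \<Phi>] using \<Phi> by (intro nn_integral_cmult) auto
  finally show ?thesis .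
qed

section \<open>The weighted image of Lebesgue measure under the Gram map\<close>

text \<open>Each column rotated onto an axis takes away one row, so column j ranges over R^(N-j),
  and over R^(N+k-j) on the weighted side.\<close>

definition gram_const :: "nat \<Rightarrow> nat \<Rightarrow> nat \<Rightarrow> real" where
  "gram_const m N k = (\<Prod>j<m. radial_const (N - j) k)"

lemma gram_const_pos: "m \<le> N \<Longrightarrow> gram_const m N k > 0"
  unfolding gram_const_def by (intro prod_pos) (auto intro!: radial_const_pos)

lemma gram_const_Suc: "gram_const (Suc m) (Suc N) k = radial_const (Suc N) k * gram_const m N k"
  unfolding gram_const_def prod.lessThan_Suc_shift by simp

lemma lmat_zero_cols: "emeasure (lmat N 0) (carrier_mat N 0) = 1"
  using emeasure_lmat_rect[of N 0 "\<lambda>_. UNIV"] by (simp add: rect_def)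

text \<open>For rho = 0 both sides vanish because \<open>powr\<close> is 0 at base 0 for every
  exponent, including the exponent 0 that k = 0 produces.\<close>

lemma det_gblock_powr:
  assumes u: "u \<in> carrier_mat 1 m" and w: "w \<in> carrier_mat N m" and \<rho>: "\<rho> \<ge> 0"
  shows "det (gblock \<rho> u (transpose_mat w * w)) powr (- (real k / 2)) =
    \<rho> powr (- real k) * det (transpose_mat w * w) powr (- (real k / 2))"
proof (cases "\<rho> = 0")
  case False
  then have "\<rho> > 0" using \<rho> by simp
  have "(\<rho>\<^sup>2) powr (- (real k / 2)) = (\<rho> powr 2) powr (- (real k / 2))" using
      \<open>\<rho> > 0\<close> by (simp add: powr_numeral)
  also have "\<dots> = \<rho> powr (- real k)" by (simp add: powr_powr)
  finally show ?thesis
    using det_gblock[OF u gram_carrier[OF w]] det_gram_nonneg[OF w] by (simp add: powr_mult)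
qed (use det_gblock[OF u gram_carrier[OF w]] in simp)

text \<open>Splitting off the first column y turns the weight into |y|^(-k) times the weight of the
  remaining matrix w. The integral over w is the induction hypothesis for one row and one column
  less, the integral over y is \<open>radial_weight\<close>, and the row u is carried along.\<close>

theorem nn_integral_gram_weight:
  assumes "m \<le> N" "F \<in> borel_measurable (mat_borel m m)"
  shows "(\<integral>\<^sup>+x. ennreal (det (transpose_mat x * x) powr (- (real k / 2))) * F
      (transpose_mat x * x) \<partial>lmat (N + k) m) =
    ennreal (gram_const m N k) * (\<integral>\<^sup>+x. F (transpose_mat x * x) \<partial>lmat N m)"
  using assms
proof (induction m arbitrary: N F)
  case 0
  have g: "transpose_mat x * x = 1\<^sub>m 0" if "x \<in> carrier_mat M 0" for M and x :: "real mat"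
    using that by (intro eq_matI) auto
  have "(\<integral>\<^sup>+x. ennreal (det (transpose_mat x * x) powr (- (real k / 2))) * F
      (transpose_mat x * x) \<partial>lmat (N + k) 0)
     = (\<integral>\<^sup>+x. F (1\<^sub>m 0) \<partial>lmat (N + k) 0)"
    by (intro nn_integral_cong) (simp add: g)
  moreover have "(\<integral>\<^sup>+x. F (transpose_mat x * x) \<partial>lmat N 0) =
      (\<integral>\<^sup>+x. F (1\<^sub>m 0) \<partial>lmat N 0)"
    by (intro nn_integral_cong) (simp add: g)
  ultimately show ?case by (simp add: lmat_zero_cols gram_const_def)
next
  case (Suc m)
  then obtain M where N: "N = 1 + M" and mM: "m \<le> M" by (metis Suc_le_D Suc_le_mono plus_1_eq_Suc)
  have F: "F \<in> borel_measurable (mat_borel (1 + m) (1 + m))" using Suc.prems by simp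
  note id = measurable_ident_sets[OF refl]
  have dm: "(\<lambda>r. ennreal (det r powr (- (real k / 2)))) \<in> borel_measurable (mat_borel n n)" for n
    using mat_det_measurable[OF id, of n] by measurable
  have DF: "(\<lambda>r. ennreal (det r powr (- (real k / 2))) * F r) \<in> borel_measurable (mat_borel
      (1 + m) (1 + m))"
    by (intro borel_measurable_times_ennreal dm F)
  define \<Phi> where "\<Phi> = (\<lambda>\<rho>. \<integral>\<^sup>+u. \<integral>\<^sup>+w. F (gblock
      \<rho> u (transpose_mat w * w)) \<partial>lmat M m \<partial>lmat 1 m)"
  interpret LM: sigma_finite_measure "lmat M m" by (rule sigma_finite_lmat)
  interpret L1: sigma_finite_measure "lmat 1 m" by (rule sigma_finite_lmat)
  have j: "(\<lambda>z. F (gblock (fst (fst z)) (snd (fst z)) (transpose_mat (snd z) * snd z))) \<in>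
      borel_measurable ((borel \<Otimes>\<^sub>M mat_borel 1 m) \<Otimes>\<^sub>M mat_borel M m)"
    by (rule measurable_compose[OF gblock_measurable[OF measurable_compose[OF measurable_fst
        measurable_fst] measurable_compose[OF measurable_fst measurable_snd] gram_measurable[OF
        measurable_snd]] F])
  have j': "(\<lambda>z. \<integral>\<^sup>+w. F (gblock (fst z) (snd z) (transpose_mat w * w))
      \<partial>lmat M m) \<in> borel_measurable (borel \<Otimes>\<^sub>M mat_borel 1 m)"
    by (rule LM.borel_measurable_nn_integral[of "\<lambda>z w. F (gblock (fst z) (snd z) (transpose_mat
        w * w))"])
      (use j in \<open>simp add: case_prod_beta' cong: measurable_cong_sets\<close>)
  have \<Phi>: "\<Phi> \<in> borel_measurable borel" unfolding \<Phi>_def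
    by (rule L1.borel_measurable_nn_integral[of "\<lambda>\<rho> u. \<integral>\<^sup>+w. F (gblock
        \<rho> u (transpose_mat w * w)) \<partial>lmat M m"])
      (use j' in \<open>simp add: case_prod_beta' cong: measurable_cong_sets\<close>)
  have Fs: "(\<lambda>s. F (gblock \<rho> u s)) \<in> borel_measurable (mat_borel m m)" if "u \<in>
      carrier_mat 1 m" for \<rho> u
    by (rule measurable_compose[OF gblock_measurable[OF measurable_const mat_const_measurable[OF that]
        id] F]) auto
  have "(\<integral>\<^sup>+x. ennreal (det (transpose_mat x * x) powr (- (real k / 2))) * F
      (transpose_mat x * x) \<partial>lmat (1 + (M + k)) (1 + m)) =
    (\<integral>\<^sup>+y. \<integral>\<^sup>+u. \<integral>\<^sup>+w. ennreal (det (gblock (sqrt (fsq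
        y)) u (transpose_mat w * w)) powr (- (real k / 2))) *
       F (gblock (sqrt (fsq y)) u (transpose_mat w * w)) \<partial>lmat (M + k) m \<partial>lmat 1 m
           \<partial>lmat (1 + (M + k)) 1)"
    by (rule nn_integral_gram_step[OF DF])
  also have "\<dots> = (\<integral>\<^sup>+y. ennreal (sqrt (fsq y) powr (- real k)) * (ennreal
      (gram_const m M k) * \<Phi> (sqrt (fsq y))) \<partial>lmat (1 + (M + k)) 1)"
  proof (rule nn_integral_cong)
    fix y :: "real mat"
    define \<rho> where "\<rho> = sqrt (fsq y)"
    have \<rho>: "\<rho> \<ge> 0" using fsq_nonneg by (simp add: \<rho>_def)
    have "(\<integral>\<^sup>+u. \<integral>\<^sup>+w. ennreal (det (gblock \<rho> u (transpose_mat w *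
        w)) powr (- (real k / 2))) * F (gblock \<rho> u (transpose_mat w * w)) \<partial>lmat (M + k) m
        \<partial>lmat 1 m)
      = (\<integral>\<^sup>+u. ennreal (\<rho> powr (- real k)) * ennreal (gram_const m M k) *
          (\<integral>\<^sup>+w. F (gblock \<rho> u (transpose_mat w * w)) \<partial>lmat M m)
          \<partial>lmat 1 m)"
    proof (rule nn_integral_cong)
      fix u assume "u \<in> space (lmat 1 m)"
      then have u: "u \<in> carrier_mat 1 m" by simp
      have "(\<integral>\<^sup>+w. ennreal (det (gblock \<rho> u (transpose_mat w * w)) powr (- (real k
          / 2))) * F (gblock \<rho> u (transpose_mat w * w)) \<partial>lmat (M + k) m)
        = (\<integral>\<^sup>+w. ennreal (\<rho> powr (- real k)) * (ennreal (det (transpose_mat w * w)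
            powr (- (real k / 2))) * F (gblock \<rho> u (transpose_mat w * w))) \<partial>lmat (M + k) m)"
        by (intro nn_integral_cong) (simp add: det_gblock_powr[OF u _ \<rho>] ennreal_mult mult.assoc)
      also have "\<dots> = ennreal (\<rho> powr (- real k)) * (\<integral>\<^sup>+w. ennreal (det
          (transpose_mat w * w) powr (- (real k / 2))) * F (gblock \<rho> u (transpose_mat w * w))
          \<partial>lmat (M + k) m)"
        using measurable_compose[OF gram_measurable[OF id] borel_measurable_times_ennreal[OF dm Fs[OF u]]]
        by (intro nn_integral_cmult) simp
      also have "\<dots> = ennreal (\<rho> powr (- real k)) * ennreal (gram_const m M k) *
          (\<integral>\<^sup>+w. F (gblock \<rho> u (transpose_mat w * w)) \<partial>lmat M m)"
        unfolding Suc.IH[OF mM Fs[OF u]] by (simp add: mult.assoc)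
      finally show "(\<integral>\<^sup>+w. ennreal (det (gblock \<rho> u (transpose_mat w * w)) powr (-
          (real k / 2))) * F (gblock \<rho> u (transpose_mat w * w)) \<partial>lmat (M + k) m)
        = ennreal (\<rho> powr (- real k)) * ennreal (gram_const m M k) * (\<integral>\<^sup>+w. F
            (gblock \<rho> u (transpose_mat w * w)) \<partial>lmat M m)" .
    qed
    also have "\<dots> = ennreal (\<rho> powr (- real k)) * ennreal (gram_const m M k) * \<Phi> \<rho>"
      unfolding \<Phi>_def using measurable_compose[OF measurable_Pair1'[of \<rho> borel "mat_borel 1 m"] j']
      by (intro nn_integral_cmult) simp
    finally show "(\<integral>\<^sup>+u. \<integral>\<^sup>+w. ennreal (det (gblock (sqrt (fsq y)) u
        (transpose_mat w * w)) powr (- (real k / 2))) *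
       F (gblock (sqrt (fsq y)) u (transpose_mat w * w)) \<partial>lmat (M + k) m \<partial>lmat 1 m) =
           ennreal (sqrt (fsq y) powr (- real k)) * (ennreal (gram_const m M k) * \<Phi> (sqrt (fsq y)))"
      by (simp add: \<rho>_def mult.assoc)
  qed
  also have "\<dots> = ennreal (radial_const (1 + M) k) * (\<integral>\<^sup>+y. ennreal (gram_const m
      M k) * \<Phi> (sqrt (fsq y)) \<partial>lmat (1 + M) 1)"
    using radial_weight[of "1 + M" "\<lambda>\<rho>. ennreal (gram_const m M k) * \<Phi> \<rho>" k]
        \<Phi> by (simp add: add.assoc)
  also have "(\<integral>\<^sup>+y. ennreal (gram_const m M k) * \<Phi> (sqrt (fsq y)) \<partial>lmat
      (1 + M) 1) = ennreal (gram_const m M k) * (\<integral>\<^sup>+y. \<Phi> (sqrt (fsq y))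
      \<partial>lmat (1 + M) 1)"
    using measurable_compose[OF measurable_compose[OF fsq_measurable[OF id] borel_measurable_sqrt]
        \<Phi>] by (intro nn_integral_cmult) simp
  also have "(\<integral>\<^sup>+y. \<Phi> (sqrt (fsq y)) \<partial>lmat (1 + M) 1) =
      (\<integral>\<^sup>+x. F (transpose_mat x * x) \<partial>lmat (1 + M) (1 + m))"
    unfolding nn_integral_gram_step[OF F] \<Phi>_def ..
  finally show ?case
    using radial_const_pos[of "Suc M" k] gram_const_pos[OF mM, of k]
    by (simp add: N gram_const_Suc ennreal_mult mult.assoc)
qed

subsection \<open>Haar measure on the orthogonal group and the Stiefel measure\<close>

text \<open>Transposition exchanges the two multiplications, so invariance of Lebesgue measure under
  right multiplication by O(m) follows from the left one.\<close>

lemma lmat_transpose: "lmat m n = distr (lmat n m) (mat_borel m n) transpose_mat"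
proof (rule lmat_eqI[symmetric])
  fix A :: "nat \<times> nat \<Rightarrow> real set" assume A: "\<And>p. p \<in> entries m n
      \<Longrightarrow> A p \<in> sets borel"
  have m: "transpose_mat \<in> lmat n m \<rightarrow>\<^sub>M mat_borel m n"
    using mat_transpose_measurable[OF measurable_ident_sets[OF refl], of n m] by simp
  have pre: "transpose_mat -` rect m n A \<inter> space (lmat n m) = rect n m (A \<circ> prod.swap)"
    by (auto simp: rect_def)
  have "emeasure (distr (lmat n m) (mat_borel m n) transpose_mat) (rect m n A) = (\<Prod>p\<in>entries
      n m. emeasure lborel ((A \<circ> prod.swap) p))"
  proof -
    have R: "rect m n A \<in> sets (mat_borel m n)" by (rule rect_sets[OF A])
    show ?thesis unfolding emeasure_distr[OF m R] pre using A by (intro emeasure_lmat_rect) auto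
  qed
  also have "\<dots> = (\<Prod>p\<in>prod.swap ` entries n m. emeasure lborel (A p))"
    by (subst prod.reindex) auto
  also have "prod.swap ` entries n m = entries m n" by (rule product_swap)
  finally show "emeasure (distr (lmat n m) (mat_borel m n) transpose_mat) (rect m n A) =
      (\<Prod>p\<in>entries m n. emeasure lborel (A p))" .
qed simp

lemma nn_integral_lmat_orth_right:
  assumes g: "g \<in> orth_group m" and G: "G \<in> borel_measurable (mat_borel n m)"
  shows "(\<integral>\<^sup>+x. G (x * g) \<partial>lmat n m) = (\<integral>\<^sup>+x. G x \<partial>lmat n m)"
proof -
  note id = measurable_ident_sets[OF refl]
  note gc = orth_groupD[OF g]
  have m: "transpose_mat \<in> lmat m n \<rightarrow>\<^sub>M mat_borel n m"
    using mat_transpose_measurable[OF id, of m n] by simp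
  have Gg: "(\<lambda>x. G (x * g)) \<in> borel_measurable (mat_borel n m)"
    by (rule measurable_compose[OF mat_mult_measurable[OF id mat_const_measurable[OF gc(1)]] G])
  have Gt: "(\<lambda>x. G (transpose_mat x)) \<in> borel_measurable (mat_borel m n)"
    by (rule measurable_compose[OF mat_transpose_measurable[OF id] G])
  have "(\<integral>\<^sup>+x. G (x * g) \<partial>lmat n m) = (\<integral>\<^sup>+x. G (transpose_mat
      x * g) \<partial>lmat m n)"
    unfolding lmat_transpose[of n m] using Gg by (intro nn_integral_distr m) simp
  also have "\<dots> = (\<integral>\<^sup>+x. G (transpose_mat (transpose_mat g * x)) \<partial>lmat m n)"
    by (intro nn_integral_cong) (use gc in \<open>simp add: transpose_mult[of _ m m _ n]\<close>)
  also have "\<dots> = (\<integral>\<^sup>+x. G (transpose_mat x) \<partial>lmat m n)"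
    by (rule nn_integral_lmat_orth[OF gc(4) Gt])
  also have "\<dots> = (\<integral>\<^sup>+x. G x \<partial>lmat n m)"
    unfolding lmat_transpose[of n m] using G by (intro nn_integral_distr[symmetric] m) simp
  finally show ?thesis .
qed

section \<open>Haar measure as the image of a uniform distribution\<close>

definition unit_ball_mat :: "nat \<Rightarrow> real mat set" where
  "unit_ball_mat n = {x \<in> carrier_mat n n. fsq x \<le> 1}"

lemma unit_ball_mat_sets: "unit_ball_mat n \<in> sets (mat_borel n n)"
proof -
  have "{x \<in> space (mat_borel n n). fsq x \<le> 1} \<in> sets (mat_borel n n)"
    using fsq_measurable[OF measurable_ident_sets[OF refl]] by measurable
  then show ?thesis by (simp add: unit_ball_mat_def)
qed

lemma emeasure_unit_ball_mat:
  "emeasure (lmat n n) (unit_ball_mat n) \<noteq> 0" "emeasure (lmat n n) (unit_ball_mat n) \<noteq>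
      \<infinity>"
proof -
  have e: "emeasure (lmat n n) (unit_ball_mat n) = ennreal (unit_ball_vol (real (n * n)))"
    using emeasure_ball_lmat[of 1 n n] by (simp add: unit_ball_mat_def)
  show "emeasure (lmat n n) (unit_ball_mat n) \<noteq> 0"
    unfolding e by (metis unit_ball_vol_pos of_nat_0_le_iff ennreal_eq_0_iff not_le)
  show "emeasure (lmat n n) (unit_ball_mat n) \<noteq> \<infinity>" unfolding e by simp
qed

text \<open>The orthogonal factor of the polar decomposition is equivariant on both sides, so it maps
  the uniform distribution on a ball of matrices to an invariant measure.\<close>
definition haar :: "nat \<Rightarrow> real mat measure" where
  "haar n = distr (uniform_measure (lmat n n) (unit_ball_mat n)) (stiefel_borel n n) (polar0 n n)"

lemma sets_haar [simp, measurable_cong]: "sets (haar n) = sets (stiefel_borel n n)"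
  by (simp add: haar_def)

lemma space_haar [simp]: "space (haar n) = orth_group n"
  by (simp add: haar_def orth_group_eq_stiefel)

lemma polar0_measurable_uniform:
  "polar0 n n \<in> uniform_measure (lmat n n) (unit_ball_mat n) \<rightarrow>\<^sub>M stiefel_borel n n"
  using polar0_measurable[of "\<lambda>x. x" "mat_borel n n" n n] measurable_ident_sets[OF refl]
  by (simp cong: measurable_cong_sets)

lemma prob_space_haar: "prob_space (haar n)"
  unfolding haar_def
  by (rule prob_space.prob_space_distr[OF prob_space_uniform_measure polar0_measurable_uniform])
    (use emeasure_unit_ball_mat in auto)

lemma nn_integral_haar:
  assumes "F \<in> borel_measurable (stiefel_borel n n)"
  shows "(\<integral>\<^sup>+g. F g \<partial>haar n) =
    (\<integral>\<^sup>+x. F (polar0 n n x) * indicator (unit_ball_mat n) x \<partial>lmat n n) /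
        emeasure (lmat n n) (unit_ball_mat n)"
proof -
  have "(\<integral>\<^sup>+g. F g \<partial>haar n) = (\<integral>\<^sup>+x. F (polar0 n n x)
      \<partial>uniform_measure (lmat n n) (unit_ball_mat n))"
    unfolding haar_def using assms by (intro nn_integral_distr polar0_measurable_uniform) simp
  also have "\<dots> = (\<integral>\<^sup>+x. F (polar0 n n x) * indicator (unit_ball_mat n) x
      \<partial>lmat n n) / emeasure (lmat n n) (unit_ball_mat n)"
    by (rule nn_integral_uniform_measure)
      (use unit_ball_mat_sets measurable_compose[OF polar0_measurable[OF measurable_ident_sets[OF refl]
          order_refl] assms] in auto)
  finally show ?thesis .
qed

lemma nn_integral_haar_left:
  assumes F: "F \<in> borel_measurable (stiefel_borel n n)" and q: "q \<in> orth_group n"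
  shows "(\<integral>\<^sup>+g. F (q * g) \<partial>haar n) = (\<integral>\<^sup>+g. F g \<partial>haar n)"
proof -
  note id = measurable_ident_sets[OF refl]
  have m: "(\<lambda>g. q * g) \<in> stiefel_borel n n \<rightarrow>\<^sub>M stiefel_borel n n"
    by (rule stiefel_borelI[OF mat_left_mult_measurable[OF orth_groupD(1)[OF q] stiefel_borelD[OF id]]])
      (use orth_mult_stiefel[OF q] in simp)
  note Fq = measurable_compose[OF m F]
  have G: "(\<lambda>x. F (polar0 n n x) * indicator (unit_ball_mat n) x) \<in> borel_measurable
      (mat_borel n n)"
    by (intro borel_measurable_times_ennreal measurable_compose[OF polar0_measurable[OF id order_refl]
        F] borel_measurable_indicator unit_ball_mat_sets)
  have "(\<integral>\<^sup>+x. F (q * polar0 n n x) * indicator (unit_ball_mat n) x \<partial>lmat n n) =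
      (\<integral>\<^sup>+x. F (polar0 n n (q * x)) * indicator (unit_ball_mat n) (q * x) \<partial>lmat n n)"
  proof (rule nn_integral_cong_AE)
    \<comment> \<open>\<open>polar0\<close> is equivariant only at full rank, because its default
      value does not rotate; the exceptions form a null set.\<close>
    show "AE x in lmat n n. F (q * polar0 n n x) * indicator (unit_ball_mat n) x = F (polar0 n n (q *
        x)) * indicator (unit_ball_mat n) (q * x)"
      using AE_det_gram[OF order_refl, of n] AE_space
    proof eventually_elim
      case (elim x)
      then have x: "x \<in> carrier_mat n n" by simp
      have qx: "q * x \<in> carrier_mat n n" using x orth_groupD(1)[OF q] by auto
      have "det (transpose_mat (q * x) * (q * x)) \<noteq> 0" using gram_orth_mult[OF q x] elim by simp
      then have "polar0 n n (q * x) = q * polar0 n n x"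
        using polar_orth_left[OF x elim(1) q] polar0_eq[OF x elim(1)] polar0_eq[OF qx] by simp
      moreover have "q * x \<in> unit_ball_mat n \<longleftrightarrow> x \<in> unit_ball_mat n"
        using fsq_orth[OF q x] x qx by (simp add: unit_ball_mat_def)
      ultimately show ?case by (simp add: indicator_def)
    qed
  qed
  also have "\<dots> = (\<integral>\<^sup>+x. F (polar0 n n x) * indicator (unit_ball_mat n) x
      \<partial>lmat n n)"
    by (rule nn_integral_lmat_orth[OF q G])
  finally show ?thesis unfolding nn_integral_haar[OF F] nn_integral_haar[OF Fq] by simp
qed

lemma nn_integral_haar_right:
  assumes F: "F \<in> borel_measurable (stiefel_borel n n)" and q: "q \<in> orth_group n"
  shows "(\<integral>\<^sup>+g. F (g * q) \<partial>haar n) = (\<integral>\<^sup>+g. F g \<partial>haar n)"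
proof -
  note id = measurable_ident_sets[OF refl]
  have m: "(\<lambda>g. g * q) \<in> stiefel_borel n n \<rightarrow>\<^sub>M stiefel_borel n n"
    by (rule stiefel_borelI[OF mat_mult_measurable[OF stiefel_borelD[OF id] mat_const_measurable[OF
        orth_groupD(1)[OF q]]]])
      (use stiefel_mult q in \<open>auto simp: orth_group_eq_stiefel\<close>)
  note Fq = measurable_compose[OF m F]
  have G: "(\<lambda>x. F (polar0 n n x) * indicator (unit_ball_mat n) x) \<in> borel_measurable
      (mat_borel n n)"
    by (intro borel_measurable_times_ennreal measurable_compose[OF polar0_measurable[OF id order_refl]
        F] borel_measurable_indicator unit_ball_mat_sets)
  have "(\<integral>\<^sup>+x. F (polar0 n n x * q) * indicator (unit_ball_mat n) x \<partial>lmat n n) =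
      (\<integral>\<^sup>+x. F (polar0 n n (x * q)) * indicator (unit_ball_mat n) (x * q) \<partial>lmat n n)"
  proof (rule nn_integral_cong_AE)
    show "AE x in lmat n n. F (polar0 n n x * q) * indicator (unit_ball_mat n) x = F (polar0 n n (x *
        q)) * indicator (unit_ball_mat n) (x * q)"
      using AE_det_gram[OF order_refl, of n] AE_space
    proof eventually_elim
      case (elim x)
      then have x: "x \<in> carrier_mat n n" by simp
      have qx: "x * q \<in> carrier_mat n n" using x orth_groupD(1)[OF q] by auto
      have "polar0 n n (x * q) = polar0 n n x * q"
        using polar_orth_right[OF x elim(1) q] polar0_eq[OF x elim(1)] polar0_eq[OF qx] by simp
      moreover have "fsq (x * q) = fsq x"
      proof -
        have tx: "fsq (transpose_mat y) = fsq y" if "y \<in> carrier_mat n n" for y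
          using that by (simp add: fsq_def) (rule sum.swap)
        have "fsq (x * q) = fsq (transpose_mat q * transpose_mat x)"
          using tx[OF qx] x orth_groupD(1)[OF q] by (simp add: transpose_mult[of _ n n _ n])
        also have "\<dots> = fsq x" using fsq_orth[OF orth_groupD(4)[OF q], of "transpose_mat x" n] x
            tx[OF x] by simp
        finally show ?thesis .
      qed
      then have "x * q \<in> unit_ball_mat n \<longleftrightarrow> x \<in> unit_ball_mat n"
        using x qx by (simp add: unit_ball_mat_def)
      ultimately show ?case by (simp add: indicator_def)
    qed
  qed
  also have "\<dots> = (\<integral>\<^sup>+x. F (polar0 n n x) * indicator (unit_ball_mat n) x
      \<partial>lmat n n)"
    by (rule nn_integral_lmat_orth_right[OF q G])
  finally show ?thesis unfolding nn_integral_haar[OF F] nn_integral_haar[OF Fq] by simp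
qed

section \<open>The Stiefel measure as an image of Haar measure\<close>

lemma stiefel_mult_measurable:
  assumes "F \<in> N \<rightarrow>\<^sub>M stiefel_borel n m" "G \<in> N \<rightarrow>\<^sub>M
      stiefel_borel m l"
  shows "(\<lambda>w. F w * G w) \<in> N \<rightarrow>\<^sub>M stiefel_borel n l"
proof (rule stiefel_borelI[OF mat_mult_measurable[OF stiefel_borelD[OF assms(1)] stiefel_borelD[OF assms(2)]]])
  fix w assume "w \<in> space N"
  then have "F w \<in> stiefel n m" "G w \<in> stiefel m l"
    using measurable_space[OF assms(1)] measurable_space[OF assms(2)] by auto
  then show "F w * G w \<in> stiefel n l" by (rule stiefel_mult)
qed

lemma stiefel_const_measurable: "E \<in> stiefel n m \<Longrightarrow> (\<lambda>w. E) \<in> N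
    \<rightarrow>\<^sub>M stiefel_borel n m"
  by (rule measurable_const) simp

text \<open>The image of Haar measure inherits left invariance. For any invariant probability
  measure mu, integrate the indicator of A at gv over both variables: taking v first gives mu(A);
  taking g first gives the image measure of A, by transitivity and right invariance of Haar measure.
  The free base point \<open>E\<close> is later adapted to each transform.\<close>

theorem stiefel_measure_eq:
  assumes E: "E \<in> stiefel n m" and mn: "m \<le> n"
  shows "stiefel_measure n m = distr (haar n) (stiefel_borel n m) (\<lambda>g. g * E)"
proof -
  note id = measurable_ident_sets[OF refl]
  have mE: "(\<lambda>g. g * E) \<in> stiefel_borel n n \<rightarrow>\<^sub>M stiefel_borel n m"
    by (rule stiefel_mult_measurable[OF id stiefel_const_measurable[OF E]])
  then have mE': "(\<lambda>g. g * E) \<in> haar n \<rightarrow>\<^sub>M stiefel_borel n m" by (simp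
      cong: measurable_cong_sets)
  define \<sigma> where "\<sigma> = distr (haar n) (stiefel_borel n m) (\<lambda>g. g * E)"
  have mq: "(\<lambda>v. q * v) \<in> stiefel_borel n m \<rightarrow>\<^sub>M stiefel_borel n m" if "q
      \<in> orth_group n" for q
    by (rule stiefel_mult_measurable[OF stiefel_const_measurable id]) (use that in \<open>simp add:
        orth_group_eq_stiefel\<close>)
  interpret H: prob_space "haar n" by (rule prob_space_haar)
  have \<sigma>e: "emeasure \<sigma> A = (\<integral>\<^sup>+g. indicator A (g * E) \<partial>haar n)"
      if "A \<in> sets (stiefel_borel n m)" for A
    unfolding \<sigma>_def using that nn_integral_distr[OF mE', of "indicator A"] by simp
  have p: "prob_space \<sigma>" unfolding \<sigma>_def by (rule H.prob_space_distr[OF mE'])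
  have s: "sets \<sigma> = sets (stiefel_borel n m)" by (simp add: \<sigma>_def)
  have inv: "distr \<sigma> \<sigma> (\<lambda>v. q * v) = \<sigma>" if q: "q \<in> orth_group n" for q
  proof (rule measure_eqI)
    fix A assume "A \<in> sets (distr \<sigma> \<sigma> (\<lambda>v. q * v))"
    then have A: "A \<in> sets (stiefel_borel n m)" using s by simp
    have mq': "(\<lambda>v. q * v) \<in> \<sigma> \<rightarrow>\<^sub>M \<sigma>" using mq[OF q] by
        (simp cong: measurable_cong_sets add: s)
    have iA: "indicator A \<in> borel_measurable (stiefel_borel n m)" using A by simp
    have "emeasure (distr \<sigma> \<sigma> (\<lambda>v. q * v)) A = (\<integral>\<^sup>+v. indicator A
        v \<partial>distr \<sigma> \<sigma> (\<lambda>v. q * v))"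
      using A s by simp
    also have "\<dots> = (\<integral>\<^sup>+v. indicator A (q * v) \<partial>\<sigma>)"
      by (rule nn_integral_distr[OF mq']) (use iA s in \<open>simp cong: measurable_cong_sets\<close>)
    also have "\<dots> = (\<integral>\<^sup>+g. indicator A (q * (g * E)) \<partial>haar n)"
      unfolding \<sigma>_def by (rule nn_integral_distr[OF mE']) (use measurable_compose[OF mq[OF q]
          iA] in simp)
    also have "\<dots> = (\<integral>\<^sup>+g. indicator A ((q * g) * E) \<partial>haar n)"
      by (intro nn_integral_cong arg_cong[where f = "indicator A"])
        (use q E orth_groupD(1) stiefelD(1) in \<open>auto simp: assoc_mult_mat[of _ n n _ n _ m]\<close>)
    also have "\<dots> = (\<integral>\<^sup>+g. indicator A (g * E) \<partial>haar n)"
      by (rule nn_integral_haar_left[OF measurable_compose[OF mE iA] q])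
    finally show "emeasure (distr \<sigma> \<sigma> (\<lambda>v. q * v)) A = emeasure \<sigma> A" using
        \<sigma>e[OF A] by simp
  qed simp
  have uniq: "\<mu> = \<sigma>" if \<mu>: "prob_space \<mu>" "sets \<mu> = sets (stiefel_borel n m)"
      "\<forall>g\<in>orth_group n. distr \<mu> \<mu> (\<lambda>v. g * v) = \<mu>" for \<mu>
  proof (rule measure_eqI)
    interpret M: prob_space \<mu> by (rule \<mu>(1))
    interpret P: pair_sigma_finite "haar n" \<mu> by standard
    fix A assume "A \<in> sets \<mu>"
    then have A: "A \<in> sets (stiefel_borel n m)" "A \<in> sets \<mu>" using \<mu>(2) by auto
    have iA: "indicator A \<in> borel_measurable (stiefel_borel n m)" using A by simp
    have sp: "space \<mu> = stiefel n m" using sets_eq_imp_space_eq[OF \<mu>(2)] by simp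
    have "(\<lambda>z. fst z * snd z) \<in> stiefel_borel n n \<Otimes>\<^sub>M stiefel_borel n m
        \<rightarrow>\<^sub>M stiefel_borel n m"
      by (rule stiefel_mult_measurable[OF measurable_fst measurable_snd])
    then have j: "(\<lambda>z. indicator A (fst z * snd z) :: ennreal) \<in> borel_measurable (haar n
        \<Otimes>\<^sub>M \<mu>)"
      using measurable_compose[OF _ iA]
      by (subst measurable_cong_sets[OF sets_pair_measure_cong[OF sets_haar \<mu>(2)] refl]) blast
    have gA: "(\<integral>\<^sup>+v. indicator A (g * v) \<partial>\<mu>) = emeasure \<mu> A" if g: "g
        \<in> orth_group n" for g
    proof -
      have mg: "(\<lambda>v. g * v) \<in> \<mu> \<rightarrow>\<^sub>M \<mu>" using mq[OF g] by (simp
          cong: measurable_cong_sets add: \<mu>(2))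
      have "emeasure \<mu> A = (\<integral>\<^sup>+v. indicator A v \<partial>distr \<mu> \<mu>
          (\<lambda>v. g * v))"
        using A \<mu>(3) g by simp
      also have "\<dots> = (\<integral>\<^sup>+v. indicator A (g * v) \<partial>\<mu>)"
        by (rule nn_integral_distr[OF mg]) (use A in simp)
      finally show ?thesis by simp
    qed
    have "emeasure \<mu> A = (\<integral>\<^sup>+g. emeasure \<mu> A \<partial>haar n)" using
        H.emeasure_space_1 by simp
    also have "\<dots> = (\<integral>\<^sup>+g. \<integral>\<^sup>+v. indicator A (g * v)
        \<partial>\<mu> \<partial>haar n)"
      by (intro nn_integral_cong) (simp add: gA)
    also have "\<dots> = (\<integral>\<^sup>+v. \<integral>\<^sup>+g. indicator A (g * v)
        \<partial>haar n \<partial>\<mu>)"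
      by (rule P.Fubini'[symmetric]) (use j in \<open>simp add: case_prod_beta'\<close>)
    also have "\<dots> = (\<integral>\<^sup>+v. emeasure \<sigma> A \<partial>\<mu>)"
    proof (rule nn_integral_cong)
      fix v assume "v \<in> space \<mu>"
      then have v: "v \<in> stiefel n m" using sp by simp
      obtain q where q: "q \<in> orth_group n" "q * E = v" using stiefel_transitive[OF E v mn] by auto
      have "(\<integral>\<^sup>+g. indicator A (g * v) \<partial>haar n) = (\<integral>\<^sup>+g.
          indicator A ((g * q) * E) \<partial>haar n)"
        by (intro nn_integral_cong arg_cong[where f = "indicator A"])
          (use q E orth_groupD(1) stiefelD(1) in \<open>auto simp: assoc_mult_mat[of _ n n _ n _ m]\<close>)
      also have "\<dots> = (\<integral>\<^sup>+g. indicator A (g * E) \<partial>haar n)"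
        by (rule nn_integral_haar_right[OF measurable_compose[OF mE iA] q(1)])
      finally show "(\<integral>\<^sup>+g. indicator A (g * v) \<partial>haar n) = emeasure \<sigma> A"
          using \<sigma>e[OF A(1)] by simp
    qed
    also have "\<dots> = emeasure \<sigma> A" by (simp add: M.emeasure_space_1)
    finally show "emeasure \<mu> A = emeasure \<sigma> A" .
  qed (use \<mu> s in simp)
  show ?thesis
    unfolding stiefel_measure_def \<sigma>_def[symmetric] stiefel_borel_def[symmetric]
  proof (rule the_equality)
    show "prob_space \<sigma> \<and> sets \<sigma> = sets (stiefel_borel n m) \<and>
        (\<forall>g\<in>orth_group n. distr \<sigma> \<sigma> (\<lambda>v. g * v) = \<sigma>)"
      using p s inv by blast
    fix \<mu> assume "prob_space \<mu> \<and> sets \<mu> = sets (stiefel_borel n m) \<and>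
        (\<forall>g\<in>orth_group n. distr \<mu> \<mu> (\<lambda>v. g * v) = \<mu>)"
    then show "\<mu> = \<sigma>" using uniq by blast
  qed
qed

subsection \<open>Disintegration of Lebesgue measure along the orthogonal group\<close>

lemma nn_integral_measurable_snd:
  assumes "sigma_finite_measure M" "(\<lambda>z. f (fst z) (snd z)) \<in> borel_measurable (N
      \<Otimes>\<^sub>M M)"
  shows "(\<lambda>x. \<integral>\<^sup>+y. f x y \<partial>M) \<in> borel_measurable N"
  using sigma_finite_measure.borel_measurable_nn_integral[OF assms(1), of f N] assms(2)
  by (simp add: case_prod_beta')

lemma sigma_finite_haar: "sigma_finite_measure (haar n)"
proof -
  interpret prob_space "haar n" by (rule prob_space_haar)
  show ?thesis by (rule sigma_finite_measure_axioms)
qed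

lemma measurable_haar_cong [simp]:
  "N \<rightarrow>\<^sub>M haar n = N \<rightarrow>\<^sub>M stiefel_borel n n" "haar n
      \<rightarrow>\<^sub>M N = stiefel_borel n n \<rightarrow>\<^sub>M N"
  "M \<Otimes>\<^sub>M haar n \<rightarrow>\<^sub>M N = M \<Otimes>\<^sub>M stiefel_borel n n
      \<rightarrow>\<^sub>M N"
  "lmat a b \<Otimes>\<^sub>M M' \<rightarrow>\<^sub>M N = mat_borel a b \<Otimes>\<^sub>M M'
      \<rightarrow>\<^sub>M N"
  "M \<Otimes>\<^sub>M lmat a b \<rightarrow>\<^sub>M N = M \<Otimes>\<^sub>M mat_borel a b
      \<rightarrow>\<^sub>M N"
  "haar n \<Otimes>\<^sub>M M' \<rightarrow>\<^sub>M N = stiefel_borel n n \<Otimes>\<^sub>M M'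
      \<rightarrow>\<^sub>M N"
  by (intro measurable_cong_sets sets_pair_measure_cong; simp)+

text \<open>The representative of the \<open>O(l + m)\<close>-orbit of the matrices with Gram matrix
    \<open>r\<close>.\<close>
definition canon :: "nat \<Rightarrow> nat \<Rightarrow> real mat \<Rightarrow> real mat" where
  "canon l m r = (0\<^sub>m l m @\<^sub>r 1\<^sub>m m) * msqrt m r"

lemma msqrt_carrier: "msqrt m r \<in> carrier_mat m m" by (simp add: msqrt_def)

lemma canon_carrier: "canon l m r \<in> carrier_mat (l + m) m"
  using stiefelD(1)[OF bot_frame_stiefel[of l m]] msqrt_carrier[of m r] by (auto simp: canon_def)

lemma canon_measurable: "F \<in> N \<rightarrow>\<^sub>M mat_borel m m \<Longrightarrow> (\<lambda>w.
    canon l m (F w)) \<in> N \<rightarrow>\<^sub>M mat_borel (l + m) m"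
  unfolding canon_def by (rule mat_left_mult_measurable[OF stiefelD(1)[OF bot_frame_stiefel] msqrt_measurable])

text \<open>The matrix q carries the bottom frame to the polar part v, and multiplication by the
  root s gives vs = x.\<close>

lemma orth_canon:
  assumes x: "x \<in> carrier_mat (l + m) m" and det: "det (transpose_mat x * x) \<noteq> 0"
    and q: "q \<in> orth_group (l + m)" "q * (0\<^sub>m l m @\<^sub>r 1\<^sub>m m) = polar_part (l + m) m x"
  shows "q * canon l m (transpose_mat x * x) = x"
proof -
  have "q * canon l m (transpose_mat x * x) = (q * (0\<^sub>m l m @\<^sub>r 1\<^sub>m m)) * msqrt m
      (transpose_mat x * x)"
    unfolding canon_def
    by (rule assoc_mult_mat[symmetric, OF orth_groupD(1)[OF q(1)] stiefelD(1)[OF bot_frame_stiefel]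
        msqrt_carrier])
  then show ?thesis using polar(2)[OF x det] msqrt_eq[OF x det] q(2) by simp
qed

lemma exists_canon:
  assumes x: "x \<in> carrier_mat (l + m) m" and det: "det (transpose_mat x * x) \<noteq> 0"
  obtains q where "q \<in> orth_group (l + m)" "q * (0\<^sub>m l m @\<^sub>r 1\<^sub>m m) = polar_part
      (l + m) m x"
    "q * canon l m (transpose_mat x * x) = x"
proof -
  obtain q where "q \<in> orth_group (l + m)" "q * (0\<^sub>m l m @\<^sub>r 1\<^sub>m m) = polar_part
      (l + m) m x"
    using stiefel_transitive[OF bot_frame_stiefel polar(1)[OF x det]] by auto
  then show ?thesis using that orth_canon[OF x det] by blast
qed

section \<open>A measurable choice of frames\<close>

text \<open>On this set, of full measure, \<open>frame0\<close> really completes the polar part.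
  Invertibility of the bottom block is what makes the projected unit vectors in
  \<open>compl_cols\<close> independent.\<close>

definition generic :: "nat \<Rightarrow> nat \<Rightarrow> real mat \<Rightarrow> bool" where
  "generic l m x \<longleftrightarrow> det (transpose_mat x * x) \<noteq> 0 \<and> det (bot_rows l m
      (polar0 (l + m) m x)) \<noteq> 0"

text \<open>A measurable choice of the orthogonal matrix \<open>g_v\<close> for the polar part
    \<open>v\<close> of \<open>x\<close>; it has the junk value
  1 on the null set where the bottom block of \<open>v\<close> is singular.\<close>
definition frame0 :: "nat \<Rightarrow> nat \<Rightarrow> real mat \<Rightarrow> real mat" where
  "frame0 l m x = (let v = polar0 (l + m) m x in
     if det (bot_rows l m v) = 0 then 1\<^sub>m (l + m)
     else append_cols (polar0 (l + m) l (compl_cols l m v)) v)"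

lemma bot_rows_measurable:
  assumes "F \<in> N \<rightarrow>\<^sub>M mat_borel (l + m) m"
  shows "(\<lambda>w. bot_rows l m (F w)) \<in> N \<rightarrow>\<^sub>M mat_borel m m"
proof (rule mat_borelI)
  fix i j assume "i < m" "j < m"
  then show "(\<lambda>w. bot_rows l m (F w) $$ (i,j)) \<in> borel_measurable N"
    using mat_borel_entry[OF assms, of "l + i" j] by (simp add: bot_rows_def)
qed (simp add: bot_rows_def)

lemma frame0_polar:
  assumes "det (bot_rows l m (polar0 (l + m) m x)) \<noteq> 0" "x \<in> carrier_mat (l + m) m"
  shows "frame0 l m x = frame_of l m (polar0 (l + m) m x)"
  using compl_cols[OF polar0_stiefel assms(1)] assms by (simp add: frame0_def frame_of_def polar0_eq Let_def)

lemma frame0_orth: "x \<in> carrier_mat (l + m) m \<Longrightarrow> frame0 l m x \<in> orth_group (l + m)"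
proof (cases "det (bot_rows l m (polar0 (l + m) m x)) = 0")
  case False
  assume "x \<in> carrier_mat (l + m) m"
  then show ?thesis using frame0_polar[OF False] frame_of(1)[OF polar0_stiefel False] by simp
qed (simp add: frame0_def orth_group_one)

lemma frame0_generic:
  assumes "generic l m x" "x \<in> carrier_mat (l + m) m"
  shows "frame0 l m x * (0\<^sub>m l m @\<^sub>r 1\<^sub>m m) = polar_part (l + m) m x"
  using frame0_polar[of l m x] frame_of(2)[OF polar0_stiefel, of x l m] assms polar0_eq by (auto simp:
      generic_def)

lemma frame0_measurable:
  assumes F: "F \<in> N \<rightarrow>\<^sub>M mat_borel (l + m) m"
  shows "(\<lambda>w. frame0 l m (F w)) \<in> N \<rightarrow>\<^sub>M stiefel_borel (l + m) (l + m)"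
proof (rule stiefel_borelI)
  let ?v = "\<lambda>w. polar0 (l + m) m (F w)"
  have v: "?v \<in> N \<rightarrow>\<^sub>M mat_borel (l + m) m" by (rule stiefel_borelD[OF
      polar0_measurable[OF F]]) simp
  have b: "{w \<in> space N. det (bot_rows l m (?v w)) = 0} \<in> sets N"
    using mat_det_measurable[OF bot_rows_measurable[OF v]] by measurable
  have C: "1\<^sub>m l @\<^sub>r (0\<^sub>m m l :: real mat) \<in> carrier_mat (l + m) l" by (rule
      stiefelD(1)[OF top_frame_stiefel])
  have k: "(\<lambda>w. compl_cols l m (?v w)) \<in> N \<rightarrow>\<^sub>M mat_borel (l + m) l"
    unfolding compl_cols_def
    by (rule mat_minus_measurable[OF mat_const_measurable[OF C] mat_mult_measurable[OF v
        mat_mult_measurable[OF mat_transpose_measurable[OF v] mat_const_measurable[OF C]]]])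
  show "(\<lambda>w. frame0 l m (F w)) \<in> N \<rightarrow>\<^sub>M mat_borel (l + m) (l + m)"
    unfolding frame0_def Let_def
    by (rule measurable_If[OF mat_const_measurable append_cols_measurable[OF stiefel_borelD[OF
        polar0_measurable[OF k]] v] b]) auto
qed (use frame0_orth mat_borel_carrier[OF F] in \<open>auto simp: orth_group_eq_stiefel\<close>)

lemma generic_sets: "{x \<in> carrier_mat (l + m) m. generic l m x} \<in> sets (mat_borel (l + m) m)"
proof -
  note id = measurable_ident_sets[OF refl]
  have v: "polar0 (l + m) m \<in> mat_borel (l + m) m \<rightarrow>\<^sub>M mat_borel (l + m) m"
    using stiefel_borelD[OF polar0_measurable[OF id]] by simp
  have "{x \<in> space (mat_borel (l + m) m). det (transpose_mat x * x) \<noteq> 0 \<and> det (bot_rows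
      l m (polar0 (l + m) m x)) \<noteq> 0} \<in> sets (mat_borel (l + m) m)"
    using mat_det_measurable[OF bot_rows_measurable[OF v]] mat_det_measurable[OF gram_measurable[OF
        id], of "l + m" m] by measurable
  then show ?thesis by (simp add: generic_def)
qed

text \<open>For fixed upper rows the bottom block of x is a Lebesgue distributed m x m matrix, hence
  invertible almost everywhere. It equals the bottom block of the polar part times the square root,
  so the latter block is invertible too.\<close>

lemma AE_generic: "AE x in lmat (l + m) m. generic l m x"
proof -
  note id = measurable_ident_sets[OF refl]
  let ?Z = "{x \<in> carrier_mat (l + m) m. det (bot_rows l m x) = 0}"
  have "{x \<in> space (mat_borel (l + m) m). det (bot_rows l m x) = 0} \<in> sets (mat_borel (l + m) m)"
    using mat_det_measurable[OF bot_rows_measurable[OF id], of l m] by measurable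
  then have Z: "?Z \<in> sets (mat_borel (l + m) m)" by simp
  have "emeasure (lmat (l + m) m) ?Z = (\<integral>\<^sup>+x. indicator ?Z x \<partial>lmat (l + m) m)"
      using Z by simp
  also have "\<dots> = (\<integral>\<^sup>+x. \<integral>\<^sup>+y. indicator ?Z (x @\<^sub>r y)
      \<partial>lmat m m \<partial>lmat l m)"
    by (rule nn_integral_append_rows) (use Z in simp)
  also have "\<dots> = (\<integral>\<^sup>+x. 0 \<partial>lmat l m)"
  proof (rule nn_integral_cong)
    fix x assume "x \<in> space (lmat l m)"
    then have x: "x \<in> carrier_mat l m" by simp
    have "(\<integral>\<^sup>+y. indicator ?Z (x @\<^sub>r y) \<partial>lmat m m) =
        (\<integral>\<^sup>+y. 0 \<partial>lmat m m)"
    proof (rule nn_integral_cong_AE)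
      show "AE y in lmat m m. (indicator ?Z (x @\<^sub>r y) :: ennreal) = 0"
        using AE_det_gram[OF order_refl, of m] AE_space
      proof eventually_elim
        case (elim y)
        then have y: "y \<in> carrier_mat m m" by simp
        have "bot_rows l m (x @\<^sub>r y) = y"
          using y by (intro eq_matI) (auto simp: bot_rows_def append_rows_index[OF x y])
        moreover have "det y \<noteq> 0" using elim(1) y det_mult[of "transpose_mat y" m y] by auto
        ultimately show ?case by simp
      qed
    qed
    then show "(\<integral>\<^sup>+y. indicator ?Z (x @\<^sub>r y) \<partial>lmat m m) = 0" by simp
  qed
  finally have "?Z \<in> null_sets (lmat (l + m) m)" using Z by (auto simp: null_sets_def)
  from AE_not_in[OF this] AE_det_gram[of m "l + m", OF le_add2] AE_space show ?thesis
  proof eventually_elim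
    case (elim x)
    then have x: "x \<in> carrier_mat (l + m) m" by simp
    define s where "s = mat_sqrt m (transpose_mat x * x)"
    have s: "s \<in> carrier_mat m m" using mat_sqrt_carrier[OF x elim(2)] by (simp add: s_def)
    note p = polar[OF x elim(2), folded s_def]
    have B: "bot_rows l m (polar_part (l + m) m x) \<in> carrier_mat m m" by (simp add: bot_rows_def)
    have "bot_rows l m x = bot_rows l m (polar_part (l + m) m x) * s"
    proof (rule eq_matI)
      fix i j assume "i < dim_row (bot_rows l m (polar_part (l + m) m x) * s)" "j < dim_col (bot_rows l
          m (polar_part (l + m) m x) * s)"
      then have ij: "i < m" "j < m" using s by (auto simp: bot_rows_def)
      have "bot_rows l m x $$ (i,j) = (polar_part (l + m) m x * s) $$ (l + i, j)"
        using p(2) ij by (simp add: bot_rows_def)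
      also have "\<dots> = (bot_rows l m (polar_part (l + m) m x) * s) $$ (i,j)"
        using ij mult_mat_index[OF stiefelD(1)[OF p(1)] s, of "l + i" j] mult_mat_index[OF B s ij]
        by (simp add: bot_rows_def del: index_mult_mat(1))
      finally show "bot_rows l m x $$ (i,j) = (bot_rows l m (polar_part (l + m) m x) * s) $$ (i,j)" .
    qed (use s in \<open>auto simp: bot_rows_def\<close>)
    moreover have "det (bot_rows l m x) \<noteq> 0" using elim(1) x by simp
    ultimately have "det (bot_rows l m (polar_part (l + m) m x)) \<noteq> 0"
      using det_mult[OF B s] by auto
    then show ?case using elim(2) polar0_eq[OF x elim(2)] by (simp add: generic_def)
  qed
qed

lemma block_orth_measurable:
  assumes "F \<in> N \<rightarrow>\<^sub>M stiefel_borel l l"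
  shows "(\<lambda>w. block_orth l (F w) m) \<in> N \<rightarrow>\<^sub>M stiefel_borel (l + m) (l + m)"
proof (rule stiefel_borelI)
  have F: "F \<in> N \<rightarrow>\<^sub>M mat_borel l l" by (rule stiefel_borelD[OF assms])
  note c = mat_borel_carrier[OF F]
  show "(\<lambda>w. block_orth l (F w) m) \<in> N \<rightarrow>\<^sub>M mat_borel (l + m) (l + m)"
  proof (rule mat_borelI)
    show "block_orth l (F w) m \<in> carrier_mat (l + m) (l + m)" if "w \<in> space N" for w
      by (rule block_orth_carrier[OF c[OF that]])
    fix i j assume ij: "i < l + m" "j < l + m"
    have "(\<lambda>w. if i < l \<and> j < l then F w $$ (i,j) else if i = j then 1 else 0) \<in>
        borel_measurable N"
      using mat_borel_entry[OF F, of i j] by (cases "i < l \<and> j < l") auto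
    then show "(\<lambda>w. block_orth l (F w) m $$ (i,j)) \<in> borel_measurable N"
    proof (rule measurable_cong[THEN iffD1, rotated])
      fix w assume w: "w \<in> space N"
      show "(if i < l \<and> j < l then F w $$ (i,j) else if i = j then 1 else 0) = block_orth l (F w)
          m $$ (i,j)"
        using ij c[OF w] by (auto simp: block_orth_def)
    qed
  qed
  show "block_orth l (F w) m \<in> stiefel (l + m) (l + m)" if "w \<in> space N" for w
    using measurable_space[OF assms that] block_orth_orth by (simp add: orth_group_eq_stiefel)
qed

section \<open>Averaging over the orthogonal group\<close>

context
  fixes l m k :: nat and E0 :: "real mat" and G :: "real mat \<Rightarrow> real mat \<Rightarrow> ennreal"
  assumes E0: "E0 \<in> stiefel (l + m) k"
    and G: "(\<lambda>z. G (fst z) (snd z)) \<in> borel_measurable (stiefel_borel (l + m) k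
        \<Otimes>\<^sub>M mat_borel (l + m) m)"
begin

lemma G_measurable:
  assumes "U \<in> N \<rightarrow>\<^sub>M stiefel_borel (l + m) k" "X \<in> N \<rightarrow>\<^sub>M
      mat_borel (l + m) m"
  shows "(\<lambda>w. G (U w) (X w)) \<in> borel_measurable N"
  using measurable_compose[OF measurable_Pair[OF assms] G] by simp

text \<open>Write x = qc with c the canonical representative. When gx is generic,
  \<open>frame0 l m (g * x)\<close> and \<open>g * q\<close> share their last m columns, hence
  differ by some diag(h0, 1), which left invariance of Haar measure on O(l) absorbs. After
  exchanging the integrals, q diag(h, 1) is a single orthogonal matrix that still sends c to x, and
  right invariance on O(l + m) removes it.\<close>

lemma fibre_average:
  assumes x: "x \<in> carrier_mat (l + m) m" and det: "det (transpose_mat x * x) \<noteq> 0"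
    and ae: "AE g in haar (l + m). generic l m (g * x)"
  shows "(\<integral>\<^sup>+g. \<integral>\<^sup>+h. G (frame0 l m (g * x) * (block_orth l h m * E0))
      (g * x) \<partial>haar l \<partial>haar (l + m)) =
    (\<integral>\<^sup>+g. G (g * E0) (g * canon l m (transpose_mat x * x)) \<partial>haar (l + m))"
proof -
  note id = measurable_ident_sets[OF refl]
  let ?n = "l + m" and ?e = "0\<^sub>m l m @\<^sub>r (1\<^sub>m m :: real mat)"
  note E = stiefelD(1)[OF E0]
  have e: "?e \<in> carrier_mat ?n m" by (rule stiefelD(1)[OF bot_frame_stiefel])
  obtain q where q: "q \<in> orth_group ?n" "q * ?e = polar_part ?n m x" "q * canon l m (transpose_mat
      x * x) = x"
    by (rule exists_canon[OF x det])
  note qc = orth_groupD(1)[OF q(1)]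
  interpret HL: prob_space "haar l" by (rule prob_space_haar)
  interpret HN: prob_space "haar ?n" by (rule prob_space_haar)
  interpret P: pair_sigma_finite "haar l" "haar ?n" by standard
  have "(\<integral>\<^sup>+g. \<integral>\<^sup>+h. G (frame0 l m (g * x) * (block_orth l h m * E0))
      (g * x) \<partial>haar l \<partial>haar ?n) =
    (\<integral>\<^sup>+g. \<integral>\<^sup>+h. G (g * (q * (block_orth l h m * E0))) (g * x)
        \<partial>haar l \<partial>haar ?n)"
  proof (rule nn_integral_cong_AE)
    show "AE g in haar ?n. (\<integral>\<^sup>+h. G (frame0 l m (g * x) * (block_orth l h m * E0)) (g *
        x) \<partial>haar l) =
        (\<integral>\<^sup>+h. G (g * (q * (block_orth l h m * E0))) (g * x) \<partial>haar l)"
      using ae AE_space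
    proof eventually_elim
      case (elim g)
      then have g: "g \<in> orth_group ?n" by simp
      note gc = orth_groupD(1)[OF g]
      have gx: "g * x \<in> carrier_mat ?n m" using gc x by auto
      have f: "frame0 l m (g * x) \<in> orth_group ?n" by (rule frame0_orth[OF gx])
      have gq: "g * q \<in> orth_group ?n" by (rule orth_group_mult[OF g q(1)])
      have "frame0 l m (g * x) * ?e = g * polar_part ?n m x"
        using frame0_generic[OF elim(1) gx] polar_orth_left[OF x det g] by simp
      also have "\<dots> = (g * q) * ?e" using q(2) gc qc e by (simp add: assoc_mult_mat[of _ ?n ?n _ ?n _ m])
      finally obtain h0 where h0: "h0 \<in> orth_group l" "frame0 l m (g * x) = (g * q) * block_orth l h0 m"
        using orth_same_last_cols[OF f gq] by auto
      note h0c = orth_groupD(1)[OF h0(1)]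
      define \<Phi> where "\<Phi> h = G (g * (q * (block_orth l h m * E0))) (g * x)" for h
      have \<Phi>: "\<Phi> \<in> borel_measurable (stiefel_borel l l)"
        unfolding \<Phi>_def
        by (rule G_measurable[OF stiefel_mult_measurable[OF stiefel_const_measurable
            stiefel_mult_measurable[OF stiefel_const_measurable stiefel_mult_measurable[OF
            block_orth_measurable[OF id] stiefel_const_measurable[OF E0]]]] mat_const_measurable[OF gx]])
          (use g q(1) in \<open>auto simp: orth_group_eq_stiefel\<close>)
      have "(\<integral>\<^sup>+h. G (frame0 l m (g * x) * (block_orth l h m * E0)) (g * x)
          \<partial>haar l) = (\<integral>\<^sup>+h. \<Phi> (h0 * h) \<partial>haar l)"
      proof (rule nn_integral_cong)
        fix h assume "h \<in> space (haar l)"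
        then have hc: "h \<in> carrier_mat l l" using orth_groupD(1) by auto
        note b = block_orth_carrier[OF hc, of m] block_orth_carrier[OF h0c, of m]
        have "frame0 l m (g * x) * (block_orth l h m * E0) = g * (q * ((block_orth l h0 m * block_orth
            l h m) * E0))"
          unfolding h0(2) using gc qc b E by (simp add: assoc_mult_mat[of _ ?n ?n _ ?n _ k]
              assoc_mult_mat[of _ ?n ?n _ ?n _ ?n])
        then show "G (frame0 l m (g * x) * (block_orth l h m * E0)) (g * x) = \<Phi> (h0 * h)"
          by (simp add: \<Phi>_def block_orth_mult[OF h0c hc])
      qed
      also have "\<dots> = (\<integral>\<^sup>+h. \<Phi> h \<partial>haar l)" by (rule
          nn_integral_haar_left[OF \<Phi> h0(1)])
      finally show ?case by (simp add: \<Phi>_def)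
    qed
  qed
  also have "\<dots> = (\<integral>\<^sup>+h. \<integral>\<^sup>+g. G (g * (q * (block_orth l h m *
      E0))) (g * x) \<partial>haar ?n \<partial>haar l)"
  proof (rule P.Fubini')
    have "(\<lambda>z. G (snd z * (q * (block_orth l (fst z) m * E0))) (snd z * x)) \<in>
        borel_measurable (stiefel_borel l l \<Otimes>\<^sub>M stiefel_borel ?n ?n)"
      by (rule G_measurable[OF stiefel_mult_measurable[OF measurable_snd stiefel_mult_measurable[OF
          stiefel_const_measurable stiefel_mult_measurable[OF block_orth_measurable[OF measurable_fst]
          stiefel_const_measurable[OF E0]]]]
          mat_mult_measurable[OF stiefel_borelD[OF measurable_snd] mat_const_measurable[OF x]]])
        (use q(1) in \<open>simp add: orth_group_eq_stiefel\<close>)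
    then show "case_prod (\<lambda>h g. G (g * (q * (block_orth l h m * E0))) (g * x)) \<in>
        borel_measurable (haar l \<Otimes>\<^sub>M haar ?n)"
      by (simp add: case_prod_beta')
  qed
  also have "\<dots> = (\<integral>\<^sup>+h. \<integral>\<^sup>+g. G (g * E0) (g * canon l m
      (transpose_mat x * x)) \<partial>haar ?n \<partial>haar l)"
  proof (rule nn_integral_cong)
    fix h assume "h \<in> space (haar l)"
    then have h: "h \<in> orth_group l" by simp
    note b = block_orth_orth[OF h, of m]
    note bc = orth_groupD(1)[OF b]
    define p where "p = q * block_orth l h m"
    have p: "p \<in> orth_group ?n" unfolding p_def by (rule orth_group_mult[OF q(1) b])
    note pc = orth_groupD(1)[OF p]
    define c where "c = canon l m (transpose_mat x * x)"
    have c: "c \<in> carrier_mat ?n m" unfolding c_def by (rule canon_carrier)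
    \<comment> \<open>diag(h, 1) acts on the first l rows only, and these vanish in the canonical
      representative.\<close>
    have "block_orth l h m * c = c"
      unfolding c_def canon_def using bc e msqrt_carrier[of m]
      by (subst assoc_mult_mat[symmetric, of _ ?n ?n _ m _ m])
        (use orth_groupD(1)[OF h] in \<open>auto simp: block_orth_rows[OF orth_groupD(1)[OF h], of
            "0\<^sub>m l m" m "1\<^sub>m m"]\<close>)
    then have pcx: "p * c = x" using q(3) qc bc c by (simp add: p_def c_def[symmetric]
        assoc_mult_mat[of _ ?n ?n _ ?n _ m])
    define \<Phi> where "\<Phi> g = G (g * E0) (g * c)" for g
    have \<Phi>: "\<Phi> \<in> borel_measurable (stiefel_borel ?n ?n)"
      unfolding \<Phi>_def
      by (rule G_measurable[OF stiefel_mult_measurable[OF id stiefel_const_measurable[OF E0]]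
          mat_mult_measurable[OF stiefel_borelD[OF id] mat_const_measurable[OF c]]])
    have "(\<integral>\<^sup>+g. G (g * (q * (block_orth l h m * E0))) (g * x) \<partial>haar ?n) =
        (\<integral>\<^sup>+g. \<Phi> (g * p) \<partial>haar ?n)"
    proof (rule nn_integral_cong)
      fix g assume "g \<in> space (haar ?n)"
      then have gc: "g \<in> carrier_mat ?n ?n" using orth_groupD(1) by auto
      have "g * p * c = g * x" using pcx gc pc c by (simp add: assoc_mult_mat[of _ ?n ?n _ ?n _ m])
      moreover have "g * p * E0 = g * (q * (block_orth l h m * E0))"
        unfolding p_def using gc qc bc E by (simp add: assoc_mult_mat[of _ ?n ?n _ ?n _ k]
            assoc_mult_mat[of _ ?n ?n _ ?n _ ?n])
      ultimately show "G (g * (q * (block_orth l h m * E0))) (g * x) = \<Phi> (g * p)" by (simp add: \<Phi>_def)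
    qed
    also have "\<dots> = (\<integral>\<^sup>+g. \<Phi> g \<partial>haar ?n)" by (rule
        nn_integral_haar_right[OF \<Phi> p])
    finally show "(\<integral>\<^sup>+g. G (g * (q * (block_orth l h m * E0))) (g * x) \<partial>haar ?n) =
        (\<integral>\<^sup>+g. G (g * E0) (g * canon l m (transpose_mat x * x)) \<partial>haar ?n)" by
            (simp add: \<Phi>_def c_def)
  qed
  also have "\<dots> = (\<integral>\<^sup>+g. G (g * E0) (g * canon l m (transpose_mat x * x))
      \<partial>haar ?n)"
    using HL.emeasure_space_1 by simp
  finally show ?thesis .
qed

text \<open>Rotations preserve null sets, so for every g almost every x has gx generic; Fubini's
  theorem turns this into almost every g for almost every x, the form required when x is fixed and g
  is averaged.\<close>

lemma AE_good_orth:
  "AE x in lmat (l + m) m. AE g in haar (l + m). generic l m (g * x)"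
proof -
  note id = measurable_ident_sets[OF refl]
  let ?n = "l + m"
  interpret LM: sigma_finite_measure "lmat ?n m" by (rule sigma_finite_lmat)
  interpret HN: prob_space "haar ?n" by (rule prob_space_haar)
  interpret P: pair_sigma_finite "haar ?n" "lmat ?n m" by standard
  let ?B = "{x \<in> carrier_mat ?n m. \<not> generic l m x}"
  have "?B = space (mat_borel ?n m) - {x \<in> carrier_mat ?n m. generic l m x}" by auto
  then have B: "?B \<in> sets (mat_borel ?n m)" using generic_sets by (metis sets.compl_sets)
  have B0: "emeasure (lmat ?n m) ?B = 0"
    using AE_generic[of l m] B AE_iff_measurable[of ?B "lmat ?n m" "generic l m"] by simp
  have mm: "(\<lambda>z. fst z * snd z) \<in> stiefel_borel ?n ?n \<Otimes>\<^sub>M mat_borel ?n m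
      \<rightarrow>\<^sub>M mat_borel ?n m"
    by (rule mat_mult_measurable[OF stiefel_borelD[OF measurable_fst] measurable_snd])
  have iB: "indicator ?B \<in> borel_measurable (mat_borel ?n m)" using B by simp
  have j: "(\<lambda>z. indicator ?B (fst z * snd z) :: ennreal) \<in> borel_measurable (stiefel_borel
      ?n ?n \<Otimes>\<^sub>M mat_borel ?n m)"
    by (rule measurable_compose[OF mm iB])
  have "(\<integral>\<^sup>+x. \<integral>\<^sup>+g. indicator ?B (g * x) \<partial>haar ?n
      \<partial>lmat ?n m) = (\<integral>\<^sup>+g. \<integral>\<^sup>+x. indicator ?B (g * x)
      \<partial>lmat ?n m \<partial>haar ?n)"
    by (rule P.Fubini') (use j in \<open>simp add: case_prod_beta'\<close>)
  also have "\<dots> = (\<integral>\<^sup>+g. 0 \<partial>haar ?n)"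
  proof (rule nn_integral_cong)
    fix g assume "g \<in> space (haar ?n)"
    then have "(\<integral>\<^sup>+x. indicator ?B (g * x) \<partial>lmat ?n m) =
        (\<integral>\<^sup>+x. indicator ?B x \<partial>lmat ?n m)"
      using nn_integral_lmat_orth[of g ?n "indicator ?B" m] iB by simp
    then show "(\<integral>\<^sup>+x. indicator ?B (g * x) \<partial>lmat ?n m) = 0" using B B0 by simp
  qed
  finally have z: "(\<integral>\<^sup>+x. \<integral>\<^sup>+g. indicator ?B (g * x) \<partial>haar ?n
      \<partial>lmat ?n m) = 0" by simp
  have mx: "(\<lambda>x. \<integral>\<^sup>+g. indicator ?B (g * x) \<partial>haar ?n) \<in>
      borel_measurable (lmat ?n m)"
    by (simp, rule nn_integral_measurable_snd[OF sigma_finite_haar])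
      (simp, rule measurable_compose[OF mat_mult_measurable[OF stiefel_borelD[OF measurable_snd]
          measurable_fst] iB])
  have "AE x in lmat ?n m. (\<integral>\<^sup>+g. indicator ?B (g * x) \<partial>haar ?n) = 0"
    using z nn_integral_0_iff_AE[OF mx] by simp
  then show ?thesis
    using AE_space
  proof eventually_elim
    case (elim x)
    then have x: "x \<in> carrier_mat ?n m" by simp
    have mg: "(\<lambda>g. indicator ?B (g * x) :: ennreal) \<in> borel_measurable (haar ?n)"
      using measurable_compose[OF mat_mult_measurable[OF stiefel_borelD[OF id] mat_const_measurable[OF
          x]] iB] by simp
    have "AE g in haar ?n. (indicator ?B (g * x) :: ennreal) = 0"
      using elim(1) nn_integral_0_iff_AE[OF mg] by simp
    then show ?case using AE_space
      by eventually_elim (use x orth_groupD(1) in \<open>force simp: indicator_def split: if_splits\<close>)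
  qed
qed

text \<open>Lebesgue measure and \<open>D\<close> at the Gram matrix are unchanged by rotations, so
  x may be replaced by gx and the result averaged over g; then \<open>fibre_average\<close> applies
  for almost every x. The new integrand depends on x through its Gram matrix alone, as
  \<open>nn_integral_gram_weight\<close> requires.\<close>

theorem nn_integral_frame:
  assumes D: "D \<in> borel_measurable (mat_borel m m)"
  shows "(\<integral>\<^sup>+x. D (transpose_mat x * x) * (\<integral>\<^sup>+h. G (frame0 l m x *
      (block_orth l h m * E0)) x \<partial>haar l) \<partial>lmat (l + m) m) =
    (\<integral>\<^sup>+x. D (transpose_mat x * x) * (\<integral>\<^sup>+g. G (g * E0) (g * canon l m
        (transpose_mat x * x)) \<partial>haar (l + m)) \<partial>lmat (l + m) m)"
proof -
  note id = measurable_ident_sets[OF refl]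
  let ?n = "l + m"
  interpret LM: sigma_finite_measure "lmat ?n m" by (rule sigma_finite_lmat)
  interpret HN: prob_space "haar ?n" by (rule prob_space_haar)
  interpret P: pair_sigma_finite "haar ?n" "lmat ?n m" by standard
  define K where "K x = (\<integral>\<^sup>+h. G (frame0 l m x * (block_orth l h m * E0)) x
      \<partial>haar l)" for x
  have K: "K \<in> borel_measurable (mat_borel ?n m)"
    unfolding K_def
    by (rule nn_integral_measurable_snd[OF sigma_finite_haar])
      (simp, rule G_measurable[OF stiefel_mult_measurable[OF frame0_measurable[OF measurable_fst]
          stiefel_mult_measurable[OF block_orth_measurable[OF measurable_snd]
          stiefel_const_measurable[OF E0]]] measurable_fst])
  have Dg: "(\<lambda>x. D (transpose_mat x * x)) \<in> borel_measurable (mat_borel ?n m)"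
    by (rule measurable_compose[OF gram_measurable[OF id] D])
  have DK: "(\<lambda>x. D (transpose_mat x * x) * K x) \<in> borel_measurable (mat_borel ?n m)"
    by (intro borel_measurable_times_ennreal Dg K)
  have mm: "(\<lambda>z. fst z * snd z) \<in> stiefel_borel ?n ?n \<Otimes>\<^sub>M mat_borel ?n m
      \<rightarrow>\<^sub>M mat_borel ?n m"
    by (rule mat_mult_measurable[OF stiefel_borelD[OF measurable_fst] measurable_snd])
  have "(\<integral>\<^sup>+x. D (transpose_mat x * x) * K x \<partial>lmat ?n m) =
      (\<integral>\<^sup>+g. (\<integral>\<^sup>+x. D (transpose_mat x * x) * K x \<partial>lmat ?n m)
      \<partial>haar ?n)"
    using HN.emeasure_space_1 by simp
  also have "\<dots> = (\<integral>\<^sup>+g. \<integral>\<^sup>+x. D (transpose_mat x * x) * K (g * x)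
      \<partial>lmat ?n m \<partial>haar ?n)"
  proof (rule nn_integral_cong)
    fix g assume "g \<in> space (haar ?n)"
    then have g: "g \<in> orth_group ?n" by simp
    have "(\<integral>\<^sup>+x. D (transpose_mat x * x) * K x \<partial>lmat ?n m) =
        (\<integral>\<^sup>+x. D (transpose_mat (g * x) * (g * x)) * K (g * x) \<partial>lmat ?n m)"
      by (rule nn_integral_lmat_orth[OF g DK, symmetric])
    also have "\<dots> = (\<integral>\<^sup>+x. D (transpose_mat x * x) * K (g * x) \<partial>lmat ?n m)"
      by (rule nn_integral_cong) (use gram_orth_mult[OF g] in auto)
    finally show "(\<integral>\<^sup>+x. D (transpose_mat x * x) * K x \<partial>lmat ?n m) =
        (\<integral>\<^sup>+x. D (transpose_mat x * x) * K (g * x) \<partial>lmat ?n m)" .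
  qed
  also have "\<dots> = (\<integral>\<^sup>+x. \<integral>\<^sup>+g. D (transpose_mat x * x) * K (g * x)
      \<partial>haar ?n \<partial>lmat ?n m)"
    by (rule P.Fubini'[symmetric])
      (simp add: case_prod_beta' borel_measurable_times_ennreal measurable_compose[OF measurable_snd
          Dg] measurable_compose[OF mm K])
  also have "\<dots> = (\<integral>\<^sup>+x. D (transpose_mat x * x) * (\<integral>\<^sup>+g. G (g *
      E0) (g * canon l m (transpose_mat x * x)) \<partial>haar ?n) \<partial>lmat ?n m)"
  proof (rule nn_integral_cong_AE)
    show "AE x in lmat ?n m. (\<integral>\<^sup>+g. D (transpose_mat x * x) * K (g * x) \<partial>haar ?n) =
        D (transpose_mat x * x) * (\<integral>\<^sup>+g. G (g * E0) (g * canon l m (transpose_mat x *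
            x)) \<partial>haar ?n)"
      using AE_good_orth AE_det_gram[of m ?n, OF le_add2] AE_space
    proof eventually_elim
      case (elim x)
      then have x: "x \<in> carrier_mat ?n m" by simp
      have "(\<integral>\<^sup>+g. D (transpose_mat x * x) * K (g * x) \<partial>haar ?n) = D
          (transpose_mat x * x) * (\<integral>\<^sup>+g. K (g * x) \<partial>haar ?n)"
        using measurable_compose[OF mat_mult_measurable[OF stiefel_borelD[OF id] mat_const_measurable[OF x]] K]
        by (intro nn_integral_cmult) simp
      then show ?case unfolding K_def fibre_average[OF x elim(2,1)] .
    qed
  qed
  finally show ?thesis unfolding K_def .
qed

end

section \<open>Matrices orthogonal to a frame, and matrices in its span\<close>

text \<open>The leading zero rows make the representative orthogonal to the frame of the first k
  unit vectors.\<close>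

lemma canon_append: "canon (k + p) m r = 0\<^sub>m k m @\<^sub>r canon p m r"
proof -
  note s = msqrt_carrier[of m r]
  have e: "0\<^sub>m (a::nat) m @\<^sub>r (1\<^sub>m m :: real mat) \<in> carrier_mat (a + m) m" for a
    by (rule stiefelD(1)[OF bot_frame_stiefel])
  have "canon a m r = 0\<^sub>m a m @\<^sub>r msqrt m r" for a
    unfolding canon_def using s by (subst append_rows_mult_right[of _ a m _ m _ m]) auto
  moreover have "0\<^sub>m (k + p) m @\<^sub>r msqrt m r = 0\<^sub>m k m @\<^sub>r (0\<^sub>m p m
      @\<^sub>r msqrt m r)"
    using s by (intro eq_matI) (auto simp: append_rows_def)
  ultimately show ?thesis by simp
qed

text \<open>Fixes the frame of the first k unit vectors and rotates its orthogonal
  complement.\<close>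

definition lower_orth :: "nat \<Rightarrow> nat \<Rightarrow> real mat \<Rightarrow> real mat" where
  "lower_orth k N q = four_block_mat (1\<^sub>m k) (0\<^sub>m k N) (0\<^sub>m N k) q"

lemma lower_orth_orth:
  assumes "q \<in> orth_group N"
  shows "lower_orth k N q \<in> orth_group (k + N)"
proof -
  note q = orth_groupD[OF assms]
  have c: "lower_orth k N q \<in> carrier_mat (k + N) (k + N)" using q by (simp add: lower_orth_def)
  have "transpose_mat (lower_orth k N q) = four_block_mat (1\<^sub>m k) (0\<^sub>m k N) (0\<^sub>m N k)
      (transpose_mat q)"
    using q by (simp add: lower_orth_def transpose_four_block_mat[of _ k k _ N _ N])
  then have "transpose_mat (lower_orth k N q) * lower_orth k N q = 1\<^sub>m (k + N)"
    using q mult_four_block_mat[of "1\<^sub>m k" k k "0\<^sub>m k N" N "0\<^sub>m N k" N "transpose_mat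
        q" "1\<^sub>m k" k "0\<^sub>m k N" N "0\<^sub>m N k" q]
    by (simp add: lower_orth_def)
  then show ?thesis using c by (simp add: orth_group_def)
qed

lemma lower_orth_rows:
  assumes "q \<in> carrier_mat N N" "X \<in> carrier_mat k c" "Y \<in> carrier_mat N c"
  shows "lower_orth k N q * (X @\<^sub>r Y) = X @\<^sub>r (q * Y)"
  using assms four_block_mult_append_rows[of "1\<^sub>m k" k k "0\<^sub>m k N" N "0\<^sub>m N k" N q X c Y]
  by (simp add: lower_orth_def)

lemma top_frame_carrier: "1\<^sub>m k @\<^sub>r (0\<^sub>m N k :: real mat) \<in> carrier_mat (k + N) k"
  by (rule stiefelD(1)[OF top_frame_stiefel])

lemma det_weight_measurable: "(\<lambda>r. ennreal (det r powr a)) \<in> borel_measurable (mat_borel m m)"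
  using mat_det_measurable[OF measurable_ident_sets[OF refl], of m] by measurable

text \<open>The average depends only on the orbit of the pair (E, y) under simultaneous rotation, so
  frame and point may be moved together.\<close>

lemma haar_right_shift:
  assumes G: "(\<lambda>z. G (fst z) (snd z)) \<in> borel_measurable (stiefel_borel n k
      \<Otimes>\<^sub>M mat_borel n m)"
    and E: "E \<in> stiefel n k" and y: "y \<in> carrier_mat n m" and p: "p \<in> orth_group n"
  shows "(\<integral>\<^sup>+g. G (g * (p * E)) (g * (p * y)) \<partial>haar n) =
      (\<integral>\<^sup>+g. G (g * E) (g * y) \<partial>haar n)"
proof -
  note id = measurable_ident_sets[OF refl]
  define \<Phi> where "\<Phi> g = G (g * E) (g * y)" for g
  have \<Phi>: "\<Phi> \<in> borel_measurable (stiefel_borel n n)"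
    using measurable_compose[OF measurable_Pair[OF stiefel_mult_measurable[OF id
        stiefel_const_measurable[OF E]] mat_mult_measurable[OF stiefel_borelD[OF id]
        mat_const_measurable[OF y]]] G]
    by (simp add: \<Phi>_def[abs_def])
  have "(\<integral>\<^sup>+g. G (g * (p * E)) (g * (p * y)) \<partial>haar n) = (\<integral>\<^sup>+g.
      \<Phi> (g * p) \<partial>haar n)"
  proof (rule nn_integral_cong)
    fix g assume "g \<in> space (haar n)"
    then have gc: "g \<in> carrier_mat n n" using orth_groupD(1) by auto
    show "G (g * (p * E)) (g * (p * y)) = \<Phi> (g * p)"
      using gc orth_groupD(1)[OF p] stiefelD(1)[OF E] y
      by (simp add: \<Phi>_def assoc_mult_mat[of _ n n _ n _ k] assoc_mult_mat[of _ n n _ n _ m])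
  qed
  also have "\<dots> = (\<integral>\<^sup>+g. \<Phi> g \<partial>haar n)" by (rule
      nn_integral_haar_right[OF \<Phi> p])
  finally show ?thesis by (simp add: \<Phi>_def)
qed

text \<open>The weight removes k of the n rows and leaves an integral over z in the complement of
  the frame. Almost every z is reached from its canonical representative by some q in O(p + m);
  since diag(1, q) fixes the frame, \<open>haar_right_shift\<close> replaces the representative by
  z.\<close>

theorem nn_integral_orthogonal_fibres:
  fixes G :: "real mat \<Rightarrow> real mat \<Rightarrow> ennreal"
  assumes n: "n = k + p + m"
    and G: "(\<lambda>z. G (fst z) (snd z)) \<in> borel_measurable (stiefel_borel n k \<Otimes>\<^sub>M
        mat_borel n m)"
  shows "(\<integral>\<^sup>+x. ennreal (det (transpose_mat x * x) powr (- (real k / 2))) *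
      (\<integral>\<^sup>+h. G (frame0 (k + p) m x * (block_orth (k + p) h m * (1\<^sub>m k @\<^sub>r
          0\<^sub>m (p + m) k))) x \<partial>haar (k + p)) \<partial>lmat n m)
    = ennreal (gram_const m (p + m) k) * (\<integral>\<^sup>+z. \<integral>\<^sup>+g. G (g * (1\<^sub>m
        k @\<^sub>r 0\<^sub>m (p + m) k)) (g * (0\<^sub>m k m @\<^sub>r z)) \<partial>haar n
        \<partial>lmat (p + m) m)"
proof -
  note id = measurable_ident_sets[OF refl]
  have n': "n = (k + p) + m" "n = k + (p + m)" "n = (p + m) + k" using n by auto
  define E :: "real mat" where "E = 1\<^sub>m k @\<^sub>r 0\<^sub>m (p + m) k"
  have E: "E \<in> stiefel n k" unfolding E_def n'(2) by (rule top_frame_stiefel)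
  \<comment> \<open>A function of the Gram matrix only; the frame \<open>E\<close> stays fixed while
    the number of rows is lowered.\<close>
  define F where "F r = (\<integral>\<^sup>+g. G (g * E) (g * (0\<^sub>m k m @\<^sub>r canon p m r))
      \<partial>haar n)" for r
  have cm: "(\<lambda>w. 0\<^sub>m k m @\<^sub>r canon p m (H w)) \<in> N' \<rightarrow>\<^sub>M
      mat_borel n m" if "H \<in> N' \<rightarrow>\<^sub>M mat_borel m m" for H and N' :: "'z measure"
    unfolding n'(2) by (rule append_rows_measurable[OF mat_const_measurable canon_measurable[OF that]]) simp
  have F: "F \<in> borel_measurable (mat_borel m m)"
    unfolding F_def
    by (rule nn_integral_measurable_snd[OF sigma_finite_haar], simp,
      rule measurable_compose[OF measurable_Pair[OF stiefel_mult_measurable[OF measurable_snd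
          stiefel_const_measurable[OF E]] mat_mult_measurable[OF stiefel_borelD[OF measurable_snd]
          cm[OF measurable_fst]]] G, simplified])
  have "(\<integral>\<^sup>+x. ennreal (det (transpose_mat x * x) powr (- (real k / 2))) *
      (\<integral>\<^sup>+h. G (frame0 (k + p) m x * (block_orth (k + p) h m * E)) x \<partial>haar (k
          + p)) \<partial>lmat ((k + p) + m) m)
    = (\<integral>\<^sup>+x. ennreal (det (transpose_mat x * x) powr (- (real k / 2))) *
      (\<integral>\<^sup>+g. G (g * E) (g * canon (k + p) m (transpose_mat x * x)) \<partial>haar ((k +
          p) + m)) \<partial>lmat ((k + p) + m) m)"
    by (rule nn_integral_frame[OF E[unfolded n'(1)] G[unfolded n'(1)] det_weight_measurable])
  also have "\<dots> = (\<integral>\<^sup>+x. ennreal (det (transpose_mat x * x) powr (- (real k / 2)))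
      * F (transpose_mat x * x) \<partial>lmat ((p + m) + k) m)"
    unfolding n'(1)[symmetric] n'(3)[symmetric] F_def canon_append ..
  also have "\<dots> = ennreal (gram_const m (p + m) k) * (\<integral>\<^sup>+z. F (transpose_mat z *
      z) \<partial>lmat (p + m) m)"
    by (rule nn_integral_gram_weight[OF le_add2 F])
  also have "(\<integral>\<^sup>+z. F (transpose_mat z * z) \<partial>lmat (p + m) m) =
      (\<integral>\<^sup>+z. \<integral>\<^sup>+g. G (g * E) (g * (0\<^sub>m k m @\<^sub>r z))
      \<partial>haar n \<partial>lmat (p + m) m)"
  proof (rule nn_integral_cong_AE)
    show "AE z in lmat (p + m) m. F (transpose_mat z * z) = (\<integral>\<^sup>+g. G (g * E) (g *
        (0\<^sub>m k m @\<^sub>r z)) \<partial>haar n)"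
      using AE_det_gram[of m "p + m", OF le_add2] AE_space
    proof eventually_elim
      case (elim z)
      then have z: "z \<in> carrier_mat (p + m) m" by simp
      obtain q where q: "q \<in> orth_group (p + m)" "q * canon p m (transpose_mat z * z) = z"
        using exists_canon[OF z elim(1)] by metis
      note qc = orth_groupD(1)[OF q(1)]
      define y where "y = 0\<^sub>m k m @\<^sub>r canon p m (transpose_mat z * z)"
      have y: "y \<in> carrier_mat n m" unfolding y_def n'(2) by (intro carrier_append_rows canon_carrier) simp
      define P where "P = lower_orth k (p + m) q"
      have P: "P \<in> orth_group n" unfolding P_def n'(2) by (rule lower_orth_orth[OF q(1)])
      have PE: "P * E = E" unfolding P_def E_def using qc by (subst lower_orth_rows[of _ _ _ _ k]) auto
      have Py: "P * y = 0\<^sub>m k m @\<^sub>r z"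
        unfolding P_def y_def using q(2) by (subst lower_orth_rows[OF qc _ canon_carrier]) auto
      show ?case unfolding F_def y_def[symmetric] using haar_right_shift[OF G E y P] PE Py by simp
    qed
  qed
  finally show ?thesis unfolding n'(1)[symmetric] E_def .
qed

text \<open>The counterpart for frames whose span contains the columns of x: the weight removes N
  rows and leaves the k x m matrix y of coordinates with respect to the frame. Since the last
  columns of \<open>E0\<close> are the last m coordinate vectors, the canonical representative lies
  in the span of \<open>E0\<close>.\<close>

theorem nn_integral_containing_fibres:
  fixes G :: "real mat \<Rightarrow> real mat \<Rightarrow> ennreal"
  assumes n: "n = p + N + m" and k: "k = p + m"
    and G: "(\<lambda>z. G (fst z) (snd z)) \<in> borel_measurable (stiefel_borel n k \<Otimes>\<^sub>M
        mat_borel n m)"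
    and inv: "\<And>u x \<gamma>. u \<in> stiefel n k \<Longrightarrow> \<gamma> \<in> orth_group k
        \<Longrightarrow> G (u * \<gamma>) x = G u x"
    and E0: "E0 \<in> stiefel n k" "E0 * (0\<^sub>m p m @\<^sub>r 1\<^sub>m m) = 0\<^sub>m (p + N) m
        @\<^sub>r 1\<^sub>m m"
  shows "(\<integral>\<^sup>+x. ennreal (det (transpose_mat x * x) powr (- (real N / 2))) *
      (\<integral>\<^sup>+h. G (frame0 (p + N) m x * (block_orth (p + N) h m * E0)) x \<partial>haar (p
          + N)) \<partial>lmat n m)
    = ennreal (gram_const m k N) * (\<integral>\<^sup>+y. \<integral>\<^sup>+g. G (g * (1\<^sub>m k
        @\<^sub>r 0\<^sub>m N k)) (g * (y @\<^sub>r 0\<^sub>m N m)) \<partial>haar n \<partial>lmat k m)"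
proof -
  note id = measurable_ident_sets[OF refl]
  have n': "n = (p + N) + m" "n = k + N" using n k by auto
  define E :: "real mat" where "E = 1\<^sub>m k @\<^sub>r 0\<^sub>m N k"
  have E: "E \<in> stiefel n k" unfolding E_def n'(2) by (rule top_frame_stiefel)
  note Ec = stiefelD(1)[OF E]
  have Ey: "E * y = y @\<^sub>r 0\<^sub>m N m" if "y \<in> carrier_mat k m" for y
    unfolding E_def using that by (subst append_rows_mult_right[of _ k k _ N _ m]) auto
  obtain r0 where r0: "r0 \<in> orth_group n" "r0 * E = E0"
    using stiefel_transitive[OF E E0(1)] n'(2) by auto
  define F where "F r = (\<integral>\<^sup>+g. G (g * E) (g * (E * canon p m r)) \<partial>haar n)" for r
  have cc: "canon p m r \<in> carrier_mat k m" for r unfolding k by (rule canon_carrier)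
  have cm: "(\<lambda>w. E * canon p m (H w)) \<in> N' \<rightarrow>\<^sub>M mat_borel n m" if "H \<in>
      N' \<rightarrow>\<^sub>M mat_borel m m" for H and N' :: "'z measure"
    by (rule mat_left_mult_measurable[OF Ec canon_measurable[OF that, of p, folded k]])
  have F: "F \<in> borel_measurable (mat_borel m m)"
    unfolding F_def
    by (rule nn_integral_measurable_snd[OF sigma_finite_haar], simp,
      rule measurable_compose[OF measurable_Pair[OF stiefel_mult_measurable[OF measurable_snd
          stiefel_const_measurable[OF E]] mat_mult_measurable[OF stiefel_borelD[OF measurable_snd]
          cm[OF measurable_fst]]] G, simplified])
  \<comment> \<open>A rotation r0 takes the standard frame \<open>E\<close> to \<open>E0\<close>.
    The canonical representative is \<open>E0\<close> times a smaller one, so it moves along with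
    the frame.\<close>
  have FF: "(\<integral>\<^sup>+g. G (g * E0) (g * canon (p + N) m r) \<partial>haar n) = F r" for r
  proof -
    have e: "0\<^sub>m p m @\<^sub>r (1\<^sub>m m :: real mat) \<in> carrier_mat k m" unfolding k by
        (rule stiefelD(1)[OF bot_frame_stiefel])
    have "canon (p + N) m r = E0 * canon p m r"
      unfolding canon_def E0(2)[symmetric]
      by (rule assoc_mult_mat[OF stiefelD(1)[OF E0(1)] e msqrt_carrier])
    also have "\<dots> = r0 * (E * canon p m r)"
      unfolding r0(2)[symmetric] by (rule assoc_mult_mat[OF orth_groupD(1)[OF r0(1)] Ec cc])
    finally show ?thesis
      using haar_right_shift[OF G E _ r0(1), of "E * canon p m r"] Ec cc[of r] r0(2) by (simp add: F_def)
  qed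
  have "(\<integral>\<^sup>+x. ennreal (det (transpose_mat x * x) powr (- (real N / 2))) *
      (\<integral>\<^sup>+h. G (frame0 (p + N) m x * (block_orth (p + N) h m * E0)) x \<partial>haar (p
          + N)) \<partial>lmat ((p + N) + m) m)
    = (\<integral>\<^sup>+x. ennreal (det (transpose_mat x * x) powr (- (real N / 2))) *
      (\<integral>\<^sup>+g. G (g * E0) (g * canon (p + N) m (transpose_mat x * x)) \<partial>haar ((p
          + N) + m)) \<partial>lmat ((p + N) + m) m)"
    by (rule nn_integral_frame[OF E0(1)[unfolded n'(1)] G[unfolded n'(1)] det_weight_measurable])
  also have "\<dots> = (\<integral>\<^sup>+x. ennreal (det (transpose_mat x * x) powr (- (real N / 2)))
      * F (transpose_mat x * x) \<partial>lmat (k + N) m)"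
    unfolding n'(1)[symmetric] n'(2)[symmetric] FF ..
  also have "\<dots> = ennreal (gram_const m k N) * (\<integral>\<^sup>+z. F (transpose_mat z * z)
      \<partial>lmat k m)"
    by (rule nn_integral_gram_weight[OF _ F]) (simp add: k)
  also have "(\<integral>\<^sup>+z. F (transpose_mat z * z) \<partial>lmat k m) =
      (\<integral>\<^sup>+y. \<integral>\<^sup>+g. G (g * E) (g * (y @\<^sub>r 0\<^sub>m N m))
      \<partial>haar n \<partial>lmat k m)"
  proof (rule nn_integral_cong_AE)
    have "m \<le> k" by (simp add: k)
    from AE_det_gram[OF this] AE_space
    show "AE y in lmat k m. F (transpose_mat y * y) = (\<integral>\<^sup>+g. G (g * E) (g * (y
        @\<^sub>r 0\<^sub>m N m)) \<partial>haar n)"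
    proof eventually_elim
      case (elim y)
      then have y: "y \<in> carrier_mat k m" by simp
      obtain q where q: "q \<in> orth_group k" "q * canon p m (transpose_mat y * y) = y"
        using exists_canon[of y p m] y elim(1) unfolding k by metis
      note qc = orth_groupD(1)[OF q(1)]
      define c where "c = canon p m (transpose_mat y * y)"
      define P where "P = block_orth k q N"
      have P: "P \<in> orth_group n" unfolding P_def n'(2) by (rule block_orth_orth[OF q(1)])
      \<comment> \<open>Here the rotation changes the frame, but only by the right factor q in O(k),
        which the invariance of \<open>G\<close> removes below.\<close>
      have PE: "P * E = E * q"
        unfolding P_def E_def using qc
        by (subst block_orth_rows[of _ _ _ k], auto simp: append_rows_mult_right[of _ k k _ N _ k])
      have c: "c \<in> carrier_mat k m" unfolding c_def by (rule cc)
      have Ecc: "E * c \<in> carrier_mat n m" using Ec c by auto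
      have "P * (E * c) = P * E * c" by (rule assoc_mult_mat[symmetric, OF orth_groupD(1)[OF P] Ec c])
      also have "\<dots> = E * y" unfolding PE using assoc_mult_mat[OF Ec qc c] q(2) by (simp add: c_def)
      finally have Pc: "P * (E * c) = y @\<^sub>r 0\<^sub>m N m" using Ey[OF y] by simp
      have "F (transpose_mat y * y) = (\<integral>\<^sup>+g. G (g * (E * q)) (g * (y @\<^sub>r
          0\<^sub>m N m)) \<partial>haar n)"
        unfolding F_def c_def[symmetric] using haar_right_shift[OF G E Ecc P] PE Pc by simp
      also have "\<dots> = (\<integral>\<^sup>+g. G (g * E) (g * (y @\<^sub>r 0\<^sub>m N m)) \<partial>haar n)"
      proof (rule nn_integral_cong)
        fix g assume "g \<in> space (haar n)"
        then have g: "g \<in> orth_group n" by simp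
        have "g * (E * q) = (g * E) * q" by (rule assoc_mult_mat[symmetric, OF orth_groupD(1)[OF g] Ec qc])
        then show "G (g * (E * q)) (g * (y @\<^sub>r 0\<^sub>m N m)) = G (g * E) (g * (y @\<^sub>r
            0\<^sub>m N m))"
          using inv[OF orth_mult_stiefel[OF g E] q(1)] by simp
      qed
      finally show ?case .
    qed
  qed
  finally show ?thesis unfolding n'(1)[symmetric] E_def .
qed

section \<open>From nonnegative to complex integrands\<close>

text \<open>Because \<open>eq\<close> holds for every nonnegative G, the two product measures, with
  densities d and c, have the same image under \<open>P\<close> and \<open>Q\<close>. An equality of
  measures applies to complex functions and transports integrability from the second side to the
  first; Fubini's theorem then separates the variables again.\<close>

lemma integral_transfer:
  fixes W :: "'s \<Rightarrow> complex" and d :: "'a \<Rightarrow> real"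
  assumes sf: "sigma_finite_measure M1" "sigma_finite_measure H1" "sigma_finite_measure M2"
      "sigma_finite_measure H2"
    and P: "P \<in> M1 \<Otimes>\<^sub>M H1 \<rightarrow>\<^sub>M S" and Q: "Q \<in> M2
        \<Otimes>\<^sub>M H2 \<rightarrow>\<^sub>M S"
    and d: "d \<in> borel_measurable M1" "\<And>x. d x \<ge> 0" and c: "c \<ge> 0"
    and eq: "\<And>G. G \<in> borel_measurable S \<Longrightarrow>
      (\<integral>\<^sup>+x. ennreal (d x) * (\<integral>\<^sup>+h. G (P (x, h)) \<partial>H1)
          \<partial>M1) = ennreal c * (\<integral>\<^sup>+z. \<integral>\<^sup>+g. G (Q (z, g))
          \<partial>H2 \<partial>M2)"
    and W: "W \<in> borel_measurable S" and int: "integrable (M2 \<Otimes>\<^sub>M H2) (\<lambda>w. W (Q w))"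
  shows "integrable M1 (\<lambda>x. of_real (d x) * (\<integral>h. W (P (x, h)) \<partial>H1))"
    and "(\<integral>x. of_real (d x) * (\<integral>h. W (P (x, h)) \<partial>H1) \<partial>M1) =
        of_real c * (\<integral>w. W (Q w) \<partial>(M2 \<Otimes>\<^sub>M H2))"
    and "(\<lambda>x. of_real (d x) * (\<integral>h. W (P (x, h)) \<partial>H1)) \<in> borel_measurable M1"
proof -
  interpret M1: sigma_finite_measure M1 by fact
  interpret H1: sigma_finite_measure H1 by fact
  interpret M2: sigma_finite_measure M2 by fact
  interpret H2: sigma_finite_measure H2 by fact
  interpret PP: pair_sigma_finite M1 H1 by standard
  interpret QQ: pair_sigma_finite M2 H2 by standard
  define A where "A = density (M1 \<Otimes>\<^sub>M H1) (\<lambda>w. ennreal (d (fst w)))"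
  define B where "B = density (M2 \<Otimes>\<^sub>M H2) (\<lambda>w. ennreal c)"
  have dm: "(\<lambda>w. d (fst w)) \<in> borel_measurable (M1 \<Otimes>\<^sub>M H1)" using d by measurable
  have PA: "P \<in> A \<rightarrow>\<^sub>M S" and QB: "Q \<in> B \<rightarrow>\<^sub>M S" using P Q by
      (simp_all add: A_def B_def)
  have e1: "(\<integral>\<^sup>+w. G (P w) \<partial>A) = (\<integral>\<^sup>+x. ennreal (d x) *
      (\<integral>\<^sup>+h. G (P (x, h)) \<partial>H1) \<partial>M1)" if G: "G \<in> borel_measurable S" for G
  proof -
    have GP: "(\<lambda>w. G (P w)) \<in> borel_measurable (M1 \<Otimes>\<^sub>M H1)" by (rule
        measurable_compose[OF P G])
    have "(\<integral>\<^sup>+w. G (P w) \<partial>A) = (\<integral>\<^sup>+w. ennreal (d (fst w)) * G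
        (P w) \<partial>(M1 \<Otimes>\<^sub>M H1))"
      unfolding A_def using dm GP by (intro nn_integral_density) auto
    also have "\<dots> = (\<integral>\<^sup>+x. \<integral>\<^sup>+h. ennreal (d x) * G (P (x, h))
        \<partial>H1 \<partial>M1)"
      using dm GP by (subst H1.nn_integral_fst[symmetric]) auto
    also have "\<dots> = (\<integral>\<^sup>+x. ennreal (d x) * (\<integral>\<^sup>+h. G (P (x, h))
        \<partial>H1) \<partial>M1)"
      using GP by (intro nn_integral_cong nn_integral_cmult) (auto intro: measurable_compose[OF
          measurable_Pair1'])
    finally show ?thesis .
  qed
  have e2: "(\<integral>\<^sup>+w. G (Q w) \<partial>B) = ennreal c * (\<integral>\<^sup>+z.
      \<integral>\<^sup>+g. G (Q (z, g)) \<partial>H2 \<partial>M2)" if G: "G \<in> borel_measurable S" for G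
  proof -
    have GQ: "(\<lambda>w. G (Q w)) \<in> borel_measurable (M2 \<Otimes>\<^sub>M H2)" by (rule
        measurable_compose[OF Q G])
    have "(\<integral>\<^sup>+w. G (Q w) \<partial>B) = (\<integral>\<^sup>+w. ennreal c * G (Q w)
        \<partial>(M2 \<Otimes>\<^sub>M H2))"
      unfolding B_def using GQ by (intro nn_integral_density) auto
    also have "\<dots> = ennreal c * (\<integral>\<^sup>+z. \<integral>\<^sup>+g. G (Q (z, g))
        \<partial>H2 \<partial>M2)"
      using GQ by (simp add: nn_integral_cmult H2.nn_integral_fst[symmetric])
    finally show ?thesis .
  qed
  have AB: "distr A S P = distr B S Q"
  proof (rule measure_eqI)
    fix X assume "X \<in> sets (distr A S P)"
    then have X: "X \<in> sets S" by simp
    then have iX: "indicator X \<in> borel_measurable S" by simp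
    have "emeasure (distr A S P) X = (\<integral>\<^sup>+w. indicator X (P w) \<partial>A)"
      using X nn_integral_distr[OF PA, of "indicator X"] by simp
    also have "\<dots> = (\<integral>\<^sup>+w. indicator X (Q w) \<partial>B)"
      unfolding e1[OF iX] e2[OF iX] by (rule eq[OF iX])
    also have "\<dots> = emeasure (distr B S Q) X"
      using X nn_integral_distr[OF QB, of "indicator X"] by simp
    finally show "emeasure (distr A S P) X = emeasure (distr B S Q) X" .
  qed simp
  have WQ: "(\<lambda>w. W (Q w)) \<in> borel_measurable (M2 \<Otimes>\<^sub>M H2)" by (rule
      measurable_compose[OF Q W])
  have WP: "(\<lambda>w. W (P w)) \<in> borel_measurable (M1 \<Otimes>\<^sub>M H1)" by (rule
      measurable_compose[OF P W])
  have "integrable B (\<lambda>w. W (Q w))"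
    unfolding B_def using WQ int c by (subst integrable_density) auto
  then have "integrable (distr A S P) W" unfolding AB using integrable_distr_eq[OF QB W] by simp
  then have "integrable A (\<lambda>w. W (P w))" using integrable_distr_eq[OF PA W] by simp
  then have i: "integrable (M1 \<Otimes>\<^sub>M H1) (\<lambda>w. d (fst w) *\<^sub>R W (P w))"
    unfolding A_def using WP dm d(2) by (subst (asm) integrable_density) auto
  have f: "(\<integral>h. d (fst (x, h)) *\<^sub>R W (P (x, h)) \<partial>H1) = of_real (d x) *
      (\<integral>h. W (P (x, h)) \<partial>H1)" for x
    by (simp add: scaleR_conv_of_real)
  show I: "integrable M1 (\<lambda>x. of_real (d x) * (\<integral>h. W (P (x, h)) \<partial>H1))"
    using PP.integrable_fst'[OF i] unfolding f .
  then show "(\<lambda>x. of_real (d x) * (\<integral>h. W (P (x, h)) \<partial>H1)) \<in>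
      borel_measurable M1" by auto
  have "(\<integral>x. of_real (d x) * (\<integral>h. W (P (x, h)) \<partial>H1) \<partial>M1) =
      (\<integral>w. d (fst w) *\<^sub>R W (P w) \<partial>(M1 \<Otimes>\<^sub>M H1))"
    using PP.integral_fst'[OF i] unfolding f .
  also have "\<dots> = (\<integral>w. W (P w) \<partial>A)"
    unfolding A_def using WP dm d(2) by (subst integral_density) auto
  also have "\<dots> = (\<integral>s. W s \<partial>distr A S P)" by (rule integral_distr[OF PA W, symmetric])
  also have "\<dots> = (\<integral>w. W (Q w) \<partial>B)" unfolding AB by (rule integral_distr[OF QB W])
  also have "\<dots> = of_real c * (\<integral>w. W (Q w) \<partial>(M2 \<Otimes>\<^sub>M H2))"
    unfolding B_def using WQ c by (subst integral_density) (auto simp: scaleR_conv_of_real)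
  finally show "(\<integral>x. of_real (d x) * (\<integral>h. W (P (x, h)) \<partial>H1) \<partial>M1)
      = of_real c * (\<integral>w. W (Q w) \<partial>(M2 \<Otimes>\<^sub>M H2))" .
qed

subsection \<open>Rapidly decreasing functions\<close>

text \<open>The decay part of the Schwartz condition, separated because it is applied both to
  partial derivatives and to Fourier transforms.\<close>

definition rapid :: "nat \<Rightarrow> nat \<Rightarrow> (real mat \<Rightarrow> complex) \<Rightarrow>
    bool" where
  "rapid n m f \<longleftrightarrow> (\<forall>qs. set qs \<subseteq> entries n m \<longrightarrow>
     bounded ((\<lambda>x. complex_of_real (\<Prod>q\<leftarrow>qs. x $$ q) * f x) ` carrier_mat n m))"

lemma rapid_cong: "(\<And>x. x \<in> carrier_mat n m \<Longrightarrow> f x = g x) \<Longrightarrow>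
    rapid n m f \<longleftrightarrow> rapid n m g"
  unfolding rapid_def by (simp cong: image_cong)

lemma rapid_mult_coord:
  assumes "rapid n m f" "q \<in> entries n m"
  shows "rapid n m (\<lambda>x. complex_of_real (x $$ q) * f x)"
  unfolding rapid_def
proof (intro allI impI)
  fix qs assume qs: "set qs \<subseteq> entries n m"
  have "bounded ((\<lambda>x. complex_of_real (\<Prod>q\<leftarrow>q # qs. x $$ q) * f x) ` carrier_mat n m)"
    using assms(1)[unfolded rapid_def, rule_format, of "q # qs"] assms(2) qs by simp
  also have "(\<lambda>x. complex_of_real (\<Prod>q\<leftarrow>q # qs. x $$ q) * f x) = (\<lambda>x.
      complex_of_real (\<Prod>q\<leftarrow>qs. x $$ q) * (complex_of_real (x $$ q) * f x))"
    by (rule ext) (simp only: list.map prod_list.Cons of_real_mult mult.assoc mult.left_commute)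
  finally show "bounded ((\<lambda>x. complex_of_real (\<Prod>q\<leftarrow>qs. x $$ q) *
      (complex_of_real (x $$ q) * f x)) ` carrier_mat n m)" .
qed

lemma rapid_zero: "rapid n m (\<lambda>x. 0)"
  unfolding rapid_def by (auto intro!: finite_imp_bounded finite_subset[of _ "{0}"])

lemma rapid_add:
  assumes "rapid n m f" "rapid n m g"
  shows "rapid n m (\<lambda>x. f x + g x)"
  unfolding rapid_def distrib_left
  using assms by (auto simp: rapid_def intro!: bounded_plus_comp)

lemma rapid_sum: "(\<And>i. i \<in> A \<Longrightarrow> rapid n m (f i)) \<Longrightarrow> rapid n m
    (\<lambda>x. \<Sum>i\<in>A. f i x)"
  by (induction A rule: infinite_finite_induct) (auto intro: rapid_zero rapid_add)

lemma fsq_entries: "x \<in> carrier_mat n m \<Longrightarrow> fsq x = (\<Sum>p\<in>entries n m. (x $$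
    p)\<^sup>2)"
  by (simp add: fsq_eq sum.cartesian_product case_prod_beta')

text \<open>\<open>1 + fsq x\<close> is 1 plus a sum of squared coordinates, and multiplication by a
  coordinate preserves rapid decay.\<close>

lemma rapid_weight:
  assumes "rapid n m f"
  shows "rapid n m (\<lambda>x. complex_of_real ((1 + fsq x) ^ N) * f x)"
proof (induction N)
  case 0
  then show ?case using assms by simp
next
  case (Suc N)
  let ?f = "\<lambda>x. complex_of_real ((1 + fsq x) ^ N) * f x"
  have "rapid n m (\<lambda>x. ?f x + (\<Sum>p\<in>entries n m. complex_of_real (x $$ p) *
      (complex_of_real (x $$ p) * ?f x)))"
    using Suc by (intro rapid_add rapid_sum rapid_mult_coord) auto
  moreover have "?f x + (\<Sum>p\<in>entries n m. complex_of_real (x $$ p) * (complex_of_real (x $$ p) * ?f x))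
     = complex_of_real ((1 + fsq x) ^ Suc N) * f x" if "x \<in> carrier_mat n m" for x
    unfolding fsq_entries[OF that] by (simp add: algebra_simps sum_distrib_left sum_distrib_right
        power2_eq_square)
  ultimately show ?case by (subst rapid_cong[symmetric]) auto
qed

text \<open>The majorant in all dominated convergence arguments for Schwartz functions: it is
  invariant under rotations and integrable once the exponent reaches the number of entries.\<close>

definition wt :: "nat \<Rightarrow> real mat \<Rightarrow> real" where
  "wt N x = inverse ((1 + fsq x) ^ N)"

lemma wt_pos: "wt N x > 0"
  using fsq_nonneg[of x] by (simp add: wt_def add_pos_nonneg)

lemma wt_measurable: "wt N \<in> borel_measurable (mat_borel n m)"
proof -
  have [measurable]: "fsq \<in> borel_measurable (mat_borel n m)"
    using fsq_measurable[OF measurable_ident_sets[OF refl]] by simp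
  show ?thesis unfolding wt_def by measurable
qed

lemma rapid_bound:
  assumes "rapid n m f"
  shows "\<exists>C\<ge>0. \<forall>x\<in>carrier_mat n m. norm (f x) \<le> C * wt N x"
proof -
  have "bounded ((\<lambda>x. complex_of_real (\<Prod>q\<leftarrow>[]. x $$ q) * (complex_of_real ((1 +
      fsq x) ^ N) * f x)) ` carrier_mat n m)"
    by (rule rapid_weight[OF assms, of N, unfolded rapid_def, rule_format]) simp
  then obtain C where C: "C > 0" "\<And>x. x \<in> carrier_mat n m \<Longrightarrow> norm
      (complex_of_real ((1 + fsq x) ^ N) * f x) \<le> C"
    by (auto simp: bounded_pos)
  have "norm (f x) \<le> C * wt N x" if "x \<in> carrier_mat n m" for x
  proof -
    have p: "(1 + fsq x) ^ N > 0" using fsq_nonneg[of x] by (simp add: add_pos_nonneg)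
    have "norm (f x) * (1 + fsq x) ^ N \<le> C"
      using C(2)[OF that] by (simp only: norm_mult norm_of_real abs_of_pos[OF p] mult.commute)
    then show ?thesis using p by (simp add: wt_def pos_le_divide_eq flip: divide_inverse)
  qed
  then show ?thesis using C(1) by (intro exI[of _ C]) auto
qed

lemma prod_one_plus_le: "finite I \<Longrightarrow> (\<And>p. p \<in> I \<Longrightarrow> a p \<ge> 0)
    \<Longrightarrow> (\<Prod>p\<in>I. 1 + a p) \<le> (1 + (\<Sum>p\<in>I. a p)) ^ card I" for a :: "'a
    \<Rightarrow> real"
proof -
  assume I: "finite I" and a: "\<And>p. p \<in> I \<Longrightarrow> a p \<ge> 0"
  have "(\<Prod>p\<in>I. 1 + a p) \<le> (\<Prod>p\<in>I. 1 + (\<Sum>p\<in>I. a p))"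
    by (intro prod_mono) (use I a in \<open>auto intro!: member_le_sum\<close>)
  then show ?thesis by simp
qed

lemma integrable_inv_1_plus_sq: "integrable lborel (\<lambda>x::real. inverse (1 + x\<^sup>2))"
  using integrable_inverse_1_plus_square by (simp add: set_integrable_def einterval_def)

text \<open>The power (1 + |x|^2)^(ab) dominates the product of 1 + x_p^2 over the entries, so the
  weight lies below a product of functions 1/(1 + t^2), one per entry.\<close>

lemma wt_integrable:
  assumes "a * b \<le> N"
  shows "integrable (lmat a b) (wt N)"
proof (rule integrableI_bounded)
  show "wt N \<in> borel_measurable (lmat a b)" using wt_measurable by simp
  have nm: "(\<lambda>x. ennreal (norm (wt N x))) \<in> borel_measurable (mat_borel a b)" using
      wt_measurable[of N a b] by measurable
  have "(\<integral>\<^sup>+x. ennreal (norm (wt N x)) \<partial>lmat a b) = (\<integral>\<^sup>+w.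
      ennreal (norm (wt N (mat a b w))) \<partial>Pi\<^sub>M (entries a b) (\<lambda>_. lborel))"
    by (rule nn_integral_lmat[OF nm])
  also have "\<dots> \<le> (\<integral>\<^sup>+w. (\<Prod>p\<in>entries a b. ennreal (inverse (1 + (w
      p)\<^sup>2))) \<partial>Pi\<^sub>M (entries a b) (\<lambda>_. lborel))"
  proof (rule nn_integral_mono)
    fix w :: "nat \<times> nat \<Rightarrow> real"
    have "(\<Prod>p\<in>entries a b. 1 + (w p)\<^sup>2) \<le> (1 + fsq (mat a b w)) ^ (a * b)"
      using prod_one_plus_le[of "entries a b" "\<lambda>p. (w p)\<^sup>2"] by (simp add: fsq_mat
          card_cartesian_product)
    also have "\<dots> \<le> (1 + fsq (mat a b w)) ^ N" using assms fsq_nonneg by (intro power_increasing) auto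
    finally have "inverse ((1 + fsq (mat a b w)) ^ N) \<le> inverse (\<Prod>p\<in>entries a b. 1 + (w
        p)\<^sup>2)"
      by (intro le_imp_inverse_le prod_pos) (auto intro: add_pos_nonneg)
    then have "ennreal (norm (wt N (mat a b w))) \<le> ennreal (inverse (\<Prod>p\<in>entries a b. 1 +
        (w p)\<^sup>2))"
      using wt_pos[of N "mat a b w"] by (intro ennreal_leI) (simp add: wt_def)
    also have "\<dots> = (\<Prod>p\<in>entries a b. ennreal (inverse (1 + (w p)\<^sup>2)))"
      by (subst prod_ennreal) (auto simp: prod_inversef[symmetric] intro: add_nonneg_nonneg)
    finally show "ennreal (norm (wt N (mat a b w))) \<le> (\<Prod>p\<in>entries a b. ennreal (inverse
        (1 + (w p)\<^sup>2)))" .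
  qed
  also have "\<dots> = (\<Prod>p\<in>entries a b. \<integral>\<^sup>+t. ennreal (inverse (1 +
      t\<^sup>2)) \<partial>lborel)"
    by (rule lb.product_nn_integral_prod) auto
  also have "\<dots> < \<infinity>"
  proof -
    have "(\<integral>\<^sup>+(t::real). ennreal (inverse (1 + t\<^sup>2)) \<partial>lborel) < \<infinity>"
      using integrable_inv_1_plus_sq by (simp add: integrable_iff_bounded add_nonneg_nonneg)
    then show ?thesis by (simp add: power_less_top_ennreal)
  qed
  finally show "(\<integral>\<^sup>+x. ennreal (norm (wt N x)) \<partial>lmat a b) < \<infinity>" .
qed

subsection \<open>Regularity of Schwartz functions\<close>

lemma mat_unit_carrier: "mat_unit n m p \<in> carrier_mat n m"
  by (simp add: mat_unit_def)

lemma mat_unit_index: "i < n \<Longrightarrow> j < m \<Longrightarrow> mat_unit n m p $$ (i,j) = (if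
    (i,j) = p then 1 else 0)"
  by (simp add: mat_unit_def)

context
  fixes n m :: nat and \<phi> :: "real mat \<Rightarrow> complex"
  assumes S: "schwartz_mat n m \<phi>"
begin

lemma schwartz_rapid: "set ps \<subseteq> entries n m \<Longrightarrow> rapid n m (mat_partials n m ps \<phi>)"
  using S unfolding schwartz_mat_def rapid_def by blast

text \<open>The definition differentiates only at t = 0, but at every base point; moving the base
  point along the line gives the derivative at all t.\<close>

lemma schwartz_deriv:
  assumes "set ps \<subseteq> entries n m" "p \<in> entries n m" "x \<in> carrier_mat n m"
  shows "((\<lambda>t. mat_partials n m ps \<phi> (x + t \<cdot>\<^sub>m mat_unit n m p)) has_vector_derivative
     mat_partials n m (p # ps) \<phi> (x + t \<cdot>\<^sub>m mat_unit n m p)) (at t)"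
proof -
  let ?F = "mat_partials n m ps \<phi>" and ?u = "mat_unit n m p"
  have c: "x + t \<cdot>\<^sub>m ?u \<in> carrier_mat n m" using assms(3) mat_unit_carrier[of n m p] by auto
  have "(\<lambda>s::real. ?F ((x + t \<cdot>\<^sub>m ?u) + s \<cdot>\<^sub>m ?u)) differentiable (at 0)"
    using S assms c unfolding schwartz_mat_def by blast
  then have "((\<lambda>s. ?F ((x + t \<cdot>\<^sub>m ?u) + s \<cdot>\<^sub>m ?u))
      has_vector_derivative mat_partial n m p ?F (x + t \<cdot>\<^sub>m ?u)) (at 0)"
    unfolding mat_partial_def using vector_derivative_works by blast
  moreover have "(x + t \<cdot>\<^sub>m ?u) + s \<cdot>\<^sub>m ?u = x + (s + t) \<cdot>\<^sub>m ?u" for s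
    using assms(3) mat_unit_carrier[of n m p] by (intro eq_matI) (auto simp: algebra_simps)
  ultimately have "((\<lambda>s. ?F (x + (s + t) \<cdot>\<^sub>m ?u)) has_vector_derivative
      mat_partials n m (p # ps) \<phi> (x + t \<cdot>\<^sub>m ?u)) (at 0)"
    by (simp add: mat_partials_def)
  then have "((\<lambda>s. ?F (x + (s + t) \<cdot>\<^sub>m ?u)) has_vector_derivative mat_partials n m
      (p # ps) \<phi> (x + t \<cdot>\<^sub>m ?u)) (at (t - t))" by simp
  moreover have "((\<lambda>s. s - t) has_vector_derivative 1) (at t)"
    by (auto intro!: derivative_eq_intros)
  ultimately show ?thesis
    using vector_diff_chain_at[of "\<lambda>s. s - t" 1 t "\<lambda>s. ?F (x + (s + t) \<cdot>\<^sub>m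
        ?u)"] by (simp add: o_def)
qed

lemma schwartz_increment:
  assumes ps: "set ps \<subseteq> entries n m" "p \<in> entries n m" "x \<in> carrier_mat n m"
    and B: "\<And>s. \<bar>s\<bar> \<le> \<bar>t\<bar> \<Longrightarrow> norm (mat_partials n m (p #
        ps) \<phi> (x + s \<cdot>\<^sub>m mat_unit n m p)) \<le> B"
  shows "norm (mat_partials n m ps \<phi> (x + t \<cdot>\<^sub>m mat_unit n m p) - mat_partials n m ps
      \<phi> x) \<le> \<bar>t\<bar> * B"
proof -
  let ?F = "mat_partials n m ps \<phi>" and ?D = "mat_partials n m (p # ps) \<phi>" and ?u = "mat_unit n m p"
  define h where "h s = ?F (x + s \<cdot>\<^sub>m ?u)" for s
  have h': "(h has_vector_derivative ?D (x + s \<cdot>\<^sub>m ?u)) (at s)" for s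
    unfolding h_def by (rule schwartz_deriv[OF ps])
  then have cont: "continuous_on X h" for X
    by (meson continuous_at_imp_continuous_on has_vector_derivative_continuous)
  have h0: "h 0 = ?F x"
  proof -
    have "x + 0 \<cdot>\<^sub>m ?u = x" using ps(3) mat_unit_carrier[of n m p] by (intro eq_matI) auto
    then show ?thesis by (simp add: h_def)
  qed
  have *: "norm (h b - h a) \<le> (b - a) * B" if ab: "a < b" "\<And>s. a < s \<Longrightarrow> s < b
      \<Longrightarrow> \<bar>s\<bar> \<le> \<bar>t\<bar>" for a b
  proof -
    have "\<exists>s\<in>{a<..<b}. norm (h b - h a) \<le> norm ((b - a) *\<^sub>R ?D (x + s
        \<cdot>\<^sub>m ?u))"
      by (rule mvt_general[OF ab(1) cont]) (use h' in \<open>simp add: has_vector_derivative_def\<close>)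
    then obtain s where s: "s \<in> {a<..<b}" "norm (h b - h a) \<le> norm ((b - a) *\<^sub>R ?D (x + s
        \<cdot>\<^sub>m ?u))" by blast
    note s(2)
    also have "norm ((b - a) *\<^sub>R ?D (x + s \<cdot>\<^sub>m ?u)) \<le> (b - a) * B" using ab s(1)
        B[of s] by (auto intro!: mult_left_mono)
    finally show ?thesis .
  qed
  consider "t = 0" | "t > 0" | "t < 0" by linarith
  then have "norm (h t - h 0) \<le> \<bar>t\<bar> * B"
  proof cases
    case 3
    then show ?thesis using *[of t 0] by (auto simp: norm_minus_commute)
  qed (use *[of 0 t] in auto)
  then show ?thesis unfolding h0 by (simp add: h_def)
qed

text \<open>The difference is telescoped along a path that changes one entry at a time; boundedness
  of the next partial derivatives supplies the constant. The induction runs over a set J of entries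
  outside which x and y agree.\<close>

lemma schwartz_lipschitz:
  assumes ps: "set ps \<subseteq> entries n m"
  shows "\<exists>L\<ge>0. \<forall>x\<in>carrier_mat n m. \<forall>y\<in>carrier_mat n m.
    norm (mat_partials n m ps \<phi> x - mat_partials n m ps \<phi> y) \<le> L * (\<Sum>p\<in>entries n
        m. \<bar>x $$ p - y $$ p\<bar>)"
proof -
  let ?F = "mat_partials n m ps \<phi>"
  have "\<forall>p\<in>entries n m. \<exists>B\<ge>0. \<forall>x\<in>carrier_mat n m. norm
      (mat_partials n m (p # ps) \<phi> x) \<le> B"
  proof
    fix p assume "p \<in> entries n m"
    then have "rapid n m (mat_partials n m (p # ps) \<phi>)" using ps by (intro schwartz_rapid) auto
    from rapid_bound[OF this, of 0] show "\<exists>B\<ge>0. \<forall>x\<in>carrier_mat n m. norm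
        (mat_partials n m (p # ps) \<phi> x) \<le> B" by (auto simp: wt_def)
  qed
  then obtain B where B: "\<And>p. p \<in> entries n m \<Longrightarrow> B p \<ge> 0"
    "\<And>p x. p \<in> entries n m \<Longrightarrow> x \<in> carrier_mat n m \<Longrightarrow> norm
        (mat_partials n m (p # ps) \<phi> x) \<le> B p" by metis
  define L where "L = (\<Sum>p\<in>entries n m. B p)"
  have BL: "B p \<le> L" if "p \<in> entries n m" for p
    unfolding L_def using that B(1) by (intro member_le_sum) auto
  have L0: "L \<ge> 0" unfolding L_def using B(1) by (intro sum_nonneg) auto
  have main: "norm (?F x - ?F y) \<le> L * (\<Sum>p\<in>J. \<bar>x $$ p - y $$ p\<bar>)"
    if "finite J" "J \<subseteq> entries n m" "x \<in> carrier_mat n m" "y \<in> carrier_mat n m"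
      "\<And>p. p \<in> entries n m \<Longrightarrow> p \<notin> J \<Longrightarrow> x $$ p = y $$ p" for J x y
    using that
  proof (induction J arbitrary: y rule: finite_induct)
    case empty
    then have "x = y" by (intro eq_matI) auto
    then show ?case by simp
  next
    case (insert p J)
    let ?u = "mat_unit n m p"
    \<comment> \<open>z has the entry p of x and the other entries of y, so the induction hypothesis
      covers x and z, and one increment covers z and y.\<close>
    define z where "z = y + (x $$ p - y $$ p) \<cdot>\<^sub>m ?u"
    have p: "p \<in> entries n m" using insert by auto
    have z: "z \<in> carrier_mat n m" using insert.prems(3) mat_unit_carrier[of n m p] by (auto simp: z_def)
    have zi: "z $$ q = (if q = p then x $$ p else y $$ q)" if "q \<in> entries n m" for q
      using that insert.prems(3) mat_unit_carrier[of n m p] by (cases q) (auto simp: z_def mat_unit_index)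
    have 1: "norm (?F x - ?F z) \<le> L * (\<Sum>q\<in>J. \<bar>x $$ q - z $$ q\<bar>)"
      using insert.prems z zi by (intro insert.IH) auto
    also have "(\<Sum>q\<in>J. \<bar>x $$ q - z $$ q\<bar>) = (\<Sum>q\<in>J. \<bar>x $$ q - y $$ q\<bar>)"
      using insert.hyps insert.prems zi by (intro sum.cong) auto
    finally have 1: "norm (?F x - ?F z) \<le> L * (\<Sum>q\<in>J. \<bar>x $$ q - y $$ q\<bar>)" .
    have "norm (?F z - ?F y) \<le> \<bar>x $$ p - y $$ p\<bar> * L"
      unfolding z_def
    proof (rule schwartz_increment[OF ps p insert.prems(3)])
      fix s :: real
      have "y + s \<cdot>\<^sub>m ?u \<in> carrier_mat n m" using insert.prems(3) mat_unit_carrier[of n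
          m p] by auto
      then show "norm (mat_partials n m (p # ps) \<phi> (y + s \<cdot>\<^sub>m ?u)) \<le> L"
        using B(2)[OF p] BL[OF p] by (meson order_trans)
    qed
    moreover have "norm (?F x - ?F y) \<le> norm (?F x - ?F z) + norm (?F z - ?F y)"
      using norm_triangle_ineq[of "?F x - ?F z" "?F z - ?F y"] by simp
    ultimately show ?case using 1 insert.hyps by (simp add: algebra_simps)
  qed
  show ?thesis using L0 by (intro exI[of _ L] conjI ballI main) auto
qed

lemma schwartz_seq_continuous:
  assumes ps: "set ps \<subseteq> entries n m" and X: "\<And>N. X N \<in> carrier_mat n m" "x \<in>
      carrier_mat n m"
    and lim: "\<And>p. p \<in> entries n m \<Longrightarrow> (\<lambda>N. X N $$ p)
        \<longlonglongrightarrow> x $$ p"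
  shows "(\<lambda>N. mat_partials n m ps \<phi> (X N)) \<longlonglongrightarrow> mat_partials n m ps \<phi> x"
proof -
  obtain L where L: "L \<ge> 0" "\<And>x y. x \<in> carrier_mat n m \<Longrightarrow> y \<in>
      carrier_mat n m \<Longrightarrow>
    norm (mat_partials n m ps \<phi> x - mat_partials n m ps \<phi> y) \<le> L * (\<Sum>p\<in>entries n
        m. \<bar>x $$ p - y $$ p\<bar>)"
    using schwartz_lipschitz[OF ps] by blast
  have "(\<lambda>N. L * (\<Sum>p\<in>entries n m. \<bar>X N $$ p - x $$ p\<bar>))
      \<longlonglongrightarrow> L * (\<Sum>p\<in>entries n m. \<bar>x $$ p - x $$ p\<bar>)"
    by (intro tendsto_intros lim)
  then have "(\<lambda>N. L * (\<Sum>p\<in>entries n m. \<bar>X N $$ p - x $$ p\<bar>))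
      \<longlonglongrightarrow> 0" by simp
  then have "(\<lambda>N. mat_partials n m ps \<phi> (X N) - mat_partials n m ps \<phi> x)
      \<longlonglongrightarrow> 0"
    by (rule Lim_null_comparison[rotated]) (use L(2) X in auto)
  then show ?thesis by (rule LIM_zero_cancel)
qed

text \<open>The Lipschitz estimate gives continuity on the space of all real functions on pairs of
  naturals, whose Borel sets form the countable product sigma-algebra. Matrices are embedded there
  by padding with zeros.\<close>

lemma schwartz_measurable:
  assumes ps: "set ps \<subseteq> entries n m"
  shows "mat_partials n m ps \<phi> \<in> borel_measurable (mat_borel n m)"
proof -
  let ?F = "mat_partials n m ps \<phi>"
  obtain L where L: "L \<ge> 0" "\<And>x y. x \<in> carrier_mat n m \<Longrightarrow> y \<in>
      carrier_mat n m \<Longrightarrow>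
    norm (?F x - ?F y) \<le> L * (\<Sum>p\<in>entries n m. \<bar>x $$ p - y $$ p\<bar>)"
    using schwartz_lipschitz[OF ps] by blast
  define g :: "(nat \<times> nat \<Rightarrow> real) \<Rightarrow> complex" where "g w = ?F (mat n m w)" for w
  have "isCont g w" for w
    unfolding isCont_def
  proof (rule LIM_zero_cancel, rule Lim_null_comparison)
    show "eventually (\<lambda>v. norm (g v - g w) \<le> L * (\<Sum>p\<in>entries n m. \<bar>v p - w
        p\<bar>)) (at w)"
    proof (intro always_eventually allI)
      fix v
      have "norm (g v - g w) \<le> L * (\<Sum>p\<in>entries n m. \<bar>mat n m v $$ p - mat n m w $$ p\<bar>)"
        unfolding g_def by (rule L(2)) auto
      also have "(\<Sum>p\<in>entries n m. \<bar>mat n m v $$ p - mat n m w $$ p\<bar>) =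
          (\<Sum>p\<in>entries n m. \<bar>v p - w p\<bar>)"
        by (intro sum.cong) auto
      finally show "norm (g v - g w) \<le> L * (\<Sum>p\<in>entries n m. \<bar>v p - w p\<bar>)" .
    qed
    have "((\<lambda>v. v p) \<longlongrightarrow> w p) (at w)" for p
      by (metis continuous_on_eq_continuous_at continuous_on_product_coordinates isCont_def open_UNIV UNIV_I)
    then have "((\<lambda>v. L * (\<Sum>p\<in>entries n m. \<bar>v p - w p\<bar>))
        \<longlongrightarrow> L * (\<Sum>p\<in>entries n m. \<bar>w p - w p\<bar>)) (at w)"
      by (intro tendsto_intros)
    then show "((\<lambda>v. L * (\<Sum>p\<in>entries n m. \<bar>v p - w p\<bar>))
        \<longlongrightarrow> 0) (at w)" by simp
  qed
  then have "g \<in> borel_measurable borel"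
    by (intro borel_measurable_continuous_onI) (simp add: continuous_on_eq_continuous_at)
  then have g: "g \<in> borel_measurable (Pi\<^sub>M UNIV (\<lambda>_. borel))"
    by (subst measurable_cong_sets[OF sets_PiM_equal_borel refl])
  have "(\<lambda>x p. if p \<in> entries n m then x $$ p else 0) \<in> mat_borel n m
      \<rightarrow>\<^sub>M Pi\<^sub>M UNIV (\<lambda>_. borel :: real measure)"
  proof (rule measurable_PiM_single')
    fix p :: "nat \<times> nat"
    show "(\<lambda>x. if p \<in> entries n m then x $$ p else 0) \<in> borel_measurable (mat_borel n m)"
      using entry_measurable[of "fst p" n "snd p" m] by (cases "p \<in> entries n m") auto
  qed auto
  from measurable_compose[OF this g]
  have "(\<lambda>x. g (\<lambda>p. if p \<in> entries n m then x $$ p else 0)) \<in> borel_measurable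
      (mat_borel n m)" .
  moreover have "g (\<lambda>p. if p \<in> entries n m then x $$ p else 0) = ?F x" if "x \<in>
      carrier_mat n m" for x
  proof -
    have "mat n m (\<lambda>p. if p \<in> entries n m then x $$ p else 0) = x" using that by (intro
        eq_matI) auto
    then show ?thesis by (simp add: g_def)
  qed
  ultimately show ?thesis by (subst measurable_cong[of "mat_borel n m" ?F "\<lambda>x. g (\<lambda>p.
      if p \<in> entries n m then x $$ p else 0)"]) auto
qed

end

subsection \<open>The Fourier transform of Schwartz functions\<close>

definition ip :: "real mat \<Rightarrow> real mat \<Rightarrow> real" where
  "ip y x = mat_tr (transpose_mat y * x)"

text \<open>\<open>fourier_mat\<close> over the measure before completion, so that Fubini's theorem
  and images of measures apply directly.\<close>

definition Ft :: "nat \<Rightarrow> nat \<Rightarrow> (real mat \<Rightarrow> complex) \<Rightarrow>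
    real mat \<Rightarrow> complex" where
  "Ft n m f y = (LINT x|lmat n m. exp (\<i> * complex_of_real (ip y x)) * f x)"

lemma ip_eq:
  assumes "y \<in> carrier_mat n m" "x \<in> carrier_mat n m"
  shows "ip y x = (\<Sum>p\<in>entries n m. y $$ p * x $$ p)"
proof -
  have "ip y x = (\<Sum>j<m. \<Sum>i<n. y $$ (i,j) * x $$ (i,j))"
    using assms mult_mat_index[of "transpose_mat y" m n x m] by (auto simp: ip_def mat_tr_def intro!: sum.cong)
  also have "\<dots> = (\<Sum>p\<in>entries n m. y $$ p * x $$ p)"
    by (subst sum.swap) (simp add: sum.cartesian_product case_prod_beta')
  finally show ?thesis .
qed

lemma ip_measurable:
  assumes "Y \<in> N \<rightarrow>\<^sub>M mat_borel n m" "X \<in> N \<rightarrow>\<^sub>M mat_borel n m"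
  shows "(\<lambda>w. ip (Y w) (X w)) \<in> borel_measurable N"
  unfolding ip_def by (rule mat_tr_measurable[OF mat_mult_measurable[OF mat_transpose_measurable[OF
      assms(1)] assms(2)]])

lemma exp_ip_measurable:
  assumes "Y \<in> N \<rightarrow>\<^sub>M mat_borel n m" "X \<in> N \<rightarrow>\<^sub>M mat_borel n m"
  shows "(\<lambda>w. exp (\<i> * complex_of_real (ip (Y w) (X w)))) \<in> borel_measurable N"
proof -
  have [measurable]: "(\<lambda>w. ip (Y w) (X w)) \<in> borel_measurable N" by (rule ip_measurable[OF assms])
  show ?thesis by measurable
qed

lemma norm_exp_ip [simp]: "norm (exp (\<i> * complex_of_real t)) = 1"
  by (simp add: norm_exp_eq_Re)

lemma fourier_mat_eq:
  assumes f: "f \<in> borel_measurable (mat_borel n m)" and y: "y \<in> carrier_mat n m"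
  shows "fourier_mat n m f y = Ft n m f y"
  unfolding fourier_mat_def Ft_def mat_lebesgue_eq ip_def[symmetric]
  by (rule integral_completion)
    (simp add: borel_measurable_times exp_ip_measurable[OF mat_const_measurable[OF y]
        measurable_ident_sets[OF refl]] f)

text \<open>For z = x + s e_p with |s| <= 1 one has |x|^2 <= 2|z|^2 + 2, hence 1 + |x|^2 <= 3(1 +
  |z|^2). This yields one majorant for all difference quotients with step at most 1.\<close>

lemma wt_shift:
  assumes x: "x \<in> carrier_mat n m" and p: "p \<in> entries n m" and s: "\<bar>s\<bar> \<le> 1"
  shows "wt N (x + s \<cdot>\<^sub>m mat_unit n m p) \<le> 3 ^ N * wt N x"
proof -
  let ?z = "x + s \<cdot>\<^sub>m mat_unit n m p"
  have z: "?z \<in> carrier_mat n m" using x mat_unit_carrier[of n m p] by auto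
  have zi: "?z $$ q = x $$ q + (if q = p then s else 0)" if "q \<in> entries n m" for q
    using that x mat_unit_carrier[of n m p] by (cases q) (auto simp: mat_unit_index)
  have sq: "u\<^sup>2 \<le> 2 * (u + v)\<^sup>2 + 2 * v\<^sup>2" for u v :: real
  proof -
    have "0 \<le> (u + 2 * v)\<^sup>2" by simp
    then show ?thesis by (simp add: power2_eq_square algebra_simps)
  qed
  have "fsq x \<le> (\<Sum>q\<in>entries n m. 2 * (?z $$ q)\<^sup>2 + 2 * (if q = p then s else 0)\<^sup>2)"
    unfolding fsq_entries[OF x] by (intro sum_mono) (use sq zi in metis)
  also have "\<dots> = 2 * fsq ?z + 2 * (\<Sum>q\<in>entries n m. (if q = p then s else 0)\<^sup>2)"
    unfolding fsq_entries[OF z] by (simp add: sum.distrib sum_distrib_left)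
  also have "(\<Sum>q\<in>entries n m. (if q = p then s else 0)\<^sup>2) = (\<Sum>q\<in>entries n m. if
      q = p then s\<^sup>2 else 0)"
    by (intro sum.cong) auto
  also have "\<dots> = s\<^sup>2" using p by simp
  also have "2 * fsq ?z + 2 * s\<^sup>2 \<le> 2 * fsq ?z + 2" using s by (simp add: abs_square_le_1)
  finally have "1 + fsq x \<le> 3 * (1 + fsq ?z)" using fsq_nonneg[of ?z] by simp
  then have "(1 + fsq x) ^ N \<le> (3 * (1 + fsq ?z)) ^ N" using fsq_nonneg[of x] by (intro power_mono) auto
  then have le: "(1 + fsq x) ^ N \<le> 3 ^ N * (1 + fsq ?z) ^ N" by (simp only: power_mult_distrib)
  have p: "(1 + fsq x) ^ N > 0" "(1 + fsq ?z) ^ N > 0" using fsq_nonneg[of x] fsq_nonneg[of ?z] by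
      (auto intro: zero_less_power add_pos_nonneg)
  show ?thesis unfolding wt_def using le p by (simp only: divide_inverse[symmetric] inverse_eq_divide
      pos_divide_le_eq pos_le_divide_eq times_divide_eq_right times_divide_eq_left mult_1_right mult_1_left)
qed

lemma integral_lmat_translate:
  fixes f :: "real mat \<Rightarrow> complex"
  assumes f: "f \<in> borel_measurable (mat_borel n m)" and t: "t \<in> carrier_mat n m"
  shows "(LINT x|lmat n m. f (t + x)) = (LINT x|lmat n m. f x)"
proof -
  have one: "1 \<cdot>\<^sub>m z = z" for z :: "real mat" by (rule eq_matI) auto
  have meas: "(\<lambda>x. t + 1 \<cdot>\<^sub>m x) \<in> lmat n m \<rightarrow>\<^sub>M mat_borel n m"
    unfolding one by (simp add: mat_add_measurable[OF mat_const_measurable[OF t]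
        measurable_ident_sets[OF refl]])
  have "lmat n m = distr (lmat n m) (mat_borel n m) (\<lambda>x. t + 1 \<cdot>\<^sub>m x)"
    using lmat_affine[OF t, of 1] by (simp add: density_1)
  then have "(LINT x|lmat n m. f x) = (LINT x|distr (lmat n m) (mat_borel n m) (\<lambda>x. t + 1
      \<cdot>\<^sub>m x). f x)" by simp
  also have "\<dots> = (LINT x|lmat n m. f (t + 1 \<cdot>\<^sub>m x))" by (rule integral_distr[OF meas f])
  finally show ?thesis unfolding one by simp
qed

context
  fixes n m :: nat and \<phi> :: "real mat \<Rightarrow> complex"
  assumes S: "schwartz_mat n m \<phi>"
begin

lemma schwartz_integrable:
  assumes "set ps \<subseteq> entries n m"
  shows "integrable (lmat n m) (mat_partials n m ps \<phi>)"
proof -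
  obtain C where C: "C \<ge> 0" "\<And>x. x \<in> carrier_mat n m \<Longrightarrow> norm (mat_partials
      n m ps \<phi> x) \<le> C * wt (n * m) x"
    using rapid_bound[OF schwartz_rapid[OF S assms]] by blast
  show ?thesis
  proof (rule Bochner_Integration.integrable_bound)
    show "integrable (lmat n m) (\<lambda>x. C * wt (n * m) x)" by (intro integrable_mult_right
        wt_integrable order_refl)
    show "AE x in lmat n m. norm (mat_partials n m ps \<phi> x) \<le> norm (C * wt (n * m) x)"
      using C wt_pos by (intro AE_I2) (simp add: abs_mult less_imp_le)
  qed (simp add: schwartz_measurable[OF S assms])
qed

text \<open>A translate along a coordinate has the same transform up to a phase, so the transform of
  the difference quotient with step t is (exp(-i t y_p) - 1)/t times that of the function. Steps
  1/(N + 1) give the factor -i y_p in the limit; the majorant comes from the mean value inequality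
  and \<open>wt_shift\<close>.\<close>

lemma Ft_partial:
  assumes ps: "set ps \<subseteq> entries n m" and p: "p \<in> entries n m" and y: "y \<in> carrier_mat n m"
  shows "Ft n m (mat_partials n m (p # ps) \<phi>) y = - \<i> * complex_of_real (y $$ p) * Ft n m
      (mat_partials n m ps \<phi>) y"
proof -
  note id = measurable_ident_sets[OF refl]
  let ?F = "mat_partials n m ps \<phi>" and ?D = "mat_partials n m (p # ps) \<phi>" and ?u = "mat_unit n m p"
  let ?e = "\<lambda>x. exp (\<i> * complex_of_real (ip y x))"
  define t where "t N = inverse (real (Suc N))" for N
  have t: "t N > 0" "t N \<le> 1" "t N \<noteq> 0" for N by (auto simp: t_def inverse_le_1_iff)
  have t0: "t \<longlonglongrightarrow> 0" unfolding t_def by (rule LIMSEQ_inverse_real_of_nat)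
  have pps: "set (p # ps) \<subseteq> entries n m" using ps p by auto
  note Fm = schwartz_measurable[OF S ps] and Dm = schwartz_measurable[OF S pps]
  have em: "?e \<in> borel_measurable (mat_borel n m)" by (rule exp_ip_measurable[OF
      mat_const_measurable[OF y] id])
  have u: "s \<cdot>\<^sub>m ?u \<in> carrier_mat n m" for s using mat_unit_carrier[of n m p] by auto
  have um: "(\<lambda>x. x + s \<cdot>\<^sub>m ?u) \<in> mat_borel n m \<rightarrow>\<^sub>M mat_borel
      n m" for s
    by (rule mat_add_measurable[OF id mat_const_measurable[OF u]])
  obtain C where C: "C \<ge> 0" "\<And>x. x \<in> carrier_mat n m \<Longrightarrow> norm (?D x) \<le> C
      * wt (n * m) x"
    using rapid_bound[OF schwartz_rapid[OF S pps]] by blast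
  define q where "q N x = ?e x * ((?F (x + t N \<cdot>\<^sub>m ?u) - ?F x) / complex_of_real (t N))" for N x
  have qm: "q N \<in> borel_measurable (mat_borel n m)" for N
    unfolding q_def by (intro borel_measurable_times em borel_measurable_divide borel_measurable_diff
        measurable_compose[OF um Fm] Fm borel_measurable_const)
  have lim1: "(\<lambda>N. LINT x|lmat n m. q N x) \<longlonglongrightarrow> (LINT x|lmat n m. ?e x * ?D x)"
  proof (rule integral_dominated_convergence[where w = "\<lambda>x. C * (3 ^ (n * m) * wt (n * m) x)"])
    show "integrable (lmat n m) (\<lambda>x. C * (3 ^ (n * m) * wt (n * m) x))" by (intro
        integrable_mult_right wt_integrable order_refl)
    show "(\<lambda>x. ?e x * ?D x) \<in> borel_measurable (lmat n m)" using borel_measurable_times[OF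
        em Dm] by simp
    show "q N \<in> borel_measurable (lmat n m)" for N using qm by simp
    show "AE x in lmat n m. (\<lambda>N. q N x) \<longlonglongrightarrow> ?e x * ?D x"
    proof (rule AE_I2)
      fix x assume "x \<in> space (lmat n m)"
      then have x: "x \<in> carrier_mat n m" by simp
      have "x + 0 \<cdot>\<^sub>m ?u = x" using x mat_unit_carrier[of n m p] by (intro eq_matI) auto
      then have "((\<lambda>t. ?F (x + t \<cdot>\<^sub>m ?u)) has_vector_derivative ?D x) (at 0)"
        using schwartz_deriv[OF S ps p x, of 0] by simp
      then have "((\<lambda>s. norm (?F (x + s \<cdot>\<^sub>m ?u) - ?F (x + 0 \<cdot>\<^sub>m ?u) - s
          *\<^sub>R ?D x) / norm s) \<longlongrightarrow> 0) (at 0)"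
        unfolding has_vector_derivative_def has_derivative_at by simp
      then have "(\<lambda>N. norm (?F (x + t N \<cdot>\<^sub>m ?u) - ?F (x + 0 \<cdot>\<^sub>m ?u) - t
          N *\<^sub>R ?D x) / norm (t N)) \<longlonglongrightarrow> 0"
        by (rule filterlim_compose) (use t0 t(3) in \<open>auto simp: filterlim_at\<close>)
      moreover have "norm (?F (x + t N \<cdot>\<^sub>m ?u) - ?F (x + 0 \<cdot>\<^sub>m ?u) - t N
          *\<^sub>R ?D x) / norm (t N) =
          norm ((?F (x + t N \<cdot>\<^sub>m ?u) - ?F x) / complex_of_real (t N) - ?D x)" for N
      proof -
        have "(?F (x + t N \<cdot>\<^sub>m ?u) - ?F x) / complex_of_real (t N) - ?D x = (?F (x + t N
            \<cdot>\<^sub>m ?u) - ?F x - t N *\<^sub>R ?D x) / complex_of_real (t N)"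
          using t(3)[of N] by (simp add: scaleR_conv_of_real diff_divide_distrib)
        then show ?thesis using \<open>x + 0 \<cdot>\<^sub>m ?u = x\<close> by (simp add: norm_divide)
      qed
      ultimately have "(\<lambda>N. (?F (x + t N \<cdot>\<^sub>m ?u) - ?F x) / complex_of_real (t N) -
          ?D x) \<longlonglongrightarrow> 0"
        by (simp add: tendsto_norm_zero_iff)
      then have "(\<lambda>N. (?F (x + t N \<cdot>\<^sub>m ?u) - ?F x) / complex_of_real (t N))
          \<longlonglongrightarrow> ?D x" by (rule LIM_zero_cancel)
      then show "(\<lambda>N. q N x) \<longlonglongrightarrow> ?e x * ?D x" unfolding q_def by (intro
          tendsto_intros)
    qed
    show "AE x in lmat n m. norm (q N x) \<le> C * (3 ^ (n * m) * wt (n * m) x)" for N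
    proof (rule AE_I2)
      fix x assume "x \<in> space (lmat n m)"
      then have x: "x \<in> carrier_mat n m" by simp
      have "norm (?F (x + t N \<cdot>\<^sub>m ?u) - ?F x) \<le> \<bar>t N\<bar> * (C * (3 ^ (n * m) *
          wt (n * m) x))"
      proof (rule schwartz_increment[OF S ps p x])
        fix s assume "\<bar>s\<bar> \<le> \<bar>t N\<bar>"
        then have s: "\<bar>s\<bar> \<le> 1" using t[of N] by simp
        have "norm (?D (x + s \<cdot>\<^sub>m ?u)) \<le> C * wt (n * m) (x + s \<cdot>\<^sub>m ?u)"
            using x u[of s] by (intro C(2)) auto
        also have "\<dots> \<le> C * (3 ^ (n * m) * wt (n * m) x)" by (intro mult_left_mono wt_shift x p s C(1))
        finally show "norm (?D (x + s \<cdot>\<^sub>m ?u)) \<le> C * (3 ^ (n * m) * wt (n * m) x)" .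
      qed
      then show "norm (q N x) \<le> C * (3 ^ (n * m) * wt (n * m) x)"
        using t(1)[of N] by (simp add: q_def norm_mult norm_divide pos_divide_le_eq mult_ac)
    qed
  qed
  have eqn: "(LINT x|lmat n m. q N x) = (exp (- \<i> * complex_of_real (t N * y $$ p)) - 1) /
      complex_of_real (t N) * Ft n m ?F y" for N
  proof -
    have iF: "integrable (lmat n m) (\<lambda>x. ?e x * ?F x)"
      by (rule Bochner_Integration.integrable_bound[OF schwartz_integrable[OF ps]])
        (use borel_measurable_times[OF em Fm] in \<open>auto simp: norm_mult\<close>)
    define E where "E = exp (- \<i> * complex_of_real (t N * y $$ p))"
    have sh: "?e x * ?F (x + t N \<cdot>\<^sub>m ?u) = E * (?e (t N \<cdot>\<^sub>m ?u + x) * ?F (t N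
        \<cdot>\<^sub>m ?u + x))" if x: "x \<in> carrier_mat n m" for x
    proof -
      have c: "t N \<cdot>\<^sub>m ?u + x = x + t N \<cdot>\<^sub>m ?u" using x u by (intro comm_add_mat) auto
      have "ip y (x + t N \<cdot>\<^sub>m ?u) = ip y x + t N * y $$ p"
      proof -
        have xu: "x + t N \<cdot>\<^sub>m ?u \<in> carrier_mat n m" using x u by auto
        have "ip y (x + t N \<cdot>\<^sub>m ?u) = (\<Sum>q\<in>entries n m. y $$ q * x $$ q + (if q = p
            then t N * y $$ p else 0))"
          unfolding ip_eq[OF y xu]
        proof (intro sum.cong refl)
          fix q assume "q \<in> entries n m"
          then show "y $$ q * (x + t N \<cdot>\<^sub>m ?u) $$ q = y $$ q * x $$ q + (if q = p then t N
              * y $$ p else 0)"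
            using x mat_unit_carrier[of n m p] by (cases q) (auto simp: mat_unit_index algebra_simps)
        qed
        then show ?thesis using p by (simp add: ip_eq[OF y x] sum.distrib)
      qed
      then have "?e (x + t N \<cdot>\<^sub>m ?u) = ?e x * exp (\<i> * complex_of_real (t N * y $$ p))"
        by (simp add: ring_distribs exp_add)
      then have "E * ?e (x + t N \<cdot>\<^sub>m ?u) = ?e x" by (simp add: E_def exp_minus)
      then show ?thesis unfolding c by (simp flip: mult.assoc)
    qed
    have m1: "(\<lambda>x. ?e x * ?F x) \<in> borel_measurable (mat_borel n m)" by (rule
        borel_measurable_times[OF em Fm])
    have I: "(LINT x|lmat n m. ?e x * ?F (x + t N \<cdot>\<^sub>m ?u)) = E * Ft n m ?F y"
    proof -
      have "(LINT x|lmat n m. ?e x * ?F (x + t N \<cdot>\<^sub>m ?u)) = (LINT x|lmat n m. E * (?e (t N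
          \<cdot>\<^sub>m ?u + x) * ?F (t N \<cdot>\<^sub>m ?u + x)))"
        by (intro Bochner_Integration.integral_cong) (use sh in auto)
      also have "\<dots> = E * (LINT x|lmat n m. ?e (t N \<cdot>\<^sub>m ?u + x) * ?F (t N
          \<cdot>\<^sub>m ?u + x))" by simp
      also have "(LINT x|lmat n m. ?e (t N \<cdot>\<^sub>m ?u + x) * ?F (t N \<cdot>\<^sub>m ?u + x)) =
          Ft n m ?F y"
        unfolding Ft_def by (rule integral_lmat_translate[OF m1 u])
      finally show ?thesis .
    qed
    have iS: "integrable (lmat n m) (\<lambda>x. ?e x * ?F (x + t N \<cdot>\<^sub>m ?u))"
    proof -
      have "integrable (lmat n m) (\<lambda>x. ?F (x + t N \<cdot>\<^sub>m ?u))"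
      proof -
        obtain C' where C': "C' \<ge> 0" "\<And>x. x \<in> carrier_mat n m \<Longrightarrow> norm (?F
            x) \<le> C' * wt (n * m) x"
          using rapid_bound[OF schwartz_rapid[OF S ps]] by blast
        show ?thesis
        proof (rule Bochner_Integration.integrable_bound)
          show "integrable (lmat n m) (\<lambda>x. C' * (3 ^ (n * m) * wt (n * m) x))" by (intro
              integrable_mult_right wt_integrable order_refl)
          show "(\<lambda>x. ?F (x + t N \<cdot>\<^sub>m ?u)) \<in> borel_measurable (lmat n m)" using
              measurable_compose[OF um Fm] by simp
          show "AE x in lmat n m. norm (?F (x + t N \<cdot>\<^sub>m ?u)) \<le> norm (C' * (3 ^ (n * m)
              * wt (n * m) x))"
          proof (rule AE_I2)
            fix x assume "x \<in> space (lmat n m)"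
            then have x: "x \<in> carrier_mat n m" by simp
            have "norm (?F (x + t N \<cdot>\<^sub>m ?u)) \<le> C' * wt (n * m) (x + t N \<cdot>\<^sub>m
                ?u)" using x u by (intro C'(2)) auto
            also have "\<dots> \<le> C' * (3 ^ (n * m) * wt (n * m) x)" using t[of N] by (intro
                mult_left_mono wt_shift x p C'(1)) auto
            finally show "norm (?F (x + t N \<cdot>\<^sub>m ?u)) \<le> norm (C' * (3 ^ (n * m) * wt (n
                * m) x))" by simp
          qed
        qed
      qed
      then show ?thesis
        by (rule Bochner_Integration.integrable_bound)
          (use borel_measurable_times[OF em measurable_compose[OF um Fm]] in \<open>auto simp:
              norm_mult\<close>)
    qed
    have "(LINT x|lmat n m. q N x) = (LINT x|lmat n m. (?e x * ?F (x + t N \<cdot>\<^sub>m ?u) - ?e x *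
        ?F x) / complex_of_real (t N))"
      by (intro Bochner_Integration.integral_cong) (auto simp: q_def right_diff_distrib diff_divide_distrib)
    also have "\<dots> = ((LINT x|lmat n m. ?e x * ?F (x + t N \<cdot>\<^sub>m ?u)) - (LINT x|lmat n m.
        ?e x * ?F x)) / complex_of_real (t N)"
      using iS iF by simp
    also have "\<dots> = (E - 1) / complex_of_real (t N) * Ft n m ?F y"
      unfolding I by (simp add: Ft_def left_diff_distrib)
    finally show ?thesis by (simp add: E_def)
  qed
  have lim2: "(\<lambda>N. (exp (- \<i> * complex_of_real (t N * y $$ p)) - 1) / complex_of_real (t N)
      * Ft n m ?F y)
      \<longlonglongrightarrow> - \<i> * complex_of_real (y $$ p) * Ft n m ?F y"
  proof -
    have "((\<lambda>z. exp (- \<i> * complex_of_real (y $$ p) * z)) has_field_derivative - \<i> *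
        complex_of_real (y $$ p)) (at 0)"
      by (auto intro!: derivative_eq_intros)
    then have "((\<lambda>z. (exp (- \<i> * complex_of_real (y $$ p) * z) - 1) / z)
        \<longlongrightarrow> - \<i> * complex_of_real (y $$ p)) (at 0)"
      by (simp add: DERIV_def)
    moreover have "filterlim (\<lambda>N. complex_of_real (t N)) (at 0) sequentially"
      using t0 t(3) by (auto simp: filterlim_at intro: tendsto_of_real_iff[THEN iffD2, of _ 0, simplified])
    ultimately have "(\<lambda>N. (exp (- \<i> * complex_of_real (y $$ p) * complex_of_real (t N)) - 1)
        / complex_of_real (t N)) \<longlonglongrightarrow> - \<i> * complex_of_real (y $$ p)"
      by (rule filterlim_compose)
    then have "(\<lambda>N. (exp (- \<i> * complex_of_real (y $$ p) * complex_of_real (t N)) - 1) /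
        complex_of_real (t N) * Ft n m ?F y) \<longlonglongrightarrow> - \<i> * complex_of_real (y $$
        p) * Ft n m ?F y"
      by (intro tendsto_intros)
    then show ?thesis by (simp add: mult_ac)
  qed
  show ?thesis unfolding Ft_def[of n m ?D] by (rule LIMSEQ_unique[OF lim1[unfolded eqn] lim2])
qed

text \<open>Up to a unimodular constant, a monomial times the transform is the transform of a
  partial derivative, which is bounded by an L1 norm.\<close>

lemma Ft_rapid: "rapid n m (Ft n m \<phi>)"
  unfolding rapid_def
proof (intro allI impI)
  fix qs assume qs: "set qs \<subseteq> entries n m"
  have e: "norm (complex_of_real (\<Prod>q\<leftarrow>qs. y $$ q) * Ft n m \<phi> y) = norm (Ft n m
      (mat_partials n m qs \<phi>) y)"
    if y: "y \<in> carrier_mat n m" for y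
    using qs
  proof (induction qs)
    case Nil
    then show ?case by (simp add: mat_partials_def)
  next
    case (Cons q qs)
    then have "Ft n m (mat_partials n m (q # qs) \<phi>) y = - \<i> * complex_of_real (y $$ q) * Ft n m
        (mat_partials n m qs \<phi>) y"
      by (intro Ft_partial y) auto
    then show ?case using Cons by (simp add: norm_mult)
  qed
  have "norm (Ft n m (mat_partials n m qs \<phi>) y) \<le> (LINT x|lmat n m. norm (mat_partials n m qs
      \<phi> x))" for y
    unfolding Ft_def by (rule order_trans[OF integral_norm_bound]) (simp add: norm_mult)
  then show "bounded ((\<lambda>x. complex_of_real (\<Prod>q\<leftarrow>qs. x $$ q) * Ft n m \<phi> x)
      ` carrier_mat n m)"
    unfolding bounded_iff using e by auto
qed

end

subsection \<open>Integrals of Fourier transforms over subspaces\<close>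

lemma of_real_measurable:
  "f \<in> borel_measurable N \<Longrightarrow> (\<lambda>w. complex_of_real (f w)) \<in> borel_measurable N"
  by measurable

text \<open>The characteristic function of the standard normal distribution, rescaled.\<close>

lemma gauss_1d:
  fixes w :: real
  defines "f \<equiv> \<lambda>t. exp (\<i> * complex_of_real (w * t)) * complex_of_real (exp (-
      t\<^sup>2 / 2))"
  shows "integrable lborel f" "(LINT t|lborel. f t) = complex_of_real (sqrt (2 * pi) * exp (- w\<^sup>2 / 2))"
proof -
  have sd: "std_normal_density t *\<^sub>R exp (\<i> * complex_of_real (w * t)) = complex_of_real (1 /
      sqrt (2 * pi)) * f t" for t
    by (simp add: std_normal_density_def f_def scaleR_conv_of_real)
  have "integrable lborel (\<lambda>t. std_normal_density t *\<^sub>R exp (\<i> * complex_of_real (w * t)))"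
  proof (rule Bochner_Integration.integrable_bound)
    show "integrable lborel std_normal_density" by (rule integrable_normal_density) simp
  qed auto
  then have "integrable lborel (\<lambda>t. complex_of_real (sqrt (2 * pi)) * (complex_of_real (1 /
      sqrt (2 * pi)) * f t))"
    unfolding sd by (rule integrable_mult_right)
  then show "integrable lborel f" by (simp flip: mult.assoc of_real_mult)
  have "complex_of_real (exp (- (w\<^sup>2) / 2)) = char std_normal_distribution w"
    unfolding char_std_normal_distribution ..
  also have "\<dots> = (LINT t|lborel. std_normal_density t *\<^sub>R exp (\<i> * complex_of_real (w * t)))"
    unfolding char_def by (subst integral_density) auto
  also have "\<dots> = complex_of_real (1 / sqrt (2 * pi)) * (LINT t|lborel. f t)" unfolding sd by simp
  finally show "(LINT t|lborel. f t) = complex_of_real (sqrt (2 * pi) * exp (- w\<^sup>2 / 2))" by simp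
qed

definition gauss :: "real mat \<Rightarrow> real" where
  "gauss z = exp (- fsq z / 2)"

lemma gauss_measurable: "gauss \<in> borel_measurable (mat_borel a b)"
proof -
  have [measurable]: "fsq \<in> borel_measurable (mat_borel a b)"
    using fsq_measurable[OF measurable_ident_sets[OF refl]] by simp
  show ?thesis unfolding gauss_def by measurable
qed

lemma gauss_Ft:
  assumes w: "w \<in> carrier_mat a b"
  shows "integrable (lmat a b) (\<lambda>z. exp (\<i> * complex_of_real (ip w z)) * complex_of_real (gauss z))"
    and "(LINT z|lmat a b. exp (\<i> * complex_of_real (ip w z)) * complex_of_real (gauss z)) =
      complex_of_real (sqrt (2 * pi) ^ (a * b) * gauss w)"
proof -
  let ?f = "\<lambda>z. exp (\<i> * complex_of_real (ip w z)) * complex_of_real (gauss z)"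
  let ?g = "\<lambda>p t. exp (\<i> * complex_of_real (w $$ p * t)) * complex_of_real (exp (- t\<^sup>2 / 2))"
  have m: "?f \<in> borel_measurable (mat_borel a b)"
    using gauss_measurable[of a b]
    by (intro borel_measurable_times exp_ip_measurable[OF mat_const_measurable[OF w]
        measurable_ident_sets[OF refl]]) measurable
  have e: "?f (mat a b u) = (\<Prod>p\<in>entries a b. ?g p (u p))" for u
  proof -
    have "ip w (mat a b u) = (\<Sum>p\<in>entries a b. w $$ p * u p)"
      by (subst ip_eq[OF w]) (auto intro!: sum.cong)
    moreover have "gauss (mat a b u) = (\<Prod>p\<in>entries a b. exp (- (u p)\<^sup>2 / 2))"
      by (simp add: gauss_def fsq_mat exp_sum[symmetric] sum_negf sum_divide_distrib)
    ultimately show ?thesis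
      by (simp add: prod.distrib of_real_prod of_real_sum sum_distrib_left exp_sum)
  qed
  have "integrable (Pi\<^sub>M (entries a b) (\<lambda>_. lborel)) (\<lambda>u. \<Prod>p\<in>entries a
      b. ?g p (u p))"
    by (rule lb.product_integrable_prod) (use gauss_1d(1) in auto)
  then show "integrable (lmat a b) ?f"
    unfolding lmat_def by (subst integrable_distr_eq[OF mat_measurable m]) (simp only: e)
  have "(LINT z|lmat a b. ?f z) = (LINT u|Pi\<^sub>M (entries a b) (\<lambda>_. lborel).
      (\<Prod>p\<in>entries a b. ?g p (u p)))"
    unfolding lmat_def by (subst integral_distr[OF mat_measurable m]) (simp only: e)
  also have "\<dots> = (\<Prod>p\<in>entries a b. LINT t|lborel. ?g p t)"
    by (rule lb.product_integral_prod) (use gauss_1d(1) in auto)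
  also have "\<dots> = (\<Prod>p\<in>entries a b. complex_of_real (sqrt (2 * pi) * exp (- (w $$
      p)\<^sup>2 / 2)))"
    by (intro prod.cong refl gauss_1d(2))
  also have "\<dots> = complex_of_real (sqrt (2 * pi) ^ (a * b) * gauss w)"
    by (simp add: prod.distrib gauss_def fsq_entries[OF w] exp_sum sum_negf sum_divide_distrib
        card_cartesian_product flip: of_real_prod sum_negf)
  finally show "(LINT z|lmat a b. ?f z) = complex_of_real (sqrt (2 * pi) ^ (a * b) * gauss w)" .
qed

lemma gauss_integral:
  "integrable (lmat a b) gauss" "(LINT z|lmat a b. gauss z) = sqrt (2 * pi) ^ (a * b)"
proof -
  let ?z = "0\<^sub>m a b :: real mat"
  have z: "?z \<in> carrier_mat a b" by simp
  have ip0: "ip ?z x = 0" if "x \<in> carrier_mat a b" for x unfolding ip_eq[OF z that] by (intro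
      sum.neutral) auto
  have g0: "gauss ?z = 1" by (simp add: gauss_def fsq_def)
  have "integrable (lmat a b) (\<lambda>z. complex_of_real (gauss z))"
    using gauss_Ft(1)[OF z] by (subst Bochner_Integration.integrable_cong[OF refl]) (auto simp: ip0)
  from integrable_Re[OF this] show "integrable (lmat a b) gauss" by simp
  have "complex_of_real (LINT z|lmat a b. gauss z) = (LINT z|lmat a b. exp (\<i> * complex_of_real (ip
      ?z z)) * complex_of_real (gauss z))"
    by (subst integral_complex_of_real[symmetric], intro Bochner_Integration.integral_cong) (auto simp: ip0)
  then show "(LINT z|lmat a b. gauss z) = sqrt (2 * pi) ^ (a * b)"
    using gauss_Ft(2)[OF z] by (simp only: g0 of_real_eq_iff mult_1_right)
qed

lemma integral_lmat_scale:
  fixes f :: "real mat \<Rightarrow> complex"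
  assumes f: "f \<in> borel_measurable (mat_borel a b)" and c: "c > 0"
  shows "(LINT z|lmat a b. f z) = complex_of_real (c ^ (a * b)) * (LINT z|lmat a b. f (c \<cdot>\<^sub>m z))"
proof -
  have meas: "(\<lambda>x. 0\<^sub>m a b + c \<cdot>\<^sub>m x) \<in> lmat a b \<rightarrow>\<^sub>M
      mat_borel a b"
    by (simp add: mat_add_measurable[OF mat_const_measurable mat_smult_measurable[OF measurable_const
        measurable_ident_sets[OF refl]]])
  have c0: "c \<noteq> 0" "\<bar>c\<bar> = c" using c by auto
  have "lmat a b = density (distr (lmat a b) (mat_borel a b) (\<lambda>x. 0\<^sub>m a b + c
      \<cdot>\<^sub>m x)) (\<lambda>_. ennreal (c ^ (a * b)))"
    using lmat_affine[OF zero_carrier_mat c0(1), of a b] c0(2) by simp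
  then have "(LINT z|lmat a b. f z) = (LINT z|density (distr (lmat a b) (mat_borel a b) (\<lambda>x.
      0\<^sub>m a b + c \<cdot>\<^sub>m x)) (\<lambda>_. ennreal (c ^ (a * b))). f z)"
    by simp
  also have "\<dots> = c ^ (a * b) *\<^sub>R (LINT z|distr (lmat a b) (mat_borel a b) (\<lambda>x.
      0\<^sub>m a b + c \<cdot>\<^sub>m x). f z)"
    using f c by (subst integral_density) auto
  also have "(LINT z|distr (lmat a b) (mat_borel a b) (\<lambda>x. 0\<^sub>m a b + c \<cdot>\<^sub>m
      x). f z) = (LINT z|lmat a b. f (0\<^sub>m a b + c \<cdot>\<^sub>m z))"
    by (rule integral_distr[OF meas f])
  also have "\<dots> = (LINT z|lmat a b. f (c \<cdot>\<^sub>m z))"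
    by (intro Bochner_Integration.integral_cong) auto
  finally show ?thesis by (simp add: scaleR_conv_of_real)
qed

lemma ip_commute: "y \<in> carrier_mat n m \<Longrightarrow> x \<in> carrier_mat n m \<Longrightarrow>
    ip y x = ip x y"
  by (simp add: ip_eq mult.commute)

lemma ip_smult:
  assumes "y \<in> carrier_mat n m" "x \<in> carrier_mat n m"
  shows "ip y (c \<cdot>\<^sub>m x) = c * ip y x" "ip (c \<cdot>\<^sub>m y) x = c * ip y x"
proof -
  have c: "c \<cdot>\<^sub>m y \<in> carrier_mat n m" "c \<cdot>\<^sub>m x \<in> carrier_mat n m" using
      assms by auto
  show "ip y (c \<cdot>\<^sub>m x) = c * ip y x" unfolding ip_eq[OF assms(1) c(2)] ip_eq[OF assms]
      sum_distrib_left
    using assms by (intro sum.cong) auto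
  show "ip (c \<cdot>\<^sub>m y) x = c * ip y x" unfolding ip_eq[OF c(1) assms(2)] ip_eq[OF assms]
      sum_distrib_left
    using assms by (intro sum.cong) auto
qed

lemma ip_append_rows:
  assumes "z \<in> carrier_mat N m" "y \<in> carrier_mat k m" "w \<in> carrier_mat N m"
  shows "ip (0\<^sub>m k m @\<^sub>r z) (y @\<^sub>r w) = ip w z"
proof -
  have "transpose_mat (0\<^sub>m k m @\<^sub>r z) * (y @\<^sub>r w) = transpose_mat z * w"
    using gram_append_rows[of "0\<^sub>m k m" k m w N m y z] assms by simp
  then show ?thesis using ip_commute[OF assms(1,3)] by (simp add: ip_def)
qed

lemma gauss_Ft_scaled:
  assumes w: "w \<in> carrier_mat a b" and c: "c > 0"
  shows "(LINT z|lmat a b. exp (\<i> * complex_of_real (ip w z)) * complex_of_real (gauss (c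
      \<cdot>\<^sub>m z))) =
      complex_of_real (inverse c ^ (a * b) * (sqrt (2 * pi) ^ (a * b) * gauss (inverse c \<cdot>\<^sub>m w)))"
proof -
  note id = measurable_ident_sets[OF refl]
  have m: "(\<lambda>z. exp (\<i> * complex_of_real (ip w z)) * complex_of_real (gauss (c
      \<cdot>\<^sub>m z))) \<in> borel_measurable (mat_borel a b)"
  proof -
    have [measurable]: "(\<lambda>z. gauss (c \<cdot>\<^sub>m z)) \<in> borel_measurable (mat_borel a b)"
      by (rule measurable_compose[OF mat_smult_measurable[OF measurable_const id] gauss_measurable]) simp
    have [measurable]: "(\<lambda>z. exp (\<i> * complex_of_real (ip w z))) \<in> borel_measurable
        (mat_borel a b)"
      by (rule exp_ip_measurable[OF mat_const_measurable[OF w] id])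
    show ?thesis by measurable
  qed
  have "(LINT z|lmat a b. exp (\<i> * complex_of_real (ip w z)) * complex_of_real (gauss (c
      \<cdot>\<^sub>m z))) =
    complex_of_real (inverse c ^ (a * b)) * (LINT z|lmat a b. exp (\<i> * complex_of_real (ip w
        (inverse c \<cdot>\<^sub>m z))) * complex_of_real (gauss (c \<cdot>\<^sub>m (inverse c
        \<cdot>\<^sub>m z))))"
    using c by (intro integral_lmat_scale[OF m]) simp
  also have "(LINT z|lmat a b. exp (\<i> * complex_of_real (ip w (inverse c \<cdot>\<^sub>m z))) *
      complex_of_real (gauss (c \<cdot>\<^sub>m (inverse c \<cdot>\<^sub>m z)))) =
    (LINT z|lmat a b. exp (\<i> * complex_of_real (ip (inverse c \<cdot>\<^sub>m w) z)) *
        complex_of_real (gauss z))"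
  proof (intro Bochner_Integration.integral_cong refl)
    fix z assume "z \<in> space (lmat a b)"
    then have z: "z \<in> carrier_mat a b" by simp
    have "c \<cdot>\<^sub>m (inverse c \<cdot>\<^sub>m z) = z" using c by (intro eq_matI) auto
    then show "exp (\<i> * complex_of_real (ip w (inverse c \<cdot>\<^sub>m z))) * complex_of_real
        (gauss (c \<cdot>\<^sub>m (inverse c \<cdot>\<^sub>m z))) =
      exp (\<i> * complex_of_real (ip (inverse c \<cdot>\<^sub>m w) z)) * complex_of_real (gauss z)"
      by (simp add: ip_smult[OF w z])
  qed
  also have "\<dots> = complex_of_real (sqrt (2 * pi) ^ (a * b) * gauss (inverse c \<cdot>\<^sub>m w))"
    using w by (intro gauss_Ft(2)) auto
  finally show ?thesis by simp
qed

lemma integrable_pair_times: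
  fixes f :: "'a \<Rightarrow> complex" and g :: "'b \<Rightarrow> complex"
  assumes "sigma_finite_measure A" "sigma_finite_measure B" "integrable A f" "integrable B g"
  shows "integrable (A \<Otimes>\<^sub>M B) (\<lambda>z. f (fst z) * g (snd z))"
proof -
  interpret B: sigma_finite_measure B by fact
  have [measurable]: "f \<in> borel_measurable A" "g \<in> borel_measurable B" using assms by auto
  show ?thesis
  proof (rule integrableI_bounded)
    have "(\<integral>\<^sup>+z. ennreal (norm (f (fst z) * g (snd z))) \<partial>(A \<Otimes>\<^sub>M
        B)) = (\<integral>\<^sup>+x. \<integral>\<^sup>+y. ennreal (norm (f x)) * ennreal (norm (g y))
        \<partial>B \<partial>A)"
      by (subst B.nn_integral_fst[symmetric]) (auto simp: norm_mult ennreal_mult)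
    also have "\<dots> = (\<integral>\<^sup>+x. ennreal (norm (f x)) \<partial>A) *
        (\<integral>\<^sup>+y. ennreal (norm (g y)) \<partial>B)"
      by (simp add: nn_integral_cmult nn_integral_multc)
    also have "\<dots> < \<infinity>"
      using assms(3,4) by (auto simp: integrable_iff_bounded ennreal_mult_less_top)
    finally show "(\<integral>\<^sup>+z. ennreal (norm (f (fst z) * g (snd z))) \<partial>(A
        \<Otimes>\<^sub>M B)) < \<infinity>" .
  qed measurable
qed

lemma Ft_measurable:
  assumes f: "f \<in> borel_measurable (mat_borel n m)" and Y: "Y \<in> N \<rightarrow>\<^sub>M mat_borel n m"
  shows "(\<lambda>w. Ft n m f (Y w)) \<in> borel_measurable N"
proof -
  interpret sigma_finite_measure "lmat n m" by (rule sigma_finite_lmat)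
  have "(\<lambda>z. exp (\<i> * complex_of_real (ip (Y (fst z)) (snd z))) * f (snd z)) \<in>
      borel_measurable (N \<Otimes>\<^sub>M mat_borel n m)"
    by (intro borel_measurable_times exp_ip_measurable[OF measurable_compose[OF measurable_fst Y]
        measurable_snd] measurable_compose[OF measurable_snd f])
  then show ?thesis unfolding Ft_def
    by (intro borel_measurable_lebesgue_integral) (simp add: case_prod_beta')
qed

lemma wt_append_le:
  assumes "y \<in> carrier_mat k m" "w \<in> carrier_mat N m"
  shows "wt M (y @\<^sub>r w) \<le> wt M y" "wt M (w @\<^sub>r y) \<le> wt M y"
proof -
  have "(1 + fsq y) ^ M \<le> (1 + fsq (y @\<^sub>r w)) ^ M" "(1 + fsq y) ^ M \<le> (1 + fsq (w
      @\<^sub>r y)) ^ M"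
    using fsq_append_rows[OF assms] fsq_append_rows[OF assms(2,1)] fsq_nonneg[of y] fsq_nonneg[of w] by
        (auto intro!: power_mono)
  moreover have "(1 + fsq y) ^ M > 0" using fsq_nonneg[of y] by (auto intro: zero_less_power add_pos_nonneg)
  ultimately show "wt M (y @\<^sub>r w) \<le> wt M y" "wt M (w @\<^sub>r y) \<le> wt M y"
    unfolding wt_def by (auto intro: le_imp_inverse_le)
qed

text \<open>The integral of the Fourier transform is regularised by a wide Gaussian; on the other side
  of Fubini's theorem this produces a narrow Gaussian concentrating at the orthogonal subspace.\<close>
theorem integral_Ft_subspace:
  fixes \<psi> :: "real mat \<Rightarrow> complex"
  assumes n: "n = k + N"
    and \<psi>: "\<psi> \<in> borel_measurable (mat_borel n m)"
    and C: "\<And>x. x \<in> carrier_mat n m \<Longrightarrow> norm (\<psi> x) \<le> C * wt (n * m) x"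
        "C \<ge> 0"
    and C': "\<And>z. z \<in> carrier_mat N m \<Longrightarrow> norm (Ft n m \<psi> (0\<^sub>m k m
        @\<^sub>r z)) \<le> C' * wt (n * m) z"
    and cont: "\<And>y w. y \<in> carrier_mat k m \<Longrightarrow> w \<in> carrier_mat N m \<Longrightarrow>
      (\<lambda>j. \<psi> (y @\<^sub>r inverse (real (Suc j)) \<cdot>\<^sub>m w))
          \<longlonglongrightarrow> \<psi> (y @\<^sub>r 0\<^sub>m N m)"
  shows "(LINT z|lmat N m. Ft n m \<psi> (0\<^sub>m k m @\<^sub>r z)) =
    complex_of_real ((2 * pi) ^ (N * m)) * (LINT y|lmat k m. \<psi> (y @\<^sub>r 0\<^sub>m N m))"
proof -
  note id = measurable_ident_sets[OF refl]
  define \<epsilon> where "\<epsilon> j = inverse (real (Suc j))" for j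
  have \<epsilon>: "\<epsilon> j > 0" for j by (simp add: \<epsilon>_def)
  have \<epsilon>0: "\<epsilon> \<longlonglongrightarrow> 0" unfolding \<epsilon>_def by (rule
      LIMSEQ_inverse_real_of_nat)
  \<comment> \<open>This factor occurs twice, from the Fourier transform of the Gaussian in z and
    from the integral of the Gaussian in w; together they make (2 pi)^(Nm).\<close>
  define s where "s = sqrt (2 * pi) ^ (N * m)"
  have ss: "s * s = (2 * pi) ^ (N * m)" unfolding s_def power_mult_distrib[symmetric] by simp
  interpret K: sigma_finite_measure "lmat k m" by (rule sigma_finite_lmat)
  interpret NN: sigma_finite_measure "lmat N m" by (rule sigma_finite_lmat)
  interpret X: sigma_finite_measure "lmat n m" by (rule sigma_finite_lmat)
  interpret KN: pair_sigma_finite "lmat k m" "lmat N m" by standard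
  interpret NX: pair_sigma_finite "lmat N m" "lmat n m" by standard
  have kN: "N * m \<le> n * m" "k * m \<le> n * m" by (auto simp: n)
  have i\<psi>: "integrable (lmat n m) \<psi>"
  proof (rule Bochner_Integration.integrable_bound)
    show "integrable (lmat n m) (\<lambda>x. C * wt (n * m) x)" by (intro integrable_mult_right
        wt_integrable order_refl)
    show "AE x in lmat n m. norm (\<psi> x) \<le> norm (C * wt (n * m) x)"
      using C wt_pos by (intro AE_I2) (simp add: abs_mult less_imp_le)
  qed (simp add: \<psi>)
  have zm: "(\<lambda>w. 0\<^sub>m k m @\<^sub>r Z w) \<in> M \<rightarrow>\<^sub>M mat_borel n m" if
      "Z \<in> M \<rightarrow>\<^sub>M mat_borel N m" for Z and M :: "'z measure"
    unfolding n by (rule append_rows_measurable[OF mat_const_measurable that]) simp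
  have Fm: "(\<lambda>z. Ft n m \<psi> (0\<^sub>m k m @\<^sub>r z)) \<in> borel_measurable (mat_borel N m)"
    by (rule Ft_measurable[OF \<psi> zm[OF id]])
  have gm: "(\<lambda>w. gauss (c \<cdot>\<^sub>m Z w)) \<in> borel_measurable M" if "Z \<in> M
      \<rightarrow>\<^sub>M mat_borel N m" for Z c and M :: "'z measure"
    by (rule measurable_compose[OF mat_smult_measurable[OF measurable_const that] gauss_measurable]) simp
  have g1: "gauss z > 0" "gauss z \<le> 1" for z using fsq_nonneg[of z] by (auto simp: gauss_def)
  \<comment> \<open>The Gaussian supplies the integrability in z that Fubini's theorem requires. It
    tends to 1 pointwise and is removed in the limit by the decay of the transform.\<close>
  define J where "J j = (LINT z|lmat N m. complex_of_real (gauss (\<epsilon> j \<cdot>\<^sub>m z)) * Ft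
      n m \<psi> (0\<^sub>m k m @\<^sub>r z))" for j
  have lim1: "J \<longlonglongrightarrow> (LINT z|lmat N m. Ft n m \<psi> (0\<^sub>m k m @\<^sub>r z))"
    unfolding J_def
  proof (rule integral_dominated_convergence[where w = "\<lambda>z. C' * wt (n * m) z"])
    show "integrable (lmat N m) (\<lambda>z. C' * wt (n * m) z)" by (intro integrable_mult_right
        wt_integrable kN)
    show "(\<lambda>z. Ft n m \<psi> (0\<^sub>m k m @\<^sub>r z)) \<in> borel_measurable (lmat N m)"
        using Fm by simp
    show "(\<lambda>z. complex_of_real (gauss (\<epsilon> j \<cdot>\<^sub>m z)) * Ft n m \<psi>
        (0\<^sub>m k m @\<^sub>r z)) \<in> borel_measurable (lmat N m)" for j
      using Fm gm[OF id, of "\<epsilon> j"] by (simp add: borel_measurable_times of_real_measurable)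
    show "AE z in lmat N m. (\<lambda>j. complex_of_real (gauss (\<epsilon> j \<cdot>\<^sub>m z)) * Ft
        n m \<psi> (0\<^sub>m k m @\<^sub>r z)) \<longlonglongrightarrow> Ft n m \<psi> (0\<^sub>m k m
        @\<^sub>r z)"
    proof (rule AE_I2)
      fix z
      have "(\<lambda>j. exp (- ((\<epsilon> j)\<^sup>2 * fsq z) / 2)) \<longlonglongrightarrow> exp (-
          (0\<^sup>2 * fsq z) / 2)" by (intro tendsto_intros \<epsilon>0) simp
      then have "(\<lambda>j. gauss (\<epsilon> j \<cdot>\<^sub>m z)) \<longlonglongrightarrow> 1" by
          (simp add: gauss_def fsq_smult)
      then have "(\<lambda>j. complex_of_real (gauss (\<epsilon> j \<cdot>\<^sub>m z)) * Ft n m \<psi>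
          (0\<^sub>m k m @\<^sub>r z)) \<longlonglongrightarrow> complex_of_real 1 * Ft n m \<psi>
          (0\<^sub>m k m @\<^sub>r z)"
        by (intro tendsto_intros)
      then show "(\<lambda>j. complex_of_real (gauss (\<epsilon> j \<cdot>\<^sub>m z)) * Ft n m \<psi>
          (0\<^sub>m k m @\<^sub>r z)) \<longlonglongrightarrow> Ft n m \<psi> (0\<^sub>m k m @\<^sub>r
          z)" by simp
    qed
    show "AE z in lmat N m. norm (complex_of_real (gauss (\<epsilon> j \<cdot>\<^sub>m z)) * Ft n m
        \<psi> (0\<^sub>m k m @\<^sub>r z)) \<le> C' * wt (n * m) z" for j
    proof (rule AE_I2)
      fix z assume "z \<in> space (lmat N m)"
      then have z: "z \<in> carrier_mat N m" by simp
      have "norm (complex_of_real (gauss (\<epsilon> j \<cdot>\<^sub>m z)) * Ft n m \<psi> (0\<^sub>m k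
          m @\<^sub>r z)) \<le> 1 * norm (Ft n m \<psi> (0\<^sub>m k m @\<^sub>r z))"
        unfolding norm_mult using g1[of "\<epsilon> j \<cdot>\<^sub>m z"] by (intro mult_right_mono) auto
      also have "\<dots> \<le> C' * wt (n * m) z" using C'[OF z] by simp
      finally show "norm (complex_of_real (gauss (\<epsilon> j \<cdot>\<^sub>m z)) * Ft n m \<psi>
          (0\<^sub>m k m @\<^sub>r z)) \<le> C' * wt (n * m) z" .
    qed
  qed
  \<comment> \<open>After the substitution w -> epsilon w the narrow Gaussian is a fixed one, and
    the shrinking sits in the argument of psi, where \<open>cont\<close> applies.\<close>
  define R where "R j y = (LINT w|lmat N m. \<psi> (y @\<^sub>r \<epsilon> j \<cdot>\<^sub>m w) *
      complex_of_real (gauss w))" for j y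
  have app: "(\<lambda>v. Y v @\<^sub>r W v) \<in> M \<rightarrow>\<^sub>M mat_borel n m" if "Y \<in> M
      \<rightarrow>\<^sub>M mat_borel k m" "W \<in> M \<rightarrow>\<^sub>M mat_borel N m" for Y W and
      M :: "'z measure"
    unfolding n by (rule append_rows_measurable[OF that])
  have Jeq: "J j = complex_of_real s * (LINT y|lmat k m. R j y)" for j
  proof -
    define e where "e z x = exp (\<i> * complex_of_real (ip (0\<^sub>m k m @\<^sub>r z) x))" for z x
    \<comment> \<open>The integral over z after the exchange: the frequency [0; z] pairs only with
      the lower rows w of x, so y drops out of the exponential.\<close>
    define \<Gamma> where "\<Gamma> w = (LINT z|lmat N m. exp (\<i> * complex_of_real (ip w z)) *
        complex_of_real (gauss (\<epsilon> j \<cdot>\<^sub>m z)))" for w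
    have ig: "integrable (lmat N m) (\<lambda>z. complex_of_real (gauss (\<epsilon> j \<cdot>\<^sub>m z)))"
    proof -
      let ?c = "\<epsilon> j"
      have "integrable (lmat N m) (\<lambda>z. gauss (?c \<cdot>\<^sub>m z))"
      proof -
        have meas: "(\<lambda>x. 0\<^sub>m N m + ?c \<cdot>\<^sub>m x) \<in> lmat N m
            \<rightarrow>\<^sub>M mat_borel N m"
          by (simp add: mat_add_measurable[OF mat_const_measurable mat_smult_measurable[OF
              measurable_const id]])
        have "integrable (density (distr (lmat N m) (mat_borel N m) (\<lambda>x. 0\<^sub>m N m + ?c
            \<cdot>\<^sub>m x)) (\<lambda>_. ennreal (\<bar>?c\<bar> ^ (N * m)))) gauss"
          using lmat_affine[OF zero_carrier_mat, of ?c N m] \<epsilon>[of j] gauss_integral(1)[of N m] by simp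
        then have "integrable (distr (lmat N m) (mat_borel N m) (\<lambda>x. 0\<^sub>m N m + ?c
            \<cdot>\<^sub>m x)) gauss"
          using gauss_measurable[of N m] \<epsilon>[of j] by (subst (asm) integrable_density) auto
        then have "integrable (lmat N m) (\<lambda>x. gauss (0\<^sub>m N m + ?c \<cdot>\<^sub>m x))"
          by (subst (asm) integrable_distr_eq[OF meas gauss_measurable])
        then show ?thesis by (subst Bochner_Integration.integrable_cong[OF refl]) auto
      qed
      then show ?thesis by simp
    qed
    have em: "(\<lambda>v. e (fst v) (snd v)) \<in> borel_measurable (mat_borel N m \<Otimes>\<^sub>M
        mat_borel n m)"
      unfolding e_def by (rule exp_ip_measurable[OF zm[OF measurable_fst] measurable_snd])
    have pm: "(\<lambda>v. complex_of_real (gauss (\<epsilon> j \<cdot>\<^sub>m fst v)) * (e (fst v)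
        (snd v) * \<psi> (snd v))) \<in> borel_measurable (mat_borel N m \<Otimes>\<^sub>M mat_borel n m)"
      using gm[OF measurable_fst] em measurable_compose[OF measurable_snd \<psi>] by (intro
          borel_measurable_times of_real_measurable)
    have ip: "integrable (lmat N m \<Otimes>\<^sub>M lmat n m) (\<lambda>v. complex_of_real (gauss
        (\<epsilon> j \<cdot>\<^sub>m fst v)) * (e (fst v) (snd v) * \<psi> (snd v)))"
      by (rule Bochner_Integration.integrable_bound[OF integrable_pair_times[OF sigma_finite_lmat
          sigma_finite_lmat ig i\<psi>]])
        (use pm in \<open>auto simp: norm_mult e_def\<close>)
    have "J j = (LINT z|lmat N m. LINT x|lmat n m. complex_of_real (gauss (\<epsilon> j \<cdot>\<^sub>m
        z)) * (e z x * \<psi> x))"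
      unfolding J_def Ft_def e_def by simp
    also have "\<dots> = (LINT x|lmat n m. LINT z|lmat N m. complex_of_real (gauss (\<epsilon> j
        \<cdot>\<^sub>m z)) * (e z x * \<psi> x))"
      by (rule NX.Fubini_integral[symmetric]) (use ip in \<open>simp add: case_prod_beta'\<close>)
    also have "\<dots> = (LINT v|(lmat k m \<Otimes>\<^sub>M lmat N m). LINT z|lmat N m.
        complex_of_real (gauss (\<epsilon> j \<cdot>\<^sub>m z)) * (e z (fst v @\<^sub>r snd v) *
        \<psi> (fst v @\<^sub>r snd v)))"
    proof -
      have hm: "(\<lambda>x. LINT z|lmat N m. complex_of_real (gauss (\<epsilon> j \<cdot>\<^sub>m z))
          * (e z x * \<psi> x)) \<in> borel_measurable (mat_borel n m)"
        using measurable_compose[OF measurable_Pair[OF measurable_snd measurable_fst] pm]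
        by (intro NN.borel_measurable_lebesgue_integral) (simp add: case_prod_beta')
      have dm: "(\<lambda>(x,y). x @\<^sub>r y) \<in> lmat k m \<Otimes>\<^sub>M lmat N m
          \<rightarrow>\<^sub>M mat_borel n m"
        using app[OF measurable_fst measurable_snd] by (simp add: case_prod_beta')
      show ?thesis
        using integral_distr[OF dm hm] unfolding n lmat_append_rows[of k N m] by (simp add: case_prod_beta')
    qed
    also have "\<dots> = (LINT v|(lmat k m \<Otimes>\<^sub>M lmat N m). \<psi> (fst v @\<^sub>r snd v)
        * \<Gamma> (snd v))"
    proof (intro Bochner_Integration.integral_cong refl)
      fix v assume "v \<in> space (lmat k m \<Otimes>\<^sub>M lmat N m)"
      then have v: "fst v \<in> carrier_mat k m" "snd v \<in> carrier_mat N m" by (auto simp: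
          space_pair_measure)
      have "(LINT z|lmat N m. complex_of_real (gauss (\<epsilon> j \<cdot>\<^sub>m z)) * (e z (fst v
          @\<^sub>r snd v) * \<psi> (fst v @\<^sub>r snd v))) =
        (LINT z|lmat N m. \<psi> (fst v @\<^sub>r snd v) * (exp (\<i> * complex_of_real (ip (snd v) z))
            * complex_of_real (gauss (\<epsilon> j \<cdot>\<^sub>m z))))"
        by (intro Bochner_Integration.integral_cong) (use ip_append_rows[OF _ v] in \<open>auto simp:
            e_def mult_ac\<close>)
      then show "(LINT z|lmat N m. complex_of_real (gauss (\<epsilon> j \<cdot>\<^sub>m z)) * (e z (fst
          v @\<^sub>r snd v) * \<psi> (fst v @\<^sub>r snd v))) = \<psi> (fst v @\<^sub>r snd v) *
          \<Gamma> (snd v)"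
        by (simp add: \<Gamma>_def)
    qed
    also have "\<dots> = (LINT y|lmat k m. LINT w|lmat N m. \<psi> (y @\<^sub>r w) * \<Gamma> w)"
    proof -
      \<comment> \<open>A bounded factor keeps the integrability of psi, which permits the split
        into an iterated integral over y and w.\<close>
      have \<Gamma>b: "norm (\<Gamma> w) \<le> (LINT z|lmat N m. gauss (\<epsilon> j \<cdot>\<^sub>m z))" for w
        unfolding \<Gamma>_def by (rule order_trans[OF integral_norm_bound]) (use g1 in \<open>simp
            add: norm_mult abs_of_pos\<close>)
      have \<Gamma>m: "\<Gamma> \<in> borel_measurable (mat_borel N m)"
        unfolding \<Gamma>_def
        using borel_measurable_times[OF exp_ip_measurable[OF measurable_fst measurable_snd]
            of_real_measurable[OF gm[OF measurable_snd]]]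
        by (intro NN.borel_measurable_lebesgue_integral) (simp add: case_prod_beta')
      have dm: "(\<lambda>v. fst v @\<^sub>r snd v) \<in> lmat k m \<Otimes>\<^sub>M lmat N m
          \<rightarrow>\<^sub>M mat_borel n m"
        using app[OF measurable_fst measurable_snd] by simp
      have "integrable (distr (lmat k m \<Otimes>\<^sub>M lmat N m) (mat_borel n m) (\<lambda>v. fst v
          @\<^sub>r snd v)) \<psi>"
        using i\<psi> unfolding n lmat_append_rows[of k N m] by (simp add: case_prod_beta')
      then have i1: "integrable (lmat k m \<Otimes>\<^sub>M lmat N m) (\<lambda>v. \<psi> (fst v
          @\<^sub>r snd v))"
        by (simp add: integrable_distr_eq[OF dm \<psi>])
      have "integrable (lmat k m \<Otimes>\<^sub>M lmat N m) (\<lambda>v. \<psi> (fst v @\<^sub>r snd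
          v) * \<Gamma> (snd v))"
      proof (rule Bochner_Integration.integrable_bound[OF integrable_mult_right[OF i1, of
          "complex_of_real (LINT z|lmat N m. gauss (\<epsilon> j \<cdot>\<^sub>m z))"]])
        show "(\<lambda>v. \<psi> (fst v @\<^sub>r snd v) * \<Gamma> (snd v)) \<in> borel_measurable
            (lmat k m \<Otimes>\<^sub>M lmat N m)"
          using measurable_compose[OF dm \<psi>] measurable_compose[OF measurable_snd \<Gamma>m] by
              (intro borel_measurable_times) auto
        show "AE v in lmat k m \<Otimes>\<^sub>M lmat N m. norm (\<psi> (fst v @\<^sub>r snd v) *
            \<Gamma> (snd v)) \<le>
            norm (complex_of_real (LINT z|lmat N m. gauss (\<epsilon> j \<cdot>\<^sub>m z)) * \<psi>
                (fst v @\<^sub>r snd v))"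
        proof (rule AE_I2)
          fix v :: "real mat \<times> real mat"
          have "norm (\<Gamma> (snd v)) * norm (\<psi> (fst v @\<^sub>r snd v)) \<le> \<bar>LINT z|lmat
              N m. gauss (\<epsilon> j \<cdot>\<^sub>m z)\<bar> * norm (\<psi> (fst v @\<^sub>r snd v))"
            using \<Gamma>b[of "snd v"] by (intro mult_right_mono) auto
          then show "norm (\<psi> (fst v @\<^sub>r snd v) * \<Gamma> (snd v)) \<le> norm
              (complex_of_real (LINT z|lmat N m. gauss (\<epsilon> j \<cdot>\<^sub>m z)) * \<psi> (fst
              v @\<^sub>r snd v))"
            by (simp add: norm_mult mult.commute)
        qed
      qed
      from KN.integral_fst'[OF this] show ?thesis by simp
    qed
    also have "\<dots> = (LINT y|lmat k m. complex_of_real s * R j y)"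
    proof (intro Bochner_Integration.integral_cong refl)
      fix y assume "y \<in> space (lmat k m)"
      then have y: "y \<in> carrier_mat k m" by simp
      \<comment> \<open>The factor epsilon^(-Nm) here meets the Jacobian epsilon^(Nm) of the
        substitution, and only s remains.\<close>
      have G: "\<Gamma> w = complex_of_real (inverse (\<epsilon> j) ^ (N * m) * (s * gauss (inverse
          (\<epsilon> j) \<cdot>\<^sub>m w)))" if "w \<in> carrier_mat N m" for w
        unfolding \<Gamma>_def s_def by (rule gauss_Ft_scaled[OF that \<epsilon>])
      have ym: "(\<lambda>w. \<psi> (y @\<^sub>r w)) \<in> borel_measurable (mat_borel N m)"
        by (rule measurable_compose[OF app[OF mat_const_measurable[OF y] id] \<psi>])
      have m1: "(\<lambda>w. \<psi> (y @\<^sub>r w) * complex_of_real (inverse (\<epsilon> j) ^ (N * m)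
          * (s * gauss (inverse (\<epsilon> j) \<cdot>\<^sub>m w)))) \<in> borel_measurable (mat_borel N m)"
        using ym gm[OF id, of "inverse (\<epsilon> j)"] by (intro borel_measurable_times
            of_real_measurable) auto
      have "(LINT w|lmat N m. \<psi> (y @\<^sub>r w) * \<Gamma> w) = (LINT w|lmat N m. \<psi> (y
          @\<^sub>r w) * complex_of_real (inverse (\<epsilon> j) ^ (N * m) * (s * gauss (inverse
          (\<epsilon> j) \<cdot>\<^sub>m w))))"
        by (intro Bochner_Integration.integral_cong) (auto simp: G)
      also have "\<dots> = complex_of_real (\<epsilon> j ^ (N * m)) * (LINT w|lmat N m. \<psi> (y
          @\<^sub>r \<epsilon> j \<cdot>\<^sub>m w) * complex_of_real (inverse (\<epsilon> j) ^ (N * m)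
          * (s * gauss (inverse (\<epsilon> j) \<cdot>\<^sub>m (\<epsilon> j \<cdot>\<^sub>m w)))))"
        by (rule integral_lmat_scale[OF m1 \<epsilon>])
      also have "\<dots> = complex_of_real (\<epsilon> j ^ (N * m)) * (LINT w|lmat N m. complex_of_real
          (inverse (\<epsilon> j) ^ (N * m) * s) * (\<psi> (y @\<^sub>r \<epsilon> j \<cdot>\<^sub>m w)
          * complex_of_real (gauss w)))"
      proof -
        have "inverse (\<epsilon> j) \<cdot>\<^sub>m (\<epsilon> j \<cdot>\<^sub>m w) = w" for w using
            \<epsilon>[of j] by (intro eq_matI) auto
        then show ?thesis by (simp add: mult_ac)
      qed
      also have "\<dots> = complex_of_real (\<epsilon> j ^ (N * m) * (inverse (\<epsilon> j) ^ (N * m)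
          * s)) * R j y"
        unfolding R_def by simp
      also have "\<epsilon> j ^ (N * m) * (inverse (\<epsilon> j) ^ (N * m) * s) = s"
        using \<epsilon>[of j] by (simp add: power_inverse)
      finally show "(LINT w|lmat N m. \<psi> (y @\<^sub>r w) * \<Gamma> w) = complex_of_real s * R j y" .
    qed
    also have "\<dots> = complex_of_real s * (LINT y|lmat k m. R j y)" by simp
    finally show ?thesis .
  qed
  \<comment> \<open>A bound independent of j and of product form, which dominates the limit in the
    inner integral over w and then that in the outer integral over y.\<close>
  have bd: "norm (\<psi> (y @\<^sub>r \<epsilon> j \<cdot>\<^sub>m w) * complex_of_real (gauss w))
      \<le> C * wt (n * m) y * gauss w"
    if "y \<in> carrier_mat k m" "w \<in> carrier_mat N m" for y w j
  proof -
    have ew: "\<epsilon> j \<cdot>\<^sub>m w \<in> carrier_mat N m" using that by auto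
    have "norm (\<psi> (y @\<^sub>r \<epsilon> j \<cdot>\<^sub>m w)) \<le> C * wt (n * m) (y @\<^sub>r
        \<epsilon> j \<cdot>\<^sub>m w)" using that ew by (intro C(1)) (auto simp: n)
    also have "\<dots> \<le> C * wt (n * m) y" by (intro mult_left_mono wt_append_le(1)[OF that(1) ew] C(2))
    finally have "norm (\<psi> (y @\<^sub>r \<epsilon> j \<cdot>\<^sub>m w)) \<le> C * wt (n * m) y" .
    then show ?thesis unfolding norm_mult norm_of_real abs_of_pos[OF g1(1)] using g1(1)[of w] by (intro
        mult_right_mono) auto
  qed
  have rm: "(\<lambda>v. \<psi> (fst v @\<^sub>r \<epsilon> j \<cdot>\<^sub>m snd v) * complex_of_real
      (gauss (snd v))) \<in> borel_measurable (mat_borel k m \<Otimes>\<^sub>M mat_borel N m)" for j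
    by (intro borel_measurable_times of_real_measurable measurable_compose[OF app[OF measurable_fst
        mat_smult_measurable[OF measurable_const measurable_snd]] \<psi>] measurable_compose[OF
        measurable_snd gauss_measurable]) simp
  have Rlim: "(\<lambda>j. R j y) \<longlonglongrightarrow> \<psi> (y @\<^sub>r 0\<^sub>m N m) *
      complex_of_real s" if y: "y \<in> carrier_mat k m" for y
  proof -
    have "(\<lambda>j. R j y) \<longlonglongrightarrow> (LINT w|lmat N m. \<psi> (y @\<^sub>r 0\<^sub>m
        N m) * complex_of_real (gauss w))"
      unfolding R_def
    proof (rule integral_dominated_convergence[where w = "\<lambda>w. C * wt (n * m) y * gauss w"])
      show "integrable (lmat N m) (\<lambda>w. C * wt (n * m) y * gauss w)" by (intro
          integrable_mult_right gauss_integral)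
      show "(\<lambda>w. \<psi> (y @\<^sub>r 0\<^sub>m N m) * complex_of_real (gauss w)) \<in>
          borel_measurable (lmat N m)"
        using gauss_measurable[of N m] by simp
      show "(\<lambda>w. \<psi> (y @\<^sub>r \<epsilon> j \<cdot>\<^sub>m w) * complex_of_real (gauss
          w)) \<in> borel_measurable (lmat N m)" for j
        using measurable_compose[OF measurable_Pair1'[of y "mat_borel k m" "mat_borel N m"] rm[of j]] y by simp
      show "AE w in lmat N m. (\<lambda>j. \<psi> (y @\<^sub>r \<epsilon> j \<cdot>\<^sub>m w) *
          complex_of_real (gauss w)) \<longlonglongrightarrow> \<psi> (y @\<^sub>r 0\<^sub>m N m) *
          complex_of_real (gauss w)"
        using cont[OF y] by (intro AE_I2 tendsto_intros) (simp add: \<epsilon>_def)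
      show "AE w in lmat N m. norm (\<psi> (y @\<^sub>r \<epsilon> j \<cdot>\<^sub>m w) *
          complex_of_real (gauss w)) \<le> C * wt (n * m) y * gauss w" for j
        using bd[OF y] by (intro AE_I2) simp
    qed
    then show ?thesis using gauss_integral(2)[of N m] by (simp add: s_def)
  qed
  have lim2: "(\<lambda>j. LINT y|lmat k m. R j y) \<longlonglongrightarrow> (LINT y|lmat k m. \<psi>
      (y @\<^sub>r 0\<^sub>m N m) * complex_of_real s)"
  proof (rule integral_dominated_convergence[where w = "\<lambda>y. C * wt (n * m) y * s"])
    show "integrable (lmat k m) (\<lambda>y. C * wt (n * m) y * s)" by (intro integrable_mult_left
        integrable_mult_right wt_integrable kN)
    show "(\<lambda>y. \<psi> (y @\<^sub>r 0\<^sub>m N m) * complex_of_real s) \<in> borel_measurable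
        (lmat k m)"
      using measurable_compose[OF app[OF id mat_const_measurable[of "0\<^sub>m N m"]] \<psi>] by simp
    show "R j \<in> borel_measurable (lmat k m)" for j
      unfolding R_def[abs_def] measurable_lmat_cong(2)
      by (rule NN.borel_measurable_lebesgue_integral) (use rm[of j] in \<open>simp add: case_prod_beta'\<close>)
    show "AE y in lmat k m. (\<lambda>j. R j y) \<longlonglongrightarrow> \<psi> (y @\<^sub>r 0\<^sub>m
        N m) * complex_of_real s"
      using Rlim by (intro AE_I2) simp
    show "AE y in lmat k m. norm (R j y) \<le> C * wt (n * m) y * s" for j
    proof (rule AE_I2)
      fix y assume "y \<in> space (lmat k m)"
      then have y: "y \<in> carrier_mat k m" by simp
      have "norm (R j y) \<le> (LINT w|lmat N m. C * wt (n * m) y * gauss w)"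
        unfolding R_def
      proof (rule order_trans[OF integral_norm_bound integral_mono])
        show i: "integrable (lmat N m) (\<lambda>w. C * wt (n * m) y * gauss w)" by (intro
            integrable_mult_right gauss_integral)
        show "norm (\<psi> (y @\<^sub>r \<epsilon> j \<cdot>\<^sub>m w) * complex_of_real (gauss w))
            \<le> C * wt (n * m) y * gauss w" if "w \<in> space (lmat N m)" for w
          using bd[OF y] that by simp
        show "integrable (lmat N m) (\<lambda>w. norm (\<psi> (y @\<^sub>r \<epsilon> j \<cdot>\<^sub>m
            w) * complex_of_real (gauss w)))"
        proof (rule integrable_norm, rule Bochner_Integration.integrable_bound[OF i])
          show "(\<lambda>w. \<psi> (y @\<^sub>r \<epsilon> j \<cdot>\<^sub>m w) * complex_of_real
              (gauss w)) \<in> borel_measurable (lmat N m)"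
            using measurable_compose[OF measurable_Pair1'[of y "mat_borel k m" "mat_borel N m"] rm[of
                j]] y by simp
          show "AE w in lmat N m. norm (\<psi> (y @\<^sub>r \<epsilon> j \<cdot>\<^sub>m w) *
              complex_of_real (gauss w)) \<le> norm (C * wt (n * m) y * gauss w)"
            using bd[OF y] by (intro AE_I2) (simp, meson abs_ge_self order_trans)
        qed
      qed
      then show "norm (R j y) \<le> C * wt (n * m) y * s" using gauss_integral(2)[of N m] by (simp add: s_def)
    qed
  qed
  have "J \<longlonglongrightarrow> complex_of_real s * (LINT y|lmat k m. \<psi> (y @\<^sub>r 0\<^sub>m
      N m) * complex_of_real s)"
    unfolding Jeq[abs_def] by (intro tendsto_intros lim2)
  then have "(LINT z|lmat N m. Ft n m \<psi> (0\<^sub>m k m @\<^sub>r z)) = complex_of_real s * (LINT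
      y|lmat k m. \<psi> (y @\<^sub>r 0\<^sub>m N m) * complex_of_real s)"
    using lim1 LIMSEQ_unique by blast
  also have "\<dots> = complex_of_real (s * s) * (LINT y|lmat k m. \<psi> (y @\<^sub>r 0\<^sub>m N m))" by simp
  finally show ?thesis unfolding ss .
qed

text \<open>Rotations preserve both the trace pairing in the exponent and Lebesgue measure.\<close>

lemma Ft_orth:
  assumes g: "g \<in> orth_group n" and f: "f \<in> borel_measurable (mat_borel n m)" and y: "y \<in>
      carrier_mat n m"
  shows "Ft n m (\<lambda>x. f (g * x)) y = Ft n m f (g * y)"
proof -
  note id = measurable_ident_sets[OF refl]
  note gc = orth_groupD[OF g]
  have gy: "g * y \<in> carrier_mat n m" using gc y by auto
  have mg: "(\<lambda>x. g * x) \<in> lmat n m \<rightarrow>\<^sub>M lmat n m" by (simp add: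
      mat_left_mult_measurable[OF gc(1) id])
  have m: "(\<lambda>x. exp (\<i> * complex_of_real (ip (g * y) x)) * f x) \<in> borel_measurable (lmat n m)"
    by (simp add: borel_measurable_times exp_ip_measurable[OF mat_const_measurable[OF gy] id] f)
  have "Ft n m f (g * y) = (LINT x|distr (lmat n m) (lmat n m) (\<lambda>x. g * x). exp (\<i> *
      complex_of_real (ip (g * y) x)) * f x)"
    unfolding Ft_def lmat_orth[OF g] ..
  also have "\<dots> = (LINT x|lmat n m. exp (\<i> * complex_of_real (ip (g * y) (g * x))) * f (g * x))"
    by (rule integral_distr[OF mg m])
  also have "\<dots> = Ft n m (\<lambda>x. f (g * x)) y"
    unfolding Ft_def
  proof (intro Bochner_Integration.integral_cong refl)
    fix x assume "x \<in> space (lmat n m)"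
    then have x: "x \<in> carrier_mat n m" by simp
    have "transpose_mat (g * y) * (g * x) = transpose_mat y * (transpose_mat g * (g * x))"
      using gc x y by (simp add: transpose_mult[of _ n n _ m] assoc_mult_mat[of _ m n _ n _ m])
    then have "ip (g * y) (g * x) = ip y x" using orth_cancel(1)[OF g x] by (simp add: ip_def)
    then show "exp (\<i> * complex_of_real (ip (g * y) (g * x))) * f (g * x) = exp (\<i> *
        complex_of_real (ip y x)) * f (g * x)" by simp
  qed
  finally show ?thesis by simp
qed

subsection \<open>The transforms in terms of Haar measure\<close>

text \<open>The integrands of the pairings contain chosen objects that are controlled only almost
  everywhere. In the completion, agreement off a null set with a measurable function already implies
  measurability.\<close>

lemma AE_eq_completion:
  fixes F H :: "'a \<Rightarrow> complex"
  assumes H: "integrable M H" and eq: "AE x in M. F x = H x"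
  shows "integrable (completion M) F" "(LINT x|completion M. F x) = (LINT x|M. H x)"
proof -
  have Hm: "H \<in> borel_measurable M" using H by auto
  obtain N where N: "N \<in> null_sets M" "{x \<in> space M. F x \<noteq> H x} \<subseteq> N"
    using AE_E[OF eq] by (metis (no_types, lifting) null_setsI)
  have Nc: "N \<in> null_sets (completion M)" using N(1) by (rule null_sets_completionI)
  have Fm: "F \<in> borel_measurable (completion M)"
  proof (rule measurableI)
    fix A :: "complex set" assume A: "A \<in> sets borel"
    have "F -` A \<inter> space (completion M) = ((H -` A \<inter> space M) - N) \<union> ((F -` A
        \<inter> space M) \<inter> N)"
      using N(2) by auto
    moreover have "(H -` A \<inter> space M) - N \<in> sets (completion M)"
      using measurable_sets[OF Hm A] N(1) by (intro sets_completionI_sets) auto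
    moreover have "(F -` A \<inter> space M) \<inter> N \<in> sets (completion M)"
      using null_sets_completion_subset[OF _ Nc, of "(F -` A \<inter> space M) \<inter> N"] by auto
    ultimately show "F -` A \<inter> space (completion M) \<in> sets (completion M)" by (simp only: sets.Un)
  qed auto
  have Hc: "H \<in> borel_measurable (completion M)" by (rule measurable_completion[OF Hm])
  have eqc: "AE x in completion M. F x = H x" by (rule AE_completion[OF eq])
  show "integrable (completion M) F"
    using integrable_cong_AE[OF Fm Hc eqc] integrable_completion[OF Hm] H by simp
  show "(LINT x|completion M. F x) = (LINT x|M. H x)"
    using integral_cong_AE[OF Fm Hc eqc] integral_completion[OF Hm] by simp
qed

lemma integral_haar_left:
  fixes F :: "real mat \<Rightarrow> complex"
  assumes F: "F \<in> borel_measurable (stiefel_borel n n)" and q: "q \<in> orth_group n"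
  shows "(LINT g|haar n. F (q * g)) = (LINT g|haar n. F g)"
proof -
  note id = measurable_ident_sets[OF refl]
  have m: "(\<lambda>g. q * g) \<in> stiefel_borel n n \<rightarrow>\<^sub>M stiefel_borel n n"
    by (rule stiefel_mult_measurable[OF stiefel_const_measurable id]) (use q in \<open>simp add:
        orth_group_eq_stiefel\<close>)
  then have m': "(\<lambda>g. q * g) \<in> haar n \<rightarrow>\<^sub>M stiefel_borel n n" by simp
  have "distr (haar n) (stiefel_borel n n) (\<lambda>g. q * g) = haar n"
  proof (rule measure_eqI)
    fix A assume "A \<in> sets (distr (haar n) (stiefel_borel n n) (\<lambda>g. q * g))"
    then have A: "A \<in> sets (stiefel_borel n n)" by simp
    then have "emeasure (distr (haar n) (stiefel_borel n n) (\<lambda>g. q * g)) A =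
        (\<integral>\<^sup>+g. indicator A (q * g) \<partial>haar n)"
      using nn_integral_distr[OF m', of "indicator A"] by simp
    also have "\<dots> = emeasure (haar n) A"
      using nn_integral_haar_left[OF _ q, of "indicator A"] A by simp
    finally show "emeasure (distr (haar n) (stiefel_borel n n) (\<lambda>g. q * g)) A = emeasure (haar n) A" .
  qed simp
  then have "(LINT g|haar n. F g) = (LINT g|distr (haar n) (stiefel_borel n n) (\<lambda>g. q * g). F
      g)" by simp
  also have "\<dots> = (LINT g|haar n. F (q * g))" by (rule integral_distr[OF m' F])
  finally show ?thesis by simp
qed

lemma frame_rot:
  assumes "v \<in> stiefel (l + m) m"
  shows "frame_rot (l + m) m v \<in> orth_group (l + m)" "frame_rot (l + m) m v * (0\<^sub>m l m
      @\<^sub>r 1\<^sub>m m) = v"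
proof -
  have "\<exists>g. g \<in> orth_group (l + m) \<and> g * (0\<^sub>m ((l + m) - m) m @\<^sub>r 1\<^sub>m m) = v"
    using stiefel_transitive[OF bot_frame_stiefel assms] by auto
  then have "frame_rot (l + m) m v \<in> orth_group (l + m) \<and> frame_rot (l + m) m v * (0\<^sub>m
      ((l + m) - m) m @\<^sub>r 1\<^sub>m m) = v"
    unfolding frame_rot_def by (rule someI_ex)
  then show "frame_rot (l + m) m v \<in> orth_group (l + m)" "frame_rot (l + m) m v * (0\<^sub>m l m
      @\<^sub>r 1\<^sub>m m) = v" by auto
qed

text \<open>\<open>frame_rot\<close> is an arbitrary choice for each frame. For a single generic x
  it differs from \<open>frame0\<close> by some diag(h0, 1), and the average over O(l) does not see
  this factor.\<close>

lemma frame_rot_average: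
  fixes f :: "real mat \<Rightarrow> complex"
  assumes f: "f \<in> borel_measurable (stiefel_borel (l + m) k)" and E0: "E0 \<in> stiefel (l + m) k"
    and x: "x \<in> carrier_mat (l + m) m" and generic: "generic l m x"
  shows "(LINT h|haar l. f (frame_rot (l + m) m (polar_part (l + m) m x) * (block_orth l h m * E0))) =
    (LINT h|haar l. f (frame0 l m x * (block_orth l h m * E0)))"
proof -
  note id = measurable_ident_sets[OF refl]
  let ?n = "l + m"
  define G0 where "G0 = frame_rot ?n m (polar_part ?n m x)"
  have det: "det (transpose_mat x * x) \<noteq> 0" using generic by (simp add: generic_def)
  note G0 = frame_rot[OF polar(1)[OF x det], folded G0_def]
  note fr = frame0_orth[OF x]
  obtain h0 where h0: "h0 \<in> orth_group l" "G0 = frame0 l m x * block_orth l h0 m"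
    using orth_same_last_cols[OF G0(1) fr] G0(2) frame0_generic[OF generic x] by auto
  note h0c = orth_groupD(1)[OF h0(1)] and frc = orth_groupD(1)[OF fr]
  define \<Phi> where "\<Phi> h = f (frame0 l m x * (block_orth l h m * E0))" for h
  have \<Phi>: "\<Phi> \<in> borel_measurable (stiefel_borel l l)"
    unfolding \<Phi>_def
    by (rule measurable_compose[OF stiefel_mult_measurable[OF stiefel_const_measurable
        stiefel_mult_measurable[OF block_orth_measurable[OF id] stiefel_const_measurable[OF E0]]] f])
      (use fr in \<open>simp add: orth_group_eq_stiefel\<close>)
  have "(LINT h|haar l. f (G0 * (block_orth l h m * E0))) = (LINT h|haar l. \<Phi> (h0 * h))"
  proof (intro Bochner_Integration.integral_cong refl)
    fix h assume "h \<in> space (haar l)"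
    then have hc: "h \<in> carrier_mat l l" using orth_groupD(1) by auto
    note b = block_orth_carrier[OF hc, of m] block_orth_carrier[OF h0c, of m]
    have "G0 * (block_orth l h m * E0) = frame0 l m x * ((block_orth l h0 m * block_orth l h m) * E0)"
      unfolding h0(2) using frc b stiefelD(1)[OF E0] by (simp add: assoc_mult_mat[of _ ?n ?n _ ?n _ k])
    then show "f (G0 * (block_orth l h m * E0)) = \<Phi> (h0 * h)" by (simp add: \<Phi>_def
        block_orth_mult[OF h0c hc])
  qed
  also have "\<dots> = (LINT h|haar l. \<Phi> h)" by (rule integral_haar_left[OF \<Phi> h0(1)])
  finally show ?thesis by (simp add: \<Phi>_def G0_def)
qed

section \<open>The two transforms as averages over O(n - m)\<close>

lemma integral_stiefel_measure:
  fixes F :: "real mat \<Rightarrow> complex"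
  assumes E: "E \<in> stiefel n m" and mn: "m \<le> n" and F: "F \<in> borel_measurable (stiefel_borel n m)"
  shows "(LINT v|stiefel_measure n m. F v) = (LINT g|haar n. F (g * E))"
    "integrable (stiefel_measure n m) F \<longleftrightarrow> integrable (haar n) (\<lambda>g. F (g * E))"
proof -
  have m: "(\<lambda>g. g * E) \<in> haar n \<rightarrow>\<^sub>M stiefel_borel n m"
    by (simp add: stiefel_mult_measurable[OF measurable_ident_sets[OF refl] stiefel_const_measurable[OF E]])
  show "(LINT v|stiefel_measure n m. F v) = (LINT g|haar n. F (g * E))"
    unfolding stiefel_measure_eq[OF E mn] by (rule integral_distr[OF m F])
  show "integrable (stiefel_measure n m) F \<longleftrightarrow> integrable (haar n) (\<lambda>g. F (g * E))"
    unfolding stiefel_measure_eq[OF E mn] by (rule integrable_distr_eq[OF m F])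
qed

lemma sets_stiefel_measure: "m \<le> n \<Longrightarrow> sets (stiefel_measure n m) = sets (stiefel_borel n m)"
  using stiefel_measure_eq[OF top_frame_stiefel[of m "n - m"]] by simp

lemma top_frame_append: "(1\<^sub>m k @\<^sub>r 0\<^sub>m a k) @\<^sub>r 0\<^sub>m b k = (1\<^sub>m k
    @\<^sub>r 0\<^sub>m (a + b) k :: real mat)"
  by (rule eq_matI) (auto simp: append_rows_def)

lemma append_zero_measurable:
  assumes "l = k + p"
  shows "(\<lambda>\<theta>. \<theta> @\<^sub>r 0\<^sub>m m k) \<in> stiefel_borel l k
      \<rightarrow>\<^sub>M stiefel_borel (l + m) k"
proof (rule stiefel_borelI)
  show "(\<lambda>\<theta>. \<theta> @\<^sub>r 0\<^sub>m m k) \<in> stiefel_borel l k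
      \<rightarrow>\<^sub>M mat_borel (l + m) k"
    by (rule append_rows_measurable[OF stiefel_borelD[OF measurable_ident_sets[OF refl]]
        mat_const_measurable]) simp
  fix \<theta> assume "\<theta> \<in> space (stiefel_borel l k)"
  then have t: "\<theta> \<in> carrier_mat l k" "transpose_mat \<theta> * \<theta> = 1\<^sub>m k" using
      stiefelD by auto
  have z: "0\<^sub>m m k \<in> carrier_mat m k" by simp
  have "transpose_mat (\<theta> @\<^sub>r 0\<^sub>m m k) * (\<theta> @\<^sub>r 0\<^sub>m m k) = 1\<^sub>m k"
    unfolding gram_append_rows[OF t(1) z t(1) z] t(2) by (intro eq_matI) auto
  then show "\<theta> @\<^sub>r 0\<^sub>m m k \<in> stiefel (l + m) k" using t(1) by (auto simp: stiefel_def)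
qed

text \<open>With base point [1; 0] the variable frame is theta = h[1; 0], and [theta; 0] is diag(h,
  1) applied to the frame of the first k unit vectors. Thus the average over frames becomes one over
  h, to which \<open>frame_rot_average\<close> applies.\<close>

lemma dual_funk_eq:
  fixes f :: "real mat \<Rightarrow> complex"
  assumes n: "n = k + p + m" and f: "f \<in> borel_measurable (stiefel_borel n k)"
    and x: "x \<in> carrier_mat n m" and generic: "generic (k + p) m x"
  shows "dual_funk n m k f (polar_part n m x) =
    (LINT h|haar (k + p). f (frame0 (k + p) m x * (block_orth (k + p) h m * (1\<^sub>m k @\<^sub>r
        0\<^sub>m (p + m) k))))"
proof -
  let ?l = "k + p"
  define E where "E = 1\<^sub>m k @\<^sub>r (0\<^sub>m p k :: real mat)"
  have E: "E \<in> stiefel ?l k" unfolding E_def by (rule top_frame_stiefel)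
  have nl: "n - m = ?l" "n = ?l + m" using n by auto
  have det: "det (transpose_mat x * x) \<noteq> 0" using generic by (simp add: generic_def)
  define G0 where "G0 = frame_rot n m (polar_part n m x)"
  have G0: "G0 \<in> orth_group n"
    unfolding G0_def nl(2) by (rule frame_rot(1)[OF polar(1)[OF x[unfolded nl(2)] det]])
  have E1: "1\<^sub>m k @\<^sub>r 0\<^sub>m (p + m) k \<in> stiefel (?l + m) k" using
      top_frame_stiefel[of k "p + m"] by (simp add: add.assoc)
  have Fm: "(\<lambda>\<theta>. f (G0 * (\<theta> @\<^sub>r 0\<^sub>m m k))) \<in> borel_measurable
      (stiefel_borel ?l k)"
    by (rule measurable_compose[OF stiefel_mult_measurable[OF stiefel_const_measurable
        append_zero_measurable[OF refl]] f[unfolded nl(2)]])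
      (use G0 nl in \<open>simp add: orth_group_eq_stiefel\<close>)
  have "dual_funk n m k f (polar_part n m x) = (LINT \<theta>|stiefel_measure ?l k. f (G0 * (\<theta>
      @\<^sub>r 0\<^sub>m m k)))"
    by (simp add: dual_funk_def nl(1) G0_def)
  also have "\<dots> = (LINT h|haar ?l. f (G0 * ((h * E) @\<^sub>r 0\<^sub>m m k)))"
    by (rule integral_stiefel_measure(1)[OF E le_add1 Fm])
  also have "\<dots> = (LINT h|haar ?l. f (G0 * (block_orth ?l h m * (1\<^sub>m k @\<^sub>r 0\<^sub>m
      (p + m) k))))"
  proof (intro Bochner_Integration.integral_cong refl)
    fix h assume "h \<in> space (haar ?l)"
    then have hc: "h \<in> carrier_mat ?l ?l" using orth_groupD(1) by auto
    have "block_orth ?l h m * (E @\<^sub>r 0\<^sub>m m k) = (h * E) @\<^sub>r 0\<^sub>m m k"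
      by (rule block_orth_rows[OF hc stiefelD(1)[OF E]]) simp
    then show "f (G0 * ((h * E) @\<^sub>r 0\<^sub>m m k)) = f (G0 * (block_orth ?l h m * (1\<^sub>m k
        @\<^sub>r 0\<^sub>m (p + m) k)))"
      unfolding E_def top_frame_append by simp
  qed
  also have "\<dots> = (LINT h|haar ?l. f (frame0 ?l m x * (block_orth ?l h m * (1\<^sub>m k @\<^sub>r
      0\<^sub>m (p + m) k))))"
    unfolding G0_def nl(2) by (rule frame_rot_average[OF f[unfolded nl(2)] E1 x[unfolded nl(2)] generic])
  finally show ?thesis .
qed

text \<open>The base point a = [1; 0] among the frames diag(a, 1) over which
  \<open>compl_radon\<close> integrates.\<close>

definition diag_frame :: "nat \<Rightarrow> nat \<Rightarrow> nat \<Rightarrow> real mat" where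
  "diag_frame p N m = four_block_mat (1\<^sub>m p @\<^sub>r 0\<^sub>m N p) (0\<^sub>m (p + N) m)
      (0\<^sub>m m p) (1\<^sub>m m)"

lemma four_block_diag_stiefel:
  assumes a: "a \<in> stiefel l p"
  shows "four_block_mat a (0\<^sub>m l m) (0\<^sub>m m p) (1\<^sub>m m) \<in> stiefel (l + m) (p + m)"
proof -
  note ac = stiefelD[OF a]
  have "transpose_mat (four_block_mat a (0\<^sub>m l m) (0\<^sub>m m p) (1\<^sub>m m)) = four_block_mat
      (transpose_mat a) (0\<^sub>m p m) (0\<^sub>m m l) (1\<^sub>m m)"
    using ac by (simp add: transpose_four_block_mat[of _ l p _ m _ m])
  then have "transpose_mat (four_block_mat a (0\<^sub>m l m) (0\<^sub>m m p) (1\<^sub>m m)) *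
      four_block_mat a (0\<^sub>m l m) (0\<^sub>m m p) (1\<^sub>m m) = 1\<^sub>m (p + m)"
    using ac mult_four_block_mat[of "transpose_mat a" p l "0\<^sub>m p m" m "0\<^sub>m m l" m
        "1\<^sub>m m" a p "0\<^sub>m l m" m "0\<^sub>m m p" "1\<^sub>m m"] by simp
  then show ?thesis using ac(1) by (simp add: stiefel_def)
qed

lemma diag_frame:
  "diag_frame p N m \<in> stiefel (p + N + m) (p + m)"
  "diag_frame p N m * (0\<^sub>m p m @\<^sub>r 1\<^sub>m m) = 0\<^sub>m (p + N) m @\<^sub>r 1\<^sub>m m"
proof -
  show "diag_frame p N m \<in> stiefel (p + N + m) (p + m)"
    unfolding diag_frame_def by (rule four_block_diag_stiefel[OF top_frame_stiefel])
  show "diag_frame p N m * (0\<^sub>m p m @\<^sub>r 1\<^sub>m m) = 0\<^sub>m (p + N) m @\<^sub>r 1\<^sub>m m"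
    unfolding diag_frame_def using top_frame_carrier[of p N]
    by (subst four_block_mult_append_rows[of _ "p + N" p _ m _ m _ _ m]) auto
qed

lemma four_block_diag_measurable:
  "(\<lambda>a. four_block_mat a (0\<^sub>m l m) (0\<^sub>m m p) (1\<^sub>m m)) \<in> stiefel_borel l p
      \<rightarrow>\<^sub>M stiefel_borel (l + m) (p + m)"
proof (rule stiefel_borelI)
  have id: "(\<lambda>a. a) \<in> stiefel_borel l p \<rightarrow>\<^sub>M mat_borel l p" by (rule
      stiefel_borelD[OF measurable_ident_sets[OF refl]])
  show "(\<lambda>a. four_block_mat a (0\<^sub>m l m) (0\<^sub>m m p) (1\<^sub>m m)) \<in>
      stiefel_borel l p \<rightarrow>\<^sub>M mat_borel (l + m) (p + m)"
  proof (rule mat_borelI)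
    fix i j assume ij: "i < l + m" "j < p + m"
    have "(\<lambda>a. if i < l \<and> j < p then a $$ (i,j) else if \<not> i < l \<and> \<not> j < p
        \<and> i - l = j - p then 1 else 0) \<in> borel_measurable (stiefel_borel l p)"
      using mat_borel_entry[OF id, of i j] by (cases "i < l \<and> j < p") auto
    then show "(\<lambda>a. four_block_mat a (0\<^sub>m l m) (0\<^sub>m m p) (1\<^sub>m m) $$ (i,j))
        \<in> borel_measurable (stiefel_borel l p)"
    proof (rule measurable_cong[THEN iffD1, rotated])
      fix a assume "a \<in> space (stiefel_borel l p)"
      then have "a \<in> carrier_mat l p" using stiefelD(1) by auto
      then show "(if i < l \<and> j < p then a $$ (i,j) else if \<not> i < l \<and> \<not> j < p \<and>
          i - l = j - p then 1 else 0) = four_block_mat a (0\<^sub>m l m) (0\<^sub>m m p) (1\<^sub>m m)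
          $$ (i,j)"
        using ij by auto
    qed
  qed (use four_block_diag_stiefel stiefelD(1) in auto)
qed (use four_block_diag_stiefel in auto)

text \<open>Since diag(ha, 1) = diag(h, 1) diag(a, 1), this is an average over the same block
  rotations as for the dual Funk transform, with another base frame.\<close>

lemma compl_radon_eq:
  fixes f :: "real mat \<Rightarrow> complex"
  assumes n: "n = p + N + m" and k: "k = p + m" and f: "f \<in> borel_measurable (stiefel_borel n k)"
    and x: "x \<in> carrier_mat n m" and generic: "generic (p + N) m x"
  shows "compl_radon n k m f (polar_part n m x) =
    (LINT h|haar (p + N). f (frame0 (p + N) m x * (block_orth (p + N) h m * diag_frame p N m)))"
proof -
  let ?l = "p + N"
  define E where "E = 1\<^sub>m p @\<^sub>r (0\<^sub>m N p :: real mat)"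
  have E: "E \<in> stiefel ?l p" unfolding E_def by (rule top_frame_stiefel)
  have nl: "n - m = ?l" "n = ?l + m" "k - m = p" using n k by auto
  have det: "det (transpose_mat x * x) \<noteq> 0" using generic by (simp add: generic_def)
  define G0 where "G0 = frame_rot n m (polar_part n m x)"
  have G0: "G0 \<in> orth_group n"
    unfolding G0_def nl(2) by (rule frame_rot(1)[OF polar(1)[OF x[unfolded nl(2)] det]])
  have Fm: "(\<lambda>a. f (G0 * four_block_mat a (0\<^sub>m ?l m) (0\<^sub>m m p) (1\<^sub>m m)))
      \<in> borel_measurable (stiefel_borel ?l p)"
    by (rule measurable_compose[OF stiefel_mult_measurable[OF stiefel_const_measurable
        four_block_diag_measurable] f[unfolded nl(2) k]])
      (use G0 nl in \<open>simp add: orth_group_eq_stiefel\<close>)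
  have "compl_radon n k m f (polar_part n m x) = (LINT a|stiefel_measure ?l p. f (G0 * four_block_mat a
      (0\<^sub>m ?l m) (0\<^sub>m m p) (1\<^sub>m m)))"
    by (simp add: compl_radon_def nl G0_def)
  also have "\<dots> = (LINT h|haar ?l. f (G0 * four_block_mat (h * E) (0\<^sub>m ?l m) (0\<^sub>m m p)
      (1\<^sub>m m)))"
    by (rule integral_stiefel_measure(1)[OF E le_add1 Fm])
  also have "\<dots> = (LINT h|haar ?l. f (G0 * (block_orth ?l h m * diag_frame p N m)))"
  proof (intro Bochner_Integration.integral_cong refl)
    fix h assume "h \<in> space (haar ?l)"
    then have hc: "h \<in> carrier_mat ?l ?l" using orth_groupD(1) by auto
    have "block_orth ?l h m * diag_frame p N m = four_block_mat (h * E) (0\<^sub>m ?l m) (0\<^sub>m m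
        p) (1\<^sub>m m)"
      unfolding block_orth_def diag_frame_def E_def[symmetric] using hc stiefelD(1)[OF E]
      by (subst mult_four_block_mat[of _ ?l ?l _ m _ m _ _ p _ m]) auto
    then show "f (G0 * four_block_mat (h * E) (0\<^sub>m ?l m) (0\<^sub>m m p) (1\<^sub>m m)) = f (G0 *
        (block_orth ?l h m * diag_frame p N m))" by simp
  qed
  also have "\<dots> = (LINT h|haar ?l. f (frame0 ?l m x * (block_orth ?l h m * diag_frame p N m)))"
    unfolding G0_def nl(2) by (rule frame_rot_average[OF f[unfolded nl(2) k] diag_frame(1) x[unfolded
        nl(2)] generic])
  finally show ?thesis .
qed

text \<open>The Gram determinant is nonnegative, so for a real exponent the complex power is the
  real one.\<close>

lemma E_ext_generic:
  assumes x: "x \<in> carrier_mat (l + m) m" and generic: "generic l m x" and a: "a = complex_of_real b"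
  shows "E_ext (l + m) m a F x = complex_of_real (det (transpose_mat x * x) powr (b / 2)) * F
      (polar_part (l + m) m x)"
proof -
  have det: "det (transpose_mat x * x) \<noteq> 0" using generic by (simp add: generic_def)
  have "complex_of_real (det (transpose_mat x * x)) powr (a / 2) = complex_of_real (det (transpose_mat
      x * x) powr (b / 2))"
    using powr_of_real[OF det_gram_nonneg[OF x], of "b / 2"] by (simp add: a)
  then show ?thesis using rank_eq_of_det_gram[OF x det] by (simp add: E_ext_def)
qed

subsection \<open>The pairings as integrals over the Stiefel manifold\<close>

text \<open>The factors Gamma((N + k - j)/2) are common to both constants and cancel, as do the
  powers of pi in front of the two Siegel gamma functions. The remaining exponents of pi match
  because km/2 + Nm = (N + k)m/2 + Nm/2.\<close>

lemma gram_const_ratio: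
  assumes "m \<le> N" "m \<le> k"
  shows "gram_const m N k * (2 * pi) ^ (N * m) =
    (2 ^ (m * N) * pi powr (real (N + k) * real m / 2) * Gamma_mult m (real N / 2) / Gamma_mult m (real
        k / 2)) * gram_const m k N"
proof -
  have G: "Gamma (real a / 2 - real j / 2) > 0" if "j < m" "m \<le> a" for a j
    using that by (intro Gamma_real_pos) (auto simp: diff_divide_distrib[symmetric])
  have r: "radial_const (a - j) b = pi powr (real b / 2) * Gamma (real a / 2 - real j / 2) / Gamma
      ((real (a + b) - real j) / 2)"
    if "j < m" "m \<le> a" for a b j
    using that by (simp add: radial_const_def of_nat_diff diff_divide_distrib algebra_simps)
  define P where "P a = (\<Prod>j<m. Gamma (real a / 2 - real j / 2))" for a :: nat
  define Q where "Q = (\<Prod>j<m. Gamma ((real (N + k) - real j) / 2))"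
  have 1: "gram_const m N k = (pi powr (real k / 2)) ^ m * P N / Q"
    unfolding gram_const_def P_def Q_def using assms(1) by (simp add: r prod_dividef prod.distrib)
  have 2: "gram_const m k N = (pi powr (real N / 2)) ^ m * P k / Q"
    unfolding gram_const_def P_def Q_def using assms(2) by (simp add: r prod_dividef prod.distrib add.commute)
  have Pk: "P k > 0" unfolding P_def using G assms by (intro prod_pos) auto
  define g where "g = pi powr (real m * (real m - 1) / 4)"
  have g: "g > 0" by (simp add: g_def)
  have 3: "Gamma_mult m (real N / 2) / Gamma_mult m (real k / 2) = P N / P k"
    unfolding Gamma_mult_def P_def g_def[symmetric] using g by simp
  have pw: "(pi powr a) ^ m = pi powr (a * real m)" for a by (simp add: powr_powr flip: powr_realpow)
  have "(pi powr (real k / 2)) ^ m * (2 * pi) ^ (N * m) = 2 ^ (m * N) * (pi powr (real k * real m / 2)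
      * pi powr (real N * real m))"
    by (simp add: pw power_mult_distrib mult.commute flip: powr_realpow)
  also have "pi powr (real k * real m / 2) * pi powr (real N * real m) = pi powr (real (N + k) * real m
      / 2) * (pi powr (real N / 2)) ^ m"
    unfolding pw powr_add[symmetric] by (simp add: field_simps)
  finally have 4: "(pi powr (real k / 2)) ^ m * (2 * pi) ^ (N * m) = 2 ^ (m * N) * (pi powr (real (N +
      k) * real m / 2) * (pi powr (real N / 2)) ^ m)" .
  have "gram_const m N k * (2 * pi) ^ (N * m) = ((pi powr (real k / 2)) ^ m * (2 * pi) ^ (N * m)) * P N / Q"
    unfolding 1 by simp
  also have "\<dots> = (2 ^ (m * N) * pi powr (real (N + k) * real m / 2) * (P N / P k)) * ((pi powr
      (real N / 2)) ^ m * P k / Q)"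
    unfolding 4 using Pk by simp
  finally show ?thesis unfolding 2 3[symmetric] by simp
qed

lemma wt_orth: "g \<in> orth_group n \<Longrightarrow> x \<in> carrier_mat n m \<Longrightarrow> wt M
    (g * x) = wt M x"
  by (simp add: wt_def fsq_orth)

text \<open>\<open>J\<close> stands for either embedding by zero rows; it does not increase the
  weight, and rotations preserve it. So the integrand is dominated by a function of z times a
  function of g, both integrable.\<close>

lemma fibre_pairing_integrable:
  fixes f \<psi> :: "real mat \<Rightarrow> complex"
  assumes E: "E \<in> stiefel n k" and f: "f \<in> borel_measurable (stiefel_borel n k)" "integrable
      (haar n) (\<lambda>g. f (g * E))"
    and \<psi>: "\<psi> \<in> borel_measurable (mat_borel n m)" "\<And>x. x \<in> carrier_mat n m
        \<Longrightarrow> norm (\<psi> x) \<le> C * wt (n * m) x"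
    and J: "J \<in> mat_borel b m \<rightarrow>\<^sub>M mat_borel n m" "\<And>z. z \<in> carrier_mat b
        m \<Longrightarrow> wt (n * m) (J z) \<le> wt (n * m) z" and b: "b \<le> n" and C: "C \<ge> 0"
  shows "integrable (lmat b m \<Otimes>\<^sub>M haar n) (\<lambda>w. f (snd w * E) * cnj (\<psi> (snd w
      * J (fst w))))"
proof -
  have i1: "integrable (lmat b m) (\<lambda>z. complex_of_real (C * wt (n * m) z))"
    using b by (intro integrable_of_real integrable_mult_right wt_integrable) auto
  have cm: "(\<lambda>z. cnj (G z)) \<in> borel_measurable M" if "G \<in> borel_measurable M" for G and
      M :: "(real mat \<times> real mat) measure"
    using that by (intro measurable_compose[OF that] borel_measurable_continuous_onI continuous_intros)
  show ?thesis
  proof (rule Bochner_Integration.integrable_bound[OF integrable_pair_times[OF sigma_finite_lmat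
      sigma_finite_haar i1 f(2)]])
    have a: "(\<lambda>w. f (snd w * E)) \<in> borel_measurable (mat_borel b m \<Otimes>\<^sub>M
        stiefel_borel n n)"
      by (rule measurable_compose[OF stiefel_mult_measurable[OF measurable_snd
          stiefel_const_measurable[OF E]] f(1)])
    have c: "(\<lambda>w. \<psi> (snd w * J (fst w))) \<in> borel_measurable (mat_borel b m
        \<Otimes>\<^sub>M stiefel_borel n n)"
      by (rule measurable_compose[OF mat_mult_measurable[OF stiefel_borelD[OF measurable_snd]
          measurable_compose[OF measurable_fst J(1)]] \<psi>(1)])
    show "(\<lambda>w. f (snd w * E) * cnj (\<psi> (snd w * J (fst w)))) \<in> borel_measurable (lmat b
        m \<Otimes>\<^sub>M haar n)"
      using borel_measurable_times[OF a cm[OF c]] by simp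
    show "AE w in lmat b m \<Otimes>\<^sub>M haar n. norm (f (snd w * E) * cnj (\<psi> (snd w * J (fst
        w)))) \<le> norm (complex_of_real (C * wt (n * m) (fst w)) * f (snd w * E))"
    proof (rule AE_I2)
      fix w assume "w \<in> space (lmat b m \<Otimes>\<^sub>M haar n)"
      then have w: "fst w \<in> carrier_mat b m" "snd w \<in> orth_group n" by (auto simp: space_pair_measure)
      have Jc: "J (fst w) \<in> carrier_mat n m" using measurable_space[OF J(1), of "fst w"] w by simp
      have "norm (\<psi> (snd w * J (fst w))) \<le> C * wt (n * m) (snd w * J (fst w))"
        using Jc orth_groupD(1)[OF w(2)] by (intro \<psi>(2)) auto
      also have "\<dots> \<le> C * wt (n * m) (fst w)" unfolding wt_orth[OF w(2) Jc] by (intro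
          mult_left_mono J(2) w C)
      finally have "norm (\<psi> (snd w * J (fst w))) \<le> \<bar>C * wt (n * m) (fst w)\<bar>" by linarith
      then show "norm (f (snd w * E) * cnj (\<psi> (snd w * J (fst w)))) \<le> norm (complex_of_real (C
          * wt (n * m) (fst w)) * f (snd w * E))"
        unfolding norm_mult norm_of_real complex_mod_cnj by (subst mult.commute, intro mult_right_mono) auto
    qed
  qed
qed

lemma pair_cnj_measurable:
  "\<psi> \<in> borel_measurable (mat_borel n m) \<Longrightarrow> (\<lambda>s. fst s * cnj (\<psi>
      (snd s))) \<in> borel_measurable (borel \<Otimes>\<^sub>M mat_borel n m)"
  for \<psi> :: "real mat \<Rightarrow> complex"
proof -
  assume \<psi>: "\<psi> \<in> borel_measurable (mat_borel n m)"
  have "(\<lambda>s. cnj (\<psi> (snd s))) \<in> borel_measurable (borel \<Otimes>\<^sub>M mat_borel n m)"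
    by (rule measurable_compose[OF measurable_compose[OF measurable_snd \<psi>]]) (intro
        borel_measurable_continuous_onI continuous_intros)
  then show ?thesis by (intro borel_measurable_times measurable_fst)
qed

lemma frame_pair_measurable:
  assumes E0: "E0 \<in> stiefel (l + m) k" and f: "f \<in> borel_measurable (stiefel_borel (l + m) k)"
  shows "(\<lambda>w. (f (frame0 l m (fst w) * (block_orth l (snd w) m * E0)), fst w)) \<in> lmat (l +
      m) m \<Otimes>\<^sub>M haar l \<rightarrow>\<^sub>M borel \<Otimes>\<^sub>M mat_borel (l + m) m"
  using measurable_Pair[OF measurable_compose[OF stiefel_mult_measurable[OF frame0_measurable[OF
      measurable_fst] stiefel_mult_measurable[OF block_orth_measurable[OF measurable_snd]
      stiefel_const_measurable[OF E0]]] f] measurable_fst]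
  by simp

lemma fibre_pair_measurable:
  assumes E: "E \<in> stiefel n k" and f: "f \<in> borel_measurable (stiefel_borel n k)" and J: "J
      \<in> mat_borel b m \<rightarrow>\<^sub>M mat_borel n m"
  shows "(\<lambda>w. (f (snd w * E), snd w * J (fst w))) \<in> lmat b m \<Otimes>\<^sub>M haar n
      \<rightarrow>\<^sub>M borel \<Otimes>\<^sub>M mat_borel n m"
  using measurable_Pair[OF measurable_compose[OF stiefel_mult_measurable[OF measurable_snd
      stiefel_const_measurable[OF E]] f]
    mat_mult_measurable[OF stiefel_borelD[OF measurable_snd] measurable_compose[OF measurable_fst J]]]
  by simp

lemma curry_measurable:
  assumes "G \<in> borel_measurable (borel \<Otimes>\<^sub>M mat_borel n m)" "f \<in> borel_measurable
      (stiefel_borel n k)"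
  shows "(\<lambda>z. G (f (fst z), snd z)) \<in> borel_measurable (stiefel_borel n k \<Otimes>\<^sub>M
      mat_borel n m)"
  by (rule measurable_compose[OF measurable_Pair[OF measurable_compose[OF measurable_fst assms(2)]
      measurable_snd] assms(1)])

context
  fixes n m k p N q :: nat and f \<psi> :: "real mat \<Rightarrow> complex" and C :: real
  assumes N: "N = p + m" and n: "n = k + N" and k: "k = q + m"
    and f: "f \<in> borel_measurable (stiefel_borel n k)" "integrable (haar n) (\<lambda>g. f (g *
        (1\<^sub>m k @\<^sub>r 0\<^sub>m N k)))"
    and \<psi>: "\<psi> \<in> borel_measurable (mat_borel n m)" "\<And>x. x \<in> carrier_mat n m
        \<Longrightarrow> norm (\<psi> x) \<le> C * wt (n * m) x" "C \<ge> 0"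
begin

lemma E1_stiefel: "1\<^sub>m k @\<^sub>r 0\<^sub>m N k \<in> stiefel n k"
  unfolding n by (rule top_frame_stiefel)

lemma zero_top_measurable: "(\<lambda>z. 0\<^sub>m k m @\<^sub>r z) \<in> mat_borel N m
    \<rightarrow>\<^sub>M mat_borel n m"
  unfolding n by (rule append_rows_measurable[OF mat_const_measurable measurable_ident_sets[OF refl]]) simp

lemma zero_bottom_measurable: "(\<lambda>y. y @\<^sub>r 0\<^sub>m N m) \<in> mat_borel k m
    \<rightarrow>\<^sub>M mat_borel n m"
  unfolding n by (rule append_rows_measurable[OF measurable_ident_sets[OF refl] mat_const_measurable]) simp

text \<open>\<open>H\<close> is meant to be \<open>fourier_mat\<close> and psi its Borel version
  \<open>Ft\<close>; they are compared only on matrices of the right format. The identity for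
  orthogonal fibres is transferred to complex integrands, and then the integral over z is made the
  inner one.\<close>

lemma pairing_dual_funk:
  fixes H :: "real mat \<Rightarrow> complex"
  assumes H: "\<And>x. x \<in> carrier_mat n m \<Longrightarrow> H x = \<psi> x"
  shows "pairing_converges n m (E_ext n m (- of_nat k) (dual_funk n m k f)) H"
    and "pairing n m (E_ext n m (- of_nat k) (dual_funk n m k f)) H = complex_of_real (gram_const m N k) *
      (LINT g|haar n. f (g * (1\<^sub>m k @\<^sub>r 0\<^sub>m N k)) * cnj (LINT z|lmat N m. \<psi> (g *
          (0\<^sub>m k m @\<^sub>r z))))"
proof -
  let ?l = "k + p" and ?E = "1\<^sub>m k @\<^sub>r (0\<^sub>m N k :: real mat)"
  have nl: "n = ?l + m" "n = k + p + m" using n N by auto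
  note E = E1_stiefel and J = zero_top_measurable
  \<comment> \<open>The pair keeps the value of \<open>f\<close> together with the point x, so the
    fibre identity is used for nonnegative functions of both, and \<open>W\<close> is a fixed Borel
    function of the pair.\<close>
  define P where "P w = (f (frame0 ?l m (fst w) * (block_orth ?l (snd w) m * ?E)), fst w)" for w ::
      "real mat \<times> real mat"
  define Q where "Q w = (f (snd w * ?E), snd w * (0\<^sub>m k m @\<^sub>r fst w))" for w :: "real mat
      \<times> real mat"
  define W where "W s = fst s * cnj (\<psi> (snd s))" for s :: "complex \<times> real mat"
  define d where "d x = det (transpose_mat x * x) powr (- (real k / 2))" for x :: "real mat"
  have Pm: "P \<in> lmat n m \<Otimes>\<^sub>M haar ?l \<rightarrow>\<^sub>M borel \<Otimes>\<^sub>M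
      mat_borel n m"
    unfolding P_def[abs_def] nl(1) by (rule frame_pair_measurable[OF E[unfolded nl(1)] f(1)[unfolded nl(1)]])
  have Qm: "Q \<in> lmat N m \<Otimes>\<^sub>M haar n \<rightarrow>\<^sub>M borel \<Otimes>\<^sub>M
      mat_borel n m"
    unfolding Q_def[abs_def] by (rule fibre_pair_measurable[OF E f(1) J])
  have dm: "d \<in> borel_measurable (lmat n m)"
    unfolding d_def[abs_def] measurable_lmat_cong(2)
    using mat_det_measurable[OF gram_measurable[OF measurable_ident_sets[OF refl]], of n m] by measurable
  have Wm: "W \<in> borel_measurable (borel \<Otimes>\<^sub>M mat_borel n m)" unfolding W_def[abs_def]
      by (rule pair_cnj_measurable[OF \<psi>(1)])
  have c0: "0 \<le> gram_const m N k" using gram_const_pos[of m N k] N by simp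
  have eq: "(\<integral>\<^sup>+x. ennreal (d x) * (\<integral>\<^sup>+h. G (P (x, h)) \<partial>haar
      ?l) \<partial>lmat n m) = ennreal (gram_const m N k) * (\<integral>\<^sup>+z.
      \<integral>\<^sup>+g. G (Q (z, g)) \<partial>haar n \<partial>lmat N m)"
    if G: "G \<in> borel_measurable (borel \<Otimes>\<^sub>M mat_borel n m)" for G
    using nn_integral_orthogonal_fibres[OF nl(2) curry_measurable[OF G f(1), simplified]] by (simp add:
        P_def Q_def d_def N)
  have wtJ: "wt (n * m) (0\<^sub>m k m @\<^sub>r z) \<le> wt (n * m) z" if "z \<in> carrier_mat N m" for z
    by (rule wt_append_le(2)[OF that zero_carrier_mat])
  have int: "integrable (lmat N m \<Otimes>\<^sub>M haar n) (\<lambda>w. W (Q w))"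
    unfolding W_def Q_def fst_conv snd_conv
    by (rule fibre_pairing_integrable[OF E f \<psi>(1,2) J wtJ _ \<psi>(3)]) (simp_all add: n)
  note T = integral_transfer[OF sigma_finite_lmat sigma_finite_haar sigma_finite_lmat sigma_finite_haar
      Pm Qm dm _ c0 eq Wm int]
  have T1: "integrable (lmat n m) (\<lambda>x. of_real (d x) * (LINT h|haar ?l. W (P (x, h))))"
    by (rule T(1)) (simp add: d_def)
  have T2: "(LINT x|lmat n m. of_real (d x) * (LINT h|haar ?l. W (P (x, h)))) = of_real (gram_const m N
      k) * (LINT w|(lmat N m \<Otimes>\<^sub>M haar n). W (Q w))"
    by (rule T(2)) (simp add: d_def)
  have ae: "AE x in lmat n m. E_ext n m (- of_nat k) (dual_funk n m k f) x * cnj (H x) = of_real (d x)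
      * (LINT h|haar ?l. W (P (x, h)))"
    using AE_generic[of ?l m, folded nl(1)] AE_space
  proof eventually_elim
    case (elim x)
    then have x: "x \<in> carrier_mat n m" by simp
    have "E_ext n m (- of_nat k) (dual_funk n m k f) x = complex_of_real (d x) * dual_funk n m k f
        (polar_part n m x)"
      using E_ext_generic[OF x[unfolded nl(1)] elim(1), of "- of_nat k" "- real k"] unfolding
          nl(1)[symmetric] d_def by simp
    then show ?case
      unfolding H[OF x] dual_funk_eq[OF nl(2) f(1) x elim(1)] N[symmetric] by (simp add: W_def P_def)
  qed
  note A = AE_eq_completion[OF T1 ae]
  show "pairing_converges n m (E_ext n m (- of_nat k) (dual_funk n m k f)) H"
    unfolding pairing_converges_def mat_lebesgue_eq by (rule A(1))
  interpret H: prob_space "haar n" by (rule prob_space_haar)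
  interpret L: sigma_finite_measure "lmat N m" by (rule sigma_finite_lmat)
  interpret PP: pair_sigma_finite "lmat N m" "haar n" by standard
  have int': "integrable (lmat N m \<Otimes>\<^sub>M haar n) (\<lambda>(z,g). W (Q (z,g)))" using int
      by (simp add: case_prod_beta')
  have "(LINT w|(lmat N m \<Otimes>\<^sub>M haar n). W (Q w)) = (LINT g|haar n. LINT z|lmat N m. W (Q (z, g)))"
    using PP.integral_snd[OF int'] by (simp add: case_prod_beta')
  also have "\<dots> = (LINT g|haar n. f (g * ?E) * cnj (LINT z|lmat N m. \<psi> (g * (0\<^sub>m k m
      @\<^sub>r z))))"
    by (simp add: W_def Q_def)
  finally show "pairing n m (E_ext n m (- of_nat k) (dual_funk n m k f)) H = complex_of_real
      (gram_const m N k) *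
      (LINT g|haar n. f (g * ?E) * cnj (LINT z|lmat N m. \<psi> (g * (0\<^sub>m k m @\<^sub>r z))))"
    unfolding pairing_def mat_lebesgue_eq A(2) T2 by simp
qed

text \<open>The same scheme with the containing fibres: k - n = -N makes the exponent of the weight
  -N/2, and the matrices left over have k rows.\<close>

lemma pairing_compl_radon:
  assumes inv: "right_orth_invariant n k f"
  shows "pairing_converges n m (E_ext n m (of_nat k - of_nat n) (compl_radon n k m f)) \<psi>"
    and "pairing n m (E_ext n m (of_nat k - of_nat n) (compl_radon n k m f)) \<psi> = complex_of_real
        (gram_const m k N) *
      (LINT g|haar n. f (g * (1\<^sub>m k @\<^sub>r 0\<^sub>m N k)) * cnj (LINT y|lmat k m. \<psi> (g *
          (y @\<^sub>r 0\<^sub>m N m))))"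
proof -
  let ?l = "q + N" and ?E = "1\<^sub>m k @\<^sub>r (0\<^sub>m N k :: real mat)" and ?D = "diag_frame q N m"
  have nl: "n = ?l + m" using n k by auto
  note E = E1_stiefel and J = zero_bottom_measurable
  have D: "?D \<in> stiefel n k" using diag_frame(1)[of q N m] unfolding nl k .
  define P where "P w = (f (frame0 ?l m (fst w) * (block_orth ?l (snd w) m * ?D)), fst w)" for w ::
      "real mat \<times> real mat"
  define Q where "Q w = (f (snd w * ?E), snd w * (fst w @\<^sub>r 0\<^sub>m N m))" for w :: "real mat
      \<times> real mat"
  define W where "W s = fst s * cnj (\<psi> (snd s))" for s :: "complex \<times> real mat"
  define d where "d x = det (transpose_mat x * x) powr (- (real N / 2))" for x :: "real mat"
  have Pm: "P \<in> lmat n m \<Otimes>\<^sub>M haar ?l \<rightarrow>\<^sub>M borel \<Otimes>\<^sub>M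
      mat_borel n m"
    unfolding P_def[abs_def] nl by (rule frame_pair_measurable[OF D[unfolded nl] f(1)[unfolded nl]])
  have Qm: "Q \<in> lmat k m \<Otimes>\<^sub>M haar n \<rightarrow>\<^sub>M borel \<Otimes>\<^sub>M
      mat_borel n m"
    unfolding Q_def[abs_def] by (rule fibre_pair_measurable[OF E f(1) J])
  have dm: "d \<in> borel_measurable (lmat n m)"
    unfolding d_def[abs_def] measurable_lmat_cong(2)
    using mat_det_measurable[OF gram_measurable[OF measurable_ident_sets[OF refl]], of n m] by measurable
  have Wm: "W \<in> borel_measurable (borel \<Otimes>\<^sub>M mat_borel n m)" unfolding W_def[abs_def]
      by (rule pair_cnj_measurable[OF \<psi>(1)])
  have c0: "0 \<le> gram_const m k N" using gram_const_pos[of m k N] k by simp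
  have eq: "(\<integral>\<^sup>+x. ennreal (d x) * (\<integral>\<^sup>+h. G (P (x, h)) \<partial>haar
      ?l) \<partial>lmat n m) = ennreal (gram_const m k N) * (\<integral>\<^sup>+z.
      \<integral>\<^sup>+g. G (Q (z, g)) \<partial>haar n \<partial>lmat k m)"
    if G: "G \<in> borel_measurable (borel \<Otimes>\<^sub>M mat_borel n m)" for G
  proof -
    have i: "G (f (u * \<gamma>), x) = G (f u, x)" if "u \<in> stiefel n k" "\<gamma> \<in> orth_group
        k" for u \<gamma> x
      using inv that by (simp add: right_orth_invariant_def)
    show ?thesis
      using nn_integral_containing_fibres[where G = "\<lambda>u x. G (f u, x)", OF nl k
          curry_measurable[OF G f(1)] i D diag_frame(2)]
      by (simp add: P_def Q_def d_def)
  qed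
  have wtJ: "wt (n * m) (z @\<^sub>r 0\<^sub>m N m) \<le> wt (n * m) z" if "z \<in> carrier_mat k m" for z
    by (rule wt_append_le(1)[OF that zero_carrier_mat])
  have int: "integrable (lmat k m \<Otimes>\<^sub>M haar n) (\<lambda>w. W (Q w))"
    unfolding W_def Q_def fst_conv snd_conv
    by (rule fibre_pairing_integrable[OF E f \<psi>(1,2) J wtJ _ \<psi>(3)]) (simp_all add: n)
  note T = integral_transfer[OF sigma_finite_lmat sigma_finite_haar sigma_finite_lmat sigma_finite_haar
      Pm Qm dm _ c0 eq Wm int]
  have T1: "integrable (lmat n m) (\<lambda>x. of_real (d x) * (LINT h|haar ?l. W (P (x, h))))"
    by (rule T(1)) (simp add: d_def)
  have T2: "(LINT x|lmat n m. of_real (d x) * (LINT h|haar ?l. W (P (x, h)))) = of_real (gram_const m k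
      N) * (LINT w|(lmat k m \<Otimes>\<^sub>M haar n). W (Q w))"
    by (rule T(2)) (simp add: d_def)
  have ae: "AE x in lmat n m. E_ext n m (of_nat k - of_nat n) (compl_radon n k m f) x * cnj (\<psi> x)
      = of_real (d x) * (LINT h|haar ?l. W (P (x, h)))"
    using AE_generic[of ?l m, folded nl] AE_space
  proof eventually_elim
    case (elim x)
    then have x: "x \<in> carrier_mat n m" by simp
    have "E_ext n m (of_nat k - of_nat n) (compl_radon n k m f) x = complex_of_real (d x) * compl_radon
        n k m f (polar_part n m x)"
      using E_ext_generic[OF x[unfolded nl] elim(1), of "of_nat k - of_nat n" "- real N"] unfolding
          nl[symmetric] d_def by (simp add: n)
    then show ?case
      unfolding compl_radon_eq[OF nl k f(1) x elim(1)] by (simp add: W_def P_def)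
  qed
  note A = AE_eq_completion[OF T1 ae]
  show "pairing_converges n m (E_ext n m (of_nat k - of_nat n) (compl_radon n k m f)) \<psi>"
    unfolding pairing_converges_def mat_lebesgue_eq by (rule A(1))
  interpret H: prob_space "haar n" by (rule prob_space_haar)
  interpret L: sigma_finite_measure "lmat k m" by (rule sigma_finite_lmat)
  interpret PP: pair_sigma_finite "lmat k m" "haar n" by standard
  have int': "integrable (lmat k m \<Otimes>\<^sub>M haar n) (\<lambda>(z,g). W (Q (z,g)))" using int
      by (simp add: case_prod_beta')
  have "(LINT w|(lmat k m \<Otimes>\<^sub>M haar n). W (Q w)) = (LINT g|haar n. LINT z|lmat k m. W (Q (z, g)))"
    using PP.integral_snd[OF int'] by (simp add: case_prod_beta')
  also have "\<dots> = (LINT g|haar n. f (g * ?E) * cnj (LINT y|lmat k m. \<psi> (g * (y @\<^sub>r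
      0\<^sub>m N m))))"
    by (simp add: W_def Q_def)
  finally show "pairing n m (E_ext n m (of_nat k - of_nat n) (compl_radon n k m f)) \<psi> =
      complex_of_real (gram_const m k N) *
      (LINT g|haar n. f (g * ?E) * cnj (LINT y|lmat k m. \<psi> (g * (y @\<^sub>r 0\<^sub>m N m))))"
    unfolding pairing_def mat_lebesgue_eq A(2) T2 by simp
qed

end

section \<open>Fourier integrals over rotated subspaces and the final identity\<close>

text \<open>The formula for a coordinate subspace is applied to x -> phi(gx), whose transform is the
  rotated one. The decay bounds carry over because rotations preserve the weight, and continuity
  comes from the Lipschitz estimate.\<close>

lemma schwartz_Ft_subspace:
  assumes S: "schwartz_mat n m \<phi>" and n: "n = k + N" and g: "g \<in> orth_group n"
  shows "(LINT z|lmat N m. Ft n m \<phi> (g * (0\<^sub>m k m @\<^sub>r z))) =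
    complex_of_real ((2 * pi) ^ (N * m)) * (LINT y|lmat k m. \<phi> (g * (y @\<^sub>r 0\<^sub>m N m)))"
proof -
  note gc = orth_groupD(1)[OF g]
  have e: "set [] \<subseteq> entries n m" "mat_partials n m [] \<phi> = \<phi>" by (auto simp:
      mat_partials_def)
  have \<phi>m: "\<phi> \<in> borel_measurable (mat_borel n m)" using schwartz_measurable[OF S e(1)]
      e(2) by simp
  obtain C where C: "C \<ge> 0" "\<And>x. x \<in> carrier_mat n m \<Longrightarrow> norm (\<phi> x)
      \<le> C * wt (n * m) x"
    using rapid_bound[OF schwartz_rapid[OF S e(1)], of "n * m"] e(2) by auto
  obtain C' where C': "C' \<ge> 0" "\<And>x. x \<in> carrier_mat n m \<Longrightarrow> norm (Ft n m
      \<phi> x) \<le> C' * wt (n * m) x"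
    using rapid_bound[OF Ft_rapid[OF S], of "n * m"] by blast
  have gx: "g * x \<in> carrier_mat n m" if "x \<in> carrier_mat n m" for x using gc that by auto
  have zc: "0\<^sub>m k m @\<^sub>r z \<in> carrier_mat n m" if "z \<in> carrier_mat N m" for z
      unfolding n using that by auto
  have yc: "y @\<^sub>r w \<in> carrier_mat n m" if "y \<in> carrier_mat k m" "w \<in> carrier_mat N m"
      for y w unfolding n using that by auto
  have F: "Ft n m (\<lambda>x. \<phi> (g * x)) (0\<^sub>m k m @\<^sub>r z) = Ft n m \<phi> (g *
      (0\<^sub>m k m @\<^sub>r z))" if "z \<in> carrier_mat N m" for z
    by (rule Ft_orth[OF g \<phi>m zc[OF that]])
  have "(LINT z|lmat N m. Ft n m (\<lambda>x. \<phi> (g * x)) (0\<^sub>m k m @\<^sub>r z)) =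
    complex_of_real ((2 * pi) ^ (N * m)) * (LINT y|lmat k m. \<phi> (g * (y @\<^sub>r 0\<^sub>m N m)))"
  proof (rule integral_Ft_subspace[OF n _ _ C(1)])
    show "(\<lambda>x. \<phi> (g * x)) \<in> borel_measurable (mat_borel n m)"
      by (rule measurable_compose[OF mat_left_mult_measurable[OF gc measurable_ident_sets[OF refl]] \<phi>m])
    show "norm (\<phi> (g * x)) \<le> C * wt (n * m) x" if x: "x \<in> carrier_mat n m" for x
      using C(2)[OF gx[OF x]] wt_orth[OF g x] by simp
    show "norm (Ft n m (\<lambda>x. \<phi> (g * x)) (0\<^sub>m k m @\<^sub>r z)) \<le> C' * wt (n * m)
        z" if z: "z \<in> carrier_mat N m" for z
    proof -
      have "norm (Ft n m \<phi> (g * (0\<^sub>m k m @\<^sub>r z))) \<le> C' * wt (n * m) (0\<^sub>m k m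
          @\<^sub>r z)"
        using C'(2)[OF gx[OF zc[OF z]]] wt_orth[OF g zc[OF z]] by simp
      also have "\<dots> \<le> C' * wt (n * m) z" 
        by (rule mult_left_mono[OF wt_append_le(2)[OF z zero_carrier_mat] C'(1)])
      finally show ?thesis unfolding F[OF z] .
    qed
    show "(\<lambda>j. \<phi> (g * (y @\<^sub>r inverse (real (Suc j)) \<cdot>\<^sub>m w)))
        \<longlonglongrightarrow> \<phi> (g * (y @\<^sub>r 0\<^sub>m N m))"
      if y: "y \<in> carrier_mat k m" and w: "w \<in> carrier_mat N m" for y w
    proof -
      have cw: "c \<cdot>\<^sub>m w \<in> carrier_mat N m" for c using w by auto
      have z: "0\<^sub>m N m \<in> carrier_mat N m" by simp
      have "(\<lambda>j. mat_partials n m [] \<phi> (g * (y @\<^sub>r inverse (real (Suc j))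
          \<cdot>\<^sub>m w))) \<longlonglongrightarrow> mat_partials n m [] \<phi> (g * (y @\<^sub>r
          0\<^sub>m N m))"
      proof (rule schwartz_seq_continuous[OF S e(1) gx[OF yc[OF y cw]] gx[OF yc[OF y z]]])
        fix p assume "p \<in> entries n m"
        then obtain a b where p: "p = (a, b)" "a < n" "b < m" by auto
        have r: "(g * (y @\<^sub>r v)) $$ p = (\<Sum>i<n. g $$ (a,i) * (if i < k then y $$ (i,b) else v
            $$ (i - k, b)))" if v: "v \<in> carrier_mat N m" for v
          unfolding p(1) mult_mat_index[OF gc yc[OF y v] p(2,3)]
          by (intro sum.cong refl) (use p(3) in \<open>auto simp: append_rows_index[OF y v] n\<close>)
        have "(\<lambda>j. \<Sum>i<n. g $$ (a,i) * (if i < k then y $$ (i,b) else (inverse (real (Suc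
            j)) \<cdot>\<^sub>m w) $$ (i - k, b))) \<longlonglongrightarrow>
          (\<Sum>i<n. g $$ (a,i) * (if i < k then y $$ (i,b) else 0\<^sub>m N m $$ (i - k, b)))"
        proof (intro tendsto_sum tendsto_mult tendsto_const)
          fix i assume i: "i \<in> {..<n}"
          show "(\<lambda>j. if i < k then y $$ (i,b) else (inverse (real (Suc j)) \<cdot>\<^sub>m w)
              $$ (i - k, b)) \<longlonglongrightarrow> (if i < k then y $$ (i,b) else 0\<^sub>m N m $$
              (i - k, b))"
          proof (cases "i < k")
            case False
            then have ik: "i - k < N" using i n by auto
            have "(\<lambda>j. inverse (real (Suc j)) * w $$ (i - k, b)) \<longlonglongrightarrow> 0 *
                w $$ (i - k, b)"
              by (intro tendsto_mult tendsto_const LIMSEQ_inverse_real_of_nat)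
            then show ?thesis using False ik p(3) w by simp
          qed simp
        qed
        then show "(\<lambda>j. (g * (y @\<^sub>r inverse (real (Suc j)) \<cdot>\<^sub>m w)) $$ p)
            \<longlonglongrightarrow> (g * (y @\<^sub>r 0\<^sub>m N m)) $$ p"
          unfolding r[OF cw] r[OF z] .
      qed
      then show ?thesis by (simp add: mat_partials_def)
    qed
  qed
  moreover have "(LINT z|lmat N m. Ft n m (\<lambda>x. \<phi> (g * x)) (0\<^sub>m k m @\<^sub>r z)) =
      (LINT z|lmat N m. Ft n m \<phi> (g * (0\<^sub>m k m @\<^sub>r z)))"
    by (intro Bochner_Integration.integral_cong refl) (use F in simp)
  ultimately show ?thesis by simp
qed

theorem theorem5p10:
  fixes n m k :: nat
    and f \<phi> :: "real mat \<Rightarrow> complex"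
  assumes dims: "1 \<le> m" "m \<le> k" "k \<le> n - m"
    and f_integrable: "integrable (stiefel_measure n k) f"
    and f_invariant: "right_orth_invariant n k f"
    and \<phi>_schwartz: "schwartz_mat n m \<phi>"
  shows "pairing_converges n m
           (E_ext n m (- of_nat k) (dual_funk n m k f)) (fourier_mat n m \<phi>) \<and>
         pairing_converges n m
           (E_ext n m (of_nat k - of_nat n) (compl_radon n k m f)) \<phi> \<and>
         pairing n m (E_ext n m (- of_nat k) (dual_funk n m k f)) (fourier_mat n m \<phi>) =
           complex_of_real
             (2 ^ (m * (n - k)) * pi powr (real n * real m / 2)
                * Gamma_mult m ((real n - real k) / 2) / Gamma_mult m (real k / 2)) *
           pairing n m (E_ext n m (of_nat k - of_nat n) (compl_radon n k m f)) \<phi>"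
proof -
  \<comment> \<open>The fibre statements are additive in the dimensions; 1 <= m <= k <= n - m makes
    the truncated differences exact, so that n = k + p + m and k = q + m.\<close>
  define N p q where "N = n - k" and "p = n - k - m" and "q = k - m"
  have N: "N = p + m" and n: "n = k + N" and k: "k = q + m" and kn: "k \<le> n"
    using dims by (auto simp: N_def p_def q_def)
  let ?E = "1\<^sub>m k @\<^sub>r (0\<^sub>m N k :: real mat)"
  have E: "?E \<in> stiefel n k" unfolding n by (rule top_frame_stiefel)
  have fm: "f \<in> borel_measurable (stiefel_borel n k)"
    using f_integrable sets_stiefel_measure[OF kn] by (auto cong: measurable_cong_sets)
  have fi: "integrable (haar n) (\<lambda>g. f (g * ?E))"
    using integral_stiefel_measure(2)[OF E kn fm] f_integrable by simp
  have e: "set [] \<subseteq> entries n m" "mat_partials n m [] \<phi> = \<phi>" by (auto simp: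
      mat_partials_def)
  have \<phi>m: "\<phi> \<in> borel_measurable (mat_borel n m)" using schwartz_measurable[OF
      \<phi>_schwartz e(1)] e(2) by simp
  have Fm: "Ft n m \<phi> \<in> borel_measurable (mat_borel n m)"
    by (rule Ft_measurable[OF \<phi>m measurable_ident_sets[OF refl]])
  obtain C where C: "C \<ge> 0" "\<And>x. x \<in> carrier_mat n m \<Longrightarrow> norm (\<phi> x)
      \<le> C * wt (n * m) x"
    using rapid_bound[OF schwartz_rapid[OF \<phi>_schwartz e(1)], of "n * m"] e(2) by auto
  obtain C' where C': "C' \<ge> 0" "\<And>x. x \<in> carrier_mat n m \<Longrightarrow> norm (Ft n m
      \<phi> x) \<le> C' * wt (n * m) x"
    using rapid_bound[OF Ft_rapid[OF \<phi>_schwartz], of "n * m"] by blast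
  \<comment> \<open>In this instance psi is the transform \<open>Ft\<close>, dominated through the
    constant C' of its decay; in the second one psi is phi itself.\<close>
  note A = pairing_dual_funk[OF N n k fm fi Fm C'(2,1) fourier_mat_eq[OF \<phi>m]]
  note B = pairing_compl_radon[OF N n k fm fi \<phi>m C(2,1) f_invariant]
  define I where "I = (LINT g|haar n. f (g * ?E) * cnj (LINT y|lmat k m. \<phi> (g * (y @\<^sub>r
      0\<^sub>m N m))))"
  have "(LINT g|haar n. f (g * ?E) * cnj (LINT z|lmat N m. Ft n m \<phi> (g * (0\<^sub>m k m @\<^sub>r z)))) =
    (LINT g|haar n. complex_of_real ((2 * pi) ^ (N * m)) * (f (g * ?E) * cnj (LINT y|lmat k m. \<phi>
        (g * (y @\<^sub>r 0\<^sub>m N m)))))"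
    by (intro Bochner_Integration.integral_cong refl) (simp add: schwartz_Ft_subspace[OF \<phi>_schwartz n])
  then have "(LINT g|haar n. f (g * ?E) * cnj (LINT z|lmat N m. Ft n m \<phi> (g * (0\<^sub>m k m
      @\<^sub>r z)))) = complex_of_real ((2 * pi) ^ (N * m)) * I"
    by (simp add: I_def)
  then have "pairing n m (E_ext n m (- of_nat k) (dual_funk n m k f)) (fourier_mat n m \<phi>) =
    complex_of_real (gram_const m N k * (2 * pi) ^ (N * m)) * I"
    using A(2) by simp
  also have "\<dots> = complex_of_real ((2 ^ (m * N) * pi powr (real (N + k) * real m / 2) * Gamma_mult
      m (real N / 2) / Gamma_mult m (real k / 2)) * gram_const m k N) * I"
    by (subst gram_const_ratio) (use N k in auto)
  also have "\<dots> = complex_of_real (2 ^ (m * N) * pi powr (real (N + k) * real m / 2) * Gamma_mult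
      m (real N / 2) / Gamma_mult m (real k / 2)) *
      pairing n m (E_ext n m (of_nat k - of_nat n) (compl_radon n k m f)) \<phi>"
    using B(2) by (simp only: of_real_mult mult.assoc I_def)
  also have "real (N + k) = real n" using n by simp
  also have "real N = real n - real k" using n by simp
  finally show ?thesis using A(1) B(1) unfolding N_def by blast
qed

end
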